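(* Let $1\le p<\infty$ and $n\in\mathbb N=\{0,1,2,\dots\}$. Throughout, the upper signs go together and the lower signs go together. (a) A function $F:\mathbb C^\pm\to\mathbb C$ belongs to $H_n^p(\mathbb C^\pm)$ if and only if there exists a unique $f\in{}^{\pm}H_n^p(\mathbb R)$ such that $$F(z)=\frac{\pm1}{2\pi i}\int_{-\infty}^{\infty}\frac{f(x)}{x-z}\,dx,\qquad z\in\mathbb C^\pm,$$ and then $\lim_{y\to0^\pm}F(x+iy)=f(x)$ for almost every $x\in\mathbb R$. (b) For $f\in W_n^p(\mathbb R)$ define $$F_\pm(z)=\frac{\pm1}{2\pi i}\int_{-\infty}^{\infty}\frac{f(x)}{x-z}\,dx,\qquad z\in\mathbb C^\pm.$$ If $p\ne1$, then $F_\pm\in H_n^p(\mathbb C^\pm)$ and $$\lim_{y\to0^\pm}F_\pm(x+iy)=\frac12 f(x)\pm\frac i2(Hf)(x)\qquad\text{for a.e. }x\in\mathbb R.$$ If $p=1$, this limit relation still holds, but $F_\pm$ need not belong to $H_n^1(\mathbb C^\pm)$ (i.e. for each choice of sign there exists $f\in W_n^1(\mathbb R)$ with $F_\pm\notin H_n^1(\mathbb C^\pm)$).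
   Context: $\mathbb C^+$ and $\mathbb C^-$ are the open upper and lower half-planes. For $1\le p<\infty$, $H^p(\mathbb C^\pm)$ is the space of holomorphic $F$ on $\mathbb C^\pm$ with $\|F\|_{H^p}=\sup_{y>0}\left(\int_{\mathbb R}|F(x\pm iy)|^p\,dx\right)^{1/p}<\infty$; such $F$ have nontangential boundary values a.e. on $\mathbb R$. ${}^{\pm}H^p(\mathbb R)\subset L^p(\mathbb R)$ denotes the set of nontangential boundary values of functions in $H^p(\mathbb C^\pm)$. $H_n^p(\mathbb C^\pm)$ is the space of holomorphic $F$ on $\mathbb C^\pm$ with $F^{(k)}\in H^p(\mathbb C^\pm)$ for $k=0,1,\dots,n$. $W_n^p(\mathbb R)$ is the Sobolev space of $f\in L^p(\mathbb R)$ whose weak derivatives $D^{(k)}f$, $k=1,\dots,n$, exist and lie in $L^p(\mathbb R)$; $W_0^p(\mathbb R)=L^p(\mathbb R)$. ${}^{\pm}H_n^p(\mathbb R)={}^{\pm}H^p(\mathbb R)\cap W_n^p(\mathbb R)$. $H$ is the Hilbert transform $Hf(x)=\frac1\pi\lim_{\varepsilon\to0}\int_{|x-t|>\varepsilon}\frac{f(t)}{x-t}\,dt$. *)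

theory Defs
  imports "HOL-Complex_Analysis.Complex_Analysis"
begin

text \<open>
  The two half-planes are handled simultaneously through a sign \<open>s\<close>, which is \<open>1\<close> for the upper
  and \<open>-1\<close> for the lower half-plane. Elements of \<open>L\<^sup>p\<close> are represented by Lebesgue
  measurable functions, so uniqueness of an element of \<open>L\<^sup>p\<close> means uniqueness up to equality
  almost everywhere.
\<close>

definition half_plane :: "real \<Rightarrow> complex set" where
  "half_plane s = {z. 0 < s * Im z}"

definition Lp_real :: "real \<Rightarrow> (real \<Rightarrow> complex) set" where
  "Lp_real p = {f. f \<in> borel_measurable lebesgue \<and> integrable lebesgue (\<lambda>x. norm (f x) powr p)}"

text \<open>
  The supremum defining the Hardy norm is finite iff all the integrals are finite and their
  \<open>p\<close>-th roots are bounded. Only the values of \<open>F\<close> on the half-plane matter.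
\<close>

definition hardy :: "real \<Rightarrow> real \<Rightarrow> (complex \<Rightarrow> complex) set" where
  "hardy s p = {F. F holomorphic_on half_plane s \<and>
     (\<forall>y>0. integrable lebesgue (\<lambda>x. norm (F (Complex x (s * y))) powr p)) \<and>
     bdd_above ((\<lambda>y. (LINT x|lebesgue. norm (F (Complex x (s * y))) powr p) powr (1 / p)) ` {0<..})}"

definition hardy_sobolev :: "real \<Rightarrow> real \<Rightarrow> nat \<Rightarrow> (complex \<Rightarrow> complex) set" where
  "hardy_sobolev s p n = {F. F holomorphic_on half_plane s \<and> (\<forall>k\<le>n. (deriv ^^ k) F \<in> hardy s p)}"

definition cone :: "real \<Rightarrow> real \<Rightarrow> real \<Rightarrow> complex set" where
  "cone s a x = {z \<in> half_plane s. \<bar>Re z - x\<bar> < a * \<bar>Im z\<bar>}"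

definition has_nontangential_limit ::
    "real \<Rightarrow> (complex \<Rightarrow> complex) \<Rightarrow> real \<Rightarrow> complex \<Rightarrow> bool" where
  "has_nontangential_limit s F x l \<longleftrightarrow>
     (\<forall>a>0. (F \<longlongrightarrow> l) (at (complex_of_real x) within cone s a x))"

definition hardy_boundary :: "real \<Rightarrow> real \<Rightarrow> (real \<Rightarrow> complex) set" where
  "hardy_boundary s p =
     {f \<in> Lp_real p. \<exists>F\<in>hardy s p. AE x in lebesgue. has_nontangential_limit s F x (f x)}"

definition test_function :: "(real \<Rightarrow> real) \<Rightarrow> bool" where
  "test_function \<phi> \<longleftrightarrow>
     (\<forall>k x. (deriv ^^ k) \<phi> field_differentiable (at x)) \<and> compact (closure {x. \<phi> x \<noteq> 0})"

definition weak_derivative :: "nat \<Rightarrow> (real \<Rightarrow> complex) \<Rightarrow> (real \<Rightarrow> complex) \<Rightarrow> bool" where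
  "weak_derivative k f g \<longleftrightarrow> (\<forall>\<phi>. test_function \<phi> \<longrightarrow>
     (LINT x|lebesgue. f x * complex_of_real ((deriv ^^ k) \<phi> x)) =
     (-1) ^ k * (LINT x|lebesgue. g x * complex_of_real (\<phi> x)))"

definition sobolev :: "real \<Rightarrow> nat \<Rightarrow> (real \<Rightarrow> complex) set" where
  "sobolev p n = {f \<in> Lp_real p. \<forall>k\<in>{1..n}. \<exists>g\<in>Lp_real p. weak_derivative k f g}"

definition hardy_sobolev_boundary :: "real \<Rightarrow> real \<Rightarrow> nat \<Rightarrow> (real \<Rightarrow> complex) set" where
  "hardy_sobolev_boundary s p n = hardy_boundary s p \<inter> sobolev p n"

definition cauchy_transform :: "real \<Rightarrow> (real \<Rightarrow> complex) \<Rightarrow> complex \<Rightarrow> complex" where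
  "cauchy_transform s f z =
     complex_of_real s / (2 * complex_of_real pi * \<i>) *
     (LINT x|lebesgue. f x / (complex_of_real x - z))"

definition truncated_hilbert :: "(real \<Rightarrow> complex) \<Rightarrow> real \<Rightarrow> real \<Rightarrow> complex" where
  "truncated_hilbert f x \<epsilon> =
     1 / complex_of_real pi *
     (LINT t:{t. \<bar>x - t\<bar> > \<epsilon>}|lebesgue. f t / complex_of_real (x - t))"

text \<open>
  The value is only meaningful where the limit exists; statements about the Hilbert transform
  should assert convergence of the truncations as well.
\<close>

definition hilbert_transform :: "(real \<Rightarrow> complex) \<Rightarrow> real \<Rightarrow> complex" where
  "hilbert_transform f x = Lim (at_right 0) (truncated_hilbert f x)"

end

theory Submission
  imports Defs
begin

text \<open>The core is that \<open>F\<close> in \<open>H\<^sup>p\<close> of a half-plane has a boundary function \<open>f\<close> of which it is both the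
  Poisson and the Cauchy integral, whereas the Cauchy integral of \<open>f\<close> over the opposite half-plane
  vanishes. Subharmonicity of \<open>|F|\<close> to the power \<open>p/2\<close> and weak compactness in \<open>L\<^sup>2\<close> give a Poisson
  majorant \<open>g\<close> of that power; then \<open>F\<close> times \<open>exp (- 2 * C g)\<close> is bounded, and bounded functions have
  vertical limits because they are, up to the factor \<open>1 / (z \<plusminus> \<i>)\<close>, Poisson integrals of \<open>L\<^sup>2\<close>
  functions. Conversely, the Cauchy integrals of \<open>f\<close> over the two half-planes add up to its Poisson
  integral, so if one of them vanishes the other one is a Poisson integral and lies in \<open>H\<^sup>p\<close>.
  Testing a weak derivative against cut-off Cauchy kernels shows that the Cauchy transform turns
  weak derivatives into complex ones, and this reduces the Sobolev statements to \<open>n = 0\<close>. For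
  \<open>p > 1\<close> the Cauchy transform is bounded by the theorem of M. Riesz; for \<open>p = 1\<close> it leaves \<open>H\<^sup>1\<close> as
  soon as the integral of \<open>f\<close> does not vanish.\<close>

text \<open>The obstacle is p = 1: bounded sets of L1 have no weak limits among functions. The power
  p/2 moves every p >= 1 into L2, where weak limits come from the parallelogram law. If g majorizes
  this power, then h = g^2 is integrable and its Poisson integrals majorize the power p. On
  horizontal lines they converge a.e. to h and all have the same total mass, so dominated
  convergence with moving majorants (Pratt) yields the boundary function and all limits under the
  integral for every p at once. Since every Lp function is integrable against 1/(1 + |t|), Lebesgue
  points, Cauchy kernels and the Hilbert transform are treated without reference to p. The damping
  factor makes F bounded because u^(2/p) exp(-u) <= 2 for u >= 0; its own limits exist and are
  nonzero a.e., so it can be divided out again. The statement speaks of Lebesgue measurable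
  functions, the analysis of Borel representatives and \<open>lborel\<close>; the two are matched
  near the end.\<close>

section \<open>Limit theorems for integrals\<close>

text \<open>Limits along \<open>at a within S\<close> are tested on sequences, by first
  countability. The bound is assumed only eventually, hence the passage to a shifted
  sequence.\<close>

lemma dominated_convergence_within:
  fixes F :: "'a::first_countable_topology \<Rightarrow> 'c \<Rightarrow> 'b::{banach, second_countable_topology}"
  assumes F: "\<And>u. u \<in> S \<Longrightarrow> F u \<in> borel_measurable M" and f: "f \<in> borel_measurable M"
    and w: "integrable M w"
    and lim: "AE t in M. ((\<lambda>u. F u t) \<longlongrightarrow> f t) (at a within S)"
    and bound: "eventually (\<lambda>u. AE t in M. norm (F u t) \<le> w t) (at a within S)"
  shows "((\<lambda>u. integral\<^sup>L M (F u)) \<longlongrightarrow> integral\<^sup>L M f) (at a within S)"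
proof (subst tendsto_at_iff_sequentially, intro allI impI)
  fix X assume X: "\<forall>i. X i \<in> S - {a}" "X \<longlonglongrightarrow> a"
  then have Xl: "filterlim X (at a within S) sequentially"
    by (auto simp: filterlim_at)
  then obtain N where N: "\<And>n. n \<ge> N \<Longrightarrow> AE t in M. norm (F (X n) t) \<le> w t"
    using filterlim_iff[THEN iffD1, OF Xl, rule_format, OF bound] unfolding eventually_sequentially by blast
  have "(\<lambda>n. integral\<^sup>L M (F (X (n + N)))) \<longlonglongrightarrow> integral\<^sup>L M f"
  proof (rule integral_dominated_convergence[OF f _ w])
    show "\<And>i. F (X (i + N)) \<in> borel_measurable M" using F X by auto
    show "AE x in M. (\<lambda>i. F (X (i + N)) x) \<longlonglongrightarrow> f x"
      using lim
    proof eventually_elim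
      case (elim x)
      show ?case by (rule LIMSEQ_ignore_initial_segment) (rule filterlim_compose[OF elim Xl])
    qed
    show "\<And>i. AE x in M. norm (F (X (i + N)) x) \<le> w x" using N by auto
  qed
  then show "((\<lambda>u. integral\<^sup>L M (F u)) \<circ> X) \<longlonglongrightarrow> integral\<^sup>L M f"
    unfolding comp_def by (rule LIMSEQ_offset)
qed

text \<open>The majorants \<open>G k\<close> move, so dominated convergence is applied only to
  \<open>m\<close> and \<open>e\<close>, which stay below 2 H and |H|. Since |u k - v| <= G k + H,
  its excess over 2 H is at most G k - H, and the integral of G k - H tends to 0 by
  hypothesis.\<close>

lemma Pratt_convergence:
  fixes u :: "nat \<Rightarrow> 'a \<Rightarrow> 'b::{banach, second_countable_topology}"
  assumes u[measurable]: "\<And>k. u k \<in> borel_measurable M" and v[measurable]: "v \<in> borel_measurable M"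
    and G: "\<And>k. integrable M (G k)" and H: "integrable M H"
    and uv: "AE x in M. (\<lambda>k. u k x) \<longlonglongrightarrow> v x" and GH: "AE x in M. (\<lambda>k. G k x) \<longlonglongrightarrow> H x"
    and uG: "\<And>k. AE x in M. norm (u k x) \<le> G k x"
    and iG: "(\<lambda>k. integral\<^sup>L M (G k)) \<longlonglongrightarrow> integral\<^sup>L M H"
  shows "integrable M v" "\<And>k. integrable M (u k)"
    and "(\<lambda>k. LINT x|M. norm (u k x - v x)) \<longlonglongrightarrow> 0"
    and "(\<lambda>k. integral\<^sup>L M (u k)) \<longlonglongrightarrow> integral\<^sup>L M v"
proof -
  have [measurable]: "\<And>k. G k \<in> borel_measurable M" "H \<in> borel_measurable M" using G H by auto
  have uG': "AE x in M. \<forall>k. norm (u k x) \<le> G k x"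
    using uG by (simp add: AE_all_countable)
  have vH: "AE x in M. norm (v x) \<le> H x"
    using uv GH uG'
  proof eventually_elim
    case (elim x)
    show ?case by (rule LIMSEQ_le[OF tendsto_norm[OF elim(1)] elim(2)]) (use elim(3) in auto)
  qed
  show iv: "integrable M v"
    by (rule Bochner_Integration.integrable_bound[OF H v]) (use vH in eventually_elim, auto)
  show iu: "integrable M (u k)" for k
  proof (rule Bochner_Integration.integrable_bound[OF G[of k] u])
    show "AE x in M. norm (u k x) \<le> norm (G k x)"
      using uG[of k] by eventually_elim simp
  qed
  define D where "D = (\<lambda>k x. norm (u k x - v x))"
  have [measurable]: "\<And>k. D k \<in> borel_measurable M" unfolding D_def by measurable
  have iD: "\<And>k. integrable M (D k)" unfolding D_def using iu iv by auto
  have D0: "\<And>k x. 0 \<le> D k x" by (auto simp: D_def)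
  have Dlim: "AE x in M. (\<lambda>k. D k x) \<longlonglongrightarrow> 0"
    using uv unfolding D_def
    by eventually_elim (simp add: LIM_zero tendsto_norm_zero)
  define m where "m = (\<lambda>k x. min (D k x) (2 * H x))"
  define e where "e = (\<lambda>k x. max 0 (H x - G k x))"
  have mlim: "(\<lambda>k. integral\<^sup>L M (m k)) \<longlonglongrightarrow> integral\<^sup>L M (\<lambda>x. 0::real)"
  proof (rule integral_dominated_convergence)
    show "integrable M (\<lambda>x. 2 * H x)" using H by auto
    show "AE x in M. (\<lambda>i. m i x) \<longlonglongrightarrow> 0"
      using Dlim vH
    proof eventually_elim
      case (elim x)
      have "0 \<le> 2 * H x" using elim(2) norm_ge_zero[of "v x"] by linarith
      then have "(\<lambda>i. min (D i x) (2 * H x)) \<longlonglongrightarrow> min 0 (2 * H x)"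
        by (intro tendsto_min elim tendsto_const)
      then show ?case using \<open>0 \<le> 2 * H x\<close> by (simp add: m_def)
    qed
    show "AE x in M. norm (m i x) \<le> 2 * H x" for i
      using vH
    proof eventually_elim
      case (elim x)
      then have "0 \<le> 2 * H x" using norm_ge_zero[of "v x"] by linarith
      then show ?case using D0[of i x] by (auto simp: m_def)
    qed
  qed (auto simp: m_def)
  have elim: "(\<lambda>k. integral\<^sup>L M (e k)) \<longlonglongrightarrow> integral\<^sup>L M (\<lambda>x. 0::real)"
  proof (rule integral_dominated_convergence)
    show "integrable M (\<lambda>x. \<bar>H x\<bar>)" using H by auto
    show "AE x in M. (\<lambda>i. e i x) \<longlonglongrightarrow> 0"
      using GH
    proof eventually_elim
      case (elim x)
      have "(\<lambda>i. max 0 (H x - G i x)) \<longlonglongrightarrow> max 0 (H x - H x)"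
        by (intro tendsto_intros elim)
      then show ?case by (simp add: e_def)
    qed
    show "AE x in M. norm (e i x) \<le> \<bar>H x\<bar>" for i
      using uG'
    proof eventually_elim
      case (elim x)
      then have "0 \<le> G i x" using norm_ge_zero[of "u i x"] order_trans by blast
      then show ?case by (auto simp: e_def)
    qed
  qed (auto simp: e_def)
  have ie: "integrable M (e k)" for k
    unfolding e_def using H G[of k] by (intro integrable_max) auto
  have im: "integrable M (m k)" for k
    unfolding m_def using H iD[of k] by (intro integrable_min) auto
  have le: "integral\<^sup>L M (D k) \<le> integral\<^sup>L M (m k) + (integral\<^sup>L M (G k) - integral\<^sup>L M H + integral\<^sup>L M (e k))" for k
  proof -
    have "integral\<^sup>L M (D k) \<le> (LINT x|M. m k x + (G k x - H x + e k x))"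
    proof (rule integral_mono_AE)
      show "integrable M (\<lambda>x. m k x + (G k x - H x + e k x))" using im ie G H by auto
      show "AE x in M. D k x \<le> m k x + (G k x - H x + e k x)"
        using uG' vH
      proof eventually_elim
        case (elim x)
        have "D k x \<le> norm (u k x) + norm (v x)" unfolding D_def by (rule norm_triangle_ineq4)
        also have "\<dots> \<le> G k x + H x" using elim by (intro add_mono) auto
        finally show ?case by (auto simp: m_def e_def)
      qed
    qed (rule iD)
    also have "\<dots> = integral\<^sup>L M (m k) + (integral\<^sup>L M (G k) - integral\<^sup>L M H + integral\<^sup>L M (e k))"
      using im ie G H by simp
    finally show ?thesis .
  qed
  have "(\<lambda>k. integral\<^sup>L M (m k) + (integral\<^sup>L M (G k) - integral\<^sup>L M H + integral\<^sup>L M (e k))) \<longlonglongrightarrow> 0 + (integral\<^sup>L M H - integral\<^sup>L M H + 0)"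
    using mlim elim iG by (intro tendsto_intros) auto
  then have "(\<lambda>k. integral\<^sup>L M (m k) + (integral\<^sup>L M (G k) - integral\<^sup>L M H + integral\<^sup>L M (e k))) \<longlonglongrightarrow> 0"
    by simp
  then show D: "(\<lambda>k. LINT x|M. norm (u k x - v x)) \<longlonglongrightarrow> 0"
    by (rule tendsto_sandwich[OF _ _ tendsto_const, rotated 2])
      (use le in \<open>auto simp: D_def intro!: integral_nonneg_AE\<close>)
  show "(\<lambda>k. integral\<^sup>L M (u k)) \<longlonglongrightarrow> integral\<^sup>L M v"
  proof (rule LIM_zero_cancel, rule Lim_null_comparison[OF _ D], rule always_eventually, rule allI)
    fix k
    have "integral\<^sup>L M (u k) - integral\<^sup>L M v = (LINT x|M. u k x - v x)" using iu iv by simp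
    then show "norm (integral\<^sup>L M (u k) - integral\<^sup>L M v) \<le> (LINT x|M. norm (u k x - v x))"
      using integral_norm_bound[of M "\<lambda>x. u k x - v x"] by simp
  qed
qed

section \<open>Completeness and weak limits in L2\<close>

lemma L2_complete:
  fixes h :: "nat \<Rightarrow> 'a \<Rightarrow> 'b::{banach, second_countable_topology}"
  assumes h[measurable]: "\<And>n. h n \<in> borel_measurable M"
    and int: "\<And>n. integrable M (\<lambda>x. (norm (h n x))\<^sup>2)"
    and cauchy: "\<And>e::real. e > 0 \<Longrightarrow> \<exists>N. \<forall>m\<ge>N. \<forall>n\<ge>N. (LINT x|M. (norm (h m x - h n x))\<^sup>2) \<le> e"
  obtains g where "g \<in> borel_measurable M" "integrable M (\<lambda>x. (norm (g x))\<^sup>2)"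
    "\<And>n. integrable M (\<lambda>x. (norm (h n x - g x))\<^sup>2)"
    "(\<lambda>n. LINT x|M. (norm (h n x - g x))\<^sup>2) \<longlonglongrightarrow> 0"
proof -
  have sq: "(norm (a - b))\<^sup>2 \<le> 2 * (norm a)\<^sup>2 + 2 * (norm b)\<^sup>2" for a b :: 'b
  proof -
    have "(norm (a - b))\<^sup>2 \<le> (norm a + norm b)\<^sup>2" by (intro power_mono norm_triangle_ineq4) auto
    also have "\<dots> \<le> 2 * (norm a)\<^sup>2 + 2 * (norm b)\<^sup>2"
      using sum_squares_bound[of "norm a" "norm b"] by (simp add: power2_sum)
    finally show ?thesis .
  qed
  have isq: "integrable M (\<lambda>x. (norm (f x - f' x))\<^sup>2)"
    if "f \<in> borel_measurable M" "f' \<in> borel_measurable M"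
      "integrable M (\<lambda>x. (norm (f x))\<^sup>2)" "integrable M (\<lambda>x. (norm (f' x))\<^sup>2)" for f f' :: "'a \<Rightarrow> 'b"
    by (rule Bochner_Integration.integrable_bound[of M "\<lambda>x. 2 * (norm (f x))\<^sup>2 + 2 * (norm (f' x))\<^sup>2"])
      (use that sq in auto)
  have nn: "(\<integral>\<^sup>+x. ennreal ((norm (h m x - h n x))\<^sup>2) \<partial>M) = ennreal (LINT x|M. (norm (h m x - h n x))\<^sup>2)" for m n
    by (rule nn_integral_eq_integral) (auto intro!: isq h int)
  have "\<forall>k. \<exists>N. \<forall>m\<ge>N. \<forall>n\<ge>N. (LINT x|M. (norm (h m x - h n x))\<^sup>2) \<le> (1/8)^k"
    by (intro allI cauchy) auto
  then obtain N where N: "\<And>k m n. m \<ge> N k \<Longrightarrow> n \<ge> N k \<Longrightarrow> (LINT x|M. (norm (h m x - h n x))\<^sup>2) \<le> (1/8)^k"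
    by metis
  \<comment> \<open>\<open>r\<close> dominates both k and \<open>N k\<close>, so consecutive members
    of the subsequence differ by at most 8^-k in squared L2 norm. The weight 2^k in \<open>a\<close>
    leaves the summable series 4^-k and still forces the pointwise differences below a multiple of
    2^(-k/2).\<close>
  define r where "r = (\<lambda>k. k + (\<Sum>j\<le>k. N j))"
  have rN: "N k \<le> r k" "N k \<le> r (Suc k)" "k \<le> r k" for k
    using member_le_sum[of k "{..k}" N] by (auto simp: r_def)
  define a where "a = (\<lambda>k x. 2^k * (norm (h (r (Suc k)) x - h (r k) x))\<^sup>2)"
  have ai: "(\<integral>\<^sup>+x. ennreal (a k x) \<partial>M) \<le> ennreal ((1/4)^k)" for k
  proof -
    have "(\<integral>\<^sup>+x. ennreal (a k x) \<partial>M) = ennreal (2^k) * (\<integral>\<^sup>+x. ennreal ((norm (h (r (Suc k)) x - h (r k) x))\<^sup>2) \<partial>M)"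
      unfolding a_def by (subst nn_integral_cmult[symmetric]) (auto simp: ennreal_mult)
    also have "\<dots> \<le> ennreal (2^k) * ennreal ((1/8)^k)"
      unfolding nn using N[OF rN(2) rN(1)] by (intro mult_left_mono ennreal_leI) auto
    also have "\<dots> = ennreal (2^k * (1/8)^k)" by (subst ennreal_mult[symmetric]) auto
    also have "2^k * (1/8)^k = (1/4::real)^k" by (subst power_mult_distrib[symmetric]) simp
    finally show ?thesis .
  qed
  have "(\<integral>\<^sup>+x. (\<Sum>k. ennreal (a k x)) \<partial>M) = (\<Sum>k. \<integral>\<^sup>+x. ennreal (a k x) \<partial>M)"
    by (rule nn_integral_suminf) (auto simp: a_def)
  also have "\<dots> \<le> (\<Sum>k. ennreal ((1/4)^k))" by (intro suminf_le ai) auto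
  also have "\<dots> < \<infinity>"
  proof -
    have "summable (\<lambda>k. (1/4::real)^k)" by (rule summable_geometric) auto
    then show ?thesis by (subst suminf_ennreal2) auto
  qed
  finally have "AE x in M. (\<Sum>k. ennreal (a k x)) \<noteq> \<infinity>"
    by (intro nn_integral_PInf_AE) (auto simp: a_def)
  then have conv: "AE x in M. convergent (\<lambda>k. h (r k) x)"
  proof eventually_elim
    case (elim x)
    then obtain C where C: "(\<Sum>k. ennreal (a k x)) = ennreal C" "C \<ge> 0"
      by (metis ennreal_cases infinity_ennreal_def)
    have aC: "a k x \<le> C" for k
    proof -
      have "ennreal (a k x) \<le> (\<Sum>k. ennreal (a k x))"
        using sum_le_suminf[of "\<lambda>k. ennreal (a k x)" "{k}"] by auto
      then show ?thesis using C by simp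
    qed
    have b: "norm (h (r (Suc k)) x - h (r k) x) \<le> sqrt C * (sqrt (1/2))^k" for k
    proof -
      have "(norm (h (r (Suc k)) x - h (r k) x))\<^sup>2 \<le> C * (1/2)^k"
        using aC[of k] by (simp add: a_def field_simps)
      then have "norm (h (r (Suc k)) x - h (r k) x) \<le> sqrt (C * (1/2)^k)"
        by (rule real_le_rsqrt)
      then show ?thesis by (simp add: real_sqrt_mult real_sqrt_power)
    qed
    have "sqrt (1/2) < 1" by (simp add: real_sqrt_lt_1_iff)
    then have "summable (\<lambda>k. sqrt C * (sqrt (1/2))^k)" by (intro summable_mult summable_geometric) auto
    then have "summable (\<lambda>k. h (r (Suc k)) x - h (r k) x)"
      by (rule summable_comparison_test'[where N=0]) (use b in auto)
    then show ?case
      unfolding summable_iff_convergent sum_lessThan_telescope[of "\<lambda>k. h (r k) x"]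
      by (simp add: convergent_diff_const_right_iff)
  qed
  define g where "g = (\<lambda>x. lim (\<lambda>k. h (r k) x))"
  have gm[measurable]: "g \<in> borel_measurable M" unfolding g_def by measurable
  have glim: "AE x in M. (\<lambda>k. h (r k) x) \<longlonglongrightarrow> g x"
    using conv by eventually_elim (simp add: g_def convergent_LIMSEQ_iff)
  \<comment> \<open>Fatou's lemma along the a.e. convergent subsequence turns the Cauchy estimate
    into an estimate of the distance to \<open>g\<close>.\<close>
  have fat: "(\<integral>\<^sup>+x. ennreal ((norm (h n x - g x))\<^sup>2) \<partial>M) \<le> ennreal e"
    if K: "\<And>m. m \<ge> K \<Longrightarrow> (LINT x|M. (norm (h n x - h m x))\<^sup>2) \<le> e" for n e K
  proof -
    have "(\<integral>\<^sup>+x. ennreal ((norm (h n x - g x))\<^sup>2) \<partial>M) = (\<integral>\<^sup>+x. liminf (\<lambda>k. ennreal ((norm (h n x - h (r k) x))\<^sup>2)) \<partial>M)"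
    proof (rule nn_integral_cong_AE, use glim in eventually_elim)
      case (elim x)
      have "(\<lambda>k. ennreal ((norm (h n x - h (r k) x))\<^sup>2)) \<longlonglongrightarrow> ennreal ((norm (h n x - g x))\<^sup>2)"
        by (intro tendsto_intros elim)
      then show ?case by (metis lim_imp_Liminf sequentially_bot)
    qed
    also have "\<dots> \<le> liminf (\<lambda>k. \<integral>\<^sup>+x. ennreal ((norm (h n x - h (r k) x))\<^sup>2) \<partial>M)"
      by (rule nn_integral_liminf) measurable
    also have "\<dots> \<le> ennreal e"
    proof (rule Liminf_le)
      show "eventually (\<lambda>k. (\<integral>\<^sup>+x. ennreal ((norm (h n x - h (r k) x))\<^sup>2) \<partial>M) \<le> ennreal e) sequentially"
        unfolding eventually_sequentially
        by (rule exI[of _ K]) (auto simp: nn intro!: ennreal_leI K order_trans[OF _ rN(3)])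
    qed auto
    finally show ?thesis .
  qed
  have ihg: "integrable M (\<lambda>x. (norm (h n x - g x))\<^sup>2)" for n
  proof -
    obtain N1 where N1: "\<And>m n. m \<ge> N1 \<Longrightarrow> n \<ge> N1 \<Longrightarrow> (LINT x|M. (norm (h m x - h n x))\<^sup>2) \<le> 1"
      using cauchy[of 1] by auto
    have "integrable M (\<lambda>x. (norm (h N1 x - g x))\<^sup>2)"
      using fat[of N1 N1 1] N1 by (intro integrableI_bounded) (auto simp: le_less_trans)
    then have "integrable M (\<lambda>x. (norm ((h N1 x - g x) - (h N1 x - h n x)))\<^sup>2)"
      using isq[OF h h int int, of N1 n] by (intro isq[of "\<lambda>x. h N1 x - g x" "\<lambda>x. h N1 x - h n x"]) simp_all
    moreover have "(h N1 x - g x) - (h N1 x - h n x) = h n x - g x" for x by simp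
    ultimately show ?thesis by simp
  qed
  have ig: "integrable M (\<lambda>x. (norm (g x))\<^sup>2)"
  proof -
    have "integrable M (\<lambda>x. (norm (h 0 x - (h 0 x - g x)))\<^sup>2)"
      by (intro isq int ihg) auto
    then show ?thesis by simp
  qed
  have "(\<lambda>n. LINT x|M. (norm (h n x - g x))\<^sup>2) \<longlonglongrightarrow> 0"
  proof (rule LIMSEQ_I)
    fix e :: real assume e: "e > 0"
    obtain N1 where N1: "\<And>m n. m \<ge> N1 \<Longrightarrow> n \<ge> N1 \<Longrightarrow> (LINT x|M. (norm (h m x - h n x))\<^sup>2) \<le> e / 2"
      using cauchy[of "e/2"] e by auto
    have "norm ((LINT x|M. (norm (h n x - g x))\<^sup>2) - 0) < e" if "n \<ge> N1" for n
    proof -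
      have "ennreal (LINT x|M. (norm (h n x - g x))\<^sup>2) = (\<integral>\<^sup>+x. ennreal ((norm (h n x - g x))\<^sup>2) \<partial>M)"
        by (rule nn_integral_eq_integral[symmetric]) (auto intro: ihg)
      also have "\<dots> \<le> ennreal (e/2)" using fat[of N1 n "e/2"] N1 that by auto
      finally have "(LINT x|M. (norm (h n x - g x))\<^sup>2) \<le> e/2" using e by (subst (asm) ennreal_le_iff) auto
      moreover have "0 \<le> (LINT x|M. (norm (h n x - g x))\<^sup>2)" by (rule integral_nonneg_AE) auto
      ultimately show ?thesis using e by simp
    qed
    then show "\<exists>no. \<forall>n\<ge>no. norm ((LINT x|M. (norm (h n x - g x))\<^sup>2) - 0) < e" by blast
  qed
  then show ?thesis using that gm ig ihg by blast
qed

text \<open>Dyadic convex combinations of the tail from index \<open>n\<close>. Midpoints suffice: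
  the parallelogram law speaks of midpoints only, and a linear condition with values in a convex set
  passes to them.\<close>

inductive_set midpoint_hull :: "(nat \<Rightarrow> 'a \<Rightarrow> 'b::real_vector) \<Rightarrow> nat \<Rightarrow> ('a \<Rightarrow> 'b) set" for f n where
  base: "n \<le> k \<Longrightarrow> f k \<in> midpoint_hull f n"
| midpoint: "g \<in> midpoint_hull f n \<Longrightarrow> h \<in> midpoint_hull f n \<Longrightarrow> (\<lambda>x. (1/2) *\<^sub>R (g x + h x)) \<in> midpoint_hull f n"

lemma midpoint_hull_antimono: "g \<in> midpoint_hull f n \<Longrightarrow> m \<le> n \<Longrightarrow> g \<in> midpoint_hull f m"
  by (induction rule: midpoint_hull.induct) (auto intro: midpoint_hull.intros)

lemma parallelogram_midpoint:
  fixes a b :: "'b::real_inner"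
  shows "(norm (a - b))\<^sup>2 = 2 * (norm a)\<^sup>2 + 2 * (norm b)\<^sup>2 - 4 * (norm ((1/2) *\<^sub>R (a + b)))\<^sup>2"
  unfolding power2_norm_eq_inner by (simp add: algebra_simps inner_commute)

lemma integrable_mult_L2:
  fixes f :: "'a \<Rightarrow> 'b::{real_normed_vector, banach, second_countable_topology}" and \<kappa> :: "'a \<Rightarrow> real"
  assumes "f \<in> borel_measurable M" "\<kappa> \<in> borel_measurable M"
    "integrable M (\<lambda>x. (norm (f x))\<^sup>2)" "integrable M (\<lambda>x. (\<kappa> x)\<^sup>2)"
  shows "integrable M (\<lambda>x. \<kappa> x *\<^sub>R f x)"
proof (rule Bochner_Integration.integrable_bound[of M "\<lambda>x. (\<kappa> x)\<^sup>2 + (norm (f x))\<^sup>2"])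
  show "AE x in M. norm (\<kappa> x *\<^sub>R f x) \<le> norm ((\<kappa> x)\<^sup>2 + (norm (f x))\<^sup>2)"
  proof (rule AE_I2)
    fix x
    have "2 * (\<bar>\<kappa> x\<bar> * norm (f x)) \<le> (\<kappa> x)\<^sup>2 + (norm (f x))\<^sup>2"
      using sum_squares_bound[of "\<bar>\<kappa> x\<bar>" "norm (f x)"] by simp
    moreover have "0 \<le> \<bar>\<kappa> x\<bar> * norm (f x)" by (rule mult_nonneg_nonneg) auto
    ultimately have "\<bar>\<kappa> x\<bar> * norm (f x) \<le> (\<kappa> x)\<^sup>2 + (norm (f x))\<^sup>2" by linarith
    then show "norm (\<kappa> x *\<^sub>R f x) \<le> norm ((\<kappa> x)\<^sup>2 + (norm (f x))\<^sup>2)" by simp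
  qed
qed (use assms in auto)

text \<open>Mazur's argument: almost minimal elements of the convex hulls of the tails are Cauchy by the
  parallelogram law, and their limit inherits every closed convex condition on the tails.\<close>

lemma L2_weak_limit:
  fixes f :: "nat \<Rightarrow> 'a \<Rightarrow> 'b::{real_inner, banach, second_countable_topology}"
  assumes f[measurable]: "\<And>n. f n \<in> borel_measurable M"
    and int: "\<And>n. integrable M (\<lambda>x. (norm (f n x))\<^sup>2)"
    and bd: "\<And>n. (LINT x|M. (norm (f n x))\<^sup>2) \<le> B"
  shows "\<exists>g\<in>borel_measurable M. integrable M (\<lambda>x. (norm (g x))\<^sup>2) \<and>
    (\<forall>\<kappa> C N. \<kappa> \<in> borel_measurable M \<longrightarrow> integrable M (\<lambda>x. (\<kappa> x)\<^sup>2) \<longrightarrow> closed C \<longrightarrow> convex C \<longrightarrow>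
       (\<forall>k\<ge>N. (LINT x|M. \<kappa> x *\<^sub>R f k x) \<in> C) \<longrightarrow> (LINT x|M. \<kappa> x *\<^sub>R g x) \<in> C)"
proof -
  define Q where "Q = (\<lambda>h::'a \<Rightarrow> 'b. LINT x|M. (norm (h x))\<^sup>2)"
  have Q0: "0 \<le> Q h" for h unfolding Q_def by (rule integral_nonneg_AE) auto
  have sqm: "(norm ((1/2) *\<^sub>R (a + b)))\<^sup>2 \<le> ((norm a)\<^sup>2 + (norm b)\<^sup>2) / 2" for a b :: 'b
  proof -
    have "m \<le> (A + B) / 2" if "x = 2 * A + 2 * B - 4 * m" "0 \<le> x" for x A B m :: real
      using that by (simp add: field_simps)
    from this[OF parallelogram_midpoint zero_le_power2] show ?thesis .
  qed
  have hull: "h \<in> borel_measurable M \<and> integrable M (\<lambda>x. (norm (h x))\<^sup>2) \<and> Q h \<le> B"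
    if "h \<in> midpoint_hull f n" for h n
    using that
  proof (induction rule: midpoint_hull.induct)
    case (base k)
    then show ?case using int bd by (auto simp: Q_def)
  next
    case (midpoint g h)
    then have [measurable]: "g \<in> borel_measurable M" "h \<in> borel_measurable M" by auto
    have i: "integrable M (\<lambda>x. (norm ((1/2) *\<^sub>R (g x + h x)))\<^sup>2)"
      by (rule Bochner_Integration.integrable_bound[of M "\<lambda>x. ((norm (g x))\<^sup>2 + (norm (h x))\<^sup>2) / 2"])
        (use midpoint sqm in auto)
    have "Q (\<lambda>x. (1/2) *\<^sub>R (g x + h x)) \<le> (LINT x|M. ((norm (g x))\<^sup>2 + (norm (h x))\<^sup>2) / 2)"
      unfolding Q_def by (rule integral_mono) (use i midpoint sqm in auto)
    also have "\<dots> = (Q g + Q h) / 2" unfolding Q_def using midpoint by simp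
    finally show ?case using i midpoint by auto
  qed
  \<comment> \<open>The tails shrink, so these infima increase; they are bounded by \<open>B\<close>
    and therefore converge. The differences \<open>d m - d n\<close> are the error term in the
    Cauchy estimate below.\<close>
  define d where "d = (\<lambda>n. Inf (Q ` midpoint_hull f n))"
  have ne: "midpoint_hull f n \<noteq> {}" for n using midpoint_hull.base[of n n f] by auto
  have bb: "bdd_below (Q ` midpoint_hull f n)" for n using Q0 by (auto intro!: bdd_belowI[of _ 0])
  have dle: "d n \<le> Q h" if "h \<in> midpoint_hull f n" for h n
    unfolding d_def using that bb by (auto intro: cInf_lower)
  have dmono: "d m \<le> d n" if "m \<le> n" for m n
    unfolding d_def by (rule cInf_superset_mono) (use ne bb in \<open>auto intro!: image_mono midpoint_hull_antimono[OF _ that]\<close>)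
  have dB: "d n \<le> B" for n using dle hull ne by (metis ex_in_conv order_trans)
  have "\<exists>h\<in>midpoint_hull f n. Q h < d n + 1 / (Suc n)" for n
    using cInf_lessD[of "Q ` midpoint_hull f n" "d n + 1 / Suc n"] ne by (auto simp: d_def)
  then obtain h where hV: "\<And>n. h n \<in> midpoint_hull f n" and hQ: "\<And>n. Q (h n) < d n + 1 / (Suc n)"
    by metis
  have hm[measurable]: "\<And>n. h n \<in> borel_measurable M" and hi: "\<And>n. integrable M (\<lambda>x. (norm (h n x))\<^sup>2)"
    using hull[OF hV] by auto
  have key: "(LINT x|M. (norm (h m x - h n x))\<^sup>2) \<le> 2 * \<bar>d m - d n\<bar> + 4 / Suc n" if "n \<le> m" for m n
  proof -
    \<comment> \<open>For \<open>n \<le> m\<close> both elements lie in the hull of tail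
      \<open>n\<close>, so their midpoint has squared norm at least \<open>d n\<close>; this lower
      bound enters the parallelogram law with a minus sign.\<close>
    have mid: "(\<lambda>x. (1/2) *\<^sub>R (h m x + h n x)) \<in> midpoint_hull f n"
      using hV midpoint_hull_antimono that by (blast intro: midpoint_hull.midpoint)
    define c where "c = Q (\<lambda>x. (1/2) *\<^sub>R (h m x + h n x))"
    have "d n \<le> c" unfolding c_def by (rule dle[OF mid])
    have "(LINT x|M. (norm (h m x - h n x))\<^sup>2) = 2 * Q (h m) + 2 * Q (h n) - 4 * c"
      unfolding parallelogram_midpoint c_def Q_def using hi hull[OF mid] by simp
    also have "\<dots> \<le> 2 * (d m + 1 / Suc m) + 2 * (d n + 1 / Suc n) - 4 * d n"
      using hQ[of m] hQ[of n] \<open>d n \<le> c\<close> by argo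
    also have "\<dots> \<le> 2 * \<bar>d m - d n\<bar> + 4 / Suc n"
    proof -
      have "1 / real (Suc m) \<le> 1 / real (Suc n)" using that by (simp add: frac_le)
      moreover have "2 * (u + e) + 2 * (v + e') - 4 * v \<le> 2 * \<bar>u - v\<bar> + 4 * e'" if "e \<le> e'" for u v e e' :: real
        using that by argo
      ultimately show ?thesis by (metis mult.right_neutral times_divide_eq_right)
    qed
    finally show ?thesis .
  qed
  have "incseq d" using dmono by (simp add: incseq_def)
  then obtain L where "d \<longlonglongrightarrow> L"
    using incseq_convergent[of d B] dB by blast
  then have "convergent d" by (rule convergentI)
  then have dC: "Cauchy d" by (rule convergent_Cauchy)
  obtain g where g: "g \<in> borel_measurable M" "integrable M (\<lambda>x. (norm (g x))\<^sup>2)"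
    "\<And>n. integrable M (\<lambda>x. (norm (h n x - g x))\<^sup>2)"
    "(\<lambda>n. LINT x|M. (norm (h n x - g x))\<^sup>2) \<longlonglongrightarrow> 0"
  proof (rule L2_complete[OF hm hi])
    fix e :: real assume e: "e > 0"
    obtain N1 where N1: "\<And>m n. m \<ge> N1 \<Longrightarrow> n \<ge> N1 \<Longrightarrow> dist (d m) (d n) < e / 4"
      using dC e by (metis (no_types) Cauchy_def divide_pos_pos zero_less_numeral)
    obtain N2 :: nat where N2: "8 / e < N2" using reals_Archimedean2 by blast
    have *: "(LINT x|M. (norm (h m x - h n x))\<^sup>2) \<le> e" if "n \<ge> N1 + N2" "n \<le> m" for m n
    proof -
      have "8 / e < real (Suc n)" using N2 that by linarith
      then have "4 / Suc n \<le> e / 2" using e by (simp add: field_simps)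
      moreover have "\<bar>d m - d n\<bar> < e / 4" using N1[of m n] that by (simp add: dist_real_def)
      moreover have "v \<le> e" if "u \<le> e / 2" "w < e / 4" "v \<le> 2 * w + u" for u v w :: real
        using that by argo
      ultimately show ?thesis using key[OF that(2)] by blast
    qed
    show "\<exists>N. \<forall>m\<ge>N. \<forall>n\<ge>N. (LINT x|M. (norm (h m x - h n x))\<^sup>2) \<le> e"
    proof (rule exI[of _ "N1 + N2"], intro allI impI)
      fix m n assume "N1 + N2 \<le> m" "N1 + N2 \<le> n"
      then show "(LINT x|M. (norm (h m x - h n x))\<^sup>2) \<le> e"
        using *[of n m] *[of m n] by (cases "n \<le> m") (auto simp: norm_minus_commute)
    qed
  qed blast
  note [measurable] = g(1)
  show ?thesis
  proof (intro bexI[OF _ g(1)] conjI g(2) allI impI)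
    fix \<kappa> :: "'a \<Rightarrow> real" and C :: "'b set" and N
    assume \<kappa>[measurable]: "\<kappa> \<in> borel_measurable M" and \<kappa>i: "integrable M (\<lambda>x. (\<kappa> x)\<^sup>2)" and C: "closed C" "convex C"
      and inC: "\<forall>k\<ge>N. (LINT x|M. \<kappa> x *\<^sub>R f k x) \<in> C"
    have hC: "(LINT x|M. \<kappa> x *\<^sub>R v x) \<in> C" if "v \<in> midpoint_hull f N" for v
      using that
    proof (induction rule: midpoint_hull.induct)
      case (base k) then show ?case using inC by auto
    next
      case (midpoint u v)
      have "(LINT x|M. \<kappa> x *\<^sub>R ((1/2) *\<^sub>R (u x + v x))) = (1/2) *\<^sub>R (LINT x|M. \<kappa> x *\<^sub>R u x) + (1/2) *\<^sub>R (LINT x|M. \<kappa> x *\<^sub>R v x)"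
      proof -
        have "integrable M (\<lambda>x. \<kappa> x *\<^sub>R u x)" "integrable M (\<lambda>x. \<kappa> x *\<^sub>R v x)"
          using hull[OF midpoint(1)] hull[OF midpoint(2)] \<kappa>i by (auto intro: integrable_mult_L2)
        moreover have "\<kappa> x *\<^sub>R ((1/2) *\<^sub>R (u x + v x)) = (1/2) *\<^sub>R (\<kappa> x *\<^sub>R u x) + (1/2) *\<^sub>R (\<kappa> x *\<^sub>R v x)" for x
          by (simp add: algebra_simps)
        ultimately show ?thesis by (simp del: scaleR_scaleR)
      qed
      then show ?case using convexD[OF C(2) midpoint(3,4), of "1/2" "1/2"] by simp
    qed
    have "(\<lambda>n. LINT x|M. \<kappa> x *\<^sub>R h n x) \<longlonglongrightarrow> (LINT x|M. \<kappa> x *\<^sub>R g x)"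
    proof (rule LIMSEQ_I)
      fix e :: real assume e: "e > 0"
      \<comment> \<open>The summand 1 keeps \<open>K\<close> positive. With
        \<open>\<delta> = e / K\<close> the first term of the weighted inequality 2 a b <= \<delta>
        a^2 + b^2 / \<delta> stays below \<open>e\<close> after integration; the second does so for
        large n.\<close>
      define K where "K = (LINT x|M. (\<kappa> x)\<^sup>2) + 1"
      have K: "K \<ge> 1" unfolding K_def using integral_nonneg_AE[of "\<lambda>x. (\<kappa> x)\<^sup>2" M] by simp
      define \<delta> where "\<delta> = e / K"
      have \<delta>: "\<delta> > 0" using e K by (simp add: \<delta>_def)
      obtain n0 where n0: "\<And>n. n \<ge> n0 \<Longrightarrow> norm ((LINT x|M. (norm (h n x - g x))\<^sup>2) - 0) < \<delta> * e"
        using LIMSEQ_D[OF g(4), of "\<delta> * e"] \<delta> e by auto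
      have "norm ((LINT x|M. \<kappa> x *\<^sub>R h n x) - (LINT x|M. \<kappa> x *\<^sub>R g x)) < e" if "n \<ge> n0" for n
      proof -
        have i: "integrable M (\<lambda>x. \<kappa> x *\<^sub>R (h n x - g x))"
          by (rule integrable_mult_L2) (use g \<kappa>i in auto)
        have "(LINT x|M. \<kappa> x *\<^sub>R h n x) - (LINT x|M. \<kappa> x *\<^sub>R g x) = (LINT x|M. \<kappa> x *\<^sub>R (h n x - g x))"
          using hi[of n] g \<kappa>i by (simp add: scaleR_diff_right integrable_mult_L2)
        then have "norm ((LINT x|M. \<kappa> x *\<^sub>R h n x) - (LINT x|M. \<kappa> x *\<^sub>R g x)) \<le> (LINT x|M. norm (\<kappa> x *\<^sub>R (h n x - g x)))"
          using integral_norm_bound[of M "\<lambda>x. \<kappa> x *\<^sub>R (h n x - g x)"] by simp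
        also have "\<dots> \<le> (LINT x|M. (\<delta> * (\<kappa> x)\<^sup>2 + (norm (h n x - g x))\<^sup>2 / \<delta>) / 2)"
        proof (rule integral_mono)
          show "integrable M (\<lambda>x. (\<delta> * (\<kappa> x)\<^sup>2 + (norm (h n x - g x))\<^sup>2 / \<delta>) / 2)" using g(3) \<kappa>i by auto
          fix x
          have "0 \<le> (\<delta> * \<bar>\<kappa> x\<bar> - norm (h n x - g x))\<^sup>2 / \<delta>" using \<delta> by simp
          also have "\<dots> = \<delta> * (\<kappa> x)\<^sup>2 + (norm (h n x - g x))\<^sup>2 / \<delta> - 2 * (\<bar>\<kappa> x\<bar> * norm (h n x - g x))"
            using \<delta> by (simp add: power2_diff field_simps power2_eq_square)
          finally show "norm (\<kappa> x *\<^sub>R (h n x - g x)) \<le> (\<delta> * (\<kappa> x)\<^sup>2 + (norm (h n x - g x))\<^sup>2 / \<delta>) / 2" by simp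
        qed (rule integrable_norm[OF i])
        also have "\<dots> = (\<delta> * (K - 1) + (LINT x|M. (norm (h n x - g x))\<^sup>2) / \<delta>) / 2"
          unfolding K_def using g(3) \<kappa>i by simp
        also have "\<dots> < e"
        proof -
          have "(LINT x|M. (norm (h n x - g x))\<^sup>2) / \<delta> < e" using n0[OF that] \<delta> by (simp add: field_simps)
          moreover have "\<delta> * (K - 1) \<le> e" using e K by (simp add: \<delta>_def field_simps)
          ultimately have "\<delta> * (K - 1) + (LINT x|M. (norm (h n x - g x))\<^sup>2) / \<delta> < e + e" by (intro add_le_less_mono)
          then show ?thesis by (simp only: divide_less_eq_numeral1 mult_2_right)
        qed
        finally show ?thesis .
      qed
      then show "\<exists>no. \<forall>n\<ge>no. norm ((LINT x|M. \<kappa> x *\<^sub>R h n x) - (LINT x|M. \<kappa> x *\<^sub>R g x)) < e" by blast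
    qed
    moreover have "eventually (\<lambda>n. (LINT x|M. \<kappa> x *\<^sub>R h n x) \<in> C) sequentially"
      unfolding eventually_sequentially
      by (rule exI[of _ N]) (use hC midpoint_hull_antimono[OF hV] in auto)
    ultimately show "(LINT x|M. \<kappa> x *\<^sub>R g x) \<in> C"
      by (intro Lim_in_closed_set[OF C(1)]) auto
  qed
qed

section \<open>The Poisson kernel\<close>

text \<open>By evenness an antiderivative is required only for x >= 0, which admits functions of |x|
  such as \<open>(1 + \<bar>x\<bar>) powr (- r)\<close>, whose formula changes at 0.\<close>

lemma nn_integral_add_half_lines:
  fixes f :: "real \<Rightarrow> real"
  assumes [measurable]: "f \<in> borel_measurable borel" and nn: "\<And>x. 0 \<le> f x" and ev: "\<And>x. f (- x) = f x"
    and deriv: "\<And>x. 0 \<le> x \<Longrightarrow> (F has_real_derivative f x) (at x)" and lim: "(F \<longlongrightarrow> T) at_top"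
  shows "has_bochner_integral lborel f (2 * (T - F 0))"
proof -
  have nnint: "(\<integral>\<^sup>+x. ennreal (f x) * indicator {0..} x \<partial>lborel) = ennreal (T - F 0)"
    by (rule nn_integral_FTC_atLeast) (use assms in auto)
  have mono: "F 0 \<le> T"
  proof (rule tendsto_lowerbound[OF lim])
    show "\<forall>\<^sub>F x in at_top. F 0 \<le> F x"
      using eventually_ge_at_top[of 0]
    proof eventually_elim
      case (elim x)
      show ?case
        by (rule DERIV_nonneg_imp_nondecreasing[OF elim]) (use deriv nn in blast)
    qed
  qed auto
  have "(\<integral>\<^sup>+x. ennreal (indicator {0..} x *\<^sub>R f x) \<partial>lborel) = (\<integral>\<^sup>+x. ennreal (f x) * indicator {0..} x \<partial>lborel)"
    by (intro nn_integral_cong) (auto simp: indicator_def)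
  then have "has_bochner_integral lborel (\<lambda>x. indicator {0..} x *\<^sub>R f x) (T - F 0)"
    by (intro has_bochner_integral_nn_integral) (use nnint nn mono in auto)
  then have "has_bochner_integral lborel f (2 *\<^sub>R (T - F 0))"
    by (rule has_bochner_integral_even_function) (use ev in auto)
  then show ?thesis by simp
qed

definition poisson :: "real \<Rightarrow> real \<Rightarrow> real" where
  "poisson y u = y / (pi * (u\<^sup>2 + y\<^sup>2))"

lemma measurable_poisson[measurable]: "poisson y \<in> borel_measurable borel"
  unfolding poisson_def by measurable

lemma poisson_minus[simp]: "poisson y (- u) = poisson y u"
  by (simp add: poisson_def)

lemma poisson_nonneg: "0 \<le> y \<Longrightarrow> 0 \<le> poisson y u"
  by (simp add: poisson_def)

lemma poisson_pos: "0 < y \<Longrightarrow> 0 < poisson y u"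
  by (simp add: poisson_def add_nonneg_pos)

lemma poisson_commute: "poisson y (u - v) = poisson y (v - u)"
  by (metis minus_diff_eq poisson_minus)

lemma poisson_le: "0 < y \<Longrightarrow> poisson y u \<le> 1 / (pi * y)"
proof -
  assume y: "0 < y"
  have "y / (pi * (u\<^sup>2 + y\<^sup>2)) \<le> y / (pi * y\<^sup>2)"
    using y by (intro divide_left_mono mult_pos_pos) (auto intro: add_nonneg_pos)
  also have "\<dots> = 1 / (pi * y)" using y by (simp add: power2_eq_square)
  finally show ?thesis by (simp add: poisson_def)
qed

lemma has_bochner_integral_poisson:
  assumes "0 < y" shows "has_bochner_integral lborel (poisson y) 1"
proof -
  have d: "((\<lambda>u. arctan (u / y) / pi) has_real_derivative poisson y x) (at x)" for x
  proof -
    have "y\<^sup>2 + x\<^sup>2 \<noteq> 0" using assms by (simp add: add_nonneg_eq_0_iff)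
    then have "1 / y * (inverse (1 + (x / y)\<^sup>2)) / pi = poisson y x"
      using assms unfolding poisson_def by (simp add: field_simps power2_eq_square)
    moreover have "((\<lambda>u. arctan (u / y) / pi) has_real_derivative 1 / y * (inverse (1 + (x / y)\<^sup>2)) / pi) (at x)"
      using assms by (auto intro!: derivative_eq_intros)
    ultimately show ?thesis by simp
  qed
  have "filterlim (\<lambda>u. u / y) at_top at_top"
    using filterlim_tendsto_pos_mult_at_top[OF tendsto_const _ filterlim_ident, of "inverse y"] assms
    by (simp add: divide_inverse mult.commute)
  then have "((\<lambda>u. arctan (u / y) / pi) \<longlongrightarrow> (pi / 2) / pi) at_top"
    by (intro tendsto_divide filterlim_compose[OF tendsto_arctan_at_top]) auto
  from nn_integral_add_half_lines[OF measurable_poisson _ _ d this]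
  show ?thesis using assms by (simp add: poisson_nonneg)
qed

lemma has_bochner_integral_poisson_shift:
  assumes "0 < y"
  shows "has_bochner_integral lborel (\<lambda>t. poisson y (x - t)) 1" "has_bochner_integral lborel (\<lambda>t. poisson y (t - x)) 1"
proof -
  have *: "has_bochner_integral lborel (\<lambda>t. poisson y (- x + 1 * t)) (1 /\<^sub>R \<bar>1\<bar>)"
    using lborel_has_bochner_integral_real_affine_iff[of 1 "poisson y" 1 "-x"] has_bochner_integral_poisson[OF assms] by simp
  then show "has_bochner_integral lborel (\<lambda>t. poisson y (t - x)) 1" by (simp add: algebra_simps)
  then show "has_bochner_integral lborel (\<lambda>t. poisson y (x - t)) 1" by (subst poisson_commute)
qed

lemma integrable_poisson[simp]: "0 < y \<Longrightarrow> integrable lborel (\<lambda>t. poisson y (x - t))"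
  and integral_poisson[simp]: "0 < y \<Longrightarrow> (LINT t|lborel. poisson y (x - t)) = 1"
  and integrable_poisson'[simp]: "0 < y \<Longrightarrow> integrable lborel (\<lambda>t. poisson y (t - x))"
  and integral_poisson'[simp]: "0 < y \<Longrightarrow> (LINT t|lborel. poisson y (t - x)) = 1"
  using has_bochner_integral_poisson_shift[of y x] by (auto simp: has_bochner_integral_iff)

lemma integrable_inverse_1_plus_square: "integrable lborel (\<lambda>t::real. 1 / (1 + t\<^sup>2))"
proof -
  have "integrable lborel (\<lambda>t. pi * poisson 1 t)"
    using has_bochner_integral_poisson[of 1] by (intro integrable_mult_right) (simp add: has_bochner_integral_iff)
  then show ?thesis by (simp add: poisson_def add.commute)
qed

lemma integrable_inverse_1_plus_abs_powr:
  assumes "1 < r" shows "integrable lborel (\<lambda>t::real. (1 + \<bar>t\<bar>) powr (- r))"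
proof -
  have "((\<lambda>t. - ((1 + t) powr (1 - r) / (r - 1))) has_real_derivative (1 + \<bar>x\<bar>) powr (- r)) (at x)" if "0 \<le> x" for x
  proof -
    have "((\<lambda>t. (1 + t) powr (1 - r)) has_real_derivative (1 - r) * (1 + x) powr (1 - r - of_nat 1) * (0 + 1)) (at x)"
      using that by (intro DERIV_fun_powr DERIV_add DERIV_const DERIV_ident) auto
    then have "((\<lambda>t. - ((1 + t) powr (1 - r) / (r - 1))) has_real_derivative - (((1 - r) * (1 + x) powr (1 - r - of_nat 1) * (0 + 1)) / (r - 1))) (at x)"
      by (intro DERIV_minus DERIV_cdivide)
    moreover have "- (((1 - r) * A * (0 + 1)) / (r - 1)) = A" for A using assms by (simp add: field_simps)
    ultimately show ?thesis using that by simp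
  qed
  moreover have "((\<lambda>t. - ((1 + t) powr (1 - r) / (r - 1))) \<longlongrightarrow> - (0 / (r - 1))) at_top"
  proof (intro tendsto_intros)
    show "((\<lambda>t. (1 + t) powr (1 - r)) \<longlongrightarrow> 0) at_top"
      by (rule tendsto_neg_powr) (use assms in \<open>auto intro: filterlim_tendsto_add_at_top filterlim_ident\<close>)
  qed (use assms in auto)
  ultimately have "has_bochner_integral lborel (\<lambda>t::real. (1 + \<bar>t\<bar>) powr (- r)) (2 * (- (0 / (r - 1)) - - ((1 + 0) powr (1 - r) / (r - 1))))"
    by (intro nn_integral_add_half_lines) auto
  then show ?thesis by (auto simp: has_bochner_integral_iff)
qed

text \<open>For p > 1 the conjugate exponent r = p / (p - 1) exceeds 1, so the weight (1 + |t|)^-r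
  is integrable. Either 1/(1 + |t|) is at most u^(p-1), and the product is at most u^p, or u is so
  small that the product is at most the weight. For p = 1 the weight is 0. This places every Lp
  inside one weighted L1 space.\<close>

lemma Young_weight:
  assumes p: "1 \<le> p"
  obtains \<omega> :: "real \<Rightarrow> real" where "integrable lborel \<omega>" "\<And>t. 0 \<le> \<omega> t" "\<And>t u. 0 \<le> u \<Longrightarrow> u / (1 + \<bar>t\<bar>) \<le> u powr p + \<omega> t"
proof (cases "p = 1")
  case True
  show ?thesis
    by (rule that[of "\<lambda>_. 0"]) (use True in \<open>auto simp: divide_le_eq mult_le_cancel_left1\<close>)
next
  case False
  then have p1: "1 < p" using p by simp
  define r where "r = p / (p - 1)"
  have r: "1 < r" "r = 1 + 1 / (p - 1)" using p1 by (auto simp: r_def field_simps)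
  show ?thesis
  proof (rule that[OF integrable_inverse_1_plus_abs_powr[OF r(1)]])
    fix t u :: real assume u: "0 \<le> u"
    define b where "b = inverse (1 + \<bar>t\<bar>)"
    have b: "0 < b" by (simp add: b_def add_pos_nonneg)
    have br: "b powr r = (1 + \<bar>t\<bar>) powr (- r)"
      by (simp add: b_def powr_minus powr_divide inverse_powr)
    have "u * b \<le> u powr p + b powr r"
    proof (cases "b \<le> u powr (p - 1)")
      case True
      have "u * b \<le> u * u powr (p - 1)" using True u by (intro mult_left_mono) auto
      also have "\<dots> = u powr p"
        using u p1 by (cases "u = 0") (auto simp: powr_mult_base)
      finally show ?thesis by (simp add: add_increasing2)
    next
      case f: False
      have "u \<le> b powr (1 / (p - 1))"
      proof (rule ccontr)
        assume "\<not> ?thesis"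
        then have "(b powr (1 / (p - 1))) powr (p - 1) \<le> u powr (p - 1)"
          using p1 by (intro powr_mono2) auto
        then show False using f p1 b by (simp add: powr_powr)
      qed
      then have "u * b \<le> b powr (1 / (p - 1)) * b" using b by (intro mult_right_mono) auto
      also have "\<dots> = b powr r" using b by (simp add: r(2) powr_add)
      finally show ?thesis by (simp add: add_increasing)
    qed
    then show "u / (1 + \<bar>t\<bar>) \<le> u powr p + (1 + \<bar>t\<bar>) powr (- r)"
      by (simp add: br) (simp add: b_def divide_inverse)
  qed auto
qed

section \<open>Convexity inequalities for Poisson means\<close>

lemma powr_above_tangent:
  fixes u m p :: real
  assumes "1 \<le> p" "0 \<le> u" "0 < m"
  shows "m powr p + p * m powr (p - 1) * (u - m) \<le> u powr p"
proof (cases "p = 1")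
  case True then show ?thesis using assms by simp
next
  case False
  then have p1: "1 < p" using assms by simp
  define q where "q = p / (p - 1)"
  have q: "1 < q" "1 / p + 1 / q = 1" using p1 by (auto simp: q_def field_simps)
  have "u * m powr (p - 1) \<le> u powr p / p + (m powr (p - 1)) powr q / q"
    by (rule Youngs_inequality) (use p1 q assms in auto)
  also have "(m powr (p - 1)) powr q = m powr p" using p1 by (simp add: powr_powr q_def)
  finally have "p * (u * m powr (p - 1)) \<le> p * (u powr p / p + m powr p / q)"
    using p1 by (intro mult_left_mono) auto
  also have "\<dots> = u powr p + (p - 1) * m powr p" using p1 by (simp add: q_def field_simps)
  finally have "p * m powr (p - 1) * u \<le> u powr p + (p - 1) * m powr p" by (simp add: mult_ac)
  moreover have "m powr (p - 1) * m = m powr p" using assms by (simp add: powr_mult_base mult.commute)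
  ultimately show ?thesis by (simp add: algebra_simps)
qed

definition poisson_integral :: "real \<Rightarrow> (real \<Rightarrow> 'b) \<Rightarrow> real \<Rightarrow> 'b::{banach, second_countable_topology}" where
  "poisson_integral y f x = (LINT t|lborel. poisson y (x - t) *\<^sub>R f t)"

lemma powr_le_1_plus:
  fixes u :: real assumes "0 \<le> u" "1 \<le> p" shows "u \<le> 1 + u powr p"
proof (cases "u \<le> 1")
  case False
  then have "u powr 1 \<le> u powr p" using assms by (intro powr_mono) auto
  then show ?thesis using False by simp
qed (simp add: add_increasing2)

lemma integrable_poisson_bounded:
  fixes f :: "real \<Rightarrow> 'b::{banach, second_countable_topology}"
  assumes "0 < y" "integrable lborel f" shows "integrable lborel (\<lambda>t. poisson y (x - t) *\<^sub>R f t)"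
proof (rule Bochner_Integration.integrable_bound[of lborel "\<lambda>t. 1 / (pi * y) * norm (f t)"])
  show "AE t in lborel. norm (poisson y (x - t) *\<^sub>R f t) \<le> norm (1 / (pi * y) * norm (f t))"
    using mult_right_mono[OF poisson_le[OF assms(1)] norm_ge_zero] poisson_nonneg[of y] assms
    by (intro AE_I2) auto
qed (use assms in \<open>auto intro!: integrable_mult_right\<close>)

lemma integrable_poisson_Lp:
  fixes f :: "real \<Rightarrow> 'b::{banach, second_countable_topology}"
  assumes y: "0 < y" and p: "1 \<le> p" and [measurable]: "f \<in> borel_measurable borel" and f: "integrable lborel (\<lambda>t. norm (f t) powr p)"
  shows "integrable lborel (\<lambda>t. poisson y (x - t) *\<^sub>R f t)"
proof (rule Bochner_Integration.integrable_bound[of lborel "\<lambda>t. poisson y (x - t) + poisson y (x - t) *\<^sub>R (norm (f t) powr p)"])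
  show "integrable lborel (\<lambda>t. poisson y (x - t) + poisson y (x - t) *\<^sub>R (norm (f t) powr p))"
    by (intro Bochner_Integration.integrable_add integrable_poisson_bounded integrable_poisson y f)
  show "AE t in lborel. norm (poisson y (x - t) *\<^sub>R f t) \<le> norm (poisson y (x - t) + poisson y (x - t) *\<^sub>R (norm (f t) powr p))"
  proof (rule AE_I2)
    fix t
    have "poisson y (x - t) * norm (f t) \<le> poisson y (x - t) * (1 + norm (f t) powr p)"
      by (intro mult_left_mono powr_le_1_plus poisson_nonneg) (use y p in auto)
    then show "norm (poisson y (x - t) *\<^sub>R f t) \<le> norm (poisson y (x - t) + poisson y (x - t) *\<^sub>R (norm (f t) powr p))"
      using poisson_nonneg[of y "x - t"] y by (simp add: algebra_simps)
  qed
qed measurable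

text \<open>Jensen's inequality: the Poisson kernel is a probability density, and the tangent of u^p
  at the mean \<open>m\<close> lies below u^p. If the mean is 0, the claim reduces to
  nonnegativity.\<close>

lemma norm_poisson_integral_powr_le:
  fixes f :: "real \<Rightarrow> 'b::{banach, second_countable_topology}"
  assumes y: "0 < y" and p: "1 \<le> p" and [measurable]: "f \<in> borel_measurable borel" and f: "integrable lborel (\<lambda>t. norm (f t) powr p)"
  shows "norm (poisson_integral y f x) powr p \<le> poisson_integral y (\<lambda>t. norm (f t) powr p) x"
proof -
  define m where "m = (LINT t|lborel. poisson y (x - t) * norm (f t))"
  have i1: "integrable lborel (\<lambda>t. poisson y (x - t) * norm (f t))"
    using integrable_poisson_Lp[OF y p, of "\<lambda>t. norm (f t)" x] f by simp
  have i2: "integrable lborel (\<lambda>t. poisson y (x - t) * norm (f t) powr p)"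
    using integrable_poisson_bounded[OF y f] by simp
  have R: "poisson_integral y (\<lambda>t. norm (f t) powr p) x = (LINT t|lborel. poisson y (x - t) * norm (f t) powr p)"
    by (simp add: poisson_integral_def)
  have "norm (poisson_integral y f x) \<le> m"
    unfolding poisson_integral_def m_def
    using integral_norm_bound[of lborel "\<lambda>t. poisson y (x - t) *\<^sub>R f t"] poisson_nonneg[of y] y by simp
  then have 1: "norm (poisson_integral y f x) powr p \<le> m powr p" using p by (intro powr_mono2) auto
  have "m powr p \<le> (LINT t|lborel. poisson y (x - t) * norm (f t) powr p)"
  proof (cases "0 < m")
    case False
    then have "m = 0" using \<open>norm (poisson_integral y f x) \<le> m\<close> norm_ge_zero[of "poisson_integral y f x"] by linarith
    then show ?thesis using poisson_nonneg[of y] y by (auto intro!: integral_nonneg_AE)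
  next
    case True
    have "m powr p = (LINT t|lborel. (m powr p - p * m powr (p - 1) * m) * poisson y (x - t) + p * m powr (p - 1) * (poisson y (x - t) * norm (f t)))"
      using y i1 by (simp add: m_def[symmetric])
    also have "\<dots> \<le> (LINT t|lborel. poisson y (x - t) * norm (f t) powr p)"
    proof (rule integral_mono)
      fix t
      have "poisson y (x - t) * (m powr p + p * m powr (p - 1) * (norm (f t) - m)) \<le> poisson y (x - t) * norm (f t) powr p"
        by (intro mult_left_mono powr_above_tangent poisson_nonneg) (use p True y in auto)
      then show "(m powr p - p * m powr (p - 1) * m) * poisson y (x - t) + p * m powr (p - 1) * (poisson y (x - t) * norm (f t)) \<le> poisson y (x - t) * norm (f t) powr p"
        by (simp add: algebra_simps)
    qed (use i1 i2 y in \<open>auto intro!: Bochner_Integration.integrable_add\<close>)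
    finally show ?thesis .
  qed
  then show ?thesis using 1 R by simp
qed

text \<open>Jensen's inequality again, with the tangent exp m (1 + (u - m)) of the exponential at
  the mean \<open>m\<close>.\<close>

lemma exp_poisson_integral_le:
  fixes w :: "real \<Rightarrow> real"
  assumes y: "0 < y" and w: "integrable lborel (\<lambda>t. poisson y (x - t) * w t)"
    and ew: "integrable lborel (\<lambda>t. poisson y (x - t) * exp (w t))"
  shows "exp (poisson_integral y w x) \<le> poisson_integral y (\<lambda>t. exp (w t)) x"
proof -
  define m where "m = (LINT t|lborel. poisson y (x - t) * w t)"
  have "exp m = (LINT t|lborel. exp m * (1 - m) * poisson y (x - t) + exp m * (poisson y (x - t) * w t))"
    using y w by (simp add: m_def[symmetric]) (simp add: algebra_simps)
  also have "\<dots> \<le> (LINT t|lborel. poisson y (x - t) * exp (w t))"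
  proof (rule integral_mono)
    fix t
    have "poisson y (x - t) * (exp m * (1 + (w t - m))) \<le> poisson y (x - t) * (exp m * exp (w t - m))"
      by (intro mult_left_mono poisson_nonneg exp_ge_add_one_self) (use y in auto)
    then show "exp m * (1 - m) * poisson y (x - t) + exp m * (poisson y (x - t) * w t) \<le> poisson y (x - t) * exp (w t)"
      by (simp add: algebra_simps exp_diff)
  qed (use w ew y in \<open>auto intro!: Bochner_Integration.integrable_add\<close>)
  finally show ?thesis by (simp add: poisson_integral_def m_def)
qed

lemma measurable_poisson_integral[measurable]:
  fixes f :: "real \<Rightarrow> 'b::{banach, second_countable_topology}"
  assumes [measurable]: "f \<in> borel_measurable borel"
  shows "poisson_integral y f \<in> borel_measurable borel"
  unfolding poisson_integral_def[abs_def] by measurable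

text \<open>Tonelli's theorem and the unit mass of the kernel in the other variable. The exact
  equality of the integrals, rather than an inequality, is what the moving majorants of the boundary
  function require.\<close>

lemma integrable_poisson_integral:
  fixes f :: "real \<Rightarrow> real"
  assumes y: "0 < y" and f: "integrable lborel f" and nn: "\<And>t. 0 \<le> f t"
  shows "has_bochner_integral lborel (poisson_integral y f) (integral\<^sup>L lborel f)"
proof -
  have [measurable]: "f \<in> borel_measurable borel" using f by auto
  have "(\<integral>\<^sup>+x. ennreal (poisson_integral y f x) \<partial>lborel) = (\<integral>\<^sup>+x. (\<integral>\<^sup>+t. ennreal (poisson y (x - t) * f t) \<partial>lborel) \<partial>lborel)"
    unfolding poisson_integral_def using integrable_poisson_bounded[OF y f] nn poisson_nonneg[of y] y
    by (intro nn_integral_cong, subst nn_integral_eq_integral) auto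
  also have "\<dots> = (\<integral>\<^sup>+t. (\<integral>\<^sup>+x. ennreal (poisson y (x - t) * f t) \<partial>lborel) \<partial>lborel)"
    by (rule lborel_pair.Fubini') measurable
  also have "\<dots> = (\<integral>\<^sup>+t. ennreal (f t) \<partial>lborel)"
  proof (rule nn_integral_cong)
    fix t
    have "(\<integral>\<^sup>+x. ennreal (poisson y (x - t) * f t) \<partial>lborel) = ennreal (LINT x|lborel. poisson y (x - t) * f t)"
      by (rule nn_integral_eq_integral) (use y nn poisson_nonneg[of y] in auto)
    then show "(\<integral>\<^sup>+x. ennreal (poisson y (x - t) * f t) \<partial>lborel) = ennreal (f t)" using y by simp
  qed
  also have "\<dots> = ennreal (integral\<^sup>L lborel f)" by (rule nn_integral_eq_integral) (use f nn in auto)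
  finally show ?thesis
    using nn poisson_nonneg[of y] y
    by (intro has_bochner_integral_nn_integral AE_I2) (auto simp: poisson_integral_def[of _ f x for x] intro!: integral_nonneg_AE)
qed

section \<open>Poisson integrals at Lebesgue points\<close>

text \<open>The condition under which the Cauchy kernel at a nonreal point is absolutely integrable
  against \<open>f\<close>. Every Borel function in Lp with p >= 1 satisfies it, so it takes the
  place of p in all pointwise arguments.\<close>

definition cauchy_integrable :: "(real \<Rightarrow> complex) \<Rightarrow> bool" where
  "cauchy_integrable f \<longleftrightarrow> f \<in> borel_measurable borel \<and> integrable lborel (\<lambda>t. norm (f t) / (1 + \<bar>t\<bar>))"

lemma cauchy_integrable_Lp:
  assumes p: "1 \<le> p" and f[measurable]: "f \<in> borel_measurable borel" and fp: "integrable lborel (\<lambda>t. norm (f t) powr p)"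
  shows "cauchy_integrable f"
proof -
  obtain \<omega> where \<omega>: "integrable lborel \<omega>" "\<And>t. 0 \<le> \<omega> t" "\<And>t u. 0 \<le> u \<Longrightarrow> u / (1 + \<bar>t\<bar>) \<le> u powr p + \<omega> t"
    using Young_weight[OF p] by metis
  have "integrable lborel (\<lambda>t. norm (f t) / (1 + \<bar>t\<bar>))"
    by (rule Bochner_Integration.integrable_bound[of lborel "\<lambda>t. norm (f t) powr p + \<omega> t"])
      (use fp \<omega> in \<open>auto intro!: AE_I2\<close>)
  then show ?thesis by (simp add: cauchy_integrable_def)
qed

lemma cauchy_integrable_bound:
  assumes f: "cauchy_integrable f" and [measurable]: "k \<in> borel_measurable borel"
    and b: "\<And>t. norm (k t) \<le> C / (1 + \<bar>t\<bar>)"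
  shows "integrable lborel (\<lambda>t. f t * k t)"
proof (rule Bochner_Integration.integrable_bound[of lborel "\<lambda>t. C * (norm (f t) / (1 + \<bar>t\<bar>))"])
  show "integrable lborel (\<lambda>t. C * (norm (f t) / (1 + \<bar>t\<bar>)))"
    using f unfolding cauchy_integrable_def by (intro integrable_mult_right) simp
  show "(\<lambda>t. f t * k t) \<in> borel_measurable lborel" using f by (auto simp: cauchy_integrable_def)
  show "AE t in lborel. norm (f t * k t) \<le> norm (C * (norm (f t) / (1 + \<bar>t\<bar>)))"
  proof (rule AE_I2)
    fix t
    have "norm (f t * k t) \<le> norm (f t) * (C / (1 + \<bar>t\<bar>))"
      unfolding norm_mult by (intro mult_left_mono b) auto
    also have "\<dots> = C * (norm (f t) / (1 + \<bar>t\<bar>))" by simp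
    also have "\<dots> \<le> norm (C * (norm (f t) / (1 + \<bar>t\<bar>)))" by (simp only: real_norm_def abs_ge_self)
    finally show "norm (f t * k t) \<le> norm (C * (norm (f t) / (1 + \<bar>t\<bar>)))" .
  qed
qed

lemma cauchy_integrable_local:
  assumes f: "cauchy_integrable f" shows "set_integrable lborel {a..b} f"
proof -
  have [measurable]: "f \<in> borel_measurable borel" using f by (simp add: cauchy_integrable_def)
  have "integrable lborel (\<lambda>t. f t * of_real (indicator {a..b} t))"
  proof (rule cauchy_integrable_bound[OF f])
    fix t show "norm (complex_of_real (indicator {a..b} t)) \<le> (1 + \<bar>a\<bar> + \<bar>b\<bar>) / (1 + \<bar>t\<bar>)"
      by (auto simp: indicator_def field_simps)
  qed measurable
  then show ?thesis by (simp add: set_integrable_def scaleR_conv_of_real mult.commute)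
qed

text \<open>Differentiation of integrals is applied to |f - q| for q in a countable dense set, so
  that one null set serves all q. At the remaining points some q lies within \<eta>/4 of f x, and
  the triangle inequality replaces q by f x.\<close>

lemma lebesgue_right:
  fixes f :: "real \<Rightarrow> complex"
  assumes [measurable]: "f \<in> borel_measurable borel" and li: "\<And>a b. set_integrable lborel {a..b} f"
  shows "AE x in lborel. \<forall>\<eta>>0. \<exists>\<delta>>0. \<forall>h. 0 < h \<and> h < \<delta> \<longrightarrow>
     (\<integral>\<^sup>+t. ennreal (norm (f t - f x)) * indicator {x..x+h} t \<partial>lborel) \<le> ennreal (\<eta> * h)"
proof -
  obtain D :: "complex set" where D: "countable D" "\<And>X. open X \<Longrightarrow> X \<noteq> {} \<Longrightarrow> \<exists>d\<in>D. d \<in> X"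
    using countable_dense_setE by blast
  have si: "set_integrable lborel {a..b} (\<lambda>t. norm (f t - q))" for q a b
  proof -
    have "set_integrable lborel {a..b} (\<lambda>t. f t - q)"
      by (intro set_integral_diff li borel_integrable_atLeastAtMost' continuous_on_const)
    then show ?thesis by (rule set_integrable_norm)
  qed
  have ae: "AE x in lborel. \<forall>e>0. \<exists>d>0. \<forall>h. 0 < h \<and> h < d \<longrightarrow>
      integral {x..x+h} (\<lambda>t. norm (f t - q)) \<le> h * (norm (f x - q) + e)" for q
  proof -
    obtain N where N: "negligible N" "\<And>x e. \<lbrakk>x \<notin> N; 0 < e\<rbrakk> \<Longrightarrow> \<exists>d>0. \<forall>h. 0 < h \<and> h < d \<longrightarrow>
        norm(integral (cbox x (x + h *\<^sub>R One)) (\<lambda>t. norm (f t - q)) /\<^sub>R h ^ DIM(real) - norm (f x - q)) < e"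
      using integrable_ccontinuous_explicit[of "\<lambda>t. norm (f t - q)"] set_borel_integral_eq_integral(1)[OF si]
      by (metis box_real(2))
    have "AE x in lborel. x \<notin> N"
      using N(1) by (metis AE_completion_iff AE_not_in negligible_iff_null_sets)
    then show ?thesis
    proof eventually_elim
      case (elim x)
      show ?case
      proof (intro allI impI)
        fix e :: real assume "0 < e"
        then obtain d where d: "d > 0" "\<And>h. 0 < h \<and> h < d \<Longrightarrow> norm(integral {x..x+h} (\<lambda>t. norm (f t - q)) / h - norm (f x - q)) < e"
          using N(2)[OF elim, of e] by (auto simp: divide_inverse mult.commute)
        have "integral {x..x+h} (\<lambda>t. norm (f t - q)) \<le> h * (norm (f x - q) + e)" if "0 < h \<and> h < d" for h
        proof -
          have "integral {x..x+h} (\<lambda>t. norm (f t - q)) / h \<le> norm (f x - q) + e" using d(2)[OF that] by (auto simp: abs_if split: if_splits)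
          then show ?thesis using that by (simp add: field_simps)
        qed
        then show "\<exists>d>0. \<forall>h. 0 < h \<and> h < d \<longrightarrow> integral {x..x+h} (\<lambda>t. norm (f t - q)) \<le> h * (norm (f x - q) + e)"
          using d(1) by blast
      qed
    qed
  qed
  have "AE x in lborel. \<forall>q\<in>D. \<forall>e>0. \<exists>d>0. \<forall>h. 0 < h \<and> h < d \<longrightarrow>
      integral {x..x+h} (\<lambda>t. norm (f t - q)) \<le> h * (norm (f x - q) + e)"
    by (subst AE_ball_countable[OF D(1)]) (use ae in blast)
  then show ?thesis
  proof eventually_elim
    case (elim x)
    show ?case
    proof (intro allI impI)
      fix \<eta> :: real assume \<eta>: "0 < \<eta>"
      obtain q where q: "q \<in> D" "q \<in> ball (f x) (\<eta>/4)" using D(2)[of "ball (f x) (\<eta>/4)"] \<eta> by auto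
      obtain d where d: "d > 0" "\<And>h. 0 < h \<and> h < d \<Longrightarrow> integral {x..x+h} (\<lambda>t. norm (f t - q)) \<le> h * (norm (f x - q) + \<eta>/4)"
        using elim q(1) \<eta> by (metis divide_pos_pos zero_less_numeral)
      have nq: "norm (f x - q) < \<eta>/4" using q(2) by (simp add: dist_norm)
      have "(\<integral>\<^sup>+t. ennreal (norm (f t - f x)) * indicator {x..x+h} t \<partial>lborel) \<le> ennreal (\<eta> * h)" if h: "0 < h \<and> h < d" for h
      proof -
        have i2: "set_integrable lborel {x..x+h} (\<lambda>t. \<eta>/4)" by (intro borel_integrable_atLeastAtMost' continuous_on_const)
        have i: "set_integrable lborel {x..x+h} (\<lambda>t. norm (f t - q) + \<eta>/4)" by (intro set_integral_add si i2)
        have "(\<integral>\<^sup>+t. ennreal (norm (f t - f x)) * indicator {x..x+h} t \<partial>lborel)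
            \<le> (\<integral>\<^sup>+t. ennreal (indicator {x..x+h} t *\<^sub>R (norm (f t - q) + \<eta>/4)) \<partial>lborel)"
        proof (rule nn_integral_mono)
          fix t
          have "norm (f t - f x) \<le> norm (f t - q) + \<eta>/4"
            using nq norm_triangle_ineq4[of "f t - q" "f x - q"] by simp
          then show "ennreal (norm (f t - f x)) * indicator {x..x+h} t \<le> ennreal (indicator {x..x+h} t *\<^sub>R (norm (f t - q) + \<eta>/4))"
            by (auto simp: indicator_def intro: ennreal_leI)
        qed
        also have "\<dots> = ennreal (LINT t:{x..x+h}|lborel. norm (f t - q) + \<eta>/4)"
          unfolding set_lebesgue_integral_def
          by (rule nn_integral_eq_integral) (use i \<eta> in \<open>auto simp: set_integrable_def\<close>)
        also have "(LINT t:{x..x+h}|lborel. norm (f t - q) + \<eta>/4) = integral {x..x+h} (\<lambda>t. norm (f t - q)) + h * (\<eta>/4)"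
        proof -
          have "(LINT t:{x..x+h}|lborel. \<eta>/4) = h * (\<eta>/4)" using h by (simp add: set_lebesgue_integral_def)
          then show ?thesis
            by (subst set_integral_add(2)[OF si i2]) (simp add: set_borel_integral_eq_integral(2)[OF si])
        qed
        also have "\<dots> \<le> \<eta> * h"
        proof -
          have "h * (norm (f x - q) + \<eta>/4) \<le> h * (\<eta>/4 + \<eta>/4)" using h nq by (intro mult_left_mono) auto
          then have "integral {x..x+h} (\<lambda>t. norm (f t - q)) + h * (\<eta>/4) \<le> h * (\<eta>/4 + \<eta>/4) + h * (\<eta>/4)"
            by (intro add_right_mono order_trans[OF d(2)[OF h]])
          also have "\<dots> \<le> \<eta> * h" using h \<eta> by (simp add: field_simps)
          finally show ?thesis .
        qed
        finally show ?thesis by (simp add: ennreal_leI)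
      qed
      then show "\<exists>\<delta>>0. \<forall>h. 0 < h \<and> h < \<delta> \<longrightarrow> (\<integral>\<^sup>+t. ennreal (norm (f t - f x)) * indicator {x..x+h} t \<partial>lborel) \<le> ennreal (\<eta> * h)"
        using d(1) by blast
    qed
  qed
qed

lemma AE_lborel_uminus:
  fixes P :: "real \<Rightarrow> bool"
  assumes "AE x in lborel. P x" shows "AE x in lborel. P (- x)"
proof -
  obtain N where N: "N \<in> null_sets lborel" "{x \<in> space lborel. \<not> P x} \<subseteq> N"
    using assms by (auto simp: eventually_ae_filter)
  have "emeasure lborel (uminus -` N \<inter> space lborel) = emeasure (distr lborel borel uminus) N"
    by (rule emeasure_distr[symmetric]) (use N in auto)
  then have "uminus -` N \<in> null_sets lborel"
    using N measurable_sets[of uminus "lborel::real measure" borel N] by (auto simp: lborel_distr_uminus null_sets_def)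
  then show ?thesis by (rule AE_I') (use N in auto)
qed

text \<open>The intervals to the left are the intervals to the right for the reflected function t ->
  f (-t).\<close>

lemma lebesgue_point:
  assumes f: "cauchy_integrable f"
  shows "AE x in lborel. \<forall>\<eta>>0. \<exists>\<delta>>0. \<forall>h. 0 < h \<and> h < \<delta> \<longrightarrow>
     (\<integral>\<^sup>+t. ennreal (norm (f t - f x)) * indicator {x-h<..<x+h} t \<partial>lborel) \<le> ennreal (\<eta> * h)"
proof -
  have [measurable]: "f \<in> borel_measurable borel" using f by (simp add: cauchy_integrable_def)
  have "cauchy_integrable (\<lambda>t. f (- t))"
    using f lborel_integrable_real_affine[of "\<lambda>t. norm (f t) / (1 + \<bar>t\<bar>)" "-1" 0] by (auto simp: cauchy_integrable_def)
  then have "set_integrable lborel {a..b} (\<lambda>t. f (- t))" for a b by (rule cauchy_integrable_local)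
  from lebesgue_right[OF _ this] have "AE x in lborel. \<forall>\<eta>>0. \<exists>\<delta>>0. \<forall>h. 0 < h \<and> h < \<delta> \<longrightarrow>
     (\<integral>\<^sup>+t. ennreal (norm (f (-t) - f (-x))) * indicator {x..x+h} t \<partial>lborel) \<le> ennreal (\<eta> * h)" by simp
  from AE_lborel_uminus[OF this]
  have L: "AE x in lborel. \<forall>\<eta>>0. \<exists>\<delta>>0. \<forall>h. 0 < h \<and> h < \<delta> \<longrightarrow>
     (\<integral>\<^sup>+t. ennreal (norm (f (-t) - f x)) * indicator {-x..-x+h} t \<partial>lborel) \<le> ennreal (\<eta> * h)" by simp
  have refl: "(\<integral>\<^sup>+t. ennreal (norm (f (-t) - f x)) * indicator {-x..-x+h} t \<partial>lborel) = (\<integral>\<^sup>+t. ennreal (norm (f t - f x)) * indicator {x-h..x} t \<partial>lborel)" for x h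
  proof -
    have "(\<integral>\<^sup>+t. ennreal (norm (f t - f x)) * indicator {x-h..x} t \<partial>lborel) = (\<integral>\<^sup>+t. ennreal (norm (f (-t) - f x)) * indicator {x-h..x} (-t) \<partial>lborel)"
      using nn_integral_real_affine[of "\<lambda>t. ennreal (norm (f t - f x)) * indicator {x-h..x} t" "-1" 0] by simp
    then show ?thesis by (auto intro!: nn_integral_cong simp: indicator_def)
  qed
  from L lebesgue_right[OF _ cauchy_integrable_local[OF f]] have
   "AE x in lborel. (\<forall>\<eta>>0. \<exists>\<delta>>0. \<forall>h. 0 < h \<and> h < \<delta> \<longrightarrow> (\<integral>\<^sup>+t. ennreal (norm (f t - f x)) * indicator {x-h..x} t \<partial>lborel) \<le> ennreal (\<eta> * h)) \<and>
     (\<forall>\<eta>>0. \<exists>\<delta>>0. \<forall>h. 0 < h \<and> h < \<delta> \<longrightarrow> (\<integral>\<^sup>+t. ennreal (norm (f t - f x)) * indicator {x..x+h} t \<partial>lborel) \<le> ennreal (\<eta> * h))"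
    unfolding refl by auto
  then show ?thesis
  proof eventually_elim
    case (elim x)
    show ?case
    proof (intro allI impI)
      fix \<eta> :: real assume \<eta>: "0 < \<eta>"
      obtain d1 where d1: "d1 > 0" "\<And>h. 0 < h \<and> h < d1 \<Longrightarrow> (\<integral>\<^sup>+t. ennreal (norm (f t - f x)) * indicator {x-h..x} t \<partial>lborel) \<le> ennreal (\<eta> / 2 * h)"
        using elim \<eta> half_gt_zero by blast
      obtain d2 where d2: "d2 > 0" "\<And>h. 0 < h \<and> h < d2 \<Longrightarrow> (\<integral>\<^sup>+t. ennreal (norm (f t - f x)) * indicator {x..x+h} t \<partial>lborel) \<le> ennreal (\<eta> / 2 * h)"
        using elim \<eta> half_gt_zero by blast
      have "(\<integral>\<^sup>+t. ennreal (norm (f t - f x)) * indicator {x-h<..<x+h} t \<partial>lborel) \<le> ennreal (\<eta> * h)" if h: "0 < h \<and> h < min d1 d2" for h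
      proof -
        have "(\<integral>\<^sup>+t. ennreal (norm (f t - f x)) * indicator {x-h<..<x+h} t \<partial>lborel)
          \<le> (\<integral>\<^sup>+t. (ennreal (norm (f t - f x)) * indicator {x-h..x} t + ennreal (norm (f t - f x)) * indicator {x..x+h} t) \<partial>lborel)"
          by (intro nn_integral_mono) (auto simp: indicator_def)
        also have "\<dots> = (\<integral>\<^sup>+t. ennreal (norm (f t - f x)) * indicator {x-h..x} t \<partial>lborel) + (\<integral>\<^sup>+t. ennreal (norm (f t - f x)) * indicator {x..x+h} t \<partial>lborel)"
          by (rule nn_integral_add) auto
        also have "\<dots> \<le> ennreal (\<eta> / 2 * h) + ennreal (\<eta> / 2 * h)"
          by (intro add_mono d1 d2) (use h in auto)
        also have "\<dots> = ennreal (\<eta> * h)" using \<eta> h by (subst ennreal_plus[symmetric]) auto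
        finally show ?thesis .
      qed
      then show "\<exists>\<delta>>0. \<forall>h. 0 < h \<and> h < \<delta> \<longrightarrow> (\<integral>\<^sup>+t. ennreal (norm (f t - f x)) * indicator {x-h<..<x+h} t \<partial>lborel) \<le> ennreal (\<eta> * h)"
        using d1(1) d2(1) by (intro exI[of _ "min d1 d2"]) auto
    qed
  qed
qed

text \<open>Use t^2 <= 2 x^2 + 2 (x - t)^2, and let (x - t)^2 + y^2 >= \<delta>^2 absorb the
  constant 1 + 2 x^2. The factor y makes the part of a Poisson integral away from x vanish as y
  tends to 0; the alternative \<open>\<delta> \<le> y\<close> serves a fixed height.\<close>

lemma poisson_le_decay:
  assumes "0 < \<delta>" "\<delta> \<le> \<bar>x - t\<bar> \<or> \<delta> \<le> y" "0 < y"
  shows "poisson y (x - t) \<le> y * ((1 + 2 * x\<^sup>2) / \<delta>\<^sup>2 + 2) / (1 + t\<^sup>2)"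
proof -
  define R where "R = (x - t)\<^sup>2 + y\<^sup>2"
  have "\<delta>\<^sup>2 \<le> R"
    using assms power_mono[of \<delta> "\<bar>x - t\<bar>" 2] power_mono[of \<delta> y 2] by (auto simp: R_def intro: add_increasing add_increasing2)
  then have 1: "1 + 2 * x\<^sup>2 \<le> (1 + 2 * x\<^sup>2) / \<delta>\<^sup>2 * R"
    using assms mult_left_mono[of 1 "R / \<delta>\<^sup>2" "1 + 2 * x\<^sup>2"] by simp
  have "t\<^sup>2 \<le> 2 * x\<^sup>2 + 2 * (x - t)\<^sup>2"
    using zero_le_power2[of "2 * x - t"] by (simp add: power2_eq_square algebra_simps)
  also have "\<dots> \<le> 2 * x\<^sup>2 + 2 * R" by (simp add: R_def)
  finally have "1 + t\<^sup>2 \<le> ((1 + 2 * x\<^sup>2) / \<delta>\<^sup>2 + 2) * R" using 1 by (simp add: algebra_simps)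
  moreover have R: "0 < R" using assms by (simp add: R_def add_nonneg_pos)
  moreover have "0 < 1 + t\<^sup>2" by (simp add: add_pos_nonneg)
  ultimately have "y / R \<le> y * ((1 + 2 * x\<^sup>2) / \<delta>\<^sup>2 + 2) / (1 + t\<^sup>2)"
    using assms by (simp add: frac_le_eq divide_le_eq pos_le_divide_eq mult_ac)
  moreover have "y / (pi * R) \<le> y / R"
    using pi_ge_two R assms by (intro divide_left_mono) (auto simp: mult_le_cancel_right1)
  ultimately show ?thesis by (simp add: poisson_def R_def)
qed

lemma one_plus_abs_le: "1 + \<bar>t\<bar> \<le> 2 * (1 + t\<^sup>2)" for t :: real
proof -
  have "0 \<le> (\<bar>t\<bar> - 1/2)\<^sup>2" by simp
  then have "\<bar>t\<bar> \<le> t\<^sup>2 + (1 / 2)\<^sup>2" by (simp add: power2_diff)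
  then have "\<bar>t\<bar> \<le> t\<^sup>2 + 1 / 4" by (simp only: power_divide power_one power2_eq_square[of "2::real"])
  moreover have "0 \<le> t\<^sup>2" by simp
  ultimately show ?thesis by argo
qed

lemma inverse_one_plus_square_le: "1 / (1 + t\<^sup>2) \<le> 2 / (1 + \<bar>t\<bar>)" for t :: real
  using one_plus_abs_le[of t] by (simp add: field_simps add_pos_nonneg)

lemma poisson_le_weight:
  assumes "0 < y" obtains C where "\<And>t. poisson y (x - t) \<le> C / (1 + \<bar>t\<bar>)" "0 \<le> C"
proof
  define C where "C = y * ((1 + 2 * x\<^sup>2) / y\<^sup>2 + 2)"
  show "0 \<le> 2 * C" using assms by (simp add: C_def)
  fix t
  have "poisson y (x - t) \<le> C * (1 / (1 + t\<^sup>2))"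
    using poisson_le_decay[of y x t y] assms by (simp add: C_def)
  also have "\<dots> \<le> C * (2 / (1 + \<bar>t\<bar>))"
    by (intro mult_left_mono inverse_one_plus_square_le) (use assms in \<open>auto simp: C_def\<close>)
  finally show "poisson y (x - t) \<le> (2 * C) / (1 + \<bar>t\<bar>)" by (simp only: times_divide_eq_right mult.commute[of C])
qed

lemma integrable_poisson_cauchy:
  assumes "cauchy_integrable f" "0 < y"
  shows "integrable lborel (\<lambda>t. poisson y (x - t) *\<^sub>R f t)"
proof -
  obtain C where C: "\<And>t. poisson y (x - t) \<le> C / (1 + \<bar>t\<bar>)" using poisson_le_weight assms by metis
  have "integrable lborel (\<lambda>t. f t * complex_of_real (poisson y (x - t)))"
    by (rule cauchy_integrable_bound[OF assms(1), of _ C]) (use C assms poisson_nonneg[of y] in auto)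
  then show ?thesis by (simp add: scaleR_conv_of_real mult.commute)
qed

text \<open>The absolute value inside the integral makes this stronger than convergence of the
  Poisson integral: the bound survives the change to another kernel that is dominated by the Poisson
  kernel, in a cone or in the truncated Hilbert transform.\<close>

definition poisson_point :: "(real \<Rightarrow> complex) \<Rightarrow> real \<Rightarrow> bool" where
  "poisson_point f x \<longleftrightarrow> ((\<lambda>y. LINT t|lborel. poisson y (x - t) * norm (f t - f x)) \<longlongrightarrow> 0) (at_right 0)"

lemma AE_poisson_point:
  assumes f: "cauchy_integrable f" shows "AE x in lborel. poisson_point f x"
  using lebesgue_point[OF f]
proof eventually_elim
  case (elim x)
  have [measurable]: "f \<in> borel_measurable borel" using f by (simp add: cauchy_integrable_def)
  define G where "G = (\<lambda>t. norm (f t - f x))"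
  have [measurable]: "G \<in> borel_measurable borel" unfolding G_def by measurable
  have G0: "0 \<le> G t" for t by (simp add: G_def)
  have Gt: "norm (f t - f x) = G t" for t by (simp add: G_def)
  have iG: "integrable lborel (\<lambda>t. G t / (1 + t\<^sup>2))"
  proof (rule Bochner_Integration.integrable_bound[of lborel "\<lambda>t. 2 * (norm (f t) / (1 + \<bar>t\<bar>)) + norm (f x) * (1 / (1 + t\<^sup>2))"])
    show "integrable lborel (\<lambda>t. 2 * (norm (f t) / (1 + \<bar>t\<bar>)) + norm (f x) * (1 / (1 + t\<^sup>2)))"
      using f integrable_inverse_1_plus_square by (intro Bochner_Integration.integrable_add integrable_mult_right) (auto simp: cauchy_integrable_def)
    show "AE t in lborel. norm (G t / (1 + t\<^sup>2)) \<le> norm (2 * (norm (f t) / (1 + \<bar>t\<bar>)) + norm (f x) * (1 / (1 + t\<^sup>2)))"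
    proof (rule AE_I2)
      fix t
      have "G t * (1 / (1 + t\<^sup>2)) \<le> (norm (f t) + norm (f x)) * (1 / (1 + t\<^sup>2))"
        unfolding G_def by (intro mult_right_mono norm_triangle_ineq4) auto
      also have "\<dots> = norm (f t) * (1 / (1 + t\<^sup>2)) + norm (f x) * (1 / (1 + t\<^sup>2))" by (rule distrib_right)
      also have "\<dots> \<le> norm (f t) * (2 / (1 + \<bar>t\<bar>)) + norm (f x) * (1 / (1 + t\<^sup>2))"
        by (intro add_right_mono mult_left_mono inverse_one_plus_square_le) auto
      finally show "norm (G t / (1 + t\<^sup>2)) \<le> norm (2 * (norm (f t) / (1 + \<bar>t\<bar>)) + norm (f x) * (1 / (1 + t\<^sup>2)))"
        using G0[of t] by (simp add: mult.commute)
    qed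
  qed measurable
  define K where "K = (LINT t|lborel. G t / (1 + t\<^sup>2))"
  have K0: "0 \<le> K" unfolding K_def by (intro integral_nonneg_AE) (auto simp: G0)
  show ?case
  proof (unfold poisson_point_def, rule tendstoI)
    fix e :: real assume e: "0 < e"
    \<comment> \<open>The shell estimates below add up to 8 \<eta> / pi, which for this choice is at
      most e / 2 since pi >= 2.\<close>
    define \<eta> where "\<eta> = e / 8"
    have \<eta>: "0 < \<eta>" using e by (simp add: \<eta>_def)
    obtain \<delta>0 where \<delta>0: "0 < \<delta>0" "\<And>h. 0 < h \<and> h < \<delta>0 \<Longrightarrow> (\<integral>\<^sup>+t. ennreal (G t) * indicator {x-h<..<x+h} t \<partial>lborel) \<le> ennreal (\<eta> * h)"
      using elim \<eta> unfolding G_def by blast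
    define \<delta> where "\<delta> = \<delta>0 / 2"
    have \<delta>: "0 < \<delta>" using \<delta>0 by (simp add: \<delta>_def)
    define A where "A = (1 + 2 * x\<^sup>2) / \<delta>\<^sup>2 + 2"
    have A0: "0 \<le> A" by (simp add: A_def)
    have main: "(LINT t|lborel. poisson y (x - t) * G t) \<le> e / 2 + y * (A * K)" if y: "0 < y" for y
    proof -
      \<comment> \<open>Dyadic shells: where 2^(k-1) y <= |x - t| < 2^k y, or |x - t| < y for k = 0,
        the kernel is at most \<open>c k\<close>, of order 4^-k / y. The radius is capped at
        \<open>\<delta>\<close>, half of \<open>\<delta>0\<close>, so that the Lebesgue point
        estimate applies to every interval and costs at most \<eta> 2^k y; the products form a
        geometric series.\<close>
      define h where "h = (\<lambda>k::nat. min \<delta> (2^k * y))"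
      define c where "c = (\<lambda>k::nat. 4 * (1/4)^k / (pi * y))"
      have near: "(\<integral>\<^sup>+t. ennreal (poisson y (x - t) * G t) * indicator {x-\<delta><..<x+\<delta>} t \<partial>lborel) \<le> ennreal (e/2)"
      proof -
        have "(\<integral>\<^sup>+t. ennreal (poisson y (x - t) * G t) * indicator {x-\<delta><..<x+\<delta>} t \<partial>lborel)
          \<le> (\<integral>\<^sup>+t. (\<Sum>k. ennreal (c k) * (ennreal (G t) * indicator {x-h k<..<x+h k} t)) \<partial>lborel)"
        proof (rule nn_integral_mono)
          fix t
          show "ennreal (poisson y (x - t) * G t) * indicator {x-\<delta><..<x+\<delta>} t \<le> (\<Sum>k. ennreal (c k) * (ennreal (G t) * indicator {x-h k<..<x+h k} t))"
          proof (cases "\<bar>x - t\<bar> < \<delta>")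
            case False
            then show ?thesis by (auto simp: indicator_def abs_less_iff)
          next
            case True
            define k where "k = (LEAST k. \<bar>x - t\<bar> < 2^k * y)"
            have ex: "\<exists>k. \<bar>x - t\<bar> < 2^k * y"
              using real_arch_pow[of 2 "\<bar>x - t\<bar> / y"] y by (auto simp: field_simps)
            have k: "\<bar>x - t\<bar> < 2^k * y" unfolding k_def by (rule LeastI_ex[OF ex])
            have 4: "4^k * y\<^sup>2 / 4 \<le> (x - t)\<^sup>2 + y\<^sup>2"
            proof (cases k)
              case (Suc j)
              then have "\<not> (\<bar>x - t\<bar> < 2^j * y)" using not_less_Least[of j "\<lambda>k. \<bar>x - t\<bar> < 2^k * y"] by (simp add: k_def)
              then have "(2^j * y)\<^sup>2 \<le> \<bar>x - t\<bar>\<^sup>2" using y by (intro power_mono) auto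
              moreover have "(2^j * y)\<^sup>2 = 4^j * y\<^sup>2" by (simp add: power_mult_distrib power_even_eq[symmetric] power_mult[symmetric] mult.commute[of j 2]) (simp add: power_mult)
              ultimately show ?thesis using Suc by (simp add: add_increasing2)
            qed (simp add: add_increasing)
            have p: "0 < 4^k * y\<^sup>2 / 4" using y by simp
            have "poisson y (x - t) \<le> y / (pi * (4^k * y\<^sup>2 / 4))"
              unfolding poisson_def using 4 p y by (intro divide_left_mono mult_left_mono mult_pos_pos) (auto intro: add_nonneg_pos)
            also have "\<dots> = c k" using y by (simp add: c_def power2_eq_square power_divide)
            finally have "poisson y (x - t) * G t \<le> c k * G t" using G0 by (rule mult_right_mono)
            moreover have "0 \<le> c k" using y by (simp add: c_def)
            ultimately have "ennreal (poisson y (x - t) * G t) \<le> ennreal (c k) * ennreal (G t)"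
              using G0 by (subst ennreal_mult[symmetric]) (auto intro!: ennreal_leI)
            moreover have "t \<in> {x-h k<..<x+h k}" using True k by (auto simp: h_def abs_less_iff)
            ultimately have "ennreal (poisson y (x - t) * G t) * indicator {x-\<delta><..<x+\<delta>} t \<le> (\<Sum>k\<in>{k}. ennreal (c k) * (ennreal (G t) * indicator {x-h k<..<x+h k} t))"
              by (auto simp: indicator_def)
            also have "\<dots> \<le> (\<Sum>k. ennreal (c k) * (ennreal (G t) * indicator {x-h k<..<x+h k} t))"
              by (rule sum_le_suminf) auto
            finally show ?thesis .
          qed
        qed
        also have "\<dots> = (\<Sum>k. \<integral>\<^sup>+t. ennreal (c k) * (ennreal (G t) * indicator {x-h k<..<x+h k} t) \<partial>lborel)"
          by (rule nn_integral_suminf) auto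
        also have "\<dots> \<le> (\<Sum>k. ennreal (4 * \<eta> / pi * (1/2)^k))"
        proof (intro suminf_le)
          fix k
          have hk: "0 < h k" "h k < \<delta>0" "h k \<le> 2^k * y" using \<delta> \<delta>0 y by (auto simp: h_def \<delta>_def)
          have "(\<integral>\<^sup>+t. ennreal (c k) * (ennreal (G t) * indicator {x-h k<..<x+h k} t) \<partial>lborel) = ennreal (c k) * (\<integral>\<^sup>+t. ennreal (G t) * indicator {x-h k<..<x+h k} t \<partial>lborel)"
            by (rule nn_integral_cmult) auto
          also have "\<dots> \<le> ennreal (c k) * ennreal (\<eta> * h k)" by (intro mult_left_mono \<delta>0) (use hk in auto)
          also have "\<dots> \<le> ennreal (c k) * ennreal (\<eta> * (2^k * y))" by (intro mult_left_mono ennreal_leI) (use hk \<eta> in auto)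
          also have "\<dots> = ennreal (c k * (\<eta> * (2^k * y)))" using \<eta> y by (subst ennreal_mult[symmetric]) (auto simp: c_def)
          also have "c k * (\<eta> * (2^k * y)) = 4 * \<eta> / pi * (1/2)^k"
          proof -
            have "(1/4::real)^k * 2^k = (1/2)^k" by (subst power_mult_distrib[symmetric]) simp
            then show ?thesis using y by (simp add: c_def field_simps)
          qed
          finally show "(\<integral>\<^sup>+t. ennreal (c k) * (ennreal (G t) * indicator {x-h k<..<x+h k} t) \<partial>lborel) \<le> ennreal (4 * \<eta> / pi * (1/2)^k)" .
        qed auto
        also have "\<dots> = ennreal (4 * \<eta> / pi * 2)"
        proof -
          have "(\<lambda>k. 4 * \<eta> / pi * (1/2)^k) sums (4 * \<eta> / pi * 2)"
            using sums_mult[OF geometric_sums[of "1/2::real"], of "4 * \<eta> / pi"] by simp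
          then show ?thesis using \<eta> by (subst suminf_ennreal2) (auto simp: sums_iff)
        qed
        also have "\<dots> \<le> ennreal (e/2)"
          using e pi_ge_two by (intro ennreal_leI) (simp add: \<eta>_def field_simps)
        finally show ?thesis .
      qed
      have far: "(\<integral>\<^sup>+t. ennreal (poisson y (x - t) * G t) * indicator (- {x-\<delta><..<x+\<delta>}) t \<partial>lborel) \<le> ennreal (y * (A * K))"
      proof -
        have "(\<integral>\<^sup>+t. ennreal (poisson y (x - t) * G t) * indicator (- {x-\<delta><..<x+\<delta>}) t \<partial>lborel) \<le> (\<integral>\<^sup>+t. ennreal (y * A * (G t / (1 + t\<^sup>2))) \<partial>lborel)"
        proof (rule nn_integral_mono)
          fix t
          show "ennreal (poisson y (x - t) * G t) * indicator (- {x-\<delta><..<x+\<delta>}) t \<le> ennreal (y * A * (G t / (1 + t\<^sup>2)))"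
          proof (cases "\<delta> \<le> \<bar>x - t\<bar>")
            case True
            have "poisson y (x - t) * G t \<le> y * A / (1 + t\<^sup>2) * G t"
              using poisson_le_decay[OF \<delta> _ y, of x t] True G0[of t] by (intro mult_right_mono) (auto simp: A_def)
            then show ?thesis by (auto simp: indicator_def mult_ac intro!: ennreal_leI)
          next
            case False
            then show ?thesis by (auto simp: indicator_def abs_less_iff)
          qed
        qed
        also have "\<dots> = ennreal (LINT t|lborel. y * A * (G t / (1 + t\<^sup>2)))"
        proof (rule nn_integral_eq_integral)
          show "integrable lborel (\<lambda>t. y * A * (G t / (1 + t\<^sup>2)))" using iG by (intro integrable_mult_right)
        qed (use y A0 G0 in auto)
        also have "(LINT t|lborel. y * A * (G t / (1 + t\<^sup>2))) = y * (A * K)"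
          unfolding K_def mult.assoc[symmetric] by (rule integral_mult_right_zero)
        finally show ?thesis .
      qed
      have "(\<integral>\<^sup>+t. ennreal (poisson y (x - t) * G t) \<partial>lborel) =
        (\<integral>\<^sup>+t. (ennreal (poisson y (x - t) * G t) * indicator {x-\<delta><..<x+\<delta>} t + ennreal (poisson y (x - t) * G t) * indicator (- {x-\<delta><..<x+\<delta>}) t) \<partial>lborel)"
        by (intro nn_integral_cong) (auto simp: indicator_def)
      also have "\<dots> = (\<integral>\<^sup>+t. ennreal (poisson y (x - t) * G t) * indicator {x-\<delta><..<x+\<delta>} t \<partial>lborel) + (\<integral>\<^sup>+t. ennreal (poisson y (x - t) * G t) * indicator (- {x-\<delta><..<x+\<delta>}) t \<partial>lborel)"
        by (rule nn_integral_add) auto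
      also have "\<dots> \<le> ennreal (e/2) + ennreal (y * (A * K))" by (intro add_mono near far)
      also have "\<dots> = ennreal (e/2 + y * (A * K))" using e y A0 K0 by (subst ennreal_plus) auto
      finally have "enn2real (\<integral>\<^sup>+t. ennreal (poisson y (x - t) * G t) \<partial>lborel) \<le> e/2 + y * (A * K)"
        using e y A0 K0 by (intro enn2real_leI) auto
      then show ?thesis
        using G0 poisson_nonneg[of y] y by (subst integral_eq_nn_integral) auto
    qed
    have "((\<lambda>y. e / 2 + y * (A * K)) \<longlongrightarrow> e / 2 + 0 * (A * K)) (at_right 0)" by (intro tendsto_intros)
    then have "\<forall>\<^sub>F y in at_right 0. e / 2 + y * (A * K) < e"
      by (rule order_tendstoD) (use e in auto)
    then show "\<forall>\<^sub>F y in at_right 0. dist (LINT t|lborel. poisson y (x - t) * norm (f t - f x)) 0 < e"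
      unfolding Gt using eventually_at_right_less[of 0]
    proof eventually_elim
      case (elim y)
      have "0 \<le> (LINT t|lborel. poisson y (x - t) * G t)"
        by (intro integral_nonneg_AE AE_I2) (use G0 poisson_nonneg[of y] elim in auto)
      then show ?case using main[OF elim(2)] elim(1) by (simp add: dist_real_def)
    qed
  qed
qed

section \<open>Cauchy's formula on horizontal lines\<close>

lemma contour_integral_linepath_same_Im:
  assumes "a < c"
  shows "contour_integral (linepath (Complex a b) (Complex c b)) h = integral {a..c} (\<lambda>t. h (Complex t b))"
proof -
  have "contour_integral (linepath (Complex a b) (Complex c b)) h = contour_integral (linepath (of_real a) (of_real c)) (\<lambda>w. h (w + Complex 0 b))"
    unfolding contour_integral_integral
    by (rule integral_cong) (auto simp: linepath_def Complex_eq scaleR_conv_of_real algebra_simps)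
  also have "\<dots> = integral {a..c} (\<lambda>t. h (of_real t + Complex 0 b))"
    using assms by (subst contour_integral_linepath_Reals_eq) auto
  finally show ?thesis by (simp add: Complex_eq)
qed

lemma rectpath_Cauchy_difference:
  fixes F :: "complex \<Rightarrow> complex"
  assumes hol: "F holomorphic_on {w. 0 < Im w}" and b: "0 < b" "b < B" and a: "0 < a"
    and z: "\<bar>Re z\<bar> < a" "b < Im z" "Im z < B" and \<zeta>: "Im \<zeta> < b"
  defines "h \<equiv> \<lambda>w. F w * (1 / (w - z) - 1 / (w - \<zeta>))"
  shows "2 * of_real pi * \<i> * F z = integral {-a..a} (\<lambda>t. h (Complex t b)) + \<i> * integral {b..B} (\<lambda>y. h (Complex a y))
     - integral {-a..a} (\<lambda>t. h (Complex t B)) - \<i> * integral {b..B} (\<lambda>y. h (Complex (-a) y))"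
proof -
  \<comment> \<open>A convex open half-plane around the rectangle. It lies in the domain of
    \<open>F\<close> and leaves out \<open>\<zeta>\<close>, so Cauchy's formula at \<open>z\<close>
    and Cauchy's theorem for the term with pole \<open>\<zeta>\<close> both apply on it.\<close>
  define S where "S = {w. max 0 (Im \<zeta>) < Im w}"
  have S: "convex S" "open S" unfolding S_def by (rule convex_halfspace_Im_gt open_halfspace_Im_gt)+
  define c1 c2 c3 c4 where "c1 = Complex (-a) b" and "c2 = Complex a b" and "c3 = Complex a B" and "c4 = Complex (-a) B"
  have img: "path_image (rectpath c1 c3) \<subseteq> S"
    using path_image_rectpath_subset_cbox[of c1 c3] a b \<zeta> by (auto simp: c1_def c3_def S_def in_cbox_complex_iff)
  have zbox: "z \<in> box c1 c3" using z by (auto simp: c1_def c3_def in_box_complex_iff)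
  have imgz: "path_image (rectpath c1 c3) \<subseteq> S - {z}"
    using img path_image_rectpath_inter_box[of c1 c3] zbox a b by (auto simp: c1_def c3_def)
  have holS: "F holomorphic_on S" by (rule holomorphic_on_subset[OF hol]) (auto simp: S_def)
  have zS: "z \<in> S" using z b \<zeta> by (auto simp: S_def)
  have 1: "((\<lambda>w. F w / (w - z)) has_contour_integral (2 * pi * \<i> * winding_number (rectpath c1 c3) z * F z)) (rectpath c1 c3)"
    by (rule Cauchy_integral_formula_convex_simple[OF S(1) holS]) (use zS S imgz in \<open>auto simp: interior_open\<close>)
  have 2: "((\<lambda>w. F w / (w - \<zeta>)) has_contour_integral 0) (rectpath c1 c3)"
    by (rule Cauchy_theorem_convex_simple[OF _ S(1) _ img]) (intro holomorphic_on_divide holS holomorphic_on_diff holomorphic_on_ident holomorphic_on_const, auto simp: S_def)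
  have h: "(h has_contour_integral 2 * pi * \<i> * F z) (rectpath c1 c3)"
    using has_contour_integral_diff[OF 1 2] winding_number_rectpath[OF zbox] by (simp add: h_def algebra_simps)
  have conth: "continuous_on (S - {z}) h"
    unfolding h_def using holomorphic_on_imp_continuous_on[OF holS]
    by (intro continuous_intros) (auto intro: continuous_on_subset simp: S_def)
  have imgs: "closed_segment c1 c2 \<subseteq> S - {z}" "closed_segment c2 c3 \<subseteq> S - {z}" "closed_segment c3 c4 \<subseteq> S - {z}" "closed_segment c4 c1 \<subseteq> S - {z}"
    using imgz by (auto simp: rectpath_def Let_def path_image_join c1_def c2_def c3_def c4_def)
  have int: "h contour_integrable_on linepath u v" if "closed_segment u v \<subseteq> S - {z}" for u v
    by (rule contour_integrable_continuous_linepath) (rule continuous_on_subset[OF conth that])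
  have rp: "rectpath c1 c3 = linepath c1 c2 +++ linepath c2 c3 +++ linepath c3 c4 +++ linepath c4 c1"
    by (simp add: rectpath_def Let_def c1_def c2_def c3_def c4_def)
  have "2 * pi * \<i> * F z = contour_integral (rectpath c1 c3) h" using h by (simp add: contour_integral_unique)
  also have "\<dots> = contour_integral (linepath c1 c2) h + contour_integral (linepath c2 c3) h + contour_integral (linepath c3 c4) h + contour_integral (linepath c4 c1) h"
    unfolding rp using int[OF imgs(1)] int[OF imgs(2)] int[OF imgs(3)] int[OF imgs(4)] by simp
  also have "contour_integral (linepath c1 c2) h = integral {-a..a} (\<lambda>t. h (Complex t b))"
    unfolding c1_def c2_def using a by (intro contour_integral_linepath_same_Im) auto
  also have "contour_integral (linepath c2 c3) h = \<i> * integral {b..B} (\<lambda>y. h (Complex a y))"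
    unfolding c2_def c3_def using b by (intro contour_integral_linepath_same_Re) auto
  also have "contour_integral (linepath c3 c4) h = - contour_integral (linepath c4 c3) h"
    using int[OF imgs(3)] by (metis contour_integral_reversepath reversepath_linepath valid_path_linepath)
  also have "contour_integral (linepath c4 c3) h = integral {-a..a} (\<lambda>t. h (Complex t B))"
    unfolding c4_def c3_def using a by (intro contour_integral_linepath_same_Im) auto
  also have "contour_integral (linepath c4 c1) h = - contour_integral (linepath c1 c4) h"
    by (metis contour_integral_reversepath reversepath_linepath valid_path_linepath)
  also have "contour_integral (linepath c1 c4) h = \<i> * integral {b..B} (\<lambda>y. h (Complex (-a) y))"
    unfolding c1_def c4_def using b by (intro contour_integral_linepath_same_Re) auto
  finally show ?thesis by simp
qed

text \<open>With w = t + i y the difference is (z - \<zeta>) / ((w - z) (w - \<zeta>)), and u v <=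
  u^2 + v^2 separates the poles. On a horizontal line each inverse square of a distance is a
  multiple of a Poisson kernel, whose integral and maximum are known.\<close>

lemma Cauchy_kernel_difference_bound:
  assumes "Im z \<noteq> y" "Im \<zeta> \<noteq> y"
  shows "norm (1 / (Complex t y - z) - 1 / (Complex t y - \<zeta>)) \<le>
     norm (z - \<zeta>) * ((pi * poisson \<bar>y - Im z\<bar> (t - Re z) / \<bar>y - Im z\<bar>) + (pi * poisson \<bar>y - Im \<zeta>\<bar> (t - Re \<zeta>) / \<bar>y - Im \<zeta>\<bar>))"
proof -
  let ?w = "Complex t y"
  have ne: "?w \<noteq> z" "?w \<noteq> \<zeta>" using assms by auto
  have P: "pi * poisson \<bar>y - Im v\<bar> (t - Re v) / \<bar>y - Im v\<bar> = 1 / (norm (?w - v))\<^sup>2" if "Im v \<noteq> y" for v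
    using that by (simp add: poisson_def cmod_power2)
  have "1 / (?w - z) - 1 / (?w - \<zeta>) = (z - \<zeta>) * (1 / (?w - z) * (1 / (?w - \<zeta>)))"
    using ne by (simp add: field_simps)
  then have "norm (1 / (?w - z) - 1 / (?w - \<zeta>)) = norm (z - \<zeta>) * (1 / norm (?w - z) * (1 / norm (?w - \<zeta>)))"
    by (simp add: norm_mult norm_divide)
  also have "\<dots> \<le> norm (z - \<zeta>) * ((1 / norm (?w - z))\<^sup>2 + (1 / norm (?w - \<zeta>))\<^sup>2)"
  proof (rule mult_left_mono)
    have "u * v \<le> u\<^sup>2 + v\<^sup>2" if "0 \<le> u" "0 \<le> v" for u v :: real
      using sum_squares_bound[of u v] mult_nonneg_nonneg[OF that] by argo
    from this[of "1 / norm (?w - z)" "1 / norm (?w - \<zeta>)"]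
    show "1 / norm (?w - z) * (1 / norm (?w - \<zeta>)) \<le> (1 / norm (?w - z))\<^sup>2 + (1 / norm (?w - \<zeta>))\<^sup>2" by (simp only: zero_le_divide_1_iff norm_ge_zero)
  qed auto
  finally show ?thesis using assms by (simp add: P power_divide)
qed

lemma measurable_line:
  assumes "F holomorphic_on {w. 0 < Im w}" "0 < y"
  shows "(\<lambda>x. F (Complex x y)) \<in> borel_measurable borel"
proof (rule borel_measurable_continuous_onI)
  have "continuous_on {w. 0 < Im w} F" using assms holomorphic_on_imp_continuous_on by blast
  moreover have "continuous_on UNIV (\<lambda>x. Complex x y)" unfolding Complex_eq by (intro continuous_intros)
  ultimately show "continuous_on UNIV (\<lambda>x. F (Complex x y))"
    by (rule continuous_on_compose2) (use assms in auto)
qed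

text \<open>By Tonelli's theorem the integral of |F|^p over the strip between heights b and B is at
  most M (B - b). If for every a >= A the two vertical segments at a and -a together carried at
  least 1, that integral would be infinite.\<close>

lemma good_vertical_lines:
  fixes F :: "complex \<Rightarrow> complex"
  assumes hol: "F holomorphic_on {w. 0 < Im w}"
    and int: "\<And>y. 0 < y \<Longrightarrow> integrable lborel (\<lambda>x. norm (F (Complex x y)) powr p)"
    and M: "\<And>y. 0 < y \<Longrightarrow> (LINT x|lborel. norm (F (Complex x y)) powr p) \<le> M"
    and b: "0 < b" "b \<le> B" and p: "1 \<le> p"
  shows "\<exists>a\<ge>A. integral {b..B} (\<lambda>y. norm (F (Complex a y)) powr p) \<le> 1 \<and> integral {b..B} (\<lambda>y. norm (F (Complex (-a) y)) powr p) \<le> 1"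
proof -
  \<comment> \<open>Extension by zero outside the half-plane makes the integrand measurable on the
    whole plane, as Tonelli's theorem requires.\<close>
  define G where "G = (\<lambda>a y. norm (indicator {w. 0 < Im w} (Complex a y) *\<^sub>R F (Complex a y)) powr p)"
  have m0[measurable]: "(\<lambda>w. indicator {w. 0 < Im w} w *\<^sub>R F w) \<in> borel_measurable borel"
    by (rule borel_measurable_continuous_on_indicator) (auto intro: holomorphic_on_imp_continuous_on hol simp: open_halfspace_Im_gt)
  have [measurable]: "(\<lambda>x. G (fst x) (snd x)) \<in> borel_measurable (borel \<Otimes>\<^sub>M borel)"
    "(\<lambda>x. G (snd x) (fst x)) \<in> borel_measurable (borel \<Otimes>\<^sub>M borel)"
    unfolding G_def Complex_eq by measurable
  have S: "borel_measurable (lborel \<Otimes>\<^sub>M lborel :: (real \<times> real) measure) = borel_measurable (borel \<Otimes>\<^sub>M borel)"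
    by (rule measurable_cong_sets) (auto intro: sets_pair_measure_cong)
  have GF: "G a y = norm (F (Complex a y)) powr p" if "0 < y" for a y using that by (simp add: G_def)
  have G0: "0 \<le> G a y" for a y by (simp add: G_def)
  have [measurable]: "(\<lambda>y. G a y) \<in> borel_measurable borel" for a
    unfolding G_def Complex_eq by measurable
  have [measurable]: "(\<lambda>a. G a y) \<in> borel_measurable borel" for y
    unfolding G_def Complex_eq by measurable
  define \<Phi> where "\<Phi> = (\<lambda>a. \<integral>\<^sup>+y. ennreal (G a y) * indicator {b..B} y \<partial>lborel)"
  have [measurable]: "\<Phi> \<in> borel_measurable lborel"
  proof -
    have "(\<lambda>x. ennreal (G (fst x) (snd x)) * indicator {b..B} (snd x)) \<in> borel_measurable (lborel \<Otimes>\<^sub>M lborel)" unfolding S by measurable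
    from lborel.borel_measurable_nn_integral_fst[OF this] show ?thesis by (simp add: \<Phi>_def)
  qed
  have "(\<integral>\<^sup>+a. \<Phi> a \<partial>lborel) = (\<integral>\<^sup>+y. (\<integral>\<^sup>+a. ennreal (G a y) * indicator {b..B} y \<partial>lborel) \<partial>lborel)"
    unfolding \<Phi>_def by (rule lborel_pair.Fubini'[symmetric]) (unfold S case_prod_beta, measurable)
  also have "\<dots> \<le> (\<integral>\<^sup>+y. ennreal M * indicator {b..B} y \<partial>lborel)"
  proof (rule nn_integral_mono)
    fix y
    show "(\<integral>\<^sup>+a. ennreal (G a y) * indicator {b..B} y \<partial>lborel) \<le> ennreal M * indicator {b..B} y"
    proof (cases "y \<in> {b..B}")
      case True
      then have y: "0 < y" using b by auto
      have "(\<integral>\<^sup>+a. ennreal (G a y) \<partial>lborel) = ennreal (LINT a|lborel. G a y)"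
        using int[OF y] G0 GF[OF y] by (intro nn_integral_eq_integral) auto
      also have "\<dots> \<le> ennreal M" using M[OF y] GF[OF y] by (intro ennreal_leI) simp
      finally show ?thesis using True by simp
    qed simp
  qed
  also have "\<dots> = ennreal M * ennreal (B - b)" using b by (subst nn_integral_cmult_indicator) auto
  also have "\<dots> < \<infinity>" by (simp add: ennreal_mult_less_top)
  finally have fin: "(\<integral>\<^sup>+a. \<Phi> a \<partial>lborel) < \<infinity>" .
  have fin2: "(\<integral>\<^sup>+a. \<Phi> (- a) \<partial>lborel) < \<infinity>"
    using fin nn_integral_real_affine[of \<Phi> "-1" 0] by simp
  have "\<exists>a\<ge>A. \<Phi> a + \<Phi> (- a) \<le> 1"
  proof (rule ccontr)
    assume "\<not> ?thesis"
    then have gt: "1 \<le> \<Phi> a + \<Phi> (- a)" if "a \<ge> A" for a using that by (meson le_cases)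
    have "\<infinity> = (\<integral>\<^sup>+a. indicator {A..} a \<partial>lborel)"
    proof -
      have "emeasure lborel {A..} = \<infinity>"
      proof (rule ccontr)
        assume "emeasure lborel {A..} \<noteq> \<infinity>"
        then obtain r where r: "emeasure lborel {A..} = ennreal r" "0 \<le> r" by (metis ennreal_cases infinity_ennreal_def)
        have "emeasure lborel {A..A + (r + 1)} \<le> emeasure lborel {A..}" by (rule emeasure_mono) auto
        then show False using r by simp
      qed
      then show ?thesis by simp
    qed
    also have "\<dots> \<le> (\<integral>\<^sup>+a. \<Phi> a + \<Phi> (- a) \<partial>lborel)"
      by (intro nn_integral_mono) (auto simp: indicator_def gt)
    also have "\<dots> = (\<integral>\<^sup>+a. \<Phi> a \<partial>lborel) + (\<integral>\<^sup>+a. \<Phi> (- a) \<partial>lborel)"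
      by (rule nn_integral_add) measurable
    also have "\<dots> < \<infinity>" using fin fin2 by simp
    finally show False by simp
  qed
  then obtain a where a: "a \<ge> A" "\<Phi> a + \<Phi> (- a) \<le> 1" by blast
  have conv: "integral {b..B} (\<lambda>y. norm (F (Complex u y)) powr p) \<le> 1" if "\<Phi> u \<le> 1" for u
  proof -
    have *: "\<Phi> u = (\<integral>\<^sup>+y\<in>{b..B}. ennreal (G u y) \<partial>lborel)" by (simp add: \<Phi>_def)
    have "(\<integral>\<^sup>+y\<in>{b..B}. ennreal (G u y) \<partial>lborel) = ennreal (integral {b..B} (G u))"
      by (rule set_nn_integral_lborel_eq_integral) (use that G0 in \<open>auto simp: set_borel_measurable_def *[symmetric] le_less_trans\<close>)
    then have "ennreal (integral {b..B} (G u)) \<le> 1" using that * by simp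
    then have "integral {b..B} (G u) \<le> 1" using ennreal_le_1 by blast
    moreover have "integral {b..B} (G u) = integral {b..B} (\<lambda>y. norm (F (Complex u y)) powr p)"
      using b by (intro integral_cong GF) auto
    ultimately show ?thesis by simp
  qed
  have "\<Phi> a \<le> 1" by (rule order_trans[OF _ a(2)]) (rule add_increasing2, auto)
  moreover have "\<Phi> (- a) \<le> 1" by (rule order_trans[OF _ a(2)]) (rule add_increasing, auto)
  ultimately have "\<Phi> a \<le> 1" "\<Phi> (- a) \<le> 1" by auto
  then show ?thesis by (intro exI[of _ a] conjI conv a(1))
qed

text \<open>The two-point kernel \<open>1/(w - z) - 1/(w - \<zeta>)\<close> decays quadratically, so that no bound on \<open>F\<close>
  beyond its integral means is needed to discard the remaining sides of the rectangles.\<close>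

lemma Cauchy_formula_line:
  fixes F :: "complex \<Rightarrow> complex"
  assumes hol: "F holomorphic_on {w. 0 < Im w}"
    and int: "\<And>y. 0 < y \<Longrightarrow> integrable lborel (\<lambda>x. norm (F (Complex x y)) powr p)"
    and M: "\<And>y. 0 < y \<Longrightarrow> (LINT x|lborel. norm (F (Complex x y)) powr p) \<le> M"
    and p: "1 \<le> p" and b: "0 < b" and z: "b < Im z" and \<zeta>: "Im \<zeta> < b"
  shows "(LINT t|lborel. F (Complex t b) * (1 / (Complex t b - z) - 1 / (Complex t b - \<zeta>))) = 2 * of_real pi * \<i> * F z"
proof -
  define k where "k = (\<lambda>w. 1 / (w - z) - 1 / (w - \<zeta>))"
  define h where "h = (\<lambda>w. F w * k w)"
  define c where "c = norm (z - \<zeta>)"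
  have c0: "0 \<le> c" by (simp add: c_def)
  define P where "P = (\<lambda>y t. c * ((pi * poisson \<bar>y - Im z\<bar> (t - Re z) / \<bar>y - Im z\<bar>) + (pi * poisson \<bar>y - Im \<zeta>\<bar> (t - Re \<zeta>) / \<bar>y - Im \<zeta>\<bar>)))"
  have kP: "norm (k (Complex t y)) \<le> P y t" if "y \<noteq> Im z" "y \<noteq> Im \<zeta>" for t y
    unfolding k_def P_def c_def using that by (intro Cauchy_kernel_difference_bound) auto
  have P0: "0 \<le> P y t" for y t unfolding P_def using c0 by (simp add: poisson_nonneg)
  have iP: "integrable lborel (P y)" "integral\<^sup>L lborel (P y) = c * ((pi / \<bar>y - Im z\<bar>) + (pi / \<bar>y - Im \<zeta>\<bar>))"
    if "y \<noteq> Im z" "y \<noteq> Im \<zeta>" for y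
    unfolding P_def using that by (auto intro!: integrable_mult_right Bochner_Integration.integrable_add)
  define m where "m = (\<lambda>y. c * ((1 / \<bar>y - Im z\<bar>\<^sup>2) + (1 / \<bar>y - Im \<zeta>\<bar>\<^sup>2)))"
  have Pm: "P y t \<le> m y" if "y \<noteq> Im z" "y \<noteq> Im \<zeta>" for y t
  proof -
    have pd: "pi * poisson d u / d \<le> 1 / d\<^sup>2" if "0 < d" for d u
    proof -
      have "pi * poisson d u / d \<le> pi * (1 / (pi * d)) / d"
        using that by (intro divide_right_mono mult_left_mono poisson_le) auto
      also have "\<dots> = 1 / d\<^sup>2" by (simp add: power2_eq_square)
      finally show ?thesis .
    qed
    show ?thesis unfolding P_def m_def using c0 that by (intro mult_left_mono add_mono pd) auto
  qed
  \<comment> \<open>Splitting by |F| <= 1 + |F|^p takes the place of Hoelder's inequality: the 1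
    meets the integrable kernel bound \<open>P\<close>, the power meets its maximum
    \<open>m\<close>.\<close>
  have hb: "norm (h (Complex t y)) \<le> P y t + m y * norm (F (Complex t y)) powr p" if "y \<noteq> Im z" "y \<noteq> Im \<zeta>" for t y
  proof -
    have "norm (h (Complex t y)) \<le> (1 + norm (F (Complex t y)) powr p) * P y t"
      unfolding h_def norm_mult using kP[OF that] P0 p by (intro mult_mono powr_le_1_plus) auto
    also have "\<dots> \<le> P y t + m y * norm (F (Complex t y)) powr p"
      using mult_right_mono[OF Pm[OF that, of t], of "norm (F (Complex t y)) powr p"] by (simp add: algebra_simps)
    finally show ?thesis .
  qed
  have [measurable]: "(\<lambda>t. F (Complex t y)) \<in> borel_measurable borel" if "0 < y" for y using measurable_line[OF hol that] .
  have mk[measurable]: "(\<lambda>t. k (Complex t y)) \<in> borel_measurable borel" for y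
    unfolding k_def Complex_eq by measurable
  have mh: "(\<lambda>t. h (Complex t y)) \<in> borel_measurable borel" if "0 < y" for y
    unfolding h_def using measurable_line[OF hol that] by measurable
  have ibd: "integrable lborel (\<lambda>t. P y t + m y * norm (F (Complex t y)) powr p)" if "y \<noteq> Im z" "y \<noteq> Im \<zeta>" "0 < y" for y
    using iP that int by (intro Bochner_Integration.integrable_add integrable_mult_right) auto
  have ih: "integrable lborel (\<lambda>t. h (Complex t y))" if "y \<noteq> Im z" "y \<noteq> Im \<zeta>" "0 < y" for y
  proof (rule Bochner_Integration.integrable_bound[OF ibd[OF that]])
    show "AE t in lborel. norm (h (Complex t y)) \<le> norm (P y t + m y * norm (F (Complex t y)) powr p)"
      using hb[OF that(1,2)] by (intro AE_I2) (metis abs_ge_self order_trans real_norm_def)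
  qed (use mh[OF that(3)] in simp)
  \<comment> \<open>A bound for the integral over the line at height y. It tends to 0 as y grows,
    because every term contains an inverse power of the vertical distance to one of the
    poles.\<close>
  define T where "T = (\<lambda>y. c * ((pi / \<bar>y - Im z\<bar>) + (pi / \<bar>y - Im \<zeta>\<bar>)) + m y * M)"
  have m0: "0 \<le> m y" for y unfolding m_def using c0 by simp
  have inth: "(LINT t|lborel. norm (h (Complex t y))) \<le> T y" if "y \<noteq> Im z" "y \<noteq> Im \<zeta>" "0 < y" for y
  proof -
    have "(LINT t|lborel. norm (h (Complex t y))) \<le> (LINT t|lborel. P y t + m y * norm (F (Complex t y)) powr p)"
      using ih[OF that] ibd[OF that] hb[OF that(1,2)] by (intro integral_mono) auto
    also have "\<dots> = c * ((pi / \<bar>y - Im z\<bar>) + (pi / \<bar>y - Im \<zeta>\<bar>)) + m y * (LINT t|lborel. norm (F (Complex t y)) powr p)"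
      using iP[OF that(1,2)] int[OF that(3)] by simp
    also have "\<dots> \<le> T y" unfolding T_def using M[OF that(3)] m0 by (intro add_left_mono mult_left_mono) auto
    finally show ?thesis .
  qed
  have HK: "integral {-a..a} (\<lambda>t. h (Complex t y)) = (LINT t|lborel. indicator {-a..a} t *\<^sub>R h (Complex t y))"
    if "y \<noteq> Im z" "y \<noteq> Im \<zeta>" "0 < y" for a y
  proof -
    have "set_integrable lborel {-a..a} (\<lambda>t. h (Complex t y))"
      unfolding set_integrable_def by (intro integrable_mult_indicator ih that) auto
    from set_borel_integral_eq_integral(2)[OF this] show ?thesis by (simp add: set_lebesgue_integral_def)
  qed
  \<comment> \<open>\<open>R\<close> bounds the real parts of both poles, so on a vertical side with
    \<open>\<bar>u\<bar> = a\<close> both distances are at least a - R and the kernel is at most c /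
    (a - R)^2.\<close>
  define R where "R = \<bar>Re z\<bar> + \<bar>Re \<zeta>\<bar>"
  define e where "e = (\<lambda>a. 2 * (c / (a - R)\<^sup>2))"
  have vert: "norm (integral {b..B} (\<lambda>y. h (Complex u y))) \<le> c / (a - R)\<^sup>2 * (B - b + 1)"
    if "b < B" "R < a" "\<bar>u\<bar> = a" "integral {b..B} (\<lambda>y. norm (F (Complex u y)) powr p) \<le> 1" for u a B
  proof -
    have Rd: "0 < a - R" using that by simp
    have far: "a - R \<le> norm (Complex u y - v)" if "v = z \<or> v = \<zeta>" for y v
    proof -
      have "a - R \<le> \<bar>u - Re v\<bar>" using that \<open>\<bar>u\<bar> = a\<close> by (auto simp: R_def)
      also have "\<dots> \<le> norm (Complex u y - v)" using abs_Re_le_cmod[of "Complex u y - v"] by simp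
      finally show ?thesis .
    qed
    have kb: "norm (k (Complex u y)) \<le> c / (a - R)\<^sup>2" for y
    proof -
      have ne: "Complex u y - z \<noteq> 0" "Complex u y - \<zeta> \<noteq> 0" using far[of z y] far[of \<zeta> y] Rd by auto
      then have "k (Complex u y) = (z - \<zeta>) / ((Complex u y - z) * (Complex u y - \<zeta>))"
        unfolding k_def by (simp add: field_simps)
      then have "norm (k (Complex u y)) = c / (norm (Complex u y - z) * norm (Complex u y - \<zeta>))"
        by (simp add: norm_divide norm_mult c_def)
      also have "\<dots> \<le> c / ((a - R) * (a - R))"
        using far[of z y] far[of \<zeta> y] Rd c0 by (intro divide_left_mono mult_mono mult_pos_pos) auto
      finally show ?thesis by (simp add: power2_eq_square)
    qed
    have cF: "continuous_on {b..B} (\<lambda>y. F (Complex u y))"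
    proof (rule continuous_on_compose2[OF holomorphic_on_imp_continuous_on[OF hol]])
      show "continuous_on {b..B} (Complex u)" unfolding Complex_eq by (intro continuous_intros)
    qed (use b in auto)
    have ck: "continuous_on {b..B} (\<lambda>y. k (Complex u y))"
    proof -
      have "Complex u y - z \<noteq> 0" "Complex u y - \<zeta> \<noteq> 0" for y using far[of z y] far[of \<zeta> y] Rd by auto
      moreover have "continuous_on {b..B} (Complex u)" unfolding Complex_eq by (intro continuous_intros)
      ultimately show ?thesis unfolding k_def by (intro continuous_intros) auto
    qed
    have i1: "(\<lambda>y. h (Complex u y)) integrable_on {b..B}"
      unfolding h_def by (intro integrable_continuous_real continuous_on_mult cF ck)
    have cFp: "continuous_on {b..B} (\<lambda>y. norm (F (Complex u y)) powr p)"
      using p by (intro continuous_on_powr' cF continuous_on_norm continuous_on_const) auto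
    have "norm (integral {b..B} (\<lambda>y. h (Complex u y))) \<le> integral {b..B} (\<lambda>y. c / (a - R)\<^sup>2 * (1 + norm (F (Complex u y)) powr p))"
    proof (rule integral_norm_bound_integral[OF i1])
      show "(\<lambda>y. c / (a - R)\<^sup>2 * (1 + norm (F (Complex u y)) powr p)) integrable_on {b..B}"
        by (intro integrable_continuous_real continuous_on_mult continuous_on_add continuous_on_const cFp)
      fix y
      show "norm (h (Complex u y)) \<le> c / (a - R)\<^sup>2 * (1 + norm (F (Complex u y)) powr p)"
        unfolding h_def norm_mult using kb[of y] p c0
        by (subst mult.commute) (intro mult_mono powr_le_1_plus, auto)
    qed
    also have "\<dots> = c / (a - R)\<^sup>2 * (integral {b..B} (\<lambda>y. 1) + integral {b..B} (\<lambda>y. norm (F (Complex u y)) powr p))"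
      using integral_add[OF integrable_continuous_real[OF continuous_on_const[of "{b..B}" "1::real"]] integrable_continuous_real[OF cFp]]
      by simp
    also have "\<dots> \<le> c / (a - R)\<^sup>2 * (B - b + 1)"
      using that c0 by (intro mult_left_mono add_mono) auto
    finally show ?thesis .
  qed
  have bne: "b \<noteq> Im z" "b \<noteq> Im \<zeta>" using z \<zeta> by auto
  \<comment> \<open>With the height \<open>B\<close> fixed, the vertical sides are moved to infinity
    along good abscissas. The top side stays below \<open>T B\<close> and is removed afterwards by
    letting \<open>B\<close> grow.\<close>
  have step: "norm (2 * of_real pi * \<i> * F z - (LINT t|lborel. h (Complex t b))) \<le> T B" if B: "Im z < B" for B
  proof -
    have bB: "b < B" "0 < B" "B \<noteq> Im z" "B \<noteq> Im \<zeta>" using z \<zeta> B b by auto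
    have "\<forall>n::nat. \<exists>a. a \<ge> R + 1 + n \<and> integral {b..B} (\<lambda>y. norm (F (Complex a y)) powr p) \<le> 1 \<and> integral {b..B} (\<lambda>y. norm (F (Complex (-a) y)) powr p) \<le> 1"
      by (intro allI good_vertical_lines[OF hol int M b less_imp_le[OF bB(1)] p])
    from choice[OF this] obtain a :: "nat \<Rightarrow> real" where a0: "\<forall>n::nat. a n \<ge> R + 1 + n \<and> integral {b..B} (\<lambda>y. norm (F (Complex (a n) y)) powr p) \<le> 1
      \<and> integral {b..B} (\<lambda>y. norm (F (Complex (- a n) y)) powr p) \<le> 1" ..
    then have a: "\<And>n::nat. a n \<ge> R + 1 + n" "\<And>n. integral {b..B} (\<lambda>y. norm (F (Complex (a n) y)) powr p) \<le> 1"
      "\<And>n. integral {b..B} (\<lambda>y. norm (F (Complex (- a n) y)) powr p) \<le> 1" by simp_all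
    have R0: "0 \<le> R" by (simp add: R_def)
    have a': "R < a n" "0 < a n" for n using a(1)[of n] R0 by auto
    have alim: "filterlim a at_top sequentially"
    proof (rule filterlim_at_top_mono[OF filterlim_real_sequentially])
      show "\<forall>\<^sub>F n in sequentially. real n \<le> a n" using R0 by (intro always_eventually allI order_trans[OF _ a(1)]) simp
    qed
    have le: "norm (2 * of_real pi * \<i> * F z - (LINT t|lborel. indicator {-a n..a n} t *\<^sub>R h (Complex t b))) \<le> T B + 2 * (c / (a n - R)\<^sup>2 * (B - b + 1))" for n
    proof -
      have "\<bar>Re z\<bar> < a n" using a'[of n] by (simp add: R_def)
      from rectpath_Cauchy_difference[OF hol b bB(1) a'(2) this z B \<zeta>]
      have eq: "2 * of_real pi * \<i> * F z - integral {-a n..a n} (\<lambda>t. h (Complex t b)) =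
         \<i> * integral {b..B} (\<lambda>y. h (Complex (a n) y)) - integral {-a n..a n} (\<lambda>t. h (Complex t B)) - \<i> * integral {b..B} (\<lambda>y. h (Complex (-a n) y))"
        by (simp add: h_def k_def)
      have top: "norm (integral {-a n..a n} (\<lambda>t. h (Complex t B))) \<le> T B"
      proof -
        have "norm (integral {-a n..a n} (\<lambda>t. h (Complex t B))) \<le> (LINT t|lborel. norm (indicator {-a n..a n} t *\<^sub>R h (Complex t B)))"
          unfolding HK[OF bB(3,4,2)] by (rule integral_norm_bound)
        also have "\<dots> \<le> (LINT t|lborel. norm (h (Complex t B)))"
          using ih[OF bB(3,4,2)] by (intro integral_mono integrable_norm integrable_mult_indicator) (auto simp: indicator_def)
        also have "\<dots> \<le> T B" by (rule inth[OF bB(3,4,2)])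
        finally show ?thesis .
      qed
      have "norm (2 * of_real pi * \<i> * F z - integral {-a n..a n} (\<lambda>t. h (Complex t b))) \<le> norm (\<i> * integral {b..B} (\<lambda>y. h (Complex (a n) y))) + norm (integral {-a n..a n} (\<lambda>t. h (Complex t B))) + norm (\<i> * integral {b..B} (\<lambda>y. h (Complex (-a n) y)))"
        unfolding eq by (intro order_trans[OF norm_triangle_ineq4] add_right_mono norm_triangle_ineq4)
      also have "\<dots> \<le> c / (a n - R)\<^sup>2 * (B - b + 1) + T B + c / (a n - R)\<^sup>2 * (B - b + 1)"
        using vert[OF bB(1) a'(1), of "a n" n] vert[OF bB(1) a'(1), of "- a n" n] a(2,3)[of n] a'[of n] top
        by (intro add_mono) (auto simp: norm_mult)
      finally show ?thesis unfolding HK[OF bne b] by simp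
    qed
    have lim1: "(\<lambda>n. LINT t|lborel. indicator {-a n..a n} t *\<^sub>R h (Complex t b)) \<longlonglongrightarrow> (LINT t|lborel. h (Complex t b))"
    proof (rule integral_dominated_convergence[where w="\<lambda>t. norm (h (Complex t b))"])
      show "AE t in lborel. (\<lambda>n. indicator {-a n..a n} t *\<^sub>R h (Complex t b)) \<longlonglongrightarrow> h (Complex t b)"
      proof (rule AE_I2, rule tendsto_eventually)
        fix t
        show "\<forall>\<^sub>F n in sequentially. indicator {-a n..a n} t *\<^sub>R h (Complex t b) = h (Complex t b)"
          using filterlim_at_top[THEN iffD1, OF alim, rule_format, of "\<bar>t\<bar>"] by eventually_elim (auto simp: indicator_def)
      qed
    qed (use ih[OF bne b] mh[OF b] in \<open>auto simp: indicator_def\<close>)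
    have "(\<lambda>n. (a n - R)\<^sup>2) = (\<lambda>n. (a n - R) ^ 2)" by simp
    have "filterlim (\<lambda>n. - R + a n) at_top sequentially" by (rule filterlim_tendsto_add_at_top[OF tendsto_const alim])
    then have "filterlim (\<lambda>n. (a n - R) ^ 2) at_top sequentially"
      by (intro filterlim_pow_at_top) (auto simp: algebra_simps)
    then have "(\<lambda>n. c / (a n - R)\<^sup>2) \<longlonglongrightarrow> 0"
      by (intro real_tendsto_divide_at_top[OF tendsto_const])
    then have lim2: "(\<lambda>n. T B + 2 * (c / (a n - R)\<^sup>2 * (B - b + 1))) \<longlonglongrightarrow> T B + 2 * (0 * (B - b + 1))"
      by (intro tendsto_intros)
    have lim3: "(\<lambda>n. norm (2 * of_real pi * \<i> * F z - (LINT t|lborel. indicator {-a n..a n} t *\<^sub>R h (Complex t b)))) \<longlonglongrightarrow> norm (2 * of_real pi * \<i> * F z - (LINT t|lborel. h (Complex t b)))"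
      by (intro tendsto_intros lim1)
    show ?thesis using LIMSEQ_le[OF lim3 lim2] le by auto
  qed
  have shift: "filterlim (\<lambda>B. \<bar>B - v\<bar>) at_top at_top" for v :: real
  proof (rule filterlim_at_top_mono)
    show "filterlim (\<lambda>B. - v + B) at_top at_top" by (rule filterlim_tendsto_add_at_top[OF tendsto_const filterlim_ident])
  qed (auto intro: always_eventually)
  have "(T \<longlongrightarrow> c * (0 + 0) + c * (0 + 0) * M) at_top"
    unfolding T_def m_def
    by (intro tendsto_intros real_tendsto_divide_at_top[OF tendsto_const] filterlim_pow_at_top shift) auto
  then have "norm (2 * of_real pi * \<i> * F z - (LINT t|lborel. h (Complex t b))) \<le> c * (0 + 0) + c * (0 + 0) * M"
    by (rule tendsto_lowerbound) (auto intro: eventually_mono[OF eventually_gt_at_top[of "Im z"]] step)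
  then show ?thesis by (simp add: h_def k_def)
qed

section \<open>Cauchy transforms\<close>

text \<open>In 1 + |t| <= |t - z| + (1 + |z|) the constant is absorbed by means of |t - z| >= |Im
  z|.\<close>

lemma Cauchy_kernel_weight:
  fixes t :: real
  assumes "Im z \<noteq> 0"
  shows "norm (1 / (of_real t - z)) \<le> (1 + (1 + norm z) / \<bar>Im z\<bar>) / (1 + \<bar>t\<bar>)"
proof -
  have d: "\<bar>Im z\<bar> \<le> norm (of_real t - z)" using abs_Im_le_cmod[of "of_real t - z"] by simp
  have ne: "0 < norm (of_real t - z)" using d assms by linarith
  have "1 + \<bar>t\<bar> \<le> norm (of_real t - z) + (1 + norm z)"
    using norm_triangle_ineq[of "of_real t - z" z] by simp
  also have "\<dots> \<le> norm (of_real t - z) + (1 + norm z) * (norm (of_real t - z) / \<bar>Im z\<bar>)"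
    using d assms mult_left_mono[of 1 "norm (of_real t - z) / \<bar>Im z\<bar>" "1 + norm z"] by simp
  also have "\<dots> = norm (of_real t - z) * (1 + (1 + norm z) / \<bar>Im z\<bar>)" by (simp add: algebra_simps)
  finally show ?thesis using ne by (simp add: norm_divide field_simps add_pos_nonneg)
qed

lemma Cauchy_kernel_norm_le:
  fixes t :: real
  assumes "Im z \<noteq> 0" shows "norm (1 / (of_real t - z)) \<le> 1 / \<bar>Im z\<bar>"
proof -
  have "\<bar>Im z\<bar> \<le> norm (of_real t - z)" using abs_Im_le_cmod[of "of_real t - z"] by simp
  then show ?thesis using assms by (simp add: norm_divide frac_le)
qed

text \<open>A majorant uniform for \<open>w\<close> in a disc around \<open>z\<close> that stays off
  the real line, as differentiation under the integral sign requires.\<close>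

lemma Cauchy_kernel_weight_locally:
  fixes t :: real
  assumes "Im z \<noteq> 0" "norm (w - z) < \<bar>Im z\<bar> / 2"
  shows "norm (1 / (of_real t - w)) \<le> (1 + (1 + 2 * norm z) / (\<bar>Im z\<bar> / 2)) / (1 + \<bar>t\<bar>)" "Im w \<noteq> 0"
proof -
  have i: "\<bar>Im z\<bar> / 2 \<le> \<bar>Im w\<bar>" using abs_Im_le_cmod[of "w - z"] assms by (auto simp: abs_if split: if_splits)
  then show "Im w \<noteq> 0" using assms by auto
  have n: "norm w \<le> 2 * norm z"
    using norm_triangle_ineq[of "w - z" z] assms abs_Im_le_cmod[of z] by simp
  have "norm (1 / (of_real t - w)) \<le> (1 + (1 + norm w) / \<bar>Im w\<bar>) / (1 + \<bar>t\<bar>)"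
    using i assms by (intro Cauchy_kernel_weight) auto
  also have "\<dots> \<le> (1 + (1 + 2 * norm z) / (\<bar>Im z\<bar> / 2)) / (1 + \<bar>t\<bar>)"
    using i n assms by (intro divide_right_mono add_left_mono frac_le) auto
  finally show "norm (1 / (of_real t - w)) \<le> (1 + (1 + 2 * norm z) / (\<bar>Im z\<bar> / 2)) / (1 + \<bar>t\<bar>)" .
qed

lemma integrable_Cauchy_kernel:
  assumes "cauchy_integrable f" "Im z \<noteq> 0"
  shows "integrable lborel (\<lambda>t. f t / (of_real t - z))"
  using cauchy_integrable_bound[OF assms(1) _ Cauchy_kernel_weight[OF assms(2)]] by simp

lemma has_field_derivative_Cauchy_integral:
  assumes f: "cauchy_integrable f" and z: "Im z \<noteq> 0"
  shows "((\<lambda>z. LINT t|lborel. f t / (of_real t - z)) has_field_derivative (LINT t|lborel. f t / (of_real t - z)\<^sup>2)) (at z)"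
proof -
  have fm[measurable]: "f \<in> borel_measurable borel" using f by (simp add: cauchy_integrable_def)
  define C where "C = (1 + (1 + 2 * norm z) / (\<bar>Im z\<bar> / 2))"
  have near: "\<forall>\<^sub>F w in at z. w \<noteq> z \<and> norm (w - z) < \<bar>Im z\<bar> / 2"
    using z unfolding eventually_at by (intro exI[of _ "\<bar>Im z\<bar> / 2"]) (auto simp: dist_norm)
  \<comment> \<open>The difference quotient of 1/(t - z) in z is exactly 1/((t - w) (t - z)), so
    continuity of this integral in \<open>w\<close> is differentiability of the Cauchy
    integral.\<close>
  have lim: "((\<lambda>w. LINT t|lborel. f t / ((of_real t - w) * (of_real t - z))) \<longlongrightarrow> (LINT t|lborel. f t / ((of_real t - z) * (of_real t - z)))) (at z)"
  proof (rule dominated_convergence_within[where w = "\<lambda>t. C * (1 / \<bar>Im z\<bar>) * (norm (f t) / (1 + \<bar>t\<bar>))"])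
    show "integrable lborel (\<lambda>t. C * (1 / \<bar>Im z\<bar>) * (norm (f t) / (1 + \<bar>t\<bar>)))"
      using f unfolding cauchy_integrable_def by (intro integrable_mult_right) simp
    show "AE t in lborel. ((\<lambda>u. f t / ((complex_of_real t - u) * (complex_of_real t - z))) \<longlongrightarrow> f t / ((complex_of_real t - z) * (complex_of_real t - z))) (at z)"
      using z by (intro AE_I2 tendsto_intros) auto
    show "\<forall>\<^sub>F w in at z. AE t in lborel. norm (f t / ((complex_of_real t - w) * (complex_of_real t - z))) \<le> C * (1 / \<bar>Im z\<bar>) * (norm (f t) / (1 + \<bar>t\<bar>))"
      using near
    proof eventually_elim
      case (elim w)
      show ?case
      proof (rule AE_I2)
        fix t :: real
        have 1: "norm (1 / (of_real t - z)) \<le> 1 / \<bar>Im z\<bar>"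
          by (rule Cauchy_kernel_norm_le[OF z])
        have 2: "norm (1 / (of_real t - w)) \<le> C / (1 + \<bar>t\<bar>)"
          unfolding C_def by (rule Cauchy_kernel_weight_locally(1)) (use z elim in auto)
        have "norm (f t) * (norm (1 / (of_real t - w)) * norm (1 / (of_real t - z))) \<le> norm (f t) * (C / (1 + \<bar>t\<bar>) * (1 / \<bar>Im z\<bar>))"
          by (intro mult_left_mono mult_mono 1 2) (auto simp: C_def intro!: divide_nonneg_pos add_nonneg_nonneg)
        then show "norm (f t / ((complex_of_real t - w) * (complex_of_real t - z))) \<le> C * (1 / \<bar>Im z\<bar>) * (norm (f t) / (1 + \<bar>t\<bar>))"
          by (simp add: norm_divide norm_mult mult_ac)
      qed
    qed
  qed measurable
  show ?thesis
    unfolding has_field_derivative_iff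
  proof (rule Lim_transform_eventually)
    show "((\<lambda>w. LINT t|lborel. f t / ((of_real t - w) * (of_real t - z))) \<longlongrightarrow> (LINT t|lborel. f t / (of_real t - z)\<^sup>2)) (at z)"
      using lim by (simp add: power2_eq_square)
    show "\<forall>\<^sub>F w in at z. (LINT t|lborel. f t / ((of_real t - w) * (of_real t - z))) =
       ((LINT t|lborel. f t / (of_real t - w)) - (LINT t|lborel. f t / (of_real t - z))) / (w - z)"
      using near
    proof eventually_elim
      case (elim w)
      have w: "Im w \<noteq> 0" using Cauchy_kernel_weight_locally(2)[OF z] elim by auto
      have "(LINT t|lborel. f t / (of_real t - w)) - (LINT t|lborel. f t / (of_real t - z)) = (LINT t|lborel. f t / (of_real t - w) - f t / (of_real t - z))"
        by (rule Bochner_Integration.integral_diff[symmetric]) (rule integrable_Cauchy_kernel[OF f], use w z in auto)+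
      also have "\<dots> = (LINT t|lborel. (w - z) * (f t / ((of_real t - w) * (of_real t - z))))"
      proof (rule Bochner_Integration.integral_cong[OF refl])
        fix t :: real
        have "of_real t - w \<noteq> 0" "of_real t - z \<noteq> 0" using w z by auto
        then show "f t / (of_real t - w) - f t / (of_real t - z) = (w - z) * (f t / ((of_real t - w) * (of_real t - z)))"
          by (simp add: field_simps)
      qed
      also have "\<dots> = (w - z) * (LINT t|lborel. f t / ((of_real t - w) * (of_real t - z)))" by (rule integral_mult_right_zero)
      finally show ?case using elim by simp
    qed
  qed
qed

lemma measurable_lebesgueI: "f \<in> borel_measurable borel \<Longrightarrow> f \<in> borel_measurable lebesgue"
  by (auto intro: measurable_completion)

lemma cauchy_transform_lborel:
  assumes [measurable]: "f \<in> borel_measurable borel"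
  shows "cauchy_transform s f z = of_real s / (2 * of_real pi * \<i>) * (LINT t|lborel. f t / (of_real t - z))"
  unfolding cauchy_transform_def by (subst integral_completion) auto

lemma has_field_derivative_cauchy_transform:
  assumes f: "cauchy_integrable f" and z: "Im z \<noteq> 0"
  shows "(cauchy_transform s f has_field_derivative of_real s / (2 * of_real pi * \<i>) * (LINT t|lborel. f t / (of_real t - z)\<^sup>2)) (at z)"
proof -
  have fm[measurable]: "f \<in> borel_measurable borel" using f by (simp add: cauchy_integrable_def)
  have "cauchy_transform s f = (\<lambda>z. of_real s / (2 * of_real pi * \<i>) * (LINT t|lborel. f t / (of_real t - z)))"
    by (rule ext) (rule cauchy_transform_lborel[OF fm])
  then show ?thesis by (simp only: DERIV_cmult[OF has_field_derivative_Cauchy_integral[OF assms]])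
qed

lemma holomorphic_cauchy_transform:
  assumes "cauchy_integrable f" shows "cauchy_transform s f holomorphic_on half_plane r"
proof (rule holomorphic_onI)
  fix z assume "z \<in> half_plane r"
  then have "Im z \<noteq> 0" by (auto simp: half_plane_def)
  from has_field_derivative_cauchy_transform[OF assms this]
  show "cauchy_transform s f field_differentiable at z within half_plane r"
    unfolding field_differentiable_def by (blast intro: has_field_derivative_at_within)
qed

section \<open>Poisson and conjugate Poisson parts of the Cauchy transform\<close>

definition conj_poisson :: "real \<Rightarrow> real \<Rightarrow> real" where
  "conj_poisson y u = u / (pi * (u\<^sup>2 + y\<^sup>2))"

lemma measurable_conj_poisson[measurable]: "conj_poisson y \<in> borel_measurable borel"
  unfolding conj_poisson_def by measurable

lemma Cauchy_kernel_split:
  assumes s: "s = 1 \<or> s = -1" and y: "0 < y"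
  shows "of_real s / (2 * of_real pi * \<i>) * (1 / (of_real t - Complex x (s * y))) =
     of_real (poisson y (x - t)) / 2 + of_real s * (\<i> / 2) * of_real (conj_poisson y (x - t))"
proof -
  define u where "u = x - t"
  have ss: "s * s = 1" using s by auto
  have e: "of_real t - Complex x (s * y) = - Complex u (s * y)" by (simp add: u_def complex_eq_iff)
  have n: "u\<^sup>2 + (s * y)\<^sup>2 = u\<^sup>2 + y\<^sup>2" using ss by (simp add: power_mult_distrib power2_eq_square[of s])
  have inv: "1 / (- Complex u (s * y)) = Complex (- u / (u\<^sup>2 + y\<^sup>2)) (s * y / (u\<^sup>2 + y\<^sup>2))"
    by (simp add: complex_eq_iff Re_divide Im_divide n)
  have "of_real s / (2 * of_real pi * \<i>) = Complex 0 (- s / (2 * pi))" by (simp add: complex_eq_iff Re_divide Im_divide power2_eq_square)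
  then have "of_real s / (2 * of_real pi * \<i>) * (1 / (of_real t - Complex x (s * y))) = Complex 0 (- s / (2 * pi)) * Complex (- u / (u\<^sup>2 + y\<^sup>2)) (s * y / (u\<^sup>2 + y\<^sup>2))"
    unfolding e inv by simp
  also have "\<dots> = of_real (poisson y u) / 2 + of_real s * (\<i> / 2) * of_real (conj_poisson y u)"
  proof (rule complex_eqI)
    show "Re (Complex 0 (- s / (2 * pi)) * Complex (- u / (u\<^sup>2 + y\<^sup>2)) (s * y / (u\<^sup>2 + y\<^sup>2))) = Re (of_real (poisson y u) / 2 + of_real s * (\<i> / 2) * of_real (conj_poisson y u))"
      using s by (auto simp: poisson_def)
  qed (simp add: conj_poisson_def)
  finally show ?thesis by (simp add: u_def)
qed

lemma cauchy_transform_split: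
  assumes f: "cauchy_integrable f" and s: "s = 1 \<or> s = -1" and y: "0 < y"
  shows "cauchy_transform s f (Complex x (s * y)) = poisson_integral y f x / 2 + of_real s * (\<i> / 2) * (LINT t|lborel. of_real (conj_poisson y (x - t)) * f t)"
    and "integrable lborel (\<lambda>t. of_real (conj_poisson y (x - t)) * f t)"
proof -
  have fm[measurable]: "f \<in> borel_measurable borel" using f by (simp add: cauchy_integrable_def)
  have ip: "integrable lborel (\<lambda>t. of_real (poisson y (x - t)) * f t)"
    using integrable_poisson_cauchy[OF f y] by (simp add: scaleR_conv_of_real)
  have s0: "of_real s * (\<i> / 2) \<noteq> 0" using s by auto
  have ic: "integrable lborel (\<lambda>t. of_real s / (2 * of_real pi * \<i>) * (f t / (of_real t - Complex x (s * y))))"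
    by (intro integrable_mult_right integrable_Cauchy_kernel f) (use s y in auto)
  have eq: "of_real s / (2 * of_real pi * \<i>) * (f t / (of_real t - Complex x (s * y))) = of_real (poisson y (x - t)) * f t / 2 + of_real s * (\<i> / 2) * (of_real (conj_poisson y (x - t)) * f t)" for t
  proof -
    have "of_real s / (2 * of_real pi * \<i>) * (f t / (of_real t - Complex x (s * y))) = (of_real s / (2 * of_real pi * \<i>) * (1 / (of_real t - Complex x (s * y)))) * f t"
      by simp
    also have "\<dots> = (of_real (poisson y (x - t)) / 2 + of_real s * (\<i> / 2) * of_real (conj_poisson y (x - t))) * f t"
      by (simp only: Cauchy_kernel_split[OF s y])
    also have "\<dots> = of_real (poisson y (x - t)) * f t / 2 + of_real s * (\<i> / 2) * (of_real (conj_poisson y (x - t)) * f t)"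
      by (simp only: distrib_right times_divide_eq_left mult.assoc)
    finally show ?thesis .
  qed
  \<comment> \<open>Integrability of the conjugate part is inherited from the Cauchy kernel and the
    Poisson part: the identity \<open>eq\<close> is solved for it.\<close>
  have "integrable lborel (\<lambda>t. (of_real s / (2 * of_real pi * \<i>) * (f t / (of_real t - Complex x (s * y))) - of_real (poisson y (x - t)) * f t / 2) / (of_real s * (\<i> / 2)))"
    using ip ic by (intro integrable_divide Bochner_Integration.integrable_diff)
  then show ic: "integrable lborel (\<lambda>t. of_real (conj_poisson y (x - t)) * f t)"
    by (simp only: eq add_diff_cancel_left' nonzero_mult_div_cancel_left[OF s0])
  have "cauchy_transform s f (Complex x (s * y)) = (LINT t|lborel. of_real s / (2 * of_real pi * \<i>) * (f t / (of_real t - Complex x (s * y))))"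
    unfolding cauchy_transform_lborel[OF fm] by (rule integral_mult_right_zero[symmetric])
  also have "\<dots> = (LINT t|lborel. of_real (poisson y (x - t)) * f t / 2) + (LINT t|lborel. of_real s * (\<i> / 2) * (of_real (conj_poisson y (x - t)) * f t))"
    unfolding eq using ip ic by (intro Bochner_Integration.integral_add) auto
  finally show "cauchy_transform s f (Complex x (s * y)) = poisson_integral y f x / 2 + of_real s * (\<i> / 2) * (LINT t|lborel. of_real (conj_poisson y (x - t)) * f t)"
    by (simp add: poisson_integral_def scaleR_conv_of_real)
qed

text \<open>At points reflected in the real axis the conjugate Poisson parts carry opposite signs
  and cancel, while the two halves of the Poisson part add up.\<close>

lemma poisson_integral_eq_cauchy:
  assumes f: "cauchy_integrable f" and s: "s = 1 \<or> s = -1" and y: "0 < y"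
  shows "poisson_integral y f x = cauchy_transform s f (Complex x (s * y)) + cauchy_transform (- s) f (Complex x (- s * y))"
proof -
  have s': "- s = 1 \<or> - s = -1" using s by auto
  show ?thesis
    unfolding cauchy_transform_split(1)[OF f s y] cauchy_transform_split(1)[OF f s' y] by (simp add: field_simps)
qed

text \<open>A comparison of Harnack type: inside the cone the kernel at x' is at most 2 + 2 a^2
  times the kernel at x, because (x - t)^2 <= 2 (x' - t)^2 + 2 (a y)^2. Thus the vertical behaviour
  at a Poisson point controls the whole cone.\<close>

lemma poisson_integral_at_poisson_point:
  assumes f: "cauchy_integrable f" and y: "0 < y" and a: "0 < a" and x': "\<bar>x' - x\<bar> \<le> a * y"
  shows "norm (poisson_integral y f x' - f x) \<le> (2 + 2 * a\<^sup>2) * (LINT t|lborel. poisson y (x - t) * norm (f t - f x))"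
proof -
  have fm[measurable]: "f \<in> borel_measurable borel" using f by (simp add: cauchy_integrable_def)
  have le: "poisson y (x' - t) \<le> (2 + 2 * a\<^sup>2) * poisson y (x - t)" for t
  proof -
    have sq: "(x' - x)\<^sup>2 \<le> (a * y)\<^sup>2" using power_mono[OF x', of 2] by simp
    have "(u + v)\<^sup>2 \<le> 2 * u\<^sup>2 + 2 * v\<^sup>2" for u v :: real
      using zero_le_power2[of "u - v"] by (simp add: power2_eq_square algebra_simps)
    from this[of "x' - t" "x - x'"] have "(x - t)\<^sup>2 \<le> 2 * (x' - t)\<^sup>2 + 2 * (x' - x)\<^sup>2"
      by (simp add: power2_commute)
    also have "\<dots> \<le> 2 * (x' - t)\<^sup>2 + 2 * (a * y)\<^sup>2" using sq by simp
    finally have "(x - t)\<^sup>2 + y\<^sup>2 \<le> 2 * (x' - t)\<^sup>2 + 2 * (a * y)\<^sup>2 + y\<^sup>2" by simp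
    also have "\<dots> \<le> (2 + 2 * a\<^sup>2) * ((x' - t)\<^sup>2 + y\<^sup>2)"
    proof -
      have "0 \<le> 2 * a\<^sup>2 * (x' - t)\<^sup>2" "0 \<le> y\<^sup>2" by auto
      then show ?thesis by (simp add: algebra_simps power_mult_distrib)
    qed
    finally have 1: "(x - t)\<^sup>2 + y\<^sup>2 \<le> (2 + 2 * a\<^sup>2) * ((x' - t)\<^sup>2 + y\<^sup>2)" .
    have p: "0 < (x - t)\<^sup>2 + y\<^sup>2" "0 < (x' - t)\<^sup>2 + y\<^sup>2" using y by (simp_all add: add_nonneg_pos)
    have "y * ((x - t)\<^sup>2 + y\<^sup>2) \<le> y * ((2 + 2 * a\<^sup>2) * ((x' - t)\<^sup>2 + y\<^sup>2))" using 1 y by (intro mult_left_mono) auto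
    then have "y / ((x' - t)\<^sup>2 + y\<^sup>2) \<le> (2 + 2 * a\<^sup>2) * y / ((x - t)\<^sup>2 + y\<^sup>2)"
      using p by (simp add: pos_divide_le_eq pos_le_divide_eq mult_ac)
    then have "y / ((x' - t)\<^sup>2 + y\<^sup>2) / pi \<le> (2 + 2 * a\<^sup>2) * y / ((x - t)\<^sup>2 + y\<^sup>2) / pi" by (intro divide_right_mono) auto
    then show ?thesis unfolding poisson_def by (simp add: mult.commute[of pi])
  qed
  have i1: "integrable lborel (\<lambda>t. poisson y (v - t) *\<^sub>R (f t - f x))" for v
    using Bochner_Integration.integrable_diff[OF integrable_poisson_cauchy[OF f y, of v], of "\<lambda>t. poisson y (v - t) *\<^sub>R f x"] y
    by (simp add: scaleR_diff_right)
  have i2: "integrable lborel (\<lambda>t. poisson y (v - t) * norm (f t - f x))" for v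
    using integrable_norm[OF i1[of v]] poisson_nonneg[of y] y by simp
  have "poisson_integral y f x' - f x = (LINT t|lborel. poisson y (x' - t) *\<^sub>R f t) - (LINT t|lborel. poisson y (x' - t) *\<^sub>R f x)"
    using y by (simp add: poisson_integral_def)
  also have "\<dots> = (LINT t|lborel. poisson y (x' - t) *\<^sub>R (f t - f x))"
    using integrable_poisson_cauchy[OF f y, of x'] y by (simp add: scaleR_diff_right)
  also have "norm \<dots> \<le> (LINT t|lborel. norm (poisson y (x' - t) *\<^sub>R (f t - f x)))" by (rule integral_norm_bound)
  also have "\<dots> = (LINT t|lborel. poisson y (x' - t) * norm (f t - f x))" using poisson_nonneg[of y] y by simp
  also have "\<dots> \<le> (LINT t|lborel. (2 + 2 * a\<^sup>2) * (poisson y (x - t) * norm (f t - f x)))"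
    unfolding mult.assoc[symmetric] by (intro integral_mono mult_right_mono le i2 norm_ge_zero) (use i2 in \<open>simp add: mult.assoc\<close>)
  finally show ?thesis by simp
qed

lemma nontangential_poisson_integral:
  assumes f: "cauchy_integrable f" and pp: "poisson_point f x" and s: "s = 1 \<or> s = -1"
    and F: "\<And>x y. 0 < y \<Longrightarrow> F (Complex x (s * y)) = poisson_integral y f x"
  shows "has_nontangential_limit s F x (f x)"
  unfolding has_nontangential_limit_def
proof (intro allI impI)
  fix a :: real assume a: "0 < a"
  define E where "E = (\<lambda>y. (2 + 2 * a\<^sup>2) * (LINT t|lborel. poisson y (x - t) * norm (f t - f x)))"
  have fl: "filterlim (\<lambda>z. s * Im z) (at_right 0) (at (of_real x) within cone s a x)"
    unfolding filterlim_at
  proof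
    show "\<forall>\<^sub>F z in at (complex_of_real x) within cone s a x. s * Im z \<in> {0<..} \<and> s * Im z \<noteq> 0"
      unfolding eventually_at_filter
    proof (intro always_eventually allI impI)
      fix z assume "z \<in> cone s a x"
      then have "0 < s * Im z" by (simp add: cone_def half_plane_def)
      then show "s * Im z \<in> {0<..} \<and> s * Im z \<noteq> 0" by (auto simp only: greaterThan_iff less_imp_not_eq2)
    qed
    have "((\<lambda>z. s * Im z) \<longlongrightarrow> s * Im (of_real x)) (at (of_real x) within cone s a x)" by (intro tendsto_intros)
    then show "((\<lambda>z. s * Im z) \<longlongrightarrow> 0) (at (of_real x) within cone s a x)" by simp
  qed
  have "(E \<longlongrightarrow> (2 + 2 * a\<^sup>2) * 0) (at_right 0)"
    unfolding E_def by (rule tendsto_mult[OF tendsto_const pp[unfolded poisson_point_def]])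
  from filterlim_compose[OF this fl]
  have "((\<lambda>z. E (s * Im z)) \<longlongrightarrow> (2 + 2 * a\<^sup>2) * 0) (at (of_real x) within cone s a x)" .
  then have lim: "((\<lambda>z. E (s * Im z)) \<longlongrightarrow> 0) (at (of_real x) within cone s a x)" by simp
  show "(F \<longlongrightarrow> f x) (at (of_real x) within cone s a x)"
  proof (rule LIM_zero_cancel, rule Lim_null_comparison[OF _ lim])
    show "\<forall>\<^sub>F z in at (complex_of_real x) within cone s a x. norm (F z - f x) \<le> E (s * Im z)"
      unfolding eventually_at_filter
    proof (rule always_eventually, intro allI impI)
      fix z assume z: "z \<in> cone s a x"
      then have y: "0 < s * Im z" "\<bar>Re z - x\<bar> \<le> a * (s * Im z)"
        using s by (auto simp: cone_def half_plane_def abs_mult)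
      have zeq: "z = Complex (Re z) (s * (s * Im z))" using s by (elim disjE) simp_all
      have "F z = poisson_integral (s * Im z) f (Re z)" by (rule trans[OF arg_cong[OF zeq, of F] F[OF y(1)]])
      then show "norm (F z - f x) \<le> E (s * Im z)"
        unfolding E_def using poisson_integral_at_poisson_point[OF f y(1) a y(2)] by simp
    qed
  qed
qed

lemma nontangential_imp_vertical:
  assumes F: "has_nontangential_limit s F x l" and s: "s = 1 \<or> s = -1"
  shows "((\<lambda>y. F (Complex x (s * y))) \<longlongrightarrow> l) (at_right 0)" "((\<lambda>y. F (Complex x y)) \<longlongrightarrow> l) (at 0 within {y. 0 < s * y})"
proof -
  have L: "(F \<longlongrightarrow> l) (at (of_real x) within cone s 1 x)" using F by (simp add: has_nontangential_limit_def)
  have mem': "Complex x y \<in> cone s 1 x \<and> Complex x y \<noteq> of_real x" if "0 < s * y" for y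
  proof -
    have "y \<noteq> 0" using that by auto
    then show ?thesis using that by (simp add: cone_def half_plane_def complex_eq_iff)
  qed
  have mem: "Complex x y \<in> cone s 1 x \<and> Complex x y \<noteq> of_real x" if "y \<in> {y. 0 < s * y}" for y
    using mem' that by simp
  have mem2: "Complex x (s * y) \<in> cone s 1 x \<and> Complex x (s * y) \<noteq> of_real x" if "y \<in> {0<..}" for y
    using mem'[of "s * y"] that s by (cases "s = 1") simp_all
  have "filterlim (\<lambda>y. Complex x (s * y)) (at (of_real x) within cone s 1 x) (at_right 0)"
    unfolding filterlim_at
  proof
    show "\<forall>\<^sub>F y in at_right 0. Complex x (s * y) \<in> cone s 1 x \<and> Complex x (s * y) \<noteq> of_real x"
      unfolding eventually_at_filter by (intro always_eventually allI impI mem2)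
    have "((\<lambda>y. of_real x + \<i> * of_real (s * y)) \<longlongrightarrow> of_real x + \<i> * of_real (s * 0)) (at_right 0)" by (intro tendsto_intros)
    then show "((\<lambda>y. Complex x (s * y)) \<longlongrightarrow> of_real x) (at_right 0)" by (simp add: Complex_eq)
  qed
  from filterlim_compose[OF L this] show "((\<lambda>y. F (Complex x (s * y))) \<longlongrightarrow> l) (at_right 0)" .
  have "filterlim (\<lambda>y. Complex x y) (at (of_real x) within cone s 1 x) (at 0 within {y. 0 < s * y})"
    unfolding filterlim_at
  proof
    show "\<forall>\<^sub>F y in at 0 within {y. 0 < s * y}. Complex x y \<in> cone s 1 x \<and> Complex x y \<noteq> of_real x"
      unfolding eventually_at_filter by (intro always_eventually allI impI mem)
    have "((\<lambda>y. of_real x + \<i> * of_real y) \<longlongrightarrow> of_real x + \<i> * of_real 0) (at 0 within {y. 0 < s * y})" by (intro tendsto_intros)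
    then show "((\<lambda>y. Complex x y) \<longlongrightarrow> of_real x) (at 0 within {y. 0 < s * y})" by (simp add: Complex_eq)
  qed
  from filterlim_compose[OF L this] show "((\<lambda>y. F (Complex x y)) \<longlongrightarrow> l) (at 0 within {y. 0 < s * y})" .
qed

section \<open>Hardy spaces\<close>

lemma open_half_plane: "open (half_plane s)"
  unfolding half_plane_def by (intro open_Collect_less continuous_intros)

lemma Complex_in_half_plane: "s = 1 \<or> s = -1 \<Longrightarrow> 0 < y \<Longrightarrow> Complex x (s * y) \<in> half_plane s"
  by (elim disjE) (simp_all add: half_plane_def)

lemma half_plane_cases:
  assumes "z \<in> half_plane s" "s = 1 \<or> s = -1"
  obtains x y where "0 < y" "z = Complex x (s * y)"
  using that[of "s * Im z" "Re z"] assms by (elim disjE) (simp_all add: half_plane_def)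

lemma continuous_on_line:
  assumes "F holomorphic_on half_plane s" "s = 1 \<or> s = -1" "0 < y"
  shows "continuous_on UNIV (\<lambda>x. F (Complex x (s * y)))"
proof (rule continuous_on_compose2[OF holomorphic_on_imp_continuous_on[OF assms(1)]])
  show "continuous_on UNIV (\<lambda>x. Complex x (s * y))" unfolding Complex_eq by (intro continuous_intros)
  show "range (\<lambda>x. Complex x (s * y)) \<subseteq> half_plane s" using Complex_in_half_plane[OF assms(2,3)] by auto
qed

lemma hardyD:
  assumes F: "F \<in> hardy s p" and s: "s = 1 \<or> s = -1" and p: "1 \<le> p"
  shows "F holomorphic_on half_plane s"
    and "\<And>y. 0 < y \<Longrightarrow> (\<lambda>x. F (Complex x (s * y))) \<in> borel_measurable borel"
    and "\<And>y. 0 < y \<Longrightarrow> integrable lborel (\<lambda>x. norm (F (Complex x (s * y))) powr p)"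
    and "\<exists>M\<ge>0. \<forall>y>0. (LINT x|lborel. norm (F (Complex x (s * y))) powr p) \<le> M"
proof -
  show hol: "F holomorphic_on half_plane s" using F by (simp add: hardy_def)
  show m: "(\<lambda>x. F (Complex x (s * y))) \<in> borel_measurable borel" if "0 < y" for y
    by (rule borel_measurable_continuous_onI[OF continuous_on_line[OF hol s that]])
  have m': "(\<lambda>x. norm (F (Complex x (s * y))) powr p) \<in> borel_measurable lborel" if "0 < y" for y
    using m[OF that] by measurable
  show "integrable lborel (\<lambda>x. norm (F (Complex x (s * y))) powr p)" if "0 < y" for y
    using F that integrable_completion[OF m'[OF that]] by (simp add: hardy_def)
  have eq: "(LINT x|lebesgue. norm (F (Complex x (s * y))) powr p) = (LINT x|lborel. norm (F (Complex x (s * y))) powr p)" if "0 < y" for y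
    by (rule integral_completion[OF m'[OF that]])
  obtain B where B: "\<And>y. 0 < y \<Longrightarrow> (LINT x|lebesgue. norm (F (Complex x (s * y))) powr p) powr (1 / p) \<le> B"
    using F by (auto simp: hardy_def bdd_above_def)
  have "(LINT x|lborel. norm (F (Complex x (s * y))) powr p) \<le> \<bar>B\<bar> powr p" if y: "0 < y" for y
  proof -
    have nn: "0 \<le> (LINT x|lborel. norm (F (Complex x (s * y))) powr p)" by (intro integral_nonneg_AE) auto
    have "((LINT x|lborel. norm (F (Complex x (s * y))) powr p) powr (1 / p)) powr p \<le> \<bar>B\<bar> powr p"
      using B[OF y] p unfolding eq[OF y] by (intro powr_mono2) auto
    then show ?thesis using nn p by (simp add: powr_powr)
  qed
  then show "\<exists>M\<ge>0. \<forall>y>0. (LINT x|lborel. norm (F (Complex x (s * y))) powr p) \<le> M"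
    by (intro exI[of _ "\<bar>B\<bar> powr p"]) auto
qed

lemma hardyI:
  assumes hol: "F holomorphic_on half_plane s" and s: "s = 1 \<or> s = -1" and p: "1 \<le> p"
    and int: "\<And>y. 0 < y \<Longrightarrow> integrable lborel (\<lambda>x. norm (F (Complex x (s * y))) powr p)"
    and M: "\<And>y. 0 < y \<Longrightarrow> (LINT x|lborel. norm (F (Complex x (s * y))) powr p) \<le> M"
  shows "F \<in> hardy s p"
proof -
  have m: "(\<lambda>x. norm (F (Complex x (s * y))) powr p) \<in> borel_measurable lborel" if "0 < y" for y
    using int[OF that] by auto
  have "(LINT x|lebesgue. norm (F (Complex x (s * y))) powr p) powr (1 / p) \<le> M powr (1 / p)" if "0 < y" for y
    using M[OF that] p unfolding integral_completion[OF m[OF that]] by (intro powr_mono2 integral_nonneg_AE) auto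
  then show ?thesis
    using hol int integrable_completion[OF m] by (auto simp: hardy_def intro!: bdd_aboveI2)
qed

section \<open>Cauchy and Poisson formulas over horizontal lines\<close>

lemma Cauchy_integral_tendsto_0:
  assumes f: "cauchy_integrable f" and c: "c = 1 \<or> c = -1"
  shows "(\<lambda>n. LINT t|lborel. f t / (of_real t - Complex 0 (c * real (Suc n)))) \<longlonglongrightarrow> 0"
proof -
  have fm[measurable]: "f \<in> borel_measurable borel" using f by (simp add: cauchy_integrable_def)
  have "(\<lambda>n. LINT t|lborel. f t / (of_real t - Complex 0 (c * real (Suc n)))) \<longlonglongrightarrow> (LINT t::real|lborel. (0::complex))"
  proof (rule integral_dominated_convergence[where w="\<lambda>t. 2 * (norm (f t) / (1 + \<bar>t\<bar>))"])
    show "integrable lborel (\<lambda>t. 2 * (norm (f t) / (1 + \<bar>t\<bar>)))"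
      using f unfolding cauchy_integrable_def by (intro integrable_mult_right) simp
    have low: "real (Suc n) \<le> norm (complex_of_real t - Complex 0 (c * real (Suc n)))" "\<bar>t\<bar> \<le> norm (complex_of_real t - Complex 0 (c * real (Suc n)))" for t n
      using abs_Im_le_cmod[of "complex_of_real t - Complex 0 (c * real (Suc n))"]
        abs_Re_le_cmod[of "complex_of_real t - Complex 0 (c * real (Suc n))"] c by (auto simp: abs_mult)
    show "AE t in lborel. (\<lambda>n. f t / (complex_of_real t - Complex 0 (c * real (Suc n)))) \<longlonglongrightarrow> 0"
    proof (rule AE_I2)
      fix t
      show "(\<lambda>n. f t / (complex_of_real t - Complex 0 (c * real (Suc n)))) \<longlonglongrightarrow> 0"
      proof (rule tendsto_norm_zero_cancel, rule Lim_null_comparison)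
        show "(\<lambda>n. norm (f t) / real (Suc n)) \<longlonglongrightarrow> 0"
          by (rule LIMSEQ_Suc[OF lim_const_over_n])
        show "\<forall>\<^sub>F n in sequentially. norm (norm (f t / (complex_of_real t - Complex 0 (c * real (Suc n))))) \<le> norm (f t) / real (Suc n)"
          using low(1) by (intro always_eventually allI) (simp add: norm_divide frac_le del: of_nat_Suc)
      qed
    qed
    fix n
    show "AE t in lborel. norm (f t / (complex_of_real t - Complex 0 (c * real (Suc n)))) \<le> 2 * (norm (f t) / (1 + \<bar>t\<bar>))"
    proof (rule AE_I2)
      fix t
      have "(1 + \<bar>t\<bar>) / 2 \<le> norm (complex_of_real t - Complex 0 (c * real (Suc n)))" using low(1)[of n t] low(2)[of t n] by simp
      then have "norm (f t) / norm (complex_of_real t - Complex 0 (c * real (Suc n))) \<le> norm (f t) / ((1 + \<bar>t\<bar>) / 2)"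
        by (intro frac_le) auto
      then show "norm (f t / (complex_of_real t - Complex 0 (c * real (Suc n)))) \<le> 2 * (norm (f t) / (1 + \<bar>t\<bar>))"
        by (simp add: norm_divide mult.commute del: of_nat_Suc)
    qed
  qed measurable
  then show ?thesis by simp
qed

text \<open>The two-point formula holds for one pole above and one below the line, here translated
  to the real axis. Sending the lower pole down the imaginary axis isolates the Cauchy integral
  above the line; reinserting its value shows that the Cauchy integral below the line is 0.\<close>

lemma upper_line_Cauchy:
  assumes hol: "F holomorphic_on {w. 0 < Im w}"
    and int: "\<And>y. 0 < y \<Longrightarrow> integrable lborel (\<lambda>x. norm (F (Complex x y)) powr p)"
    and M: "\<And>y. 0 < y \<Longrightarrow> (LINT x|lborel. norm (F (Complex x y)) powr p) \<le> M"
    and p: "1 \<le> p" and b: "0 < b" and y: "0 < y"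
  shows "(LINT t|lborel. F (Complex t b) / (of_real t - Complex x y)) = 2 * of_real pi * \<i> * F (Complex x (b + y))"
    "(LINT t|lborel. F (Complex t b) / (of_real t - Complex x (- y))) = 0"
proof -
  define I where "I = (\<lambda>z. LINT t|lborel. F (Complex t b) / (of_real t - z))"
  have ci: "cauchy_integrable (\<lambda>t. F (Complex t b))"
    by (rule cauchy_integrable_Lp[OF p measurable_line[OF hol b] int[OF b]])
  have key: "I z - I \<zeta> = 2 * of_real pi * \<i> * F (z + Complex 0 b)" if z: "0 < Im z" and \<zeta>: "Im \<zeta> < 0" for z \<zeta>
  proof -
    have k: "1 / (Complex t b - (v + Complex 0 b)) = 1 / (of_real t - v)" for t v
    proof -
      have "Complex t b - (v + Complex 0 b) = of_real t - v" by (simp add: complex_eq_iff)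
      then show ?thesis by (simp only:)
    qed
    have "2 * of_real pi * \<i> * F (z + Complex 0 b) = (LINT t|lborel. F (Complex t b) * (1 / (Complex t b - (z + Complex 0 b)) - 1 / (Complex t b - (\<zeta> + Complex 0 b))))"
      by (rule Cauchy_formula_line[OF hol int M p b, symmetric]) (use z \<zeta> in auto)
    also have "\<dots> = (LINT t|lborel. F (Complex t b) / (of_real t - z) - F (Complex t b) / (of_real t - \<zeta>))"
      unfolding k by (simp add: right_diff_distrib)
    also have "\<dots> = I z - I \<zeta>"
      unfolding I_def by (rule Bochner_Integration.integral_diff) (rule integrable_Cauchy_kernel[OF ci], use z \<zeta> in auto)+
    finally show ?thesis by simp
  qed
  have up: "I z = 2 * of_real pi * \<i> * F (z + Complex 0 b)" if z: "0 < Im z" for z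
  proof -
    have "I z - I (Complex 0 (-1 * real (Suc n))) = 2 * of_real pi * \<i> * F (z + Complex 0 b)" for n
      by (rule key[OF z]) simp
    moreover have "(\<lambda>n. I z - I (Complex 0 (-1 * real (Suc n)))) \<longlonglongrightarrow> I z - 0"
      unfolding I_def by (intro tendsto_diff tendsto_const Cauchy_integral_tendsto_0[OF ci]) simp
    ultimately have "(\<lambda>n::nat. 2 * of_real pi * \<i> * F (z + Complex 0 b)) \<longlonglongrightarrow> I z - 0" by (simp only:)
    then show ?thesis unfolding LIMSEQ_const_iff by simp
  qed
  show "(LINT t|lborel. F (Complex t b) / (of_real t - Complex x y)) = 2 * of_real pi * \<i> * F (Complex x (b + y))"
  proof -
    have "Complex x y + Complex 0 b = Complex x (b + y)" by (simp add: complex_eq_iff)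
    then show ?thesis using up[of "Complex x y"] y by (simp add: I_def)
  qed
  have "I (Complex x (- y)) = 0" using key[of "Complex 0 1" "Complex x (- y)"] up[of "Complex 0 1"] y by simp
  then show "(LINT t|lborel. F (Complex t b) / (of_real t - Complex x (- y))) = 0" by (simp add: I_def)
qed

lemma hardy_line_cauchy_integrable:
  assumes F: "F \<in> hardy s p" and s: "s = 1 \<or> s = -1" and p: "1 \<le> p" and b: "0 < b"
  shows "cauchy_integrable (\<lambda>t. F (Complex t (s * b)))"
  using cauchy_integrable_Lp[OF p] hardyD[OF F s p] b by blast

lemma hardy_line_Cauchy:
  assumes F: "F \<in> hardy s p" and s: "s = 1 \<or> s = -1" and p: "1 \<le> p" and b: "0 < b" and y: "0 < y"
  shows "cauchy_transform s (\<lambda>t. F (Complex t (s * b))) (Complex x (s * y)) = F (Complex x (s * (b + y)))"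
    "cauchy_transform (- s) (\<lambda>t. F (Complex t (s * b))) (Complex x (- s * y)) = 0"
proof -
  note D = hardyD[OF F s p]
  obtain M where M: "\<And>y. 0 < y \<Longrightarrow> (LINT x|lborel. norm (F (Complex x (s * y))) powr p) \<le> M"
    using D(4) by auto
  \<comment> \<open>For s = -1 the rotation z -> -z carries the lower half-plane to the upper one.
    Unlike conjugation of the argument it keeps the function holomorphic, and on lines it only
    reflects the integration variable.\<close>
  define F' where "F' = (\<lambda>z. F (of_real s * z))"
  have im: "z \<in> {w. 0 < Im w} \<Longrightarrow> of_real s * z \<in> half_plane s" for z
    using s by (elim disjE) (simp_all add: half_plane_def)
  have hol: "F' holomorphic_on {w. 0 < Im w}"
    unfolding F'_def
    by (rule holomorphic_on_compose_gen[OF _ D(1), unfolded comp_def]) (use im in \<open>auto intro: holomorphic_intros\<close>)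
  have F'C: "F' (Complex x y) = F (Complex (s * x) (s * y))" for x y
  proof -
    have "of_real s * Complex x y = Complex (s * x) (s * y)" by (simp add: complex_eq_iff)
    then show ?thesis by (simp only: F'_def)
  qed
  have s0: "s \<noteq> 0" "\<bar>s\<bar> = 1" using s by auto
  have aff: "integrable lborel (\<lambda>x. g (s * x))" "(LINT x|lborel. g (s * x)) = integral\<^sup>L lborel g" if "integrable lborel g" for g :: "real \<Rightarrow> real"
    using lborel_integrable_real_affine[OF that, of s 0] lborel_integral_real_affine[of s g 0] s0 by simp_all
  have int: "integrable lborel (\<lambda>x. norm (F' (Complex x y)) powr p)" if "0 < y" for y
    unfolding F'C using aff(1)[OF D(3)[OF that]] .
  have M': "(LINT x|lborel. norm (F' (Complex x y)) powr p) \<le> M" if "0 < y" for y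
    unfolding F'C using aff(2)[OF D(3)[OF that]] M[OF that] by simp
  have affc: "(LINT t|lborel. g (s * t)) = integral\<^sup>L lborel g" for g :: "real \<Rightarrow> complex"
    using lborel_integral_real_affine[of s g 0] s0 by simp
  have fm: "(\<lambda>t. F (Complex t (s * b))) \<in> borel_measurable borel" by (rule D(2)[OF b])
  have conv: "(LINT t|lborel. F (Complex t (s * b)) / (of_real t - of_real s * v)) = of_real s * (LINT t|lborel. F' (Complex t b) / (of_real t - v))" for v
  proof -
    have "(LINT t|lborel. F (Complex t (s * b)) / (of_real t - of_real s * v)) = (LINT t|lborel. F (Complex (s * t) (s * b)) / (of_real (s * t) - of_real s * v))"
      by (rule affc[symmetric])
    also have "\<dots> = (LINT t|lborel. of_real s * (F' (Complex t b) / (of_real t - v)))"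
    proof (rule Bochner_Integration.integral_cong[OF refl])
      fix t
      have "1 / (of_real (s * t) - of_real s * v) = of_real s * (1 / (of_real t - v))"
        using s by (elim disjE) (simp_all add: minus_divide_right)
      then have "F (Complex (s * t) (s * b)) * (1 / (of_real (s * t) - of_real s * v)) = F (Complex (s * t) (s * b)) * (of_real s * (1 / (of_real t - v)))" by (rule arg_cong)
      then show "F (Complex (s * t) (s * b)) / (of_real (s * t) - of_real s * v) = of_real s * (F' (Complex t b) / (of_real t - v))"
        unfolding F'C by (simp add: mult.commute)
    qed
    also have "\<dots> = of_real s * (LINT t|lborel. F' (Complex t b) / (of_real t - v))" by (rule integral_mult_right_zero)
    finally show ?thesis .
  qed
  have ss: "of_real s * of_real s = (1::complex)" using s by auto
  have v1: "Complex x (s * y) = of_real s * Complex (s * x) y" using s by (elim disjE) (simp_all add: complex_eq_iff)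
  have v2: "Complex x (- s * y) = of_real s * Complex (s * x) (- y)" using s by (elim disjE) (simp_all add: complex_eq_iff)
  have U1: "(LINT t|lborel. F' (Complex t b) / (of_real t - Complex (s * x) y)) = 2 * of_real pi * \<i> * F' (Complex (s * x) (b + y))"
    by (rule upper_line_Cauchy(1)[OF hol int M' p b y])
  have U2: "(LINT t|lborel. F' (Complex t b) / (of_real t - Complex (s * x) (- y))) = 0"
    by (rule upper_line_Cauchy(2)[OF hol int M' p b y])
  have r: "s * (s * x) = x" using s by (elim disjE) simp_all
  have "cauchy_transform s (\<lambda>t. F (Complex t (s * b))) (Complex x (s * y)) = of_real s / (2 * of_real pi * \<i>) * (of_real s * (2 * of_real pi * \<i> * F' (Complex (s * x) (b + y))))"
    by (simp only: cauchy_transform_lborel[OF fm] v1 conv U1)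
  also have "\<dots> = (of_real s * of_real s) * F' (Complex (s * x) (b + y))"
  proof -
    have "a / c * (a * (c * w)) = (a * a) * w" if "c \<noteq> 0" for a c w :: complex using that by simp
    note * = this
    show ?thesis by (rule *) simp
  qed
  also have "\<dots> = F (Complex x (s * (b + y)))" unfolding ss F'C r by simp
  finally show "cauchy_transform s (\<lambda>t. F (Complex t (s * b))) (Complex x (s * y)) = F (Complex x (s * (b + y)))" .
  show "cauchy_transform (- s) (\<lambda>t. F (Complex t (s * b))) (Complex x (- s * y)) = 0"
    by (simp only: cauchy_transform_lborel[OF fm] v2 conv U2 mult_zero_right)
qed

lemma hardy_line_poisson:
  assumes F: "F \<in> hardy s p" and s: "s = 1 \<or> s = -1" and p: "1 \<le> p" and b: "0 < b" and y: "0 < y"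
  shows "F (Complex x (s * (b + y))) = poisson_integral y (\<lambda>t. F (Complex t (s * b))) x"
  using poisson_integral_eq_cauchy[OF hardy_line_cauchy_integrable[OF F s p b] s y]
    hardy_line_Cauchy[OF F s p b y] by simp

section \<open>Size of a Hardy function away from the real line\<close>

lemma poisson_le_inverse:
  assumes "0 < y" shows "poisson y u \<le> 2 / (y + \<bar>u\<bar>)"
proof -
  have R: "0 < u\<^sup>2 + y\<^sup>2" using assms by (simp add: add_nonneg_pos)
  have "0 \<le> (y - \<bar>u\<bar>)\<^sup>2" by simp
  then have "2 * (y * \<bar>u\<bar>) \<le> y\<^sup>2 + u\<^sup>2" by (simp add: power2_diff)
  moreover have "0 \<le> y\<^sup>2" "0 \<le> u\<^sup>2" by auto
  ultimately have "y\<^sup>2 + y * \<bar>u\<bar> \<le> 2 * (u\<^sup>2 + y\<^sup>2)" by argo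
  then have "y * (y + \<bar>u\<bar>) \<le> 2 * (u\<^sup>2 + y\<^sup>2)" by (simp add: distrib_left power2_eq_square)
  then have "y / (u\<^sup>2 + y\<^sup>2) \<le> 2 / (y + \<bar>u\<bar>)" using R assms by (simp add: pos_divide_le_eq pos_le_divide_eq add_pos_nonneg)
  moreover have "y / (pi * (u\<^sup>2 + y\<^sup>2)) \<le> y / (u\<^sup>2 + y\<^sup>2)"
    using pi_ge_two R assms by (intro divide_left_mono) (auto simp: mult_le_cancel_right1)
  ultimately show ?thesis by (simp add: poisson_def)
qed

lemma hardy_bounded:
  assumes F: "F \<in> hardy s p" and s: "s = 1 \<or> s = -1" and p: "1 \<le> p" and b: "0 < b"
  obtains N where "0 \<le> N" "\<And>x y. b \<le> y \<Longrightarrow> norm (F (Complex x (s * y))) \<le> N"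
proof -
  note D = hardyD[OF F s p]
  obtain M where M: "0 \<le> M" "\<And>y. 0 < y \<Longrightarrow> (LINT x|lborel. norm (F (Complex x (s * y))) powr p) \<le> M"
    using D(4) by auto
  \<comment> \<open>The Poisson formula is started from the line at height b/2. Every point
    considered lies at least b/2 above that line, so the kernel is at most 1 / (pi c).\<close>
  define c where "c = b / 2"
  have c: "0 < c" using b by (simp add: c_def)
  define K where "K = 1 / (pi * c) * M"
  have "norm (F (Complex x (s * y))) \<le> K powr (1 / p)" if y: "b \<le> y" for x y
  proof -
    have yc: "0 < y - c" "c \<le> y - c" using y b by (auto simp: c_def)
    have ip: "integrable lborel (\<lambda>t. poisson (y - c) (x - t) * norm (F (Complex t (s * c))) powr p)"
      using integrable_poisson_bounded[OF yc(1) D(3)[OF c]] by simp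
    have "norm (F (Complex x (s * y))) powr p = norm (poisson_integral (y - c) (\<lambda>t. F (Complex t (s * c))) x) powr p"
      using hardy_line_poisson[OF F s p c yc(1)] by simp
    also have "\<dots> \<le> poisson_integral (y - c) (\<lambda>t. norm (F (Complex t (s * c))) powr p) x"
      by (rule norm_poisson_integral_powr_le[OF yc(1) p D(2)[OF c] D(3)[OF c]])
    also have "\<dots> = (LINT t|lborel. poisson (y - c) (x - t) * norm (F (Complex t (s * c))) powr p)"
      by (simp add: poisson_integral_def)
    also have "\<dots> \<le> (LINT t|lborel. 1 / (pi * c) * norm (F (Complex t (s * c))) powr p)"
    proof (rule integral_mono[OF ip])
      show "integrable lborel (\<lambda>t. 1 / (pi * c) * norm (F (Complex t (s * c))) powr p)"
        using D(3)[OF c] by (intro integrable_mult_right)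
      fix t
      have "poisson (y - c) (x - t) \<le> 1 / (pi * (y - c))" by (rule poisson_le[OF yc(1)])
      also have "\<dots> \<le> 1 / (pi * c)" using yc c by (intro divide_left_mono mult_left_mono mult_pos_pos) auto
      finally show "poisson (y - c) (x - t) * norm (F (Complex t (s * c))) powr p \<le> 1 / (pi * c) * norm (F (Complex t (s * c))) powr p"
        by (rule mult_right_mono) simp
    qed
    also have "\<dots> = 1 / (pi * c) * (LINT t|lborel. norm (F (Complex t (s * c))) powr p)" by (rule integral_mult_right_zero)
    also have "\<dots> \<le> K" unfolding K_def using M c by (intro mult_left_mono) auto
    finally have "norm (F (Complex x (s * y))) powr p \<le> K" .
    then have "(norm (F (Complex x (s * y))) powr p) powr (1 / p) \<le> K powr (1 / p)" using p by (intro powr_mono2) auto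
    then show ?thesis using p by (simp add: powr_powr)
  qed
  then show ?thesis using that[of "K powr (1 / p)"] by simp
qed

text \<open>By Jensen's inequality |F|^p at height >= b is at most a Poisson mean of one fixed
  integrable function, |F|^p on the line at height b/2. Along points going to infinity the kernel
  stays bounded and tends to 0 pointwise, so dominated convergence contradicts a lower bound
  \<open>e\<close>.\<close>

lemma hardy_decay:
  assumes F: "F \<in> hardy s p" and s: "s = 1 \<or> s = -1" and p: "1 \<le> p" and b: "0 < b" and e: "0 < e"
  shows "\<exists>R. \<forall>x y. b \<le> y \<longrightarrow> R \<le> y + \<bar>x\<bar> \<longrightarrow> norm (F (Complex x (s * y))) < e"
proof (rule ccontr)
  note D = hardyD[OF F s p]
  assume neg: "\<not> ?thesis"
  have "\<forall>n::nat. \<exists>x y. b \<le> y \<and> real n \<le> y + \<bar>x\<bar> \<and> e \<le> norm (F (Complex x (s * y)))"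
  proof
    fix n :: nat
    show "\<exists>x y. b \<le> y \<and> real n \<le> y + \<bar>x\<bar> \<and> e \<le> norm (F (Complex x (s * y)))"
      using neg not_le by metis
  qed
  from choice[OF this] obtain X :: "nat \<Rightarrow> real" where "\<forall>n. \<exists>y. b \<le> y \<and> real n \<le> y + \<bar>X n\<bar> \<and> e \<le> norm (F (Complex (X n) (s * y)))" ..
  from choice[OF this] obtain Y :: "nat \<Rightarrow> real" where XY0: "\<forall>n. b \<le> Y n \<and> real n \<le> Y n + \<bar>X n\<bar> \<and> e \<le> norm (F (Complex (X n) (s * Y n)))" ..
  then have XY: "b \<le> Y n" "real n \<le> Y n + \<bar>X n\<bar>" "e \<le> norm (F (Complex (X n) (s * Y n)))" for n by auto
  define c where "c = b / 2"
  have c: "0 < c" using b by (simp add: c_def)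
  have Yc: "c \<le> Y n - c" "0 < Y n - c" for n using XY(1)[of n] b by (auto simp: c_def)
  define \<phi> where "\<phi> = (\<lambda>t. norm (F (Complex t (s * c))) powr p)"
  have i\<phi>: "integrable lborel \<phi>" unfolding \<phi>_def by (rule D(3)[OF c])
  have [measurable]: "\<phi> \<in> borel_measurable borel" using i\<phi> by auto
  have "(\<lambda>n. LINT t|lborel. poisson (Y n - c) (X n - t) * \<phi> t) \<longlonglongrightarrow> (LINT t::real|lborel. (0::real))"
  proof (rule integral_dominated_convergence[where w="\<lambda>t. 1 / (pi * c) * \<phi> t"])
    show "integrable lborel (\<lambda>t. 1 / (pi * c) * \<phi> t)" using i\<phi> by (intro integrable_mult_right)
    show "AE t in lborel. norm (poisson (Y n - c) (X n - t) * \<phi> t) \<le> 1 / (pi * c) * \<phi> t" for n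
    proof (rule AE_I2)
      fix t
      have "poisson (Y n - c) (X n - t) \<le> 1 / (pi * (Y n - c))" by (rule poisson_le[OF Yc(2)])
      also have "\<dots> \<le> 1 / (pi * c)" using Yc[of n] c by (intro divide_left_mono mult_left_mono mult_pos_pos) auto
      finally have "poisson (Y n - c) (X n - t) * \<phi> t \<le> 1 / (pi * c) * \<phi> t"
        by (rule mult_right_mono) (simp add: \<phi>_def)
      then show "norm (poisson (Y n - c) (X n - t) * \<phi> t) \<le> 1 / (pi * c) * \<phi> t"
        using poisson_nonneg[of "Y n - c" "X n - t"] Yc(2)[of n] by (simp add: abs_mult \<phi>_def)
    qed
    show "AE t in lborel. (\<lambda>n. poisson (Y n - c) (X n - t) * \<phi> t) \<longlonglongrightarrow> 0"
    proof (rule AE_I2)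
      fix t
      have "(\<lambda>n. poisson (Y n - c) (X n - t)) \<longlonglongrightarrow> 0"
      proof (rule Lim_null_comparison)
        have fl: "filterlim (\<lambda>n. - (c + \<bar>t\<bar>) + real n) at_top sequentially"
          by (rule filterlim_tendsto_add_at_top[OF tendsto_const filterlim_real_sequentially])
        show "(\<lambda>n. 2 / (- (c + \<bar>t\<bar>) + real n)) \<longlonglongrightarrow> 0"
          by (rule real_tendsto_divide_at_top[OF tendsto_const fl])
        have "\<forall>\<^sub>F n in sequentially. 0 < - (c + \<bar>t\<bar>) + real n"
          by (rule fl[unfolded filterlim_at_top_dense, rule_format])
        then show "\<forall>\<^sub>F n in sequentially. norm (poisson (Y n - c) (X n - t)) \<le> 2 / (- (c + \<bar>t\<bar>) + real n)"
        proof eventually_elim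
          case (elim n)
          have "norm (poisson (Y n - c) (X n - t)) = poisson (Y n - c) (X n - t)"
            using poisson_nonneg[of "Y n - c" "X n - t"] Yc(2)[of n] by simp
          also have "\<dots> \<le> 2 / ((Y n - c) + \<bar>X n - t\<bar>)" by (rule poisson_le_inverse[OF Yc(2)])
          also have "\<dots> \<le> 2 / (- (c + \<bar>t\<bar>) + real n)"
          proof (rule frac_le)
            show "- (c + \<bar>t\<bar>) + real n \<le> (Y n - c) + \<bar>X n - t\<bar>" using XY(2)[of n] by linarith
          qed (use elim in auto)
          finally show ?case .
        qed
      qed
      then show "(\<lambda>n. poisson (Y n - c) (X n - t) * \<phi> t) \<longlonglongrightarrow> 0" by (rule tendsto_mult_left_zero)
    qed
  qed measurable
  then have lim: "(\<lambda>n. poisson_integral (Y n - c) \<phi> (X n)) \<longlonglongrightarrow> 0" by (simp add: poisson_integral_def)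
  have "e powr p \<le> poisson_integral (Y n - c) \<phi> (X n)" for n
  proof -
    have "e powr p \<le> norm (F (Complex (X n) (s * Y n))) powr p" using XY(3)[of n] e p by (intro powr_mono2) auto
    also have "\<dots> = norm (poisson_integral (Y n - c) (\<lambda>t. F (Complex t (s * c))) (X n)) powr p"
      using hardy_line_poisson[OF F s p c Yc(2)[of n]] by simp
    also have "\<dots> \<le> poisson_integral (Y n - c) \<phi> (X n)"
      unfolding \<phi>_def by (rule norm_poisson_integral_powr_le[OF Yc(2) p D(2)[OF c] D(3)[OF c]])
    finally show ?thesis .
  qed
  then have "e powr p \<le> 0" by (intro tendsto_lowerbound[OF lim]) auto
  then show False using e by simp
qed

section \<open>A maximum principle and subharmonicity\<close>

lemma poisson_integral_of_real:
  "poisson_integral y (\<lambda>t. complex_of_real (r t)) x = of_real (poisson_integral y r x)"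
  by (simp add: poisson_integral_def scaleR_conv_of_real of_real_mult[symmetric] del: of_real_mult)

lemma Re_cauchy_transform_of_real:
  assumes r: "cauchy_integrable (\<lambda>t. complex_of_real (r t))" and s: "s = 1 \<or> s = -1" and y: "0 < y"
  shows "Re (2 * cauchy_transform s (\<lambda>t. complex_of_real (r t)) (Complex x (s * y))) = poisson_integral y r x"
proof -
  have "(LINT t|lborel. complex_of_real (conj_poisson y (x - t)) * complex_of_real (r t)) = of_real (LINT t|lborel. conj_poisson y (x - t) * r t)"
    by (simp add: of_real_mult[symmetric] del: of_real_mult)
  then show ?thesis
    unfolding cauchy_transform_split(1)[OF r s y] poisson_integral_of_real by simp
qed

text \<open>After the substitution the kernel is the same for all points, so continuity up to the
  boundary becomes a case of dominated convergence.\<close>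

lemma poisson_integral_rescale:
  fixes w :: "real \<Rightarrow> real"
  assumes y: "0 < y"
  shows "poisson_integral y w x = (LINT u|lborel. poisson 1 u * w (x + y * u))"
proof -
  have "poisson_integral y w x = \<bar>y\<bar> *\<^sub>R (LINT u|lborel. poisson y (x - (x + y * u)) *\<^sub>R w (x + y * u))"
    unfolding poisson_integral_def using y by (intro lborel_integral_real_affine) simp
  also have "\<dots> = (LINT u|lborel. y * (poisson y (x - (x + y * u)) * w (x + y * u)))" using y by simp
  also have "\<dots> = (LINT u|lborel. poisson 1 u * w (x + y * u))"
  proof (rule Bochner_Integration.integral_cong[OF refl])
    fix u :: real
    have "u\<^sup>2 + 1 \<noteq> 0" by (simp add: add_nonneg_eq_0_iff)
    moreover have "(y * u)\<^sup>2 + y\<^sup>2 = y\<^sup>2 * (u\<^sup>2 + 1)" by (simp add: power_mult_distrib distrib_left)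
    ultimately have "y * poisson y (x - (x + y * u)) = poisson 1 u"
      using y by (simp add: poisson_def power2_eq_square[of y])
    then show "y * (poisson y (x - (x + y * u)) * w (x + y * u)) = poisson 1 u * w (x + y * u)" by (simp only: mult.assoc[symmetric])
  qed
  finally show ?thesis .
qed

lemma poisson_integral_continuous_boundary:
  fixes w :: "real \<Rightarrow> real"
  assumes w: "continuous_on UNIV w" and B: "\<And>t. \<bar>w t\<bar> \<le> B" and s: "s = 1 \<or> s = -1"
  shows "((\<lambda>z. poisson_integral (s * Im z) w (Re z)) \<longlongrightarrow> w x) (at (of_real x) within half_plane s)"
proof -
  have [measurable]: "w \<in> borel_measurable borel" by (rule borel_measurable_continuous_onI[OF w])
  have "((\<lambda>z. LINT u|lborel. poisson 1 u * w (Re z + s * Im z * u)) \<longlongrightarrow> (LINT u|lborel. poisson 1 u * w x)) (at (of_real x) within half_plane s)"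
  proof (rule dominated_convergence_within[where w="\<lambda>u. B * poisson 1 u"])
    show "integrable lborel (\<lambda>u. B * poisson 1 u)"
      using has_bochner_integral_poisson[of 1] by (intro integrable_mult_right) (simp add: has_bochner_integral_iff)
    show "AE u in lborel. ((\<lambda>z. poisson 1 u * w (Re z + s * Im z * u)) \<longlongrightarrow> poisson 1 u * w x) (at (of_real x) within half_plane s)"
    proof (rule AE_I2, rule tendsto_mult[OF tendsto_const])
      fix u
      have "((\<lambda>z. Re z + s * Im z * u) \<longlongrightarrow> Re (of_real x) + s * Im (of_real x) * u) (at (of_real x) within half_plane s)"
        by (intro tendsto_intros)
      then have "((\<lambda>z. Re z + s * Im z * u) \<longlongrightarrow> x) (at (of_real x) within half_plane s)" by simp
      moreover have "isCont w x" using w by (simp add: continuous_on_eq_continuous_at)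
      ultimately show "((\<lambda>z. w (Re z + s * Im z * u)) \<longlongrightarrow> w x) (at (of_real x) within half_plane s)"
        using isCont_tendsto_compose by blast
    qed
    show "\<forall>\<^sub>F z in at (of_real x) within half_plane s. AE u in lborel. norm (poisson 1 u * w (Re z + s * Im z * u)) \<le> B * poisson 1 u"
    proof (intro always_eventually allI AE_I2)
      fix z u
      have "poisson 1 u * \<bar>w (Re z + s * Im z * u)\<bar> \<le> poisson 1 u * B" by (intro mult_left_mono B poisson_nonneg) simp
      then show "norm (poisson 1 u * w (Re z + s * Im z * u)) \<le> B * poisson 1 u"
        using poisson_nonneg[of 1 u] by (simp add: abs_mult mult.commute)
    qed
  qed measurable
  moreover have "integral\<^sup>L lborel (poisson 1) = 1"
    using has_bochner_integral_poisson[of 1] by (simp add: has_bochner_integral_iff)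
  ultimately have "((\<lambda>z. LINT u|lborel. poisson 1 u * w (Re z + s * Im z * u)) \<longlongrightarrow> w x) (at (of_real x) within half_plane s)"
    by (simp only: integral_mult_left_zero mult_1_left)
  then show ?thesis
  proof (rule Lim_transform_eventually)
    show "\<forall>\<^sub>F z in at (of_real x) within half_plane s. (LINT u|lborel. poisson 1 u * w (Re z + s * Im z * u)) = poisson_integral (s * Im z) w (Re z)"
      unfolding eventually_at_filter
    proof (intro always_eventually allI impI)
      fix z assume "z \<in> half_plane s"
      then show "(LINT u|lborel. poisson 1 u * w (Re z + s * Im z * u)) = poisson_integral (s * Im z) w (Re z)"
        by (intro poisson_integral_rescale[symmetric]) (simp add: half_plane_def)
    qed
  qed
qed

text \<open>The bound is demanded near each boundary point and near infinity; no extension of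
  \<open>R\<close> to the boundary is involved. The set \<open>V\<close> where |R| > \<delta> is
  therefore open and bounded with closure inside the half-plane, and the maximum modulus theorem
  applies on \<open>V\<close> itself.\<close>

lemma maximum_principle_half_plane:
  assumes hol: "R holomorphic_on half_plane s" and s: "s = 1 \<or> s = -1"
    and bd: "\<And>x. \<forall>\<^sub>F z in at (of_real x) within half_plane s. norm (R z) \<le> \<delta>"
    and inf: "\<And>x y. 0 < y \<Longrightarrow> R0 \<le> y + \<bar>x\<bar> \<Longrightarrow> norm (R (Complex x (s * y))) \<le> \<delta>"
    and z: "z \<in> half_plane s"
  shows "norm (R z) \<le> \<delta>"
proof (rule ccontr)
  assume neg: "\<not> norm (R z) \<le> \<delta>"
  define V where "V = {w \<in> half_plane s. \<delta> < norm (R w)}"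
  have zV: "z \<in> V" using z neg by (simp add: V_def)
  have contR: "continuous_on (half_plane s) R" by (rule holomorphic_on_imp_continuous_on[OF hol])
  have openV: "open V"
  proof -
    have "open (half_plane s \<inter> R -` {v. \<delta> < norm v})"
      by (rule continuous_open_preimage[OF contR open_half_plane]) (intro open_Collect_less continuous_intros)
    then show ?thesis by (simp add: V_def vimage_def Int_def)
  qed
  have bV: "bounded V"
  proof (rule boundedI[of _ "R0"])
    fix w assume "w \<in> V"
    then have wh: "w \<in> half_plane s" and gt: "\<delta> < norm (R w)" by (simp_all add: V_def)
    obtain x y where y: "0 < y" "w = Complex x (s * y)" using half_plane_cases[OF wh s] by blast
    have "norm w \<le> \<bar>x\<bar> + \<bar>s * y\<bar>" unfolding y(2) using cmod_le[of "Complex x (s * y)"] by simp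
    also have "\<bar>s * y\<bar> = y" using s y by auto
    finally show "norm w \<le> R0" using inf[OF y(1), of x] gt y(2) by (cases "R0 \<le> y + \<bar>x\<bar>") auto
  qed
  have clV: "closure V \<subseteq> half_plane s"
  proof
    fix w assume w: "w \<in> closure V"
    have "closed {w. 0 \<le> s * Im w}" by (intro closed_Collect_le continuous_intros)
    moreover have "V \<subseteq> {w. 0 \<le> s * Im w}" by (auto simp: V_def half_plane_def)
    ultimately have "0 \<le> s * Im w" using closure_minimal w by blast
    show "w \<in> half_plane s"
    proof (rule ccontr)
      assume nw: "w \<notin> half_plane s"
      then have "s * Im w = 0" using \<open>0 \<le> s * Im w\<close> by (simp add: half_plane_def)
      then have wr: "w = of_real (Re w)" using s by (auto simp: complex_eq_iff)
      have "w \<notin> V" using nw by (simp add: V_def)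
      then have "w islimpt V" using w by (auto simp: closure_def)
      then have nt: "at w within V \<noteq> bot" by (simp add: trivial_limit_within)
      have "\<forall>\<^sub>F z in at w within half_plane s. norm (R z) \<le> \<delta>" using bd[of "Re w"] wr by simp
      then have "\<forall>\<^sub>F z in at w within V. norm (R z) \<le> \<delta>"
        by (rule filter_leD[OF at_le, rotated]) (auto simp: V_def)
      then have "\<forall>\<^sub>F z in at w within V. False"
        unfolding eventually_at_filter by (rule eventually_mono) (auto simp: V_def)
      then show False using nt by (simp add: trivial_limit_def)
    qed
  qed
  have "norm (R z) \<le> \<delta>"
  proof (rule maximum_modulus_frontier[OF _ _ bV _ zV])
    show "R holomorphic_on interior V" by (rule holomorphic_on_subset[OF hol]) (use openV in \<open>auto simp: V_def interior_open\<close>)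
    show "continuous_on (closure V) R" by (rule continuous_on_subset[OF contR clV])
    show "norm (R w) \<le> \<delta>" if "w \<in> frontier V" for w
    proof -
      have "w \<in> closure V" "w \<notin> V" using that openV by (auto simp: frontier_def interior_open)
      then show ?thesis using clV by (auto simp: V_def)
    qed
  qed
  then show False using neg by simp
qed

text \<open>The comparison function is the outer function with boundary modulus \<open>\<delta> + |F|\<close>; the
  maximum principle bounds the quotient, and Jensen's inequality turns the resulting logarithmic
  mean into a \<open>q\<close>-mean.\<close>

lemma hardy_subharmonic:
  assumes F: "F \<in> hardy s p" and s: "s = 1 \<or> s = -1" and p: "1 \<le> p" and b: "0 < b" and y: "0 < y" and q: "0 < q"
  shows "norm (F (Complex x (s * (b + y)))) powr q \<le> poisson_integral y (\<lambda>t. norm (F (Complex t (s * b))) powr q) x"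
proof -
  note D = hardyD[OF F s p]
  obtain N where N: "0 \<le> N" "\<And>x y. b \<le> y \<Longrightarrow> norm (F (Complex x (s * y))) \<le> N"
    using hardy_bounded[OF F s p b] by blast
  define \<phi> where "\<phi> = (\<lambda>t. norm (F (Complex t (s * b))))"
  have \<phi>m[measurable]: "\<phi> \<in> borel_measurable borel" unfolding \<phi>_def using D(2)[OF b] by measurable
  have \<phi>0: "0 \<le> \<phi> t" for t by (simp add: \<phi>_def)
  have \<phi>N: "\<phi> t \<le> N" for t unfolding \<phi>_def by (rule N(2)) simp
  have \<phi>c: "continuous_on UNIV \<phi>" unfolding \<phi>_def by (intro continuous_on_norm continuous_on_line[OF D(1) s b])
  define \<Phi> where "\<Phi> = (\<lambda>z. F (z + Complex 0 (s * b)))"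
  have \<Phi>C: "\<Phi> (Complex x (s * y)) = F (Complex x (s * (b + y)))" for x y
  proof -
    have "Complex x (s * y) + Complex 0 (s * b) = Complex x (s * (b + y))" by (simp add: complex_eq_iff distrib_left)
    then show ?thesis by (simp only: \<Phi>_def)
  qed
  have shift: "z + Complex 0 (s * b) \<in> half_plane s" if "0 \<le> s * Im z" for z
    using that s b by (elim disjE) (auto simp: half_plane_def)
  have hol\<Phi>: "\<Phi> holomorphic_on half_plane s"
    unfolding \<Phi>_def
  proof (rule holomorphic_on_compose_gen[OF _ D(1), unfolded comp_def])
    show "(\<lambda>z. z + Complex 0 (s * b)) holomorphic_on half_plane s" by (intro holomorphic_intros)
    show "(\<lambda>z. z + Complex 0 (s * b)) ` half_plane s \<subseteq> half_plane s"
    proof (rule image_subsetI, rule shift)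
      fix z assume "z \<in> half_plane s" then show "0 \<le> s * Im z" unfolding half_plane_def by (auto simp only: mem_Collect_eq less_imp_le)
    qed
  qed
  have step: "norm (F (Complex x (s * (b + y)))) powr q \<le> poisson_integral y (\<lambda>t. (\<delta> + \<phi> t) powr q) x" if \<delta>: "0 < \<delta>" for \<delta>
  proof -
    \<comment> \<open>The logarithm of (\<delta> + \<phi>) / \<delta> rather than of \<delta> +
      \<phi>: it is nonnegative and, by ln (1 + u) <= u, inherits the integrability of
      \<open>\<phi>\<close>, so that its Cauchy transform exists.\<close>
    define w where "w = (\<lambda>t. ln (1 + \<phi> t / \<delta>))"
    have one: "1 \<le> 1 + \<phi> t / \<delta>" for t using \<phi>0[of t] \<delta> by simp
    have wm[measurable]: "w \<in> borel_measurable borel" unfolding w_def by measurable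
    have wle: "w t \<le> \<phi> t / \<delta>" for t
      unfolding w_def using \<phi>0[of t] \<delta> by (intro ln_add_one_self_le_self) simp
    have w0: "0 \<le> w t" for t unfolding w_def by (rule ln_ge_zero[OF one])
    have wc: "continuous_on UNIV w"
    proof (unfold w_def, rule continuous_on_ln)
      show "continuous_on UNIV (\<lambda>t. 1 + \<phi> t / \<delta>)"
        using \<delta> by (intro continuous_on_add continuous_on_divide continuous_on_const \<phi>c) auto
      show "\<forall>t\<in>UNIV. 1 + \<phi> t / \<delta> \<noteq> 0" using one by (metis not_one_le_zero)
    qed
    have wB: "\<bar>w t\<bar> \<le> N / \<delta>" for t
      using w0[of t] order_trans[OF wle divide_right_mono[OF \<phi>N less_imp_le[OF \<delta>]]] by simp
    have ci: "cauchy_integrable (\<lambda>t. complex_of_real (w t))"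
    proof (rule cauchy_integrable_Lp[OF p])
      show "integrable lborel (\<lambda>t. norm (complex_of_real (w t)) powr p)"
      proof (rule Bochner_Integration.integrable_bound[of lborel "\<lambda>t. (1 / \<delta>) powr p * \<phi> t powr p"])
        show "integrable lborel (\<lambda>t. (1 / \<delta>) powr p * \<phi> t powr p)"
          unfolding \<phi>_def by (intro integrable_mult_right D(3)[OF b])
        show "AE t in lborel. norm (norm (complex_of_real (w t)) powr p) \<le> norm ((1 / \<delta>) powr p * \<phi> t powr p)"
        proof (rule AE_I2)
          fix t
          have "\<bar>w t\<bar> powr p \<le> (1 / \<delta> * \<phi> t) powr p" using w0[of t] wle[of t] p by (intro powr_mono2) auto
          also have "\<dots> = (1 / \<delta>) powr p * \<phi> t powr p" by (rule powr_mult)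
          finally show "norm (norm (complex_of_real (w t)) powr p) \<le> norm ((1 / \<delta>) powr p * \<phi> t powr p)" by simp
        qed
      qed measurable
    qed measurable
    define A where "A = (\<lambda>z. 2 * cauchy_transform s (\<lambda>t. complex_of_real (w t)) z)"
    have ReA: "Re (A (Complex x (s * y))) = poisson_integral y w x" if "0 < y" for x y
      unfolding A_def by (rule Re_cauchy_transform_of_real[OF ci s that])
    have P0: "0 \<le> poisson_integral y w x" if "0 < y" for x y
      unfolding poisson_integral_def using w0 poisson_nonneg[of y] that by (intro integral_nonneg_AE AE_I2) auto
    define R where "R = (\<lambda>z. \<Phi> z * exp (- A z))"
    have nR: "norm (R z) = norm (\<Phi> z) * exp (- Re (A z))" for z
      by (simp add: R_def norm_mult)
    have "norm (R (Complex x (s * y))) \<le> \<delta>"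
    proof -
      obtain R0 where R0: "\<And>x y. b \<le> y \<Longrightarrow> R0 \<le> y + \<bar>x\<bar> \<Longrightarrow> norm (F (Complex x (s * y))) < \<delta>"
        using hardy_decay[OF F s p b \<delta>] by blast
      show ?thesis
      proof (rule maximum_principle_half_plane[where R=R and z="Complex x (s * y)" and ?R0.0=R0, OF _ s])
        show "R holomorphic_on half_plane s"
          unfolding R_def A_def by (intro holomorphic_intros hol\<Phi> holomorphic_cauchy_transform[OF ci])
        show "Complex x (s * y) \<in> half_plane s" by (rule Complex_in_half_plane[OF s y])
        show "norm (R (Complex x (s * y))) \<le> \<delta>" if "0 < y" "R0 \<le> y + \<bar>x\<bar>" for x y
        proof -
          have "norm (\<Phi> (Complex x (s * y))) \<le> \<delta>"
            unfolding \<Phi>C using R0[of "b + y" x] that b by simp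
          moreover have "exp (- Re (A (Complex x (s * y)))) \<le> 1" using P0[OF that(1)] ReA[OF that(1)] by simp
          ultimately have "norm (\<Phi> (Complex x (s * y))) * exp (- Re (A (Complex x (s * y)))) \<le> \<delta> * 1"
            using \<delta> by (intro mult_mono) auto
          then show ?thesis unfolding nR by simp
        qed
        show "\<forall>\<^sub>F z in at (of_real u) within half_plane s. norm (R z) \<le> \<delta>" for u
        proof -
          have "continuous_on {z. 0 \<le> s * Im z} \<Phi>"
            unfolding \<Phi>_def
          proof (rule continuous_on_compose2[OF holomorphic_on_imp_continuous_on[OF D(1)]])
            show "continuous_on {z. 0 \<le> s * Im z} (\<lambda>z. z + Complex 0 (s * b))" by (intro continuous_intros)
            show "(\<lambda>z. z + Complex 0 (s * b)) ` {z. 0 \<le> s * Im z} \<subseteq> half_plane s"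
              by (rule image_subsetI, rule shift) simp
          qed
          then have "(\<Phi> \<longlongrightarrow> \<Phi> (of_real u)) (at (of_real u) within {z. 0 \<le> s * Im z})"
            by (simp add: continuous_on_def)
          then have t1: "(\<Phi> \<longlongrightarrow> \<Phi> (of_real u)) (at (of_real u) within half_plane s)"
            by (rule tendsto_within_subset) (auto simp: half_plane_def)
          have t2: "((\<lambda>z. poisson_integral (s * Im z) w (Re z)) \<longlongrightarrow> w u) (at (of_real u) within half_plane s)"
            by (rule poisson_integral_continuous_boundary[OF wc wB s])
          \<comment> \<open>At a boundary point the modulus of \<open>R\<close> tends to \<delta>
            \<phi> / (\<delta> + \<phi>). This is strictly below \<delta>, so the bound holds in a
            whole neighbourhood.\<close>
          have t3: "((\<lambda>z. norm (\<Phi> z) * exp (- poisson_integral (s * Im z) w (Re z))) \<longlongrightarrow> norm (\<Phi> (of_real u)) * exp (- w u)) (at (of_real u) within half_plane s)"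
            by (intro tendsto_intros t1 t2)
          have "norm (\<Phi> (of_real u)) = \<phi> u" using \<Phi>C[of u 0] by (simp add: \<phi>_def complex_of_real_def)
          moreover have "exp (- w u) = 1 / (1 + \<phi> u / \<delta>)"
          proof -
            have "0 < 1 + \<phi> u / \<delta>" using one[of u] by linarith
            then show ?thesis by (simp add: w_def exp_minus divide_inverse)
          qed
          ultimately have "norm (\<Phi> (of_real u)) * exp (- w u) = \<delta> * \<phi> u / (\<delta> + \<phi> u)"
            using \<delta> \<phi>0[of u] by (simp add: field_simps)
          also have "\<dots> < \<delta>" using \<delta> \<phi>0[of u] by (simp add: divide_less_eq add_pos_nonneg)
          finally have "\<forall>\<^sub>F z in at (of_real u) within half_plane s. norm (\<Phi> z) * exp (- poisson_integral (s * Im z) w (Re z)) < \<delta>"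
            by (rule order_tendstoD(2)[OF t3])
          then show ?thesis
            unfolding eventually_at_filter
          proof (rule eventually_mono, intro impI)
            fix z assume imp: "z \<noteq> complex_of_real u \<longrightarrow> z \<in> half_plane s \<longrightarrow> norm (\<Phi> z) * exp (- poisson_integral (s * Im z) w (Re z)) < \<delta>"
              and z: "z \<noteq> complex_of_real u" "z \<in> half_plane s"
            obtain x' y' where xy: "0 < y'" "z = Complex x' (s * y')" using half_plane_cases[OF z(2) s] by blast
            have e: "s * Im z = y'" "Re z = x'" unfolding xy(2) using s by (elim disjE; simp)+
            have "Re (A z) = poisson_integral (s * Im z) w (Re z)" unfolding e using ReA[OF xy(1), of x'] by (simp only: xy(2))
            then show "norm (R z) \<le> \<delta>" unfolding nR using imp z by simp
          qed
        qed
      qed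
    qed
    then have "norm (F (Complex x (s * (b + y)))) * exp (- poisson_integral y w x) \<le> \<delta>"
      unfolding nR \<Phi>C ReA[OF y] .
    then have le: "norm (F (Complex x (s * (b + y)))) \<le> \<delta> * exp (poisson_integral y w x)"
      by (simp add: exp_minus field_simps)
    have mult: "\<delta> * exp (w t) = \<delta> + \<phi> t" for t
    proof -
      have "0 < 1 + \<phi> t / \<delta>" using one[of t] by linarith
      then show ?thesis using \<delta> by (simp add: w_def field_simps)
    qed
    have eq: "exp (q * w t) = (\<delta> + \<phi> t) powr q / \<delta> powr q" for t
      unfolding mult[symmetric] using \<delta> by (simp add: powr_mult exp_powr_real mult.commute)
    have "norm (F (Complex x (s * (b + y)))) powr q \<le> (\<delta> * exp (poisson_integral y w x)) powr q"
      using le q by (intro powr_mono2) auto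
    also have "\<dots> = \<delta> powr q * exp (poisson_integral y (\<lambda>t. q * w t) x)"
    proof -
      have "poisson_integral y (\<lambda>t. q * w t) x = q * poisson_integral y w x"
        unfolding poisson_integral_def by (subst integral_mult_right_zero[symmetric]) (simp add: mult.left_commute)
      then show ?thesis using \<delta> by (simp add: powr_mult exp_powr_real mult.commute)
    qed
    also have "\<dots> \<le> \<delta> powr q * poisson_integral y (\<lambda>t. exp (q * w t)) x"
    proof (intro mult_left_mono exp_poisson_integral_le[OF y])
      have bnd: "integrable lborel (\<lambda>t. poisson y (x - t) * v t)" if "v \<in> borel_measurable borel" "\<And>t. \<bar>v t\<bar> \<le> K" for v K
      proof (rule Bochner_Integration.integrable_bound[of lborel "\<lambda>t. K * poisson y (x - t)"])
        show "integrable lborel (\<lambda>t. K * poisson y (x - t))" using y by (intro integrable_mult_right) simp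
        show "AE t in lborel. norm (poisson y (x - t) * v t) \<le> norm (K * poisson y (x - t))"
        proof (rule AE_I2)
          fix t
          have "poisson y (x - t) * \<bar>v t\<bar> \<le> poisson y (x - t) * \<bar>K\<bar>"
            using that(2)[of t] y by (intro mult_left_mono poisson_nonneg) auto
          then show "norm (poisson y (x - t) * v t) \<le> norm (K * poisson y (x - t))" by (simp add: abs_mult mult.commute poisson_nonneg y less_imp_le)
        qed
      qed (use that(1) in measurable)
      show "integrable lborel (\<lambda>t. poisson y (x - t) * (q * w t))"
      proof (rule bnd[of _ "q * (N / \<delta>)"])
        fix t
        have "\<bar>q * w t\<bar> = q * \<bar>w t\<bar>" using q by (simp add: abs_mult)
        also have "\<dots> \<le> q * (N / \<delta>)" using q by (intro mult_left_mono wB) simp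
        finally show "\<bar>q * w t\<bar> \<le> q * (N / \<delta>)" .
      qed measurable
      have "w t \<le> N / \<delta>" for t using wB[of t] by (rule abs_le_D1)
      then have qw: "q * w t \<le> q * (N / \<delta>)" for t using q by (intro mult_left_mono) auto
      show "integrable lborel (\<lambda>t. poisson y (x - t) * exp (q * w t))"
      proof (rule bnd[of _ "exp (q * (N / \<delta>))"])
        show "\<bar>exp (q * w t)\<bar> \<le> exp (q * (N / \<delta>))" for t unfolding abs_exp_cancel by (simp only: exp_le_cancel_iff qw)
      qed measurable
    qed simp
    also have "\<dots> = poisson_integral y (\<lambda>t. (\<delta> + \<phi> t) powr q) x"
    proof -
      have "\<delta> powr q * poisson_integral y (\<lambda>t. exp (q * w t)) x = (LINT t|lborel. \<delta> powr q * (poisson y (x - t) *\<^sub>R exp (q * w t)))"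
        unfolding poisson_integral_def by (rule integral_mult_right_zero[symmetric])
      also have "\<dots> = poisson_integral y (\<lambda>t. (\<delta> + \<phi> t) powr q) x"
        unfolding poisson_integral_def eq using \<delta> by (intro Bochner_Integration.integral_cong refl) simp
      finally show ?thesis .
    qed
    finally show ?thesis .
  qed
  \<comment> \<open>The regularization \<delta> is removed along 1 / (n + 1); boundedness of
    \<open>F\<close> on the line supplies the majorant.\<close>
  have "(\<lambda>n. poisson_integral y (\<lambda>t. (1 / real (Suc n) + \<phi> t) powr q) x) \<longlonglongrightarrow> poisson_integral y (\<lambda>t. \<phi> t powr q) x"
    unfolding poisson_integral_def
  proof (rule integral_dominated_convergence[where w="\<lambda>t. (1 + N) powr q * poisson y (x - t)"])
    show "integrable lborel (\<lambda>t. (1 + N) powr q * poisson y (x - t))" using y by (intro integrable_mult_right) simp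
    show "AE t in lborel. (\<lambda>n. poisson y (x - t) *\<^sub>R (1 / real (Suc n) + \<phi> t) powr q) \<longlonglongrightarrow> poisson y (x - t) *\<^sub>R \<phi> t powr q"
    proof (rule AE_I2, rule tendsto_scaleR[OF tendsto_const])
      fix t
      have "(\<lambda>n. 1 / real (Suc n) + \<phi> t) \<longlonglongrightarrow> 0 + \<phi> t"
        by (intro tendsto_add tendsto_const LIMSEQ_Suc[OF lim_const_over_n])
      then have "(\<lambda>n. 1 / real (Suc n) + \<phi> t) \<longlonglongrightarrow> \<phi> t" by simp
      then show "(\<lambda>n. (1 / real (Suc n) + \<phi> t) powr q) \<longlonglongrightarrow> \<phi> t powr q"
        by (intro tendsto_powr' tendsto_const) (use \<phi>0[of t] q in \<open>auto intro!: always_eventually add_nonneg_nonneg\<close>)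
    qed
    fix n
    show "AE t in lborel. norm (poisson y (x - t) *\<^sub>R (1 / real (Suc n) + \<phi> t) powr q) \<le> (1 + N) powr q * poisson y (x - t)"
    proof (rule AE_I2)
      fix t
      have "1 / real (Suc n) \<le> 1" by simp
      then have "(1 / real (Suc n) + \<phi> t) powr q \<le> (1 + N) powr q"
        using \<phi>0[of t] \<phi>N[of t] q by (intro powr_mono2 add_mono) auto
      then have "poisson y (x - t) * (1 / real (Suc n) + \<phi> t) powr q \<le> poisson y (x - t) * (1 + N) powr q"
        using y by (intro mult_left_mono poisson_nonneg) auto
      then show "norm (poisson y (x - t) *\<^sub>R (1 / real (Suc n) + \<phi> t) powr q) \<le> (1 + N) powr q * poisson y (x - t)"
        using poisson_nonneg[of y "x - t"] y by (simp add: mult.commute del: of_nat_Suc)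
    qed
  qed measurable
  then have "norm (F (Complex x (s * (b + y)))) powr q \<le> poisson_integral y (\<lambda>t. \<phi> t powr q) x"
    by (rule tendsto_lowerbound) (auto intro!: always_eventually step)
  then show ?thesis by (simp add: \<phi>_def)
qed

section \<open>Vertical limits\<close>

lemma integrable_poisson_square:
  assumes y: "0 < y" shows "integrable lborel (\<lambda>t. (poisson y (x - t))\<^sup>2)"
proof (rule Bochner_Integration.integrable_bound[of lborel "\<lambda>t. 1 / (pi * y) * poisson y (x - t)"])
  show "integrable lborel (\<lambda>t. 1 / (pi * y) * poisson y (x - t))" using y by (intro integrable_mult_right) simp
  show "AE t in lborel. norm ((poisson y (x - t))\<^sup>2) \<le> norm (1 / (pi * y) * poisson y (x - t))"
  proof (rule AE_I2)
    fix t
    have nn: "0 \<le> poisson y (x - t)" using y by (simp add: poisson_nonneg)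
    have "poisson y (x - t) * poisson y (x - t) \<le> 1 / (pi * y) * poisson y (x - t)"
      by (rule mult_right_mono[OF poisson_le[OF y] nn])
    then show "norm ((poisson y (x - t))\<^sup>2) \<le> norm (1 / (pi * y) * poisson y (x - t))"
      using nn y by (simp add: power2_eq_square abs_mult)
  qed
qed measurable

lemma powr_2_eq: "0 \<le> u \<Longrightarrow> u powr 2 = u\<^sup>2" for u :: real
  by (cases "u = 0") (simp_all add: powr_numeral)

lemma tendsto_line_points:
  assumes F: "F holomorphic_on half_plane s" and s: "s = 1 \<or> s = -1" and y: "0 < y"
  shows "(\<lambda>k. F (Complex x (s * (1 / real (Suc k) + y)))) \<longlonglongrightarrow> F (Complex x (s * y))"
proof -
  have "(\<lambda>k. 1 / real (Suc k) + y) \<longlonglongrightarrow> 0 + y" by (intro tendsto_add tendsto_const LIMSEQ_Suc[OF lim_const_over_n])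
  from tendsto_add[OF tendsto_const tendsto_mult[OF tendsto_const tendsto_of_real[OF tendsto_mult[OF tendsto_const this]]]]
  have "(\<lambda>k. of_real x + \<i> * of_real (s * (1 / real (Suc k) + y))) \<longlonglongrightarrow> of_real x + \<i> * of_real (s * (0 + y))" .
  then have l: "(\<lambda>k. Complex x (s * (1 / real (Suc k) + y))) \<longlonglongrightarrow> Complex x (s * y)" by (simp add: Complex_eq)
  have "isCont F (Complex x (s * y))"
    using holomorphic_on_imp_continuous_on[OF F] Complex_in_half_plane[OF s y] open_half_plane
    by (simp add: continuous_on_eq_continuous_at)
  from isCont_tendsto_compose[OF this l] show ?thesis .
qed

lemma hardy_majorant:
  assumes F: "F \<in> hardy s p" and s: "s = 1 \<or> s = -1" and p: "1 \<le> p"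
  obtains g :: "real \<Rightarrow> real" where "g \<in> borel_measurable borel" "\<And>t. 0 \<le> g t" "integrable lborel (\<lambda>t. (g t)\<^sup>2)"
    "\<And>x y. 0 < y \<Longrightarrow> norm (F (Complex x (s * y))) powr (p / 2) \<le> poisson_integral y g x"
proof -
  note D = hardyD[OF F s p]
  obtain M where M: "\<And>y. 0 < y \<Longrightarrow> (LINT x|lborel. norm (F (Complex x (s * y))) powr p) \<le> M"
    using D(4) by auto
  define b where "b = (\<lambda>k. 1 / real (Suc k))"
  have b: "0 < b k" for k by (simp add: b_def)
  define f where "f = (\<lambda>k t. norm (F (Complex t (s * b k))) powr (p / 2))"
  have f2: "(norm (f k t))\<^sup>2 = norm (F (Complex t (s * b k))) powr p" for k t
    by (simp add: f_def power2_eq_square powr_add[symmetric])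
  have fm: "f k \<in> borel_measurable lborel" for k
    unfolding f_def using D(2)[OF b] by measurable
  have fi: "integrable lborel (\<lambda>t. (norm (f k t))\<^sup>2)" for k unfolding f2 by (rule D(3)[OF b])
  have fb: "(LINT t|lborel. (norm (f k t))\<^sup>2) \<le> M" for k unfolding f2 by (rule M[OF b])
  obtain g where g1: "g \<in> borel_measurable lborel" and g2: "integrable lborel (\<lambda>x. (norm (g x))\<^sup>2) \<and>
    (\<forall>\<kappa> C N. \<kappa> \<in> borel_measurable lborel \<longrightarrow> integrable lborel (\<lambda>x. (\<kappa> x)\<^sup>2) \<longrightarrow> closed C \<longrightarrow> convex C \<longrightarrow>
       (\<forall>k\<ge>N. (LINT x|lborel. \<kappa> x *\<^sub>R f k x) \<in> C) \<longrightarrow> (LINT x|lborel. \<kappa> x *\<^sub>R g x) \<in> C)"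
    using L2_weak_limit[of f lborel M, OF fm fi fb] by (rule bexE)
  note g = g1 g2[THEN conjunct1] g2[THEN conjunct2, rule_format]
  have gm: "g \<in> borel_measurable borel" using g(1) by simp
  have le: "norm (F (Complex x (s * y))) powr (p / 2) \<le> poisson_integral y g x" if y: "0 < y" for x y
  proof (rule field_le_epsilon)
    fix e :: real assume e: "0 < e"
    define a where "a = norm (F (Complex x (s * y))) powr (p / 2)"
    have "(\<lambda>k. norm (F (Complex x (s * (b k + y)))) powr (p / 2)) \<longlonglongrightarrow> a"
      unfolding a_def b_def
      by (intro tendsto_powr' tendsto_norm tendsto_line_points[OF D(1) s y] tendsto_const) (use p in auto)
    then have "\<forall>\<^sub>F k in sequentially. a - e < norm (F (Complex x (s * (b k + y)))) powr (p / 2)"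
      by (rule order_tendstoD) (use e in auto)
    then obtain N where N: "\<And>k. k \<ge> N \<Longrightarrow> a - e < norm (F (Complex x (s * (b k + y)))) powr (p / 2)"
      by (auto simp: eventually_sequentially)
    \<comment> \<open>The Poisson kernel is square integrable, hence admissible as a test for the
      weak limit, and the half-line \<open>{a - e..}\<close> is closed and convex; so a lower bound
      valid for all large \<open>k\<close> passes to \<open>g\<close>.\<close>
    have "(LINT t|lborel. poisson y (x - t) *\<^sub>R g t) \<in> {a - e..}"
    proof (rule g(3)[of "\<lambda>t. poisson y (x - t)" _ N])
      show "integrable lborel (\<lambda>t. (poisson y (x - t))\<^sup>2)" by (rule integrable_poisson_square[OF y])
      fix k assume "N \<le> k"
      have "norm (F (Complex x (s * (b k + y)))) powr (p / 2) \<le> (LINT t|lborel. poisson y (x - t) *\<^sub>R f k t)"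
        using hardy_subharmonic[OF F s p b y, of "p/2" x k] p by (simp add: f_def poisson_integral_def)
      then show "(LINT t|lborel. poisson y (x - t) *\<^sub>R f k t) \<in> {a - e..}" using N[OF \<open>N \<le> k\<close>] by simp
    qed auto
    then show "norm (F (Complex x (s * y))) powr (p / 2) \<le> poisson_integral y g x + e"
      by (simp add: a_def poisson_integral_def)
  qed
  have ig: "integrable lborel (\<lambda>t. poisson y (x - t) *\<^sub>R h t)" if "0 < y" "h \<in> borel_measurable borel" "integrable lborel (\<lambda>t. (norm (h t))\<^sup>2)" for x y and h :: "real \<Rightarrow> real"
    by (rule integrable_poisson_Lp[of y 2]) (use that in \<open>simp_all add: powr_2_eq\<close>)
  \<comment> \<open>Positivity of the majorant is enforced by passing to |g|, which keeps the square
    integral and does not lower the Poisson integral.\<close>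
  show ?thesis
  proof (rule that[of "\<lambda>t. \<bar>g t\<bar>"])
    show "integrable lborel (\<lambda>t. \<bar>g t\<bar>\<^sup>2)" using g(2) by simp
    show "norm (F (Complex x (s * y))) powr (p / 2) \<le> poisson_integral y (\<lambda>t. \<bar>g t\<bar>) x" if y: "0 < y" for x y
    proof -
      have "poisson_integral y g x \<le> poisson_integral y (\<lambda>t. \<bar>g t\<bar>) x"
        unfolding poisson_integral_def
      proof (rule integral_mono)
        show "integrable lborel (\<lambda>t. poisson y (x - t) *\<^sub>R g t)" by (rule ig[OF y gm g(2)])
        show "integrable lborel (\<lambda>t. poisson y (x - t) *\<^sub>R \<bar>g t\<bar>)" by (rule ig[OF y]) (use gm g(2) in auto)
        show "poisson y (x - t) *\<^sub>R g t \<le> poisson y (x - t) *\<^sub>R \<bar>g t\<bar>" for t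
          using poisson_nonneg[of y "x - t"] y by (simp add: mult_left_mono)
      qed
      then show ?thesis using le[OF y, of x] by simp
    qed
  qed (use gm in auto)
qed

lemma hardy2_poisson:
  assumes F: "F \<in> hardy s 2" and s: "s = 1 \<or> s = -1"
  obtains f where "cauchy_integrable f" "\<And>x y. 0 < y \<Longrightarrow> F (Complex x (s * y)) = poisson_integral y f x"
proof -
  have p: "(1::real) \<le> 2" by simp
  note D = hardyD[OF F s p]
  obtain M where M: "\<And>y. 0 < y \<Longrightarrow> (LINT x|lborel. norm (F (Complex x (s * y))) powr 2) \<le> M"
    using D(4) by auto
  define b where "b = (\<lambda>k. 1 / real (Suc k))"
  have b: "0 < b k" for k by (simp add: b_def)
  define f where "f = (\<lambda>k t. F (Complex t (s * b k)))"
  have f2: "(norm (f k t))\<^sup>2 = norm (F (Complex t (s * b k))) powr 2" for k t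
    by (simp add: f_def powr_2_eq)
  have fm: "f k \<in> borel_measurable lborel" for k
    unfolding f_def using D(2)[OF b] by measurable
  have fi: "integrable lborel (\<lambda>t. (norm (f k t))\<^sup>2)" for k unfolding f2 by (rule D(3)[OF b])
  have fb: "(LINT t|lborel. (norm (f k t))\<^sup>2) \<le> M" for k unfolding f2 by (rule M[OF b])
  obtain g where g1: "g \<in> borel_measurable lborel" and g2: "integrable lborel (\<lambda>x. (norm (g x))\<^sup>2) \<and>
    (\<forall>\<kappa> C N. \<kappa> \<in> borel_measurable lborel \<longrightarrow> integrable lborel (\<lambda>x. (\<kappa> x)\<^sup>2) \<longrightarrow> closed C \<longrightarrow> convex C \<longrightarrow>
       (\<forall>k\<ge>N. (LINT x|lborel. \<kappa> x *\<^sub>R f k x) \<in> C) \<longrightarrow> (LINT x|lborel. \<kappa> x *\<^sub>R g x) \<in> C)"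
    using L2_weak_limit[of f lborel M, OF fm fi fb] by (rule bexE)
  note g = g1 g2[THEN conjunct1] g2[THEN conjunct2, rule_format]
  show ?thesis
  proof (rule that[of g])
    show "cauchy_integrable g"
      by (rule cauchy_integrable_Lp[OF p]) (use g(1,2) in \<open>simp_all add: powr_2_eq\<close>)
    show "F (Complex x (s * y)) = poisson_integral y g x" if y: "0 < y" for x y
    proof -
      have "norm (poisson_integral y g x - F (Complex x (s * y))) \<le> 0 + e" if e: "0 < e" for e
      proof -
        have "\<forall>\<^sub>F k in sequentially. dist (F (Complex x (s * (b k + y)))) (F (Complex x (s * y))) < e"
          unfolding b_def by (rule tendstoD[OF tendsto_line_points[OF D(1) s y] e])
        then obtain N where N: "\<And>k. k \<ge> N \<Longrightarrow> dist (F (Complex x (s * (b k + y)))) (F (Complex x (s * y))) < e"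
          by (auto simp: eventually_sequentially)
        \<comment> \<open>Here the closed convex sets are balls around the value of
          \<open>F\<close>; letting the radius shrink gives equality.\<close>
        have "(LINT t|lborel. poisson y (x - t) *\<^sub>R g t) \<in> cball (F (Complex x (s * y))) e"
        proof (rule g(3)[of "\<lambda>t. poisson y (x - t)" _ N])
          show "integrable lborel (\<lambda>t. (poisson y (x - t))\<^sup>2)" by (rule integrable_poisson_square[OF y])
          fix k assume "N \<le> k"
          have "F (Complex x (s * (b k + y))) = (LINT t|lborel. poisson y (x - t) *\<^sub>R f k t)"
            using hardy_line_poisson[OF F s p b y, of x k] by (simp add: f_def poisson_integral_def)
          then show "(LINT t|lborel. poisson y (x - t) *\<^sub>R f k t) \<in> cball (F (Complex x (s * y))) e"
            using N[OF \<open>N \<le> k\<close>] by (simp add: dist_commute)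
        qed auto
        then show ?thesis by (simp add: poisson_integral_def dist_norm norm_minus_commute)
      qed
      then have "norm (poisson_integral y g x - F (Complex x (s * y))) \<le> 0" by (rule field_le_epsilon)
      then show ?thesis by simp
    qed
  qed
qed

lemma bounded_holomorphic_vertical_limits:
  assumes hol: "B holomorphic_on half_plane s" and s: "s = 1 \<or> s = -1"
    and bd: "\<And>x y. 0 < y \<Longrightarrow> norm (B (Complex x (s * y))) \<le> N"
  shows "AE x in lborel. \<exists>l. ((\<lambda>y. B (Complex x (s * y))) \<longlongrightarrow> l) (at_right 0)"
proof -
  \<comment> \<open>The divisor vanishes only at -i s, in the opposite half-plane. It turns the
    bound \<open>N\<close> into the integrable bound N^2 / (1 + x^2) for |K|^2 on all lines at once,
    so \<open>K\<close> is in H2; afterwards the factor is multiplied back.\<close>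
  define K where "K = (\<lambda>z. B z / (z + Complex 0 s))"
  have ne: "Complex x (s * y) + Complex 0 s = Complex x (s * (y + 1))" for x y
    by (simp add: complex_eq_iff distrib_left)
  have nz: "z + Complex 0 s \<noteq> 0" if "z \<in> half_plane s" for z
    using that s by (elim disjE) (auto simp: half_plane_def complex_eq_iff)
  have holK: "K holomorphic_on half_plane s"
    unfolding K_def by (intro holomorphic_on_divide hol holomorphic_on_add holomorphic_on_ident holomorphic_on_const nz)
  have Kle: "norm (K (Complex x (s * y))) powr 2 \<le> N\<^sup>2 * (1 / (1 + x\<^sup>2))" if y: "0 < y" for x y
  proof -
    have "(norm (Complex x (s * (y + 1))))\<^sup>2 = x\<^sup>2 + (y + 1)\<^sup>2"
      using s by (elim disjE) (simp_all add: cmod_power2, simp add: power2_eq_square algebra_simps)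
    moreover have "1 \<le> (y + 1)\<^sup>2" using y by (simp add: power2_eq_square algebra_simps)
    ultimately have 1: "1 + x\<^sup>2 \<le> (norm (Complex x (s * (y + 1))))\<^sup>2" by simp
    have "norm (K (Complex x (s * y))) powr 2 = (norm (B (Complex x (s * y))))\<^sup>2 / (norm (Complex x (s * (y + 1))))\<^sup>2"
      by (simp only: powr_2_eq norm_ge_zero) (simp only: K_def ne norm_divide power_divide)
    also have "\<dots> \<le> N\<^sup>2 / (1 + x\<^sup>2)"
      using 1 bd[OF y] by (intro frac_le power_mono) (auto simp: add_pos_nonneg)
    finally show ?thesis by simp
  qed
  have i0: "integrable lborel (\<lambda>x. N\<^sup>2 * (1 / (1 + x\<^sup>2)))" by (intro integrable_mult_right integrable_inverse_1_plus_square)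
  have Km: "(\<lambda>x. K (Complex x (s * y))) \<in> borel_measurable borel" if "0 < y" for y
    by (rule borel_measurable_continuous_onI[OF continuous_on_line[OF holK s that]])
  have iK: "integrable lborel (\<lambda>x. norm (K (Complex x (s * y))) powr 2)" if y: "0 < y" for y
  proof (rule Bochner_Integration.integrable_bound[OF i0])
    show "(\<lambda>x. norm (K (Complex x (s * y))) powr 2) \<in> borel_measurable lborel" using Km[OF y] by measurable
    show "AE x in lborel. norm (norm (K (Complex x (s * y))) powr 2) \<le> norm (N\<^sup>2 * (1 / (1 + x\<^sup>2)))"
    proof (rule AE_I2)
      fix x
      have "norm (norm (K (Complex x (s * y))) powr 2) = norm (K (Complex x (s * y))) powr 2" by simp
      also have "\<dots> \<le> N\<^sup>2 * (1 / (1 + x\<^sup>2))" by (rule Kle[OF y])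
      also have "\<dots> \<le> norm (N\<^sup>2 * (1 / (1 + x\<^sup>2)))" by (simp only: real_norm_def abs_ge_self)
      finally show "norm (norm (K (Complex x (s * y))) powr 2) \<le> norm (N\<^sup>2 * (1 / (1 + x\<^sup>2)))" .
    qed
  qed
  have "K \<in> hardy s 2"
  proof (rule hardyI[OF holK s _ iK])
    show "(LINT x|lborel. norm (K (Complex x (s * y))) powr 2) \<le> (LINT x|lborel. N\<^sup>2 * (1 / (1 + x\<^sup>2)))" if "0 < y" for y
      by (rule integral_mono[OF iK[OF that] i0 Kle[OF that]])
  qed simp_all
  then obtain f where f: "cauchy_integrable f" "\<And>x y. 0 < y \<Longrightarrow> K (Complex x (s * y)) = poisson_integral y f x"
    using hardy2_poisson[OF _ s] by blast
  show ?thesis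
    using AE_poisson_point[OF f(1)]
  proof eventually_elim
    case (elim x)
    have "((\<lambda>y. K (Complex x (s * y))) \<longlongrightarrow> f x) (at_right 0)"
      by (rule nontangential_imp_vertical(1)[OF nontangential_poisson_integral[OF f(1) elim s f(2)] s])
    moreover have "((\<lambda>y. of_real x + \<i> * of_real (s * (y + 1))) \<longlongrightarrow> of_real x + \<i> * of_real (s * (0 + 1))) (at_right 0)"
      by (intro tendsto_intros)
    ultimately have "((\<lambda>y. K (Complex x (s * y)) * (of_real x + \<i> * of_real (s * (y + 1)))) \<longlongrightarrow> f x * (of_real x + \<i> * of_real (s * (0 + 1)))) (at_right 0)"
      by (rule tendsto_mult)
    moreover have "\<forall>\<^sub>F y in at_right 0. K (Complex x (s * y)) * (of_real x + \<i> * of_real (s * (y + 1))) = B (Complex x (s * y))"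
      unfolding eventually_at_filter
    proof (intro always_eventually allI impI)
      fix y :: real assume "y \<in> {0<..}"
      then have "Complex x (s * y) + Complex 0 s \<noteq> 0" by (intro nz Complex_in_half_plane s) simp
      moreover have "of_real x + \<i> * of_real (s * (y + 1)) = Complex x (s * y) + Complex 0 s" unfolding ne by (simp only: Complex_eq)
      ultimately show "K (Complex x (s * y)) * (of_real x + \<i> * of_real (s * (y + 1))) = B (Complex x (s * y))" by (simp add: K_def)
    qed
    ultimately have "((\<lambda>y. B (Complex x (s * y))) \<longlongrightarrow> f x * (of_real x + \<i> * of_real (s * (0 + 1)))) (at_right 0)"
      by (rule Lim_transform_eventually)
    then show ?case ..
  qed
qed

text \<open>Near the boundary \<open>h\<close> is close to 1 and has a principal logarithm.
  Subtracting it from \<open>\<gamma>\<close> leaves a continuous function whose exponential is the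
  constant \<open>e\<close>; its values are discrete, so it is constant on an interval, and
  \<open>\<gamma>\<close> converges with the logarithm.\<close>

lemma exp_limit_imp_limit:
  fixes \<gamma> :: "real \<Rightarrow> complex"
  assumes cont: "continuous_on {0<..} \<gamma>" and lim: "((\<lambda>y. exp (\<gamma> y)) \<longlongrightarrow> e) (at_right 0)" and e: "e \<noteq> 0"
  shows "\<exists>l. (\<gamma> \<longlongrightarrow> l) (at_right 0)"
proof -
  define h where "h = (\<lambda>y. exp (\<gamma> y) / e)"
  have h1: "(h \<longlongrightarrow> 1) (at_right 0)" unfolding h_def using tendsto_divide[OF lim tendsto_const e] e by simp
  have "\<forall>\<^sub>F y in at_right 0. dist (h y) 1 < 1" by (rule tendstoD[OF h1]) simp
  then obtain d where d: "0 < d" "\<And>y. 0 < y \<Longrightarrow> y < d \<Longrightarrow> dist (h y) 1 < 1"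
    by (auto simp: eventually_at_right_field)
  have Re: "0 < Re (h y)" if "0 < y" "y < d" for y
    using d(2)[OF that] abs_Re_le_cmod[of "h y - 1"] by (simp add: dist_norm)
  have nn: "h y \<notin> \<real>\<^sub>\<le>\<^sub>0" if "0 < y" "y < d" for y using Re[OF that] by (auto simp: complex_nonpos_Reals_iff)
  have conth: "continuous_on {0<..<d} h" unfolding h_def
    by (intro continuous_on_divide continuous_on_exp continuous_on_const continuous_on_subset[OF cont]) (use e in auto)
  define D where "D = (\<lambda>y. \<gamma> y - Ln (h y))"
  have contD: "continuous_on {0<..<d} D"
    unfolding D_def by (intro continuous_on_diff continuous_on_Ln' conth continuous_on_subset[OF cont]) (use nn in auto)
  have expD: "exp (D y) = e" if "0 < y" "y < d" for y
  proof -
    have "h y \<noteq> 0" using Re[OF that] by auto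
    then show ?thesis using e by (simp add: D_def exp_diff h_def)
  qed
  have "D constant_on {0<..<d}"
  proof (rule continuous_discrete_range_constant[OF _ contD])
    fix y assume y: "y \<in> {0<..<d}"
    show "\<exists>r>0. \<forall>y'. y' \<in> {0<..<d} \<and> D y' \<noteq> D y \<longrightarrow> r \<le> norm (D y' - D y)"
    proof (intro exI[of _ "2 * pi"] conjI allI impI)
      fix y' assume y': "y' \<in> {0<..<d} \<and> D y' \<noteq> D y"
      show "2 * pi \<le> norm (D y' - D y)"
      proof (rule ccontr)
        assume "\<not> ?thesis"
        then have "\<bar>Im (D y') - Im (D y)\<bar> < 2 * pi" using abs_Im_le_cmod[of "D y' - D y"] by simp
        moreover have "exp (D y') = exp (D y)" using expD y y' by simp
        ultimately show False using exp_complex_eqI y' by blast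
      qed
    qed simp
  qed simp
  then obtain c where c: "\<And>y. 0 < y \<Longrightarrow> y < d \<Longrightarrow> D y = c" by (auto simp: constant_on_def)
  have "((\<lambda>y. c + Ln (h y)) \<longlongrightarrow> c + Ln 1) (at_right 0)"
    by (intro tendsto_add tendsto_const tendsto_Ln h1) simp
  moreover have "\<forall>\<^sub>F y in at_right 0. c + Ln (h y) = \<gamma> y"
    unfolding eventually_at_right_field
  proof (intro exI[of _ d] conjI allI impI)
    fix y assume "0 < y" "y < d"
    from c[OF this] show "c + Ln (h y) = \<gamma> y" by (simp add: D_def algebra_simps)
  qed (rule d(1))
  ultimately have "(\<gamma> \<longlongrightarrow> c + Ln 1) (at_right 0)" by (rule Lim_transform_eventually)
  then show ?thesis ..
qed

lemma continuous_on_vertical: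
  assumes F: "F holomorphic_on half_plane s" and s: "s = 1 \<or> s = -1"
  shows "continuous_on {0<..} (\<lambda>y. F (Complex x (s * y)))"
proof (rule continuous_on_compose2[OF holomorphic_on_imp_continuous_on[OF F]])
  show "continuous_on {0<..} (\<lambda>y. Complex x (s * y))" unfolding Complex_eq by (intro continuous_intros)
  show "(\<lambda>y. Complex x (s * y)) ` {0<..} \<subseteq> half_plane s"
    by (rule image_subsetI, rule Complex_in_half_plane[OF s]) simp
qed

text \<open>For nonnegative \<open>r\<close> the function \<open>exp (- 2 * C r)\<close> is bounded, and its limits have the modulus
  \<open>exp (- r)\<close>; since this does not vanish, the exponent converges as well.\<close>

lemma cauchy_transform_vertical_limit_nonneg:
  assumes r: "cauchy_integrable (\<lambda>t. complex_of_real (r t))" and r0: "\<And>t. 0 \<le> r t" and s: "s = 1 \<or> s = -1"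
  shows "AE x in lborel. \<exists>l. ((\<lambda>y. cauchy_transform s (\<lambda>t. complex_of_real (r t)) (Complex x (s * y))) \<longlongrightarrow> l) (at_right 0)"
proof -
  define A where "A = (\<lambda>z. 2 * cauchy_transform s (\<lambda>t. complex_of_real (r t)) z)"
  have ReA: "Re (A (Complex x (s * y))) = poisson_integral y r x" if "0 < y" for x y
    unfolding A_def by (rule Re_cauchy_transform_of_real[OF r s that])
  have P0: "0 \<le> poisson_integral y r x" if "0 < y" for x y
    unfolding poisson_integral_def using r0 poisson_nonneg[of y] that by (intro integral_nonneg_AE AE_I2) auto
  have holA: "A holomorphic_on half_plane s" unfolding A_def by (intro holomorphic_intros holomorphic_cauchy_transform[OF r])
  have "AE x in lborel. \<exists>l. ((\<lambda>y. exp (- A (Complex x (s * y)))) \<longlongrightarrow> l) (at_right 0)"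
  proof (rule bounded_holomorphic_vertical_limits[OF _ s])
    show "(\<lambda>z. exp (- A z)) holomorphic_on half_plane s" by (intro holomorphic_intros holA)
    show "norm (exp (- A (Complex x (s * y)))) \<le> 1" if "0 < y" for x y
      using P0[OF that] ReA[OF that] by simp
  qed
  then show ?thesis
    using AE_poisson_point[OF r]
  proof eventually_elim
    case (elim x)
    then obtain l where l: "((\<lambda>y. exp (- A (Complex x (s * y)))) \<longlongrightarrow> l) (at_right 0)" by blast
    have "((\<lambda>y. poisson_integral y (\<lambda>t. complex_of_real (r t)) x) \<longlongrightarrow> complex_of_real (r x)) (at_right 0)"
    proof -
      define G where "G = (\<lambda>z. poisson_integral (s * Im z) (\<lambda>t. complex_of_real (r t)) (Re z))"
      have sy: "s * (s * y) = y" for y using s by (elim disjE) simp_all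
      have "has_nontangential_limit s G x (complex_of_real (r x))"
        by (rule nontangential_poisson_integral[OF r elim(2) s]) (simp add: G_def sy)
      from nontangential_imp_vertical(1)[OF this s] show ?thesis by (simp add: G_def sy)
    qed
    then have "((\<lambda>y. Re (poisson_integral y (\<lambda>t. complex_of_real (r t)) x)) \<longlongrightarrow> Re (complex_of_real (r x))) (at_right 0)"
      by (rule tendsto_Re)
    then have P: "((\<lambda>y. poisson_integral y r x) \<longlongrightarrow> r x) (at_right 0)" by (simp add: poisson_integral_of_real)
    have "((\<lambda>y. norm (exp (- A (Complex x (s * y))))) \<longlongrightarrow> exp (- r x)) (at_right 0)"
    proof (rule Lim_transform_eventually)
      show "((\<lambda>y. exp (- poisson_integral y r x)) \<longlongrightarrow> exp (- r x)) (at_right 0)" by (intro tendsto_intros P)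
      show "\<forall>\<^sub>F y in at_right 0. exp (- poisson_integral y r x) = norm (exp (- A (Complex x (s * y))))"
        unfolding eventually_at_filter
      proof (intro always_eventually allI impI)
        fix y :: real assume "y \<in> {0<..}"
        then show "exp (- poisson_integral y r x) = norm (exp (- A (Complex x (s * y))))" using ReA[of y x] by simp
      qed
    qed
    then have "norm l = exp (- r x)" using tendsto_unique[OF _ tendsto_norm[OF l]] by simp
    then have "l \<noteq> 0" by auto
    have "\<exists>l. ((\<lambda>y. - A (Complex x (s * y))) \<longlongrightarrow> l) (at_right 0)"
      by (rule exp_limit_imp_limit[OF _ l \<open>l \<noteq> 0\<close>]) (intro continuous_on_minus continuous_on_vertical[OF holA s])
    then obtain v where "((\<lambda>y. - A (Complex x (s * y))) \<longlongrightarrow> v) (at_right 0)" ..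
    from tendsto_mult_left[OF this, of "- (1/2)"]
    have "((\<lambda>y. cauchy_transform s (\<lambda>t. complex_of_real (r t)) (Complex x (s * y))) \<longlongrightarrow> - (1/2) * v) (at_right 0)" by (simp add: A_def)
    then show ?case ..
  qed
qed

lemma cauchy_integrable_le:
  assumes f: "cauchy_integrable f" and [measurable]: "g \<in> borel_measurable borel" and le: "\<And>t. norm (g t) \<le> norm (f t)"
  shows "cauchy_integrable g"
proof -
  have "integrable lborel (\<lambda>t. norm (g t) / (1 + \<bar>t\<bar>))"
  proof (rule Bochner_Integration.integrable_bound)
    show "integrable lborel (\<lambda>t. norm (f t) / (1 + \<bar>t\<bar>))" using f by (simp add: cauchy_integrable_def)
    show "AE t in lborel. norm (norm (g t) / (1 + \<bar>t\<bar>)) \<le> norm (norm (f t) / (1 + \<bar>t\<bar>))"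
      using le by (intro AE_I2) (simp add: divide_right_mono)
  qed measurable
  then show ?thesis by (simp add: cauchy_integrable_def)
qed

lemma cauchy_transform_linear:
  assumes f: "cauchy_integrable f" and g: "cauchy_integrable g" and z: "Im z \<noteq> 0"
  shows "cauchy_transform s (\<lambda>t. f t + c * g t) z = cauchy_transform s f z + c * cauchy_transform s g z"
proof -
  have [measurable]: "f \<in> borel_measurable borel" "g \<in> borel_measurable borel" using f g by (auto simp: cauchy_integrable_def)
  have "(LINT t|lborel. (f t + c * g t) / (of_real t - z)) = (LINT t|lborel. f t / (of_real t - z) + c * (g t / (of_real t - z)))"
    by (simp add: add_divide_distrib)
  also have "\<dots> = (LINT t|lborel. f t / (of_real t - z)) + (LINT t|lborel. c * (g t / (of_real t - z)))"
    by (intro Bochner_Integration.integral_add integrable_mult_right integrable_Cauchy_kernel f g z)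
  also have "(LINT t|lborel. c * (g t / (of_real t - z))) = c * (LINT t|lborel. g t / (of_real t - z))" by (rule integral_mult_right_zero)
  finally show ?thesis by (simp add: cauchy_transform_lborel distrib_left mult.left_commute)
qed

text \<open>By linearity it suffices to treat the positive and negative parts of the real and
  imaginary parts. Each of them is dominated by |f|, hence again
  \<open>cauchy_integrable\<close>.\<close>

lemma cauchy_transform_vertical_limit:
  assumes f: "cauchy_integrable f" and s: "s = 1 \<or> s = -1"
  shows "AE x in lborel. \<exists>l. ((\<lambda>y. cauchy_transform s f (Complex x (s * y))) \<longlongrightarrow> l) (at_right 0)"
proof -
  have [measurable]: "f \<in> borel_measurable borel" using f by (simp add: cauchy_integrable_def)
  have real: "AE x in lborel. \<exists>l. ((\<lambda>y. cauchy_transform s (\<lambda>t. complex_of_real (r t)) (Complex x (s * y))) \<longlongrightarrow> l) (at_right 0)"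
    if rm[measurable]: "r \<in> borel_measurable borel" and r: "\<And>t. \<bar>r t\<bar> \<le> norm (f t)" for r :: "real \<Rightarrow> real"
  proof -
    have rle: "r t \<le> norm (f t)" "- r t \<le> norm (f t)" for t using r[of t] by auto
    have c1: "cauchy_integrable (\<lambda>t. complex_of_real (max 0 (r t)))"
      by (rule cauchy_integrable_le[OF f], measurable) (use rle in \<open>auto simp: max_def\<close>)
    have c2: "cauchy_integrable (\<lambda>t. complex_of_real (max 0 (- r t)))"
      by (rule cauchy_integrable_le[OF f], measurable) (use rle in \<open>auto simp: max_def\<close>)
    have dec: "complex_of_real (r t) = complex_of_real (max 0 (r t)) + (-1) * complex_of_real (max 0 (- r t))" for t
      by (simp add: max_def)
    have m0: "0 \<le> max 0 (r t)" "0 \<le> max 0 (- r t)" for t by simp_all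
    show ?thesis
      using cauchy_transform_vertical_limit_nonneg[OF c1 m0(1) s] cauchy_transform_vertical_limit_nonneg[OF c2 m0(2) s]
    proof eventually_elim
      case (elim x)
      then obtain l m where l: "((\<lambda>y. cauchy_transform s (\<lambda>t. complex_of_real (max 0 (r t))) (Complex x (s * y))) \<longlongrightarrow> l) (at_right 0)"
        and m: "((\<lambda>y. cauchy_transform s (\<lambda>t. complex_of_real (max 0 (- r t))) (Complex x (s * y))) \<longlongrightarrow> m) (at_right 0)" by blast
      have "((\<lambda>y. cauchy_transform s (\<lambda>t. complex_of_real (r t)) (Complex x (s * y))) \<longlongrightarrow> l + (-1) * m) (at_right 0)"
      proof (rule Lim_transform_eventually)
        show "((\<lambda>y. cauchy_transform s (\<lambda>t. complex_of_real (max 0 (r t))) (Complex x (s * y)) + (-1) * cauchy_transform s (\<lambda>t. complex_of_real (max 0 (- r t))) (Complex x (s * y))) \<longlongrightarrow> l + (-1) * m) (at_right 0)"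
          by (intro tendsto_intros l m)
        show "\<forall>\<^sub>F y in at_right 0. cauchy_transform s (\<lambda>t. complex_of_real (max 0 (r t))) (Complex x (s * y)) + (-1) * cauchy_transform s (\<lambda>t. complex_of_real (max 0 (- r t))) (Complex x (s * y)) = cauchy_transform s (\<lambda>t. complex_of_real (r t)) (Complex x (s * y))"
          unfolding eventually_at_filter
        proof (intro always_eventually allI impI)
          fix y :: real assume "y \<in> {0<..}"
          then have "Im (Complex x (s * y)) \<noteq> 0" using s by auto
          from cauchy_transform_linear[OF c1 c2 this, of s "-1"]
          show "cauchy_transform s (\<lambda>t. complex_of_real (max 0 (r t))) (Complex x (s * y)) + (-1) * cauchy_transform s (\<lambda>t. complex_of_real (max 0 (- r t))) (Complex x (s * y)) = cauchy_transform s (\<lambda>t. complex_of_real (r t)) (Complex x (s * y))"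
            unfolding dec[symmetric] ..
        qed
      qed
      then show ?case ..
    qed
  qed
  have c1: "cauchy_integrable (\<lambda>t. complex_of_real (Re (f t)))"
    by (rule cauchy_integrable_le[OF f], measurable) (simp add: abs_Re_le_cmod)
  have c2: "cauchy_integrable (\<lambda>t. complex_of_real (Im (f t)))"
    by (rule cauchy_integrable_le[OF f], measurable) (simp add: abs_Im_le_cmod)
  have r1: "(\<lambda>t. Re (f t)) \<in> borel_measurable borel" and r2: "(\<lambda>t. Im (f t)) \<in> borel_measurable borel" by measurable
  have dec: "complex_of_real (Re (f t)) + \<i> * complex_of_real (Im (f t)) = f t" for t by (rule complex_eq[symmetric])
  show ?thesis
    using real[OF r1 abs_Re_le_cmod] real[OF r2 abs_Im_le_cmod]
  proof eventually_elim
    case (elim x)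
    then obtain l m where l: "((\<lambda>y. cauchy_transform s (\<lambda>t. complex_of_real (Re (f t))) (Complex x (s * y))) \<longlongrightarrow> l) (at_right 0)"
      and m: "((\<lambda>y. cauchy_transform s (\<lambda>t. complex_of_real (Im (f t))) (Complex x (s * y))) \<longlongrightarrow> m) (at_right 0)" by blast
    have "((\<lambda>y. cauchy_transform s f (Complex x (s * y))) \<longlongrightarrow> l + \<i> * m) (at_right 0)"
    proof (rule Lim_transform_eventually)
      show "((\<lambda>y. cauchy_transform s (\<lambda>t. complex_of_real (Re (f t))) (Complex x (s * y)) + \<i> * cauchy_transform s (\<lambda>t. complex_of_real (Im (f t))) (Complex x (s * y))) \<longlongrightarrow> l + \<i> * m) (at_right 0)"
        by (intro tendsto_intros l m)
      show "\<forall>\<^sub>F y in at_right 0. cauchy_transform s (\<lambda>t. complex_of_real (Re (f t))) (Complex x (s * y)) + \<i> * cauchy_transform s (\<lambda>t. complex_of_real (Im (f t))) (Complex x (s * y)) = cauchy_transform s f (Complex x (s * y))"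
        unfolding eventually_at_filter
      proof (intro always_eventually allI impI)
        fix y :: real assume "y \<in> {0<..}"
        then have "Im (Complex x (s * y)) \<noteq> 0" using s by auto
        from cauchy_transform_linear[OF c1 c2 this, of s "\<i>"]
        show "cauchy_transform s (\<lambda>t. complex_of_real (Re (f t))) (Complex x (s * y)) + \<i> * cauchy_transform s (\<lambda>t. complex_of_real (Im (f t))) (Complex x (s * y)) = cauchy_transform s f (Complex x (s * y))"
          unfolding dec ..
      qed
    qed
    then show ?case ..
  qed
qed

section \<open>Boundary functions\<close>

lemma poisson_integral_vertical_limit:
  assumes f: "cauchy_integrable f" and x: "poisson_point f x"
  shows "((\<lambda>y. poisson_integral y f x) \<longlongrightarrow> f x) (at_right 0)"
proof -
  define G where "G = (\<lambda>z. poisson_integral (1 * Im z) f (Re z))"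
  have s: "(1::real) = 1 \<or> (1::real) = -1" by simp
  have "has_nontangential_limit 1 G x (f x)"
    by (rule nontangential_poisson_integral[OF f x s]) (simp add: G_def)
  from nontangential_imp_vertical(1)[OF this s] show ?thesis by (simp add: G_def)
qed

lemma filterlim_inverse_Suc: "filterlim (\<lambda>k. 1 / real (Suc k)) (at_right 0) sequentially"
  unfolding filterlim_at
proof
  show "\<forall>\<^sub>F k in sequentially. 1 / real (Suc k) \<in> {0<..} \<and> 1 / real (Suc k) \<noteq> 0" by (intro always_eventually allI) simp
  show "(\<lambda>k. 1 / real (Suc k)) \<longlonglongrightarrow> 0" by (rule LIMSEQ_Suc[OF lim_const_over_n])
qed

text \<open>The last clause says that the restrictions of \<open>F\<close> to the lines at height \<open>1 / (k + 1)\<close> converge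
  weakly to \<open>f\<close>; it makes weak derivatives pass to the boundary.\<close>

definition hardy_repr :: "real \<Rightarrow> real \<Rightarrow> (complex \<Rightarrow> complex) \<Rightarrow> (real \<Rightarrow> complex) \<Rightarrow> bool" where
  "hardy_repr s p F f \<longleftrightarrow> f \<in> borel_measurable borel \<and> integrable lborel (\<lambda>t. norm (f t) powr p) \<and>
    (\<forall>x y. 0 < y \<longrightarrow> F (Complex x (s * y)) = poisson_integral y f x) \<and>
    (\<forall>x y. 0 < y \<longrightarrow> cauchy_transform s f (Complex x (s * y)) = F (Complex x (s * y))) \<and>
    (\<forall>x y. 0 < y \<longrightarrow> cauchy_transform (- s) f (Complex x (- s * y)) = 0) \<and>
    (AE x in lborel. has_nontangential_limit s F x (f x)) \<and>
    (\<forall>\<kappa> C. \<kappa> \<in> borel_measurable borel \<longrightarrow> (\<forall>t. norm (\<kappa> t) \<le> C / (1 + \<bar>t\<bar>)) \<longrightarrow>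
       (\<lambda>k. LINT t|lborel. F (Complex t (s * (1 / real (Suc k)))) * \<kappa> t) \<longlonglongrightarrow> (LINT t|lborel. f t * \<kappa> t))"

text \<open>It follows from u^a <= 1 + u^2 <= 2 exp u and is applied with a = 2/p, which lies in (0,
  2] because p >= 1.\<close>

lemma powr_exp_bound:
  fixes u a :: real
  assumes "0 \<le> u" "0 < a" "a \<le> 2" shows "u powr a * exp (- u) \<le> 2"
proof -
  have u2: "0 \<le> u\<^sup>2" by simp
  have "u powr a \<le> 1 + u\<^sup>2"
  proof (cases "u \<le> 1")
    case True
    then have "u powr a \<le> 1" using assms by (simp add: powr_le1)
    then show ?thesis using u2 by linarith
  next
    case False
    then have "u powr a \<le> u powr 2" using assms by (intro powr_mono) auto
    then show ?thesis using assms by (simp add: powr_2_eq)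
  qed
  moreover have "1 + u + u\<^sup>2 / 2 \<le> exp u" using assms by (intro exp_lower_Taylor_quadratic)
  ultimately have "u powr a \<le> 2 * exp u" using assms(1) u2 by argo
  then show ?thesis by (simp add: exp_minus field_simps)
qed

text \<open>The majorant is h = g^2: Jensen's inequality with exponent 2 moves the square inside the
  Poisson mean, so |F|^p acquires an integrable majorant whatever p is.\<close>

lemma hardy_vertical_limit_majorant:
  assumes F: "F \<in> hardy s p" and s: "s = 1 \<or> s = -1" and p: "1 \<le> p"
  obtains h :: "real \<Rightarrow> real" where "h \<in> borel_measurable borel" "\<And>t. 0 \<le> h t" "integrable lborel h"
    "\<And>x y. 0 < y \<Longrightarrow> norm (F (Complex x (s * y))) powr p \<le> poisson_integral y h x"
    "AE x in lborel. \<exists>l. ((\<lambda>y. F (Complex x (s * y))) \<longlongrightarrow> l) (at_right 0)"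
proof -
  note D = hardyD[OF F s p]
  obtain g :: "real \<Rightarrow> real" where g[measurable]: "g \<in> borel_measurable borel" and g0: "\<And>t. 0 \<le> g t" and g2: "integrable lborel (\<lambda>t. (g t)\<^sup>2)"
    and le: "\<And>x y. 0 < y \<Longrightarrow> norm (F (Complex x (s * y))) powr (p / 2) \<le> poisson_integral y g x"
    by (rule hardy_majorant[OF F s p]) (rule that, assumption+)
  have gp: "integrable lborel (\<lambda>t. norm (g t) powr 2)" using g2 g0 by (simp add: powr_2_eq)
  have P0: "0 \<le> poisson_integral y g x" if "0 < y" for x y
    unfolding poisson_integral_def using g0 poisson_nonneg[of y] that by (intro integral_nonneg_AE AE_I2) auto
  have ci: "cauchy_integrable (\<lambda>t. complex_of_real (g t))"
    by (rule cauchy_integrable_Lp[of 2]) (use gp in simp_all)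
  have lep: "norm (F (Complex x (s * y))) powr p \<le> poisson_integral y (\<lambda>t. (g t)\<^sup>2) x" if y: "0 < y" for x y
  proof -
    have "norm (F (Complex x (s * y))) powr p = (norm (F (Complex x (s * y))) powr (p / 2)) powr 2"
      by (simp add: powr_powr)
    also have "\<dots> \<le> (poisson_integral y g x) powr 2" by (intro powr_mono2 le y) auto
    also have "\<dots> = norm (poisson_integral y g x) powr 2" using P0[OF y, of x] by simp
    also have "\<dots> \<le> poisson_integral y (\<lambda>t. norm (g t) powr 2) x"
      by (rule norm_poisson_integral_powr_le[OF y _ g gp]) simp
    also have "(\<lambda>t. norm (g t) powr 2) = (\<lambda>t. (g t)\<^sup>2)" using g0 by (intro ext) (simp add: powr_2_eq)
    finally show ?thesis .
  qed
  define A where "A = (\<lambda>z. 2 * cauchy_transform s (\<lambda>t. complex_of_real (g t)) z)"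
  have ReA: "Re (A (Complex x (s * y))) = poisson_integral y g x" if "0 < y" for x y
    unfolding A_def by (rule Re_cauchy_transform_of_real[OF ci s that])
  have AE1: "AE x in lborel. \<exists>l. ((\<lambda>y. F (Complex x (s * y)) * exp (- A (Complex x (s * y)))) \<longlongrightarrow> l) (at_right 0)"
  proof (rule bounded_holomorphic_vertical_limits[OF _ s])
    show "(\<lambda>z. F z * exp (- A z)) holomorphic_on half_plane s"
      unfolding A_def by (intro holomorphic_intros D(1) holomorphic_cauchy_transform[OF ci])
    fix x y :: real assume y: "0 < y"
    let ?u = "poisson_integral y g x"
    have "norm (F (Complex x (s * y))) = (norm (F (Complex x (s * y))) powr (p / 2)) powr (2 / p)"
      using p by (simp add: powr_powr)
    also have "\<dots> \<le> ?u powr (2 / p)" using p by (intro powr_mono2 le y) auto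
    finally have 1: "norm (F (Complex x (s * y))) \<le> ?u powr (2 / p)" .
    have "norm (F (Complex x (s * y)) * exp (- A (Complex x (s * y)))) = norm (F (Complex x (s * y))) * exp (- ?u)"
      by (simp add: norm_mult ReA[OF y])
    also have "\<dots> \<le> ?u powr (2 / p) * exp (- ?u)" by (intro mult_right_mono 1) simp
    also have "\<dots> \<le> 2" using p by (intro powr_exp_bound P0[OF y]) (auto simp: field_simps)
    finally show "norm (F (Complex x (s * y)) * exp (- A (Complex x (s * y)))) \<le> 2" .
  qed
  have AE2: "AE x in lborel. \<exists>l. ((\<lambda>y. F (Complex x (s * y))) \<longlongrightarrow> l) (at_right 0)"
    using AE1 cauchy_transform_vertical_limit[OF ci s]
  proof eventually_elim
    case (elim x)
    then obtain l m where l: "((\<lambda>y. F (Complex x (s * y)) * exp (- A (Complex x (s * y)))) \<longlongrightarrow> l) (at_right 0)"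
      and m: "((\<lambda>y. cauchy_transform s (\<lambda>t. complex_of_real (g t)) (Complex x (s * y))) \<longlongrightarrow> m) (at_right 0)" by (elim exE) (rule that)
    have "((\<lambda>y. exp (- A (Complex x (s * y)))) \<longlongrightarrow> exp (- (2 * m))) (at_right 0)"
      unfolding A_def by (intro tendsto_exp tendsto_minus tendsto_mult tendsto_const m)
    \<comment> \<open>The limit of the damping factor is an exponential, hence nonzero, and can be
      divided out.\<close>
    from tendsto_divide[OF l this] have "((\<lambda>y. F (Complex x (s * y))) \<longlongrightarrow> l / exp (- (2 * m))) (at_right 0)" by simp
    then show ?case ..
  qed
  show ?thesis
    by (rule that[of "\<lambda>t. (g t)\<^sup>2", OF _ _ g2 lep AE2]) simp_all
qed

text \<open>Pratt's theorem is applied with the Poisson integrals \<open>G k\<close> of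
  \<open>h\<close> at height \<open>b k\<close>. It gives the integrability of the limit
  \<open>f\<close> and, after the weight from Young's inequality is added to the majorants,
  convergence against every kernel bounded by a multiple of 1/(1 + |t|). The Poisson kernel and the
  Cauchy kernels on both sides are of this kind, so all formulas on lines pass to the
  boundary.\<close>

theorem hardy_boundary_function:
  assumes F: "F \<in> hardy s p" and s: "s = 1 \<or> s = -1" and p: "1 \<le> p"
  shows "\<exists>f. hardy_repr s p F f"
proof -
  note D = hardyD[OF F s p]
  obtain h :: "real \<Rightarrow> real" where hm[measurable]: "h \<in> borel_measurable borel" and h0: "\<And>t. 0 \<le> h t" and hi: "integrable lborel h"
    and hle: "\<And>x y. 0 < y \<Longrightarrow> norm (F (Complex x (s * y))) powr p \<le> poisson_integral y h x"
    and hlim: "AE x in lborel. \<exists>l. ((\<lambda>y. F (Complex x (s * y))) \<longlongrightarrow> l) (at_right 0)"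
    by (rule hardy_vertical_limit_majorant[OF F s p]) (rule that, assumption+)
  define b where "b = (\<lambda>k. 1 / real (Suc k))"
  have b: "0 < b k" for k by (simp add: b_def)
  define Fb where "Fb = (\<lambda>k t. F (Complex t (s * b k)))"
  have Fbm[measurable]: "Fb k \<in> borel_measurable borel" for k unfolding Fb_def by (rule D(2)[OF b])
  \<comment> \<open>Written with \<open>lim\<close> along one sequence of heights, so that
    \<open>f\<close> is Borel measurable; divergence is confined to a null set.\<close>
  define f where "f = (\<lambda>x. lim (\<lambda>k. Fb k x))"
  have fm[measurable]: "f \<in> borel_measurable borel" unfolding f_def by measurable
  have Fbf: "AE x in lborel. (\<lambda>k. Fb k x) \<longlonglongrightarrow> f x"
    using hlim
  proof eventually_elim
    case (elim x)
    then obtain l where l: "((\<lambda>y. F (Complex x (s * y))) \<longlongrightarrow> l) (at_right 0)" ..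
    have "(\<lambda>k. Fb k x) \<longlonglongrightarrow> l"
      unfolding Fb_def b_def by (rule filterlim_compose[OF l filterlim_inverse_Suc])
    then show ?case unfolding f_def by (simp add: limI)
  qed
  define G where "G = (\<lambda>k x. poisson_integral (b k) h x)"
  have Gi: "integrable lborel (G k)" "integral\<^sup>L lborel (G k) = integral\<^sup>L lborel h" for k
    using integrable_poisson_integral[OF b hi h0, of k] by (simp_all add: G_def[abs_def] has_bochner_integral_iff)
  have hci: "cauchy_integrable (\<lambda>t. complex_of_real (h t))"
    by (rule cauchy_integrable_Lp[of 1]) (use hi h0 in simp_all)
  have Gh: "AE x in lborel. (\<lambda>k. G k x) \<longlonglongrightarrow> h x"
    using AE_poisson_point[OF hci]
  proof eventually_elim
    case (elim x)
    have "((\<lambda>y. Re (poisson_integral y (\<lambda>t. complex_of_real (h t)) x)) \<longlongrightarrow> Re (complex_of_real (h x))) (at_right 0)"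
      by (rule tendsto_Re[OF poisson_integral_vertical_limit[OF hci elim]])
    then have "((\<lambda>y. poisson_integral y h x) \<longlongrightarrow> h x) (at_right 0)" by (simp add: poisson_integral_of_real)
    then show ?case unfolding G_def b_def by (rule filterlim_compose[OF _ filterlim_inverse_Suc])
  qed
  have FG: "norm (Fb k x) powr p \<le> G k x" for k x unfolding Fb_def G_def by (rule hle[OF b])
  have fp: "integrable lborel (\<lambda>t. norm (f t) powr p)"
  proof (rule Pratt_convergence(1)[of "\<lambda>k t. norm (Fb k t) powr p" lborel _ G h])
    show "AE x in lborel. (\<lambda>k. norm (Fb k x) powr p) \<longlonglongrightarrow> norm (f x) powr p"
      using Fbf
    proof eventually_elim
      case (elim x)
      show ?case by (intro tendsto_powr' tendsto_norm elim tendsto_const) (use p in auto)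
    qed
    show "AE x in lborel. norm (norm (Fb k x) powr p) \<le> G k x" for k using FG by (intro AE_I2) simp
    show "(\<lambda>k. integral\<^sup>L lborel (G k)) \<longlonglongrightarrow> integral\<^sup>L lborel h" unfolding Gi(2) by (rule tendsto_const)
  qed (use Gi(1) hi Gh in simp_all)
  obtain \<omega> :: "real \<Rightarrow> real" where \<omega>: "integrable lborel \<omega>" "\<And>t. 0 \<le> \<omega> t" "\<And>t u. 0 \<le> u \<Longrightarrow> u / (1 + \<bar>t\<bar>) \<le> u powr p + \<omega> t"
    by (rule Young_weight[OF p]) (rule that, assumption+)
  have \<kappa>lim: "(\<lambda>k. LINT t|lborel. Fb k t * \<kappa> t) \<longlonglongrightarrow> (LINT t|lborel. f t * \<kappa> t)"
    if \<kappa>[measurable]: "\<kappa> \<in> borel_measurable borel" and \<kappa>C: "\<And>t. norm (\<kappa> t) \<le> C / (1 + \<bar>t\<bar>)" for \<kappa> C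
  proof -
    have C0: "0 \<le> C" using order_trans[OF norm_ge_zero \<kappa>C[of 0]] by simp
    show ?thesis
    proof (rule Pratt_convergence(4)[of "\<lambda>k t. Fb k t * \<kappa> t" lborel _ "\<lambda>k t. C * (G k t + \<omega> t)" "\<lambda>t. C * (h t + \<omega> t)"])
      show "integrable lborel (\<lambda>t. C * (G k t + \<omega> t))" for k by (intro integrable_mult_right Bochner_Integration.integrable_add Gi \<omega>)
      show "integrable lborel (\<lambda>t. C * (h t + \<omega> t))" by (intro integrable_mult_right Bochner_Integration.integrable_add hi \<omega>)
      show "AE x in lborel. (\<lambda>k. Fb k x * \<kappa> x) \<longlonglongrightarrow> f x * \<kappa> x"
        using Fbf by eventually_elim (intro tendsto_mult tendsto_const)
      show "AE x in lborel. (\<lambda>k. C * (G k x + \<omega> x)) \<longlonglongrightarrow> C * (h x + \<omega> x)"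
        using Gh by eventually_elim (intro tendsto_mult tendsto_add tendsto_const)
      show "AE x in lborel. norm (Fb k x * \<kappa> x) \<le> C * (G k x + \<omega> x)" for k
      proof (rule AE_I2)
        fix x
        have "norm (Fb k x * \<kappa> x) \<le> norm (Fb k x) * (C / (1 + \<bar>x\<bar>))" unfolding norm_mult by (intro mult_left_mono \<kappa>C) simp
        also have "\<dots> = C * (norm (Fb k x) / (1 + \<bar>x\<bar>))" by simp
        also have "\<dots> \<le> C * (norm (Fb k x) powr p + \<omega> x)" by (intro mult_left_mono \<omega>(3) C0) simp
        also have "\<dots> \<le> C * (G k x + \<omega> x)" by (intro mult_left_mono add_right_mono FG C0)
        finally show "norm (Fb k x * \<kappa> x) \<le> C * (G k x + \<omega> x)" .
      qed
      have "(LINT t|lborel. C * (G k t + \<omega> t)) = (LINT t|lborel. C * (h t + \<omega> t))" for k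
      proof -
        have "(LINT t|lborel. C * (G k t + \<omega> t)) = C * (integral\<^sup>L lborel (G k) + integral\<^sup>L lborel \<omega>)"
          unfolding integral_mult_right_zero by (simp only: Bochner_Integration.integral_add[OF Gi(1) \<omega>(1)])
        also have "\<dots> = (LINT t|lborel. C * (h t + \<omega> t))"
          unfolding integral_mult_right_zero Gi(2) by (simp only: Bochner_Integration.integral_add[OF hi \<omega>(1)])
        finally show ?thesis .
      qed
      then show "(\<lambda>k. LINT t|lborel. C * (G k t + \<omega> t)) \<longlonglongrightarrow> (LINT t|lborel. C * (h t + \<omega> t))" by (simp only: tendsto_const)
    qed measurable
  qed
  have fci: "cauchy_integrable f" by (rule cauchy_integrable_Lp[OF p fm fp])
  have pt: "(\<lambda>k. F (Complex x (s * (b k + y)))) \<longlonglongrightarrow> F (Complex x (s * y))" if "0 < y" for x y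
    unfolding b_def by (rule tendsto_line_points[OF D(1) s that])
  have rep: "F (Complex x (s * y)) = poisson_integral y f x" if y: "0 < y" for x y
  proof -
    obtain C where C: "\<And>t. poisson y (x - t) \<le> C / (1 + \<bar>t\<bar>)" "0 \<le> C"
      by (rule poisson_le_weight[OF y, of x]) (rule that)
    have "(\<lambda>k. LINT t|lborel. Fb k t * complex_of_real (poisson y (x - t))) \<longlonglongrightarrow> (LINT t|lborel. f t * complex_of_real (poisson y (x - t)))"
    proof (rule \<kappa>lim)
      show "norm (complex_of_real (poisson y (x - t))) \<le> C / (1 + \<bar>t\<bar>)" for t
        using C(1)[of t] poisson_nonneg[of y "x - t"] y by simp
    qed measurable
    moreover have "(LINT t|lborel. v t * complex_of_real (poisson y (x - t))) = poisson_integral y v x" for v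
      unfolding poisson_integral_def by (simp add: scaleR_conv_of_real mult.commute)
    ultimately have "(\<lambda>k. poisson_integral y (Fb k) x) \<longlonglongrightarrow> poisson_integral y f x" by (simp only:)
    moreover have "poisson_integral y (Fb k) x = F (Complex x (s * (b k + y)))" for k
      unfolding Fb_def by (rule hardy_line_poisson[OF F s p b y, symmetric])
    ultimately have "(\<lambda>k. F (Complex x (s * (b k + y)))) \<longlonglongrightarrow> poisson_integral y f x" by (simp only:)
    then show ?thesis by (rule LIMSEQ_unique[OF pt[OF y]])
  qed
  have ct: "(\<lambda>k. cauchy_transform r (Fb k) z) \<longlonglongrightarrow> cauchy_transform r f z" if z: "Im z \<noteq> 0" for r z
  proof -
    have "(\<lambda>k. LINT t|lborel. Fb k t * (1 / (of_real t - z))) \<longlonglongrightarrow> (LINT t|lborel. f t * (1 / (of_real t - z)))"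
      by (rule \<kappa>lim[OF _ Cauchy_kernel_weight[OF z]]) measurable
    then have "(\<lambda>k. LINT t|lborel. Fb k t / (of_real t - z)) \<longlonglongrightarrow> (LINT t|lborel. f t / (of_real t - z))" by simp
    then show ?thesis
      unfolding cauchy_transform_lborel[OF Fbm] cauchy_transform_lborel[OF fm] by (rule tendsto_mult_left)
  qed
  have im: "Im (Complex x (r * y)) \<noteq> 0" if "0 < y" "r = 1 \<or> r = -1" for x y r using that by auto
  have s': "- s = 1 \<or> - s = -1" using s by auto
  have c1: "cauchy_transform s f (Complex x (s * y)) = F (Complex x (s * y))" if y: "0 < y" for x y
  proof -
    have "(\<lambda>k. cauchy_transform s (Fb k) (Complex x (s * y))) \<longlonglongrightarrow> cauchy_transform s f (Complex x (s * y))"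
      by (rule ct[OF im[OF y s]])
    moreover have "cauchy_transform s (Fb k) (Complex x (s * y)) = F (Complex x (s * (b k + y)))" for k
      unfolding Fb_def by (rule hardy_line_Cauchy(1)[OF F s p b y])
    ultimately have "(\<lambda>k. F (Complex x (s * (b k + y)))) \<longlonglongrightarrow> cauchy_transform s f (Complex x (s * y))" by (simp only:)
    then show ?thesis by (rule LIMSEQ_unique[OF _ pt[OF y]])
  qed
  have c2: "cauchy_transform (- s) f (Complex x (- s * y)) = 0" if y: "0 < y" for x y
  proof -
    have "(\<lambda>k. cauchy_transform (- s) (Fb k) (Complex x (- s * y))) \<longlonglongrightarrow> cauchy_transform (- s) f (Complex x (- s * y))"
      by (rule ct[OF im[OF y s']])
    moreover have "cauchy_transform (- s) (Fb k) (Complex x (- s * y)) = 0" for k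
      unfolding Fb_def by (rule hardy_line_Cauchy(2)[OF F s p b y])
    ultimately have "(\<lambda>k::nat. (0::complex)) \<longlonglongrightarrow> cauchy_transform (- s) f (Complex x (- s * y))" by (simp only:)
    then show ?thesis by (simp only: LIMSEQ_const_iff)
  qed
  have nt: "AE x in lborel. has_nontangential_limit s F x (f x)"
    using AE_poisson_point[OF fci] by eventually_elim (rule nontangential_poisson_integral[OF fci _ s rep])
  show ?thesis
    unfolding hardy_repr_def
    by (rule exI[of _ f]) (intro conjI allI impI fm fp rep c1 c2 nt \<kappa>lim[unfolded Fb_def b_def], auto)
qed

text \<open>The leading coefficient of the Cauchy integral at infinity: along the imaginary axis v /
  (t - v) tends to -1 and has modulus at most 1.\<close>

lemma Cauchy_integral_asymptotic:
  fixes f :: "real \<Rightarrow> complex"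
  assumes fi: "integrable lborel f" and c: "c = 1 \<or> c = -1"
  defines "v \<equiv> \<lambda>n. Complex 0 (c * real (Suc n))"
  shows "(\<lambda>n. v n * (LINT t|lborel. f t / (of_real t - v n))) \<longlonglongrightarrow> - (LINT t|lborel. f t)"
proof -
  have fm[measurable]: "f \<in> borel_measurable borel" using fi by auto
  have fn: "integrable lborel (\<lambda>t. norm (f t))" using fi by simp
  have v0: "v n \<noteq> 0" and vn: "norm (v n) = real (Suc n)" for n
    using c by (auto simp: v_def complex_eq_iff cmod_def)
  have low: "norm (v n) \<le> norm (complex_of_real t - v n)" for n t
    using abs_Im_le_cmod[of "complex_of_real t - v n"] c unfolding vn by (auto simp: v_def)
  have "(\<lambda>n. LINT t|lborel. v n * (f t / (of_real t - v n))) \<longlonglongrightarrow> (LINT t|lborel. - f t)"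
  proof (rule integral_dominated_convergence[where w="\<lambda>t. norm (f t)"])
    show "AE t in lborel. (\<lambda>n. v n * (f t / (of_real t - v n))) \<longlonglongrightarrow> - f t"
    proof (rule AE_I2)
      fix t
      have inv: "(\<lambda>n. complex_of_real t / v n) \<longlonglongrightarrow> 0"
      proof (rule tendsto_norm_zero_cancel)
        have "(\<lambda>n. \<bar>t\<bar> / real (Suc n)) \<longlonglongrightarrow> 0" by (rule LIMSEQ_Suc[OF lim_const_over_n])
        then show "(\<lambda>n. norm (complex_of_real t / v n)) \<longlonglongrightarrow> 0" unfolding norm_divide vn by simp
      qed
      have "(\<lambda>n. f t / (complex_of_real t / v n - 1)) \<longlonglongrightarrow> f t / (0 - 1)"
        by (intro tendsto_divide tendsto_diff tendsto_const inv) simp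
      moreover have "f t / (complex_of_real t / v n - 1) = v n * (f t / (of_real t - v n))" for n
      proof -
        have "0 < norm (complex_of_real t - v n)" by (rule less_le_trans[OF _ low]) (simp add: vn)
        then have "of_real t - v n \<noteq> 0" by simp
        moreover have "complex_of_real t / v n - 1 = (of_real t - v n) / v n" using v0[of n] by (simp add: diff_divide_distrib)
        ultimately show ?thesis by simp
      qed
      ultimately show "(\<lambda>n. v n * (f t / (of_real t - v n))) \<longlonglongrightarrow> - f t" by simp
    qed
    show "AE t in lborel. norm (v n * (f t / (of_real t - v n))) \<le> norm (f t)" for n
    proof (rule AE_I2)
      fix t
      have "0 < norm (complex_of_real t - v n)" by (rule less_le_trans[OF _ low]) (simp add: vn)
      then have "norm (v n) * (norm (f t) / norm (complex_of_real t - v n)) \<le> norm (f t)"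
        using mult_right_mono[OF low[of n t] norm_ge_zero[of "f t"]] by (simp add: pos_divide_le_eq mult.commute)
      then show "norm (v n * (f t / (of_real t - v n))) \<le> norm (f t)" by (simp only: norm_mult norm_divide)
    qed
  qed (use fn in simp_all)
  then show ?thesis unfolding integral_mult_right_zero by simp
qed

text \<open>The Cauchy integral of the line values vanishes on the opposite side, hence so does its
  leading coefficient at infinity, which is minus the integral.\<close>

lemma hardy1_line_integral_0:
  assumes F: "F \<in> hardy s 1" and s: "s = 1 \<or> s = -1" and b: "0 < b"
  shows "(LINT t|lborel. F (Complex t (s * b))) = 0"
proof -
  have p: "(1::real) \<le> 1" by simp
  note D = hardyD[OF F s p]
  define f where "f = (\<lambda>t. F (Complex t (s * b)))"
  have fm[measurable]: "f \<in> borel_measurable borel" unfolding f_def by (rule D(2)[OF b])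
  have fi: "integrable lborel f" using D(3)[OF b] fm by (simp add: f_def integrable_norm_iff)
  have s': "- s = 1 \<or> - s = -1" using s by auto
  have s0: "complex_of_real s \<noteq> 0" using s by auto
  have zero: "(LINT t|lborel. f t / (of_real t - Complex 0 (- s * real (Suc n)))) = 0" for n
  proof -
    have "cauchy_transform (- s) f (Complex 0 (- s * real (Suc n))) = 0"
      unfolding f_def by (rule hardy_line_Cauchy(2)[OF F s p b]) simp
    then show ?thesis using s0 by (simp add: cauchy_transform_lborel)
  qed
  from Cauchy_integral_asymptotic[OF fi s'] have "- (LINT t|lborel. f t) = 0"
    unfolding zero mult_zero_right by (simp only: LIMSEQ_const_iff)
  then show ?thesis by (simp add: f_def)
qed

section \<open>The Hilbert transform and boundary values of Cauchy transforms\<close>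

lemma truncated_kernel_bound:
  fixes u e :: real
  assumes e: "0 < e"
  shows "\<bar>(if e < \<bar>u\<bar> then 1 / (pi * u) else 0) - conj_poisson e u\<bar> \<le> poisson e u"
proof -
  have R: "0 < u\<^sup>2 + e\<^sup>2" using e by (simp add: add_nonneg_pos)
  show ?thesis
  proof (cases "e < \<bar>u\<bar>")
    case True
    then have u0: "u \<noteq> 0" using e by auto
    \<comment> \<open>Outside the truncation the difference of the kernels is, up to sign, e / |u|
      times the Poisson kernel, and e < |u|. Inside, only the conjugate kernel remains, and |u| <= e
      puts it below the Poisson kernel.\<close>
    have "1 / u - u / (u\<^sup>2 + e\<^sup>2) = e\<^sup>2 / (u * (u\<^sup>2 + e\<^sup>2))"
      using u0 R by (simp add: field_simps power2_eq_square)
    then have "\<bar>1 / u - u / (u\<^sup>2 + e\<^sup>2)\<bar> = e / \<bar>u\<bar> * (e / (u\<^sup>2 + e\<^sup>2))"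
      using R e by (simp add: abs_mult power2_eq_square[of e])
    also have "\<dots> \<le> 1 * (e / (u\<^sup>2 + e\<^sup>2))" using True e R by (intro mult_right_mono) auto
    finally have "\<bar>1 / u - u / (u\<^sup>2 + e\<^sup>2)\<bar> / pi \<le> (e / (u\<^sup>2 + e\<^sup>2)) / pi" by (intro divide_right_mono) auto
    moreover have "1 / (pi * u) - conj_poisson e u = (1 / u - u / (u\<^sup>2 + e\<^sup>2)) / pi"
      by (simp add: conj_poisson_def diff_divide_distrib mult.commute)
    ultimately show ?thesis using True by (simp add: poisson_def mult.commute)
  next
    case False
    then have "\<bar>u\<bar> / (pi * (u\<^sup>2 + e\<^sup>2)) \<le> e / (pi * (u\<^sup>2 + e\<^sup>2))" using R by (intro divide_right_mono) auto
    then show ?thesis using False R by (simp add: conj_poisson_def poisson_def abs_mult)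
  qed
qed

text \<open>The difference \<open>d\<close> of the truncated and the conjugate Poisson kernel is odd
  and integrable, so it annihilates constants and f may be replaced by f - f x. As |d| is at most
  the Poisson kernel, the integral from \<open>poisson_point\<close> appears.\<close>

lemma truncated_hilbert_approx:
  assumes f: "cauchy_integrable f" and e: "0 < e"
  shows "norm (truncated_hilbert f x e - (LINT t|lborel. of_real (conj_poisson e (x - t)) * f t))
    \<le> (LINT t|lborel. poisson e (x - t) * norm (f t - f x))"
proof -
  have fm[measurable]: "f \<in> borel_measurable borel" using f by (simp add: cauchy_integrable_def)
  define k where "k = (\<lambda>u::real. if e < \<bar>u\<bar> then 1 / (pi * u) else 0)"
  have km[measurable]: "k \<in> borel_measurable borel" unfolding k_def by measurable
  define d where "d = (\<lambda>u. k u - conj_poisson e u)"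
  have dm[measurable]: "d \<in> borel_measurable borel" unfolding d_def by measurable
  have dP: "\<bar>d u\<bar> \<le> poisson e u" for u unfolding d_def k_def by (rule truncated_kernel_bound[OF e])
  have dodd: "d (- u) = - d u" for u by (simp add: d_def k_def conj_poisson_def)
  have id: "integrable lborel (\<lambda>t. d (x - t))"
  proof (rule Bochner_Integration.integrable_bound[OF integrable_poisson[OF e]])
    show "AE t in lborel. norm (d (x - t)) \<le> norm (poisson e (x - t))"
      by (intro AE_I2) (simp only: real_norm_def order_trans[OF dP abs_ge_self])
  qed measurable
  have intd: "(LINT t|lborel. d (x - t)) = 0"
  proof -
    have sh: "integral\<^sup>L lborel d = (LINT t|lborel. d (x - t))"
      using lborel_integral_real_affine[of "-1" d x] by simp
    have "integral\<^sup>L lborel d = (LINT t|lborel. d (- t))"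
      using lborel_integral_real_affine[of "-1" d 0] by simp
    also have "\<dots> = - integral\<^sup>L lborel d" unfolding dodd by simp
    finally show ?thesis using sh by simp
  qed
  have idf: "integrable lborel (\<lambda>t. of_real (d (x - t)) * f t)"
  proof (rule Bochner_Integration.integrable_bound[OF integrable_norm[OF integrable_poisson_cauchy[OF f e, of x]]])
    show "AE t in lborel. norm (complex_of_real (d (x - t)) * f t) \<le> norm (norm (poisson e (x - t) *\<^sub>R f t))"
    proof (rule AE_I2)
      fix t
      have "\<bar>d (x - t)\<bar> * norm (f t) \<le> poisson e (x - t) * norm (f t)" by (intro mult_right_mono dP) simp
      then show "norm (complex_of_real (d (x - t)) * f t) \<le> norm (norm (poisson e (x - t) *\<^sub>R f t))"
        using poisson_nonneg[of e "x - t"] e by (simp add: norm_mult)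
    qed
  qed measurable
  have s1: "(1::real) = 1 \<or> (1::real) = -1" by simp
  note iQ = cauchy_transform_split(2)[OF f s1 e, of x]
  have kd: "complex_of_real (k (x - t)) * f t = of_real (d (x - t)) * f t + of_real (conj_poisson e (x - t)) * f t" for t
    by (simp add: d_def left_diff_distrib)
  have "truncated_hilbert f x e = 1 / of_real pi * (LINT t|lborel. indicator {t. e < \<bar>x - t\<bar>} t *\<^sub>R (f t / of_real (x - t)))"
  proof -
    have "(LINT t|lebesgue. indicator {t. e < \<bar>x - t\<bar>} t *\<^sub>R (f t / of_real (x - t))) = (LINT t|lborel. indicator {t. e < \<bar>x - t\<bar>} t *\<^sub>R (f t / of_real (x - t)))"
      by (rule integral_completion) measurable
    then show ?thesis unfolding truncated_hilbert_def set_lebesgue_integral_def by (rule arg_cong)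
  qed
  also have "\<dots> = (LINT t|lborel. 1 / of_real pi * (indicator {t. e < \<bar>x - t\<bar>} t *\<^sub>R (f t / of_real (x - t))))"
    by (rule integral_mult_right_zero[symmetric])
  also have "\<dots> = (LINT t|lborel. of_real (k (x - t)) * f t)"
  proof (rule Bochner_Integration.integral_cong[OF refl])
    fix t
    show "1 / of_real pi * (indicator {t. e < \<bar>x - t\<bar>} t *\<^sub>R (f t / of_real (x - t))) = of_real (k (x - t)) * f t"
      by (cases "e < \<bar>x - t\<bar>") (simp_all add: k_def)
  qed
  also have "\<dots> = (LINT t|lborel. of_real (d (x - t)) * f t) + (LINT t|lborel. of_real (conj_poisson e (x - t)) * f t)"
    unfolding kd by (rule Bochner_Integration.integral_add[OF idf iQ])
  finally have "truncated_hilbert f x e - (LINT t|lborel. of_real (conj_poisson e (x - t)) * f t) = (LINT t|lborel. of_real (d (x - t)) * f t)"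
    by simp
  also have "\<dots> = (LINT t|lborel. of_real (d (x - t)) * f t) - (LINT t|lborel. of_real (d (x - t)) * f x)"
  proof -
    have "(LINT t|lborel. of_real (d (x - t)) * f x) = of_real (LINT t|lborel. d (x - t)) * f x" by simp
    then show ?thesis by (simp only: intd) simp
  qed
  also have "\<dots> = (LINT t|lborel. of_real (d (x - t)) * f t - of_real (d (x - t)) * f x)"
    by (rule Bochner_Integration.integral_diff[symmetric, OF idf]) (intro integrable_mult_left integrable_of_real id)
  also have "\<dots> = (LINT t|lborel. of_real (d (x - t)) * (f t - f x))" by (simp only: right_diff_distrib)
  also have "norm \<dots> \<le> (LINT t|lborel. norm (of_real (d (x - t)) * (f t - f x)))" by (rule integral_norm_bound)
  also have "\<dots> \<le> (LINT t|lborel. poisson e (x - t) * norm (f t - f x))"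
  proof (rule integral_mono)
    show i: "integrable lborel (\<lambda>t. poisson e (x - t) * norm (f t - f x))"
    proof -
      have "integrable lborel (\<lambda>t. poisson e (x - t) *\<^sub>R (f t - f x))"
        unfolding scaleR_diff_right
        by (rule Bochner_Integration.integrable_diff[OF integrable_poisson_cauchy[OF f e]]) (intro integrable_scaleR_left, use e in simp)
      from integrable_norm[OF this] show ?thesis using poisson_nonneg[of e] e by simp
    qed
    show le: "norm (of_real (d (x - t)) * (f t - f x)) \<le> poisson e (x - t) * norm (f t - f x)" for t
      unfolding norm_mult norm_of_real by (intro mult_right_mono dP) simp
    show "integrable lborel (\<lambda>t. norm (of_real (d (x - t)) * (f t - f x)))"
    proof (rule Bochner_Integration.integrable_bound[OF i])
      show "AE t in lborel. norm (norm (of_real (d (x - t)) * (f t - f x))) \<le> norm (poisson e (x - t) * norm (f t - f x))"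
      proof (rule AE_I2)
        fix t
        show "norm (norm (of_real (d (x - t)) * (f t - f x))) \<le> norm (poisson e (x - t) * norm (f t - f x))"
          using le[of t] by (simp only: real_norm_def abs_norm_cancel)
      qed
    qed measurable
  qed
  finally show ?thesis .
qed

text \<open>The vertical limit of the Cauchy transform exists a.e. and its Poisson part tends to f x
  / 2; hence the conjugate Poisson integral converges. At Poisson points the truncated Hilbert
  transform has the same limit, so existence of the principal value comes out as a
  consequence.\<close>

theorem cauchy_transform_boundary_values:
  assumes f: "cauchy_integrable f" and s: "s = 1 \<or> s = -1"
  shows "AE x in lborel. (truncated_hilbert f x \<longlongrightarrow> hilbert_transform f x) (at_right 0) \<and>
     ((\<lambda>y. cauchy_transform s f (Complex x y)) \<longlongrightarrow> f x / 2 + of_real s * (\<i> / 2) * hilbert_transform f x) (at 0 within {y. 0 < s * y})"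
  using AE_poisson_point[OF f] cauchy_transform_vertical_limit[OF f s]
proof eventually_elim
  case (elim x)
  then obtain l where l: "((\<lambda>y. cauchy_transform s f (Complex x (s * y))) \<longlongrightarrow> l) (at_right 0)" by (elim exE)
  define Q where "Q = (\<lambda>y. LINT t|lborel. complex_of_real (conj_poisson y (x - t)) * f t)"
  define c where "c = complex_of_real s * (\<i> / 2)"
  have c0: "c \<noteq> 0" using s by (auto simp: c_def)
  define q where "q = (l - f x / 2) / c"
  have P: "((\<lambda>y. poisson_integral y f x) \<longlongrightarrow> f x) (at_right 0)" by (rule poisson_integral_vertical_limit[OF f elim(1)])
  have Q: "(Q \<longlongrightarrow> q) (at_right 0)"
  proof (rule Lim_transform_eventually)
    show "((\<lambda>y. (cauchy_transform s f (Complex x (s * y)) - poisson_integral y f x / 2) / c) \<longlongrightarrow> q) (at_right 0)"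
      unfolding q_def by (intro tendsto_divide tendsto_diff l P tendsto_const c0) simp
    show "\<forall>\<^sub>F y in at_right 0. (cauchy_transform s f (Complex x (s * y)) - poisson_integral y f x / 2) / c = Q y"
      unfolding eventually_at_filter
    proof (intro always_eventually allI impI)
      fix y :: real assume "y \<in> {0<..}"
      then have y: "0 < y" by simp
      have "cauchy_transform s f (Complex x (s * y)) - poisson_integral y f x / 2 = c * Q y"
        unfolding cauchy_transform_split(1)[OF f s y] c_def Q_def by (rule add_diff_cancel_left')
      then show "(cauchy_transform s f (Complex x (s * y)) - poisson_integral y f x / 2) / c = Q y" using c0 by simp
    qed
  qed
  have "((\<lambda>y. truncated_hilbert f x y - Q y) \<longlongrightarrow> 0) (at_right 0)"
  proof (rule Lim_null_comparison[OF _ elim(1)[unfolded poisson_point_def]])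
    show "\<forall>\<^sub>F y in at_right 0. norm (truncated_hilbert f x y - Q y) \<le> (LINT t|lborel. poisson y (x - t) * norm (f t - f x))"
      unfolding eventually_at_filter Q_def
      by (intro always_eventually allI impI truncated_hilbert_approx[OF f]) simp
  qed
  from tendsto_add[OF this Q] have H: "(truncated_hilbert f x \<longlongrightarrow> q) (at_right 0)" by simp
  then have hq: "hilbert_transform f x = q" unfolding hilbert_transform_def by (intro tendsto_Lim) simp_all
  have lq: "l = f x / 2 + of_real s * (\<i> / 2) * hilbert_transform f x"
    unfolding hq q_def c_def[symmetric] using c0 by simp
  have fl: "filterlim (\<lambda>y. s * y) (at_right 0) (at 0 within {y. 0 < s * y})"
    unfolding filterlim_at
  proof
    show "\<forall>\<^sub>F y in at 0 within {y. 0 < s * y}. s * y \<in> {0<..} \<and> s * y \<noteq> 0"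
      unfolding eventually_at_filter by (intro always_eventually allI impI) (auto simp only: mem_Collect_eq greaterThan_iff less_imp_not_eq2)
    have "((\<lambda>y. s * y) \<longlongrightarrow> s * 0) (at 0 within {y. 0 < s * y})" by (intro tendsto_intros)
    then show "((\<lambda>y. s * y) \<longlongrightarrow> 0) (at 0 within {y. 0 < s * y})" by simp
  qed
  have sy: "s * (s * y) = y" for y using s by (elim disjE) simp_all
  have V: "((\<lambda>y. cauchy_transform s f (Complex x y)) \<longlongrightarrow> l) (at 0 within {y. 0 < s * y})"
    using filterlim_compose[OF l fl] unfolding sy .
  show ?case by (rule conjI[OF H[folded hq] V[unfolded lq]])
qed

section \<open>The theorem of M. Riesz\<close>

lemma riesz_constants:
  fixes p :: real
  assumes p: "1 < p" "p \<le> 2"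
  obtains a \<beta> where "0 \<le> a" "0 \<le> \<beta>" "\<And>\<theta>. \<bar>\<theta>\<bar> \<le> pi / 2 \<Longrightarrow> 1 \<le> a * (cos \<theta>) powr p - \<beta> * cos (p * \<theta>)"
proof -
  \<comment> \<open>The midpoint of pi / (2 p) and pi / 2. Beyond it p \<theta> lies in (pi/2, pi],
    because p <= 2, and the cosine of p \<theta> is negative; up to it cos \<theta> stays away from
    0.\<close>
  define \<theta>0 where "\<theta>0 = pi / 4 * (1 + 1 / p)"
  have p0: "0 < p" using p by simp
  have ip: "1 / p < 1" "0 < 1 / p" using p by (simp_all add: divide_less_eq)
  have t0: "0 < \<theta>0" "\<theta>0 < pi / 2"
    using ip pi_gt_zero mult_strict_left_mono[of "1 + 1 / p" 2 "pi / 4"] by (simp_all add: \<theta>0_def add_pos_pos)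
  have pt: "p * \<theta>0 = pi / 4 * (p + 1)" using p0 by (simp add: \<theta>0_def field_simps)
  have pt1: "pi / 2 < p * \<theta>0" using mult_strict_left_mono[of 2 "p + 1" "pi / 4"] p pi_gt_zero unfolding pt by simp
  have pt2: "p * \<theta>0 < pi" using mult_strict_left_mono[of "p + 1" 4 "pi / 4"] p pi_gt_zero unfolding pt by simp
  have cpt: "cos (p * \<theta>0) < 0"
  proof -
    have "cos (p * \<theta>0) < cos (pi / 2)" using pt1 pt2 by (intro cos_monotone_0_pi) auto
    then show ?thesis by simp
  qed
  have ct: "0 < cos \<theta>0" using t0 by (intro cos_gt_zero) auto
  \<comment> \<open>Normalized so that - \<beta> cos (p \<theta>) is at least 1 beyond
    \<open>\<theta>0\<close>; then \<open>a\<close> is taken large enough to outweigh the worst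
    value \<beta> of \<beta> cos (p \<theta>) up to \<open>\<theta>0\<close>.\<close>
  define \<beta> where "\<beta> = - 1 / cos (p * \<theta>0)"
  have \<beta>0: "0 < \<beta>" using cpt by (simp add: \<beta>_def zero_less_divide_iff)
  define a where "a = (1 + \<beta>) / (cos \<theta>0) powr p"
  have a0: "0 \<le> a" using \<beta>0 by (simp add: a_def)
  have main: "1 \<le> a * (cos \<theta>) powr p - \<beta> * cos (p * \<theta>)" if \<theta>: "0 \<le> \<theta>" "\<theta> \<le> pi / 2" for \<theta>
  proof (cases "\<theta> \<le> \<theta>0")
    case True
    have "cos \<theta>0 \<le> cos \<theta>" using True \<theta> t0 by (intro cos_monotone_0_pi_le) auto
    then have "(cos \<theta>0) powr p \<le> (cos \<theta>) powr p" using ct p0 by (intro powr_mono2) auto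
    then have "a * (cos \<theta>0) powr p \<le> a * (cos \<theta>) powr p" using a0 by (rule mult_left_mono)
    moreover have "a * (cos \<theta>0) powr p = 1 + \<beta>" using ct by (simp add: a_def)
    moreover have "\<beta> * cos (p * \<theta>) \<le> \<beta> * 1" using \<beta>0 by (intro mult_left_mono) auto
    ultimately show ?thesis by simp
  next
    case False
    then have "p * \<theta>0 \<le> p * \<theta>" using p0 by simp
    moreover have "p * \<theta> \<le> pi"
    proof -
      have "p * \<theta> \<le> 2 * (pi / 2)" using p \<theta> by (intro mult_mono) auto
      then show ?thesis by simp
    qed
    ultimately have "cos (p * \<theta>) \<le> cos (p * \<theta>0)" using pt1 pi_gt_zero by (intro cos_monotone_0_pi_le) auto
    then have "\<beta> * cos (p * \<theta>) \<le> \<beta> * cos (p * \<theta>0)" using \<beta>0 by (intro mult_left_mono) auto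
    moreover have "\<beta> * cos (p * \<theta>0) = - 1" using cpt by (simp add: \<beta>_def)
    moreover have "0 \<le> a * (cos \<theta>) powr p" using a0 by simp
    ultimately show ?thesis by simp
  qed
  show ?thesis
  proof (rule that[OF a0 less_imp_le[OF \<beta>0]])
    fix \<theta> :: real assume "\<bar>\<theta>\<bar> \<le> pi / 2"
    then have "1 \<le> a * (cos \<bar>\<theta>\<bar>) powr p - \<beta> * cos (p * \<bar>\<theta>\<bar>)" by (intro main) auto
    then show "1 \<le> a * (cos \<theta>) powr p - \<beta> * cos (p * \<theta>)" by (cases "0 \<le> \<theta>") simp_all
  qed
qed

text \<open>Homogeneity: for w = |w| exp (i \<theta>) with |\<theta>| < pi/2 the trigonometric
  inequality is multiplied by |w|^p. Its last term becomes the real part of a holomorphic power of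
  w, which can be integrated by Cauchy's theorem.\<close>

lemma riesz_pointwise:
  assumes w: "0 < Re w" and c: "\<And>\<theta>. \<bar>\<theta>\<bar> \<le> pi / 2 \<Longrightarrow> 1 \<le> a * (cos \<theta>) powr p - \<beta> * cos (p * \<theta>)"
  shows "norm w powr p \<le> a * (Re w) powr p - \<beta> * Re (exp (of_real p * Ln w))"
    and "norm (exp (of_real p * Ln w)) = norm w powr p"
proof -
  have w0: "w \<noteq> 0" using w by auto
  define \<theta> where "\<theta> = Im (Ln w)"
  have \<theta>: "\<bar>\<theta>\<bar> < pi / 2" unfolding \<theta>_def using Re_Ln_pos_lt[OF w0] w by simp
  have n: "norm w = exp (Re (Ln w))" using w0 by (simp add: Re_Ln)
  have np: "norm w powr p = exp (p * Re (Ln w))" unfolding n by (simp add: exp_powr_real mult.commute)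
  show e: "norm (exp (of_real p * Ln w)) = norm w powr p" unfolding np by simp
  have Rew: "Re w = norm w * cos \<theta>"
  proof -
    have "Re w = Re (exp (Ln w))" using w0 by simp
    also have "\<dots> = exp (Re (Ln w)) * cos (Im (Ln w))" by (rule Re_exp)
    finally show ?thesis by (simp only: n \<theta>_def)
  qed
  have Ree: "Re (exp (of_real p * Ln w)) = norm w powr p * cos (p * \<theta>)"
    unfolding np \<theta>_def by (simp add: Re_exp)
  have "norm w powr p * 1 \<le> norm w powr p * (a * (cos \<theta>) powr p - \<beta> * cos (p * \<theta>))"
    using c[of \<theta>] \<theta> by (intro mult_left_mono) auto
  also have "\<dots> = a * (norm w * cos \<theta>) powr p - \<beta> * (norm w powr p * cos (p * \<theta>))"
    by (simp add: powr_mult algebra_simps)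
  finally show "norm w powr p \<le> a * (Re w) powr p - \<beta> * Re (exp (of_real p * Ln w))"
    unfolding Ree Rew by simp
qed

text \<open>Compact support yields decay like 1/|x|, uniformly on lines of height at least c. For p
  > 1 the p-th power is thus known to be integrable before any norm inequality is available.\<close>

lemma cauchy_transform_compact_decay:
  fixes r :: "real \<Rightarrow> real"
  assumes rm[measurable]: "r \<in> borel_measurable borel" and r: "integrable lborel r" and supp: "\<And>t. T < \<bar>t\<bar> \<Longrightarrow> r t = 0" and T: "0 \<le> T"
    and s: "s = 1 \<or> s = -1" and c: "0 < c" "c \<le> y"
  shows "norm (2 * cauchy_transform s (\<lambda>t. complex_of_real (r t)) (Complex x (s * y))) \<le> (LINT t|lborel. \<bar>r t\<bar>) * (1 + (1 + T) / c) / (1 + \<bar>x\<bar>)"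
proof -
  let ?z = "Complex x (s * y)"
  let ?d = "(1 + (1 + T) / c) / (1 + \<bar>x\<bar>)"
  have ker: "norm (complex_of_real (r t) / (of_real t - ?z)) \<le> ?d * \<bar>r t\<bar>" for t
  proof (cases "T < \<bar>t\<bar>")
    case True then show ?thesis by (simp add: supp)
  next
    case False
    have yn: "c \<le> norm (of_real t - ?z)" using abs_Im_le_cmod[of "of_real t - ?z"] s c by (auto simp: abs_mult)
    have "1 + \<bar>x\<bar> \<le> \<bar>t - x\<bar> + (1 + T)" using False by linarith
    also have "\<dots> \<le> norm (of_real t - ?z) + (1 + T)" using abs_Re_le_cmod[of "of_real t - ?z"] by simp
    also have "\<dots> \<le> norm (of_real t - ?z) + (1 + T) * (norm (of_real t - ?z) / c)"
      using mult_left_mono[of 1 "norm (of_real t - ?z) / c" "1 + T"] yn c T by simp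
    also have "\<dots> = norm (of_real t - ?z) * (1 + (1 + T) / c)" by (simp add: algebra_simps)
    finally have le: "1 + \<bar>x\<bar> \<le> norm (of_real t - ?z) * (1 + (1 + T) / c)" .
    have "1 / n \<le> B / q" if "q \<le> n * B" "0 < n" "0 < q" for n B q :: real using that by (simp add: field_simps)
    from this[OF le less_le_trans[OF c(1) yn]] have "1 / norm (of_real t - ?z) \<le> ?d" by simp
    then have "\<bar>r t\<bar> * (1 / norm (of_real t - ?z)) \<le> \<bar>r t\<bar> * ?d" by (intro mult_left_mono) auto
    then show ?thesis by (simp add: norm_divide mult.commute)
  qed
  have "norm (LINT t|lborel. complex_of_real (r t) / (of_real t - ?z)) \<le> (LINT t|lborel. norm (complex_of_real (r t) / (of_real t - ?z)))"
    by (rule integral_norm_bound)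
  also have "\<dots> \<le> (LINT t|lborel. ?d * \<bar>r t\<bar>)"
  proof (rule integral_mono')
    show "integrable lborel (\<lambda>t. ?d * \<bar>r t\<bar>)" using r by (intro integrable_mult_right) simp
    show "0 \<le> ?d * \<bar>r t\<bar>" for t using T c by (intro mult_nonneg_nonneg divide_nonneg_pos) auto
  qed (rule ker)
  also have "\<dots> = (LINT t|lborel. \<bar>r t\<bar>) * (1 + (1 + T) / c) / (1 + \<bar>x\<bar>)" by simp
  finally have "norm (LINT t|lborel. complex_of_real (r t) / (of_real t - ?z)) \<le> (LINT t|lborel. \<bar>r t\<bar>) * (1 + (1 + T) / c) / (1 + \<bar>x\<bar>)" .
  moreover have "norm (2 * cauchy_transform s (\<lambda>t. complex_of_real (r t)) ?z) = 1 / pi * norm (LINT t|lborel. complex_of_real (r t) / (of_real t - ?z))"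
  proof -
    have "cauchy_transform s (\<lambda>t. complex_of_real (r t)) ?z = of_real s / (2 * of_real pi * \<i>) * (LINT t|lborel. complex_of_real (r t) / (of_real t - ?z))"
      by (rule cauchy_transform_lborel) measurable
    then show ?thesis using s by (auto simp: norm_mult norm_divide)
  qed
  moreover have "1 / pi * v \<le> v" if "0 \<le> v" for v
    using mult_right_mono[OF _ that, of "1 / pi" 1] pi_ge_two by simp
  ultimately show ?thesis by (simp only:) (rule order_trans, simp_all)
qed

text \<open>The pointwise inequality is integrated along a line with \<open>w = 2 * C r\<close>. The term with \<open>\<beta>\<close> drops
  out, because \<open>w\<close> to the power \<open>p\<close> is in \<open>H\<^sup>1\<close> and thus has integral zero there.\<close>

lemma riesz_nonneg_compact:
  fixes r :: "real \<Rightarrow> real"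
  assumes p: "1 < p" and ab: "0 \<le> a" "0 \<le> \<beta>"
    and c: "\<And>\<theta>. \<bar>\<theta>\<bar> \<le> pi / 2 \<Longrightarrow> 1 \<le> a * (cos \<theta>) powr p - \<beta> * cos (p * \<theta>)"
    and rm[measurable]: "r \<in> borel_measurable borel" and r0: "\<And>t. 0 \<le> r t" and ri: "integrable lborel r"
    and rp: "integrable lborel (\<lambda>t. r t powr p)" and supp: "\<And>t. T < \<bar>t\<bar> \<Longrightarrow> r t = 0" and T: "0 \<le> T"
    and s: "s = 1 \<or> s = -1" and y: "0 < y"
  shows "(\<integral>\<^sup>+x. ennreal (norm (2 * cauchy_transform s (\<lambda>t. complex_of_real (r t)) (Complex x (s * y))) powr p) \<partial>lborel) \<le> ennreal (a * (LINT t|lborel. r t powr p))"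
proof -
  define A where "A = (\<lambda>z. 2 * cauchy_transform s (\<lambda>t. complex_of_real (r t)) z)"
  have ci: "cauchy_integrable (\<lambda>t. complex_of_real (r t))"
    by (rule cauchy_integrable_Lp[of 1]) (use ri r0 in simp_all)
  have holA: "A holomorphic_on half_plane s" unfolding A_def by (intro holomorphic_intros holomorphic_cauchy_transform[OF ci])
  have ReA: "Re (A (Complex x (s * y))) = poisson_integral y r x" if "0 < y" for x y
    unfolding A_def by (rule Re_cauchy_transform_of_real[OF ci s that])
  have goal: "(\<integral>\<^sup>+x. ennreal (norm (A (Complex x (s * y))) powr p) \<partial>lborel) \<le> ennreal (a * (LINT t|lborel. r t powr p))"
  proof (cases "AE t in lborel. r t = 0")
    case True
    have "A z = 0" for z
    proof -
      have "(LINT t|lborel. complex_of_real (r t) / (of_real t - z)) = (LINT t::real|lborel. (0::complex))"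
        by (rule integral_cong_AE) (use True in \<open>auto elim: eventually_mono\<close>)
      moreover have "cauchy_transform s (\<lambda>t. complex_of_real (r t)) z = of_real s / (2 * of_real pi * \<i>) * (LINT t|lborel. complex_of_real (r t) / (of_real t - z))"
        by (rule cauchy_transform_lborel) measurable
      ultimately show ?thesis by (simp add: A_def)
    qed
    then show ?thesis by simp
  next
    case False
    \<comment> \<open>Unless \<open>r\<close> vanishes a.e., its Poisson integral is strictly
      positive. The values of \<open>A\<close> then lie in the right half-plane, where the principal
      logarithm is holomorphic.\<close>
    have pos: "0 < Re (A (Complex x (s * y)))" if y: "0 < y" for x y
    proof -
      have i: "integrable lborel (\<lambda>t. poisson y (x - t) * r t)" using integrable_poisson_bounded[OF y ri, of x] by simp
      have nn: "0 \<le> poisson_integral y r x"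
        unfolding poisson_integral_def using r0 poisson_nonneg[of y] y by (intro integral_nonneg_AE AE_I2) auto
      have "poisson_integral y r x \<noteq> 0"
      proof
        assume "poisson_integral y r x = 0"
        then have "(LINT t|lborel. poisson y (x - t) * r t) = 0" by (simp add: poisson_integral_def)
        moreover have "AE t in lborel. 0 \<le> poisson y (x - t) * r t" using r0 poisson_nonneg[of y] y by (intro AE_I2) auto
        ultimately have "AE t in lborel. poisson y (x - t) * r t = 0"
          using integral_nonneg_eq_0_iff_AE[OF i] by simp
        then have "AE t in lborel. r t = 0"
        proof eventually_elim
          case (elim t)
          then show ?case using poisson_pos[OF y, of "x - t"] by simp
        qed
        then show False using False by simp
      qed
      then show ?thesis unfolding ReA[OF y] using nn by simp
    qed
    define W where "W = (\<lambda>z. exp (of_real p * Ln (A z)))"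
    have posz: "0 < Re (A z)" if z: "z \<in> half_plane s" for z
    proof -
      obtain x' y' where "0 < y'" "z = Complex x' (s * y')" using half_plane_cases[OF z s] by blast
      then show ?thesis using pos by simp
    qed
    have holLn: "(\<lambda>z. Ln (A z)) holomorphic_on half_plane s"
    proof (rule holomorphic_on_Ln'[OF _ holA])
      show "A z \<notin> \<real>\<^sub>\<le>\<^sub>0" if "z \<in> half_plane s" for z
        using posz[OF that] by (auto simp: complex_nonpos_Reals_iff)
    qed
    have holW: "W holomorphic_on half_plane s"
      unfolding W_def by (intro holomorphic_intros holLn)
    have nW: "norm (W z) = norm (A z) powr p" if "z \<in> half_plane s" for z
      unfolding W_def by (rule riesz_pointwise(2)[OF posz[OF that] c])
    \<comment> \<open>The function is lifted by half the height: all its lines then lie at height at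
      least \<open>d\<close>, where a single decay bound holds, which puts the lifted
      \<open>W\<close> in H1. The line at height y is its line at height d.\<close>
    define d where "d = y / 2"
    have d: "0 < d" "d + d = y" using y by (simp_all add: d_def)
    define D where "D = (LINT t|lborel. \<bar>r t\<bar>) * (1 + (1 + T) / d)"
    have Ad: "norm (A (Complex x (s * v))) powr p \<le> D powr p * (1 + \<bar>x\<bar>) powr (- p)" if v: "d \<le> v" for x v
    proof -
      have "norm (A (Complex x (s * v))) \<le> D / (1 + \<bar>x\<bar>)"
        unfolding A_def D_def by (rule cauchy_transform_compact_decay[OF rm ri supp T s d(1) v])
      then have "norm (A (Complex x (s * v))) powr p \<le> (D / (1 + \<bar>x\<bar>)) powr p" using p by (intro powr_mono2) auto
      also have "\<dots> = D powr p * (1 + \<bar>x\<bar>) powr (- p)"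
        by (simp add: divide_inverse powr_mult inverse_powr powr_minus)
      finally show ?thesis .
    qed
    have ib: "integrable lborel (\<lambda>x. D powr p * (1 + \<bar>x\<bar>) powr (- p))"
      by (intro integrable_mult_right integrable_inverse_1_plus_abs_powr p)
    have inH: "Complex x (s * v) \<in> half_plane s" if "0 < v" for x v by (rule Complex_in_half_plane[OF s that])
    have iA: "integrable lborel (\<lambda>x. norm (A (Complex x (s * v))) powr p)" if v: "d \<le> v" for v
    proof (rule Bochner_Integration.integrable_bound[OF ib])
      have "(\<lambda>x. A (Complex x (s * v))) \<in> borel_measurable borel"
        by (rule borel_measurable_continuous_onI[OF continuous_on_line[OF holA s]]) (use d v in simp)
      then show "(\<lambda>x. norm (A (Complex x (s * v))) powr p) \<in> borel_measurable lborel" by measurable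
      show "AE x in lborel. norm (norm (A (Complex x (s * v))) powr p) \<le> norm (D powr p * (1 + \<bar>x\<bar>) powr (- p))"
        using Ad[OF v] by (intro AE_I2) simp
    qed
    have shiftC: "Complex x (s * v) + Complex 0 (s * d) = Complex x (s * (d + v))" for x v
      by (simp add: complex_eq_iff distrib_left)
    have "(\<lambda>z. W (z + Complex 0 (s * d))) \<in> hardy s 1"
    proof (rule hardyI[OF _ s])
      show "(\<lambda>z. W (z + Complex 0 (s * d))) holomorphic_on half_plane s"
      proof (rule holomorphic_on_compose_gen[OF _ holW, unfolded comp_def])
        show "(\<lambda>z. z + Complex 0 (s * d)) holomorphic_on half_plane s" by (intro holomorphic_intros)
        show "(\<lambda>z. z + Complex 0 (s * d)) ` half_plane s \<subseteq> half_plane s"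
        proof (rule image_subsetI)
          fix z assume z: "z \<in> half_plane s"
          obtain x' y' where xy: "0 < y'" "z = Complex x' (s * y')" using half_plane_cases[OF z s] by blast
          show "z + Complex 0 (s * d) \<in> half_plane s" unfolding xy(2) shiftC using xy(1) d(1) by (intro inH) simp
        qed
      qed
      fix v :: real assume v: "0 < v"
      have eq: "norm (W (Complex x (s * v) + Complex 0 (s * d))) powr 1 = norm (A (Complex x (s * (d + v)))) powr p" for x
        unfolding shiftC using nW[OF inH, of "d + v" x] v d(1) by simp
      show "integrable lborel (\<lambda>x. norm (W (Complex x (s * v) + Complex 0 (s * d))) powr 1)"
        unfolding eq using v by (intro iA) simp
      show "(LINT x|lborel. norm (W (Complex x (s * v) + Complex 0 (s * d))) powr 1) \<le> (LINT x|lborel. D powr p * (1 + \<bar>x\<bar>) powr (- p))"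
        unfolding eq using v by (intro integral_mono iA ib Ad) simp_all
    qed simp
    from hardy1_line_integral_0[OF this s d(1)]
    have W0: "(LINT x|lborel. W (Complex x (s * y))) = 0" unfolding shiftC d(2) .
    have dy: "d \<le> y" using y by (simp add: d_def)
    have iW: "integrable lborel (\<lambda>x. W (Complex x (s * y)))"
    proof (rule Bochner_Integration.integrable_bound[OF iA[OF dy]])
      show "(\<lambda>x. W (Complex x (s * y))) \<in> borel_measurable lborel"
        using borel_measurable_continuous_onI[OF continuous_on_line[OF holW s y]] by simp
      show "AE x in lborel. norm (W (Complex x (s * y))) \<le> norm (norm (A (Complex x (s * y))) powr p)"
        using nW[OF inH[OF y]] by (intro AE_I2) simp
    qed
    have rp': "integrable lborel (\<lambda>t. norm (r t) powr p)" using rp r0 by simp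
    have PP: "(poisson_integral y r x) powr p \<le> poisson_integral y (\<lambda>t. r t powr p) x" for x
      using norm_poisson_integral_powr_le[OF y less_imp_le[OF p] rm rp', of x] r0 pos[OF y, of x] unfolding ReA[OF y] by simp
    have Ph: "has_bochner_integral lborel (poisson_integral y (\<lambda>t. r t powr p)) (LINT t|lborel. r t powr p)"
      by (rule integrable_poisson_integral[OF y rp]) simp
    then have Pi: "integrable lborel (poisson_integral y (\<lambda>t. r t powr p))" "integral\<^sup>L lborel (poisson_integral y (\<lambda>t. r t powr p)) = (LINT t|lborel. r t powr p)"
      by (simp_all add: has_bochner_integral_iff)
    have "(LINT x|lborel. norm (A (Complex x (s * y))) powr p) \<le> (LINT x|lborel. a * poisson_integral y (\<lambda>t. r t powr p) x - \<beta> * Re (W (Complex x (s * y))))"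
    proof (rule integral_mono[OF iA[OF dy]])
      show "integrable lborel (\<lambda>x. a * poisson_integral y (\<lambda>t. r t powr p) x - \<beta> * Re (W (Complex x (s * y))))"
        by (intro Bochner_Integration.integrable_diff integrable_mult_right Pi(1) integrable_Re iW)
      fix x
      have "norm (A (Complex x (s * y))) powr p \<le> a * (Re (A (Complex x (s * y)))) powr p - \<beta> * Re (W (Complex x (s * y)))"
        unfolding W_def by (rule riesz_pointwise(1)[OF pos[OF y] c])
      also have "\<dots> \<le> a * poisson_integral y (\<lambda>t. r t powr p) x - \<beta> * Re (W (Complex x (s * y)))"
        unfolding ReA[OF y] by (intro diff_right_mono mult_left_mono PP ab)
      finally show "norm (A (Complex x (s * y))) powr p \<le> a * poisson_integral y (\<lambda>t. r t powr p) x - \<beta> * Re (W (Complex x (s * y)))" .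
    qed
    also have "\<dots> = (LINT x|lborel. a * poisson_integral y (\<lambda>t. r t powr p) x) - (LINT x|lborel. \<beta> * Re (W (Complex x (s * y))))"
      by (intro Bochner_Integration.integral_diff integrable_mult_right Pi(1) integrable_Re iW)
    also have "\<dots> = a * (LINT t|lborel. r t powr p) - \<beta> * Re (LINT x|lborel. W (Complex x (s * y)))"
      unfolding integral_mult_right_zero Pi(2) integral_Re[OF iW] ..
    finally have "(LINT x|lborel. norm (A (Complex x (s * y))) powr p) \<le> a * (LINT t|lborel. r t powr p)" unfolding W0 by simp
    then show ?thesis
      by (subst nn_integral_eq_integral[OF iA[OF dy]]) (auto intro: ennreal_leI)
  qed
  then show ?thesis by (simp only: A_def)
qed

lemma measurable_cauchy_transform_line:
  assumes "cauchy_integrable f" "s = 1 \<or> s = -1" "0 < y"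
  shows "(\<lambda>x. cauchy_transform s f (Complex x (s * y))) \<in> borel_measurable borel"
  by (rule borel_measurable_continuous_onI[OF continuous_on_line[OF holomorphic_cauchy_transform[OF assms(1)] assms(2,3)]])

lemma riesz_nonneg:
  fixes r :: "real \<Rightarrow> real"
  assumes p: "1 < p" and ab: "0 \<le> a" "0 \<le> \<beta>"
    and c: "\<And>\<theta>. \<bar>\<theta>\<bar> \<le> pi / 2 \<Longrightarrow> 1 \<le> a * (cos \<theta>) powr p - \<beta> * cos (p * \<theta>)"
    and rm[measurable]: "r \<in> borel_measurable borel" and r0: "\<And>t. 0 \<le> r t"
    and rp: "integrable lborel (\<lambda>t. r t powr p)"
    and s: "s = 1 \<or> s = -1" and y: "0 < y"
  shows "(\<integral>\<^sup>+x. ennreal (norm (2 * cauchy_transform s (\<lambda>t. complex_of_real (r t)) (Complex x (s * y))) powr p) \<partial>lborel) \<le> ennreal (a * (LINT t|lborel. r t powr p))"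
proof -
  \<comment> \<open>Cut off in height and in support, so that the compact case applies. The
    resulting bound is independent of the cut-off and passes to \<open>r\<close> by Fatou's
    lemma.\<close>
  define rn where "rn = (\<lambda>(n::nat) t. min (r t) n * indicator {- real n..real n} t)"
  have rnm[measurable]: "rn n \<in> borel_measurable borel" for n unfolding rn_def by measurable
  have rn0: "0 \<le> rn n t" and rnr: "rn n t \<le> r t" and rnn: "rn n t \<le> real n * indicator {- real n..real n} t" for n t
    using r0[of t] by (auto simp: rn_def indicator_def)
  have ci: "cauchy_integrable (\<lambda>t. complex_of_real (r t))"
    by (rule cauchy_integrable_Lp[of p]) (use p rp r0 in simp_all)
  have cin: "cauchy_integrable (\<lambda>t. complex_of_real (rn n t))" for n
    by (rule cauchy_integrable_le[OF ci]) (use rn0 rnr r0 in simp_all)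
  have rni: "integrable lborel (rn n)" for n
  proof (rule Bochner_Integration.integrable_bound[of lborel "\<lambda>t. real n * indicator {- real n..real n} t"])
    show "AE t in lborel. norm (rn n t) \<le> norm (real n * indicator {- real n..real n} t)"
      using rn0[of n] rnn[of n] by (intro AE_I2) (simp add: order_trans[OF _ abs_ge_self])
  qed (auto intro!: integrable_mult_right)
  have rnp: "rn n t powr p \<le> r t powr p" for n t using rn0 rnr p by (intro powr_mono2) auto
  have rnpi: "integrable lborel (\<lambda>t. rn n t powr p)" for n
    by (rule Bochner_Integration.integrable_bound[OF rp]) (use rnp in auto)
  define A where "A = (\<lambda>r' x. norm (2 * cauchy_transform s (\<lambda>t. complex_of_real (r' t)) (Complex x (s * y))) powr p)"
  have An: "(\<integral>\<^sup>+x. ennreal (A (rn n) x) \<partial>lborel) \<le> ennreal (a * (LINT t|lborel. r t powr p))" for n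
  proof -
    have "(\<integral>\<^sup>+x. ennreal (A (rn n) x) \<partial>lborel) \<le> ennreal (a * (LINT t|lborel. rn n t powr p))"
      unfolding A_def
      by (rule riesz_nonneg_compact[OF p ab c rnm rn0 rni rnpi, where T="real n"]) (use s y in \<open>auto simp: rn_def indicator_def\<close>)
    also have "\<dots> \<le> ennreal (a * (LINT t|lborel. r t powr p))"
      by (intro ennreal_leI mult_left_mono integral_mono rnpi rp rnp ab)
    finally show ?thesis .
  qed
  have lim: "(\<lambda>n. A (rn n) x) \<longlonglongrightarrow> A r x" for x
  proof -
    let ?z = "Complex x (s * y)"
    have z: "Im ?z \<noteq> 0" using s y by auto
    have "(\<lambda>n. LINT t|lborel. complex_of_real (rn n t) / (of_real t - ?z)) \<longlonglongrightarrow> (LINT t|lborel. complex_of_real (r t) / (of_real t - ?z))"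
    proof (rule integral_dominated_convergence[where w="\<lambda>t. norm (complex_of_real (r t) / (of_real t - ?z))"])
      show "integrable lborel (\<lambda>t. norm (complex_of_real (r t) / (of_real t - ?z)))"
        by (rule integrable_norm[OF integrable_Cauchy_kernel[OF ci z]])
      show "AE t in lborel. (\<lambda>n. complex_of_real (rn n t) / (of_real t - ?z)) \<longlonglongrightarrow> complex_of_real (r t) / (of_real t - ?z)"
      proof (rule AE_I2)
        fix t
        obtain m :: nat where m: "\<bar>t\<bar> + r t \<le> real m" using real_arch_simple by blast
        have "\<forall>\<^sub>F n in sequentially. rn n t = r t"
          unfolding eventually_sequentially
        proof (intro exI[of _ m] allI impI)
          fix n assume "m \<le> n"
          then have n: "\<bar>t\<bar> + r t \<le> real n" using m by (meson of_nat_mono order_trans)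
          have "r t \<le> real n" "t \<in> {- real n..real n}" using n r0[of t] by auto
          then show "rn n t = r t" by (simp add: rn_def)
        qed
        then have "\<forall>\<^sub>F n in sequentially. complex_of_real (rn n t) / (of_real t - ?z) = complex_of_real (r t) / (of_real t - ?z)"
          by (rule eventually_mono) simp
        then show "(\<lambda>n. complex_of_real (rn n t) / (of_real t - ?z)) \<longlonglongrightarrow> complex_of_real (r t) / (of_real t - ?z)"
          by (rule tendsto_eventually)
      qed
      show "AE t in lborel. norm (complex_of_real (rn n t) / (of_real t - ?z)) \<le> norm (complex_of_real (r t) / (of_real t - ?z))" for n
        using rn0[of n] rnr[of n] r0 by (intro AE_I2) (simp add: norm_divide divide_right_mono)
    qed measurable
    then have "(\<lambda>n. cauchy_transform s (\<lambda>t. complex_of_real (rn n t)) ?z) \<longlonglongrightarrow> cauchy_transform s (\<lambda>t. complex_of_real (r t)) ?z"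
      using cin ci unfolding cauchy_integrable_def by (simp only: cauchy_transform_lborel) (intro tendsto_mult_left)
    then show ?thesis unfolding A_def
      by (intro tendsto_powr' tendsto_norm tendsto_mult tendsto_const) (use p in auto)
  qed
  have Am: "A (rn n) \<in> borel_measurable borel" for n
    unfolding A_def using measurable_cauchy_transform_line[OF cin s y] by measurable
  have "(\<integral>\<^sup>+x. ennreal (A r x) \<partial>lborel) = (\<integral>\<^sup>+x. liminf (\<lambda>n. ennreal (A (rn n) x)) \<partial>lborel)"
  proof (rule nn_integral_cong)
    fix x
    have "(\<lambda>n. ennreal (A (rn n) x)) \<longlonglongrightarrow> ennreal (A r x)" by (intro tendsto_ennrealI lim)
    then show "ennreal (A r x) = liminf (\<lambda>n. ennreal (A (rn n) x))" by (intro lim_imp_Liminf[symmetric]) simp_all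
  qed
  also have "\<dots> \<le> liminf (\<lambda>n. \<integral>\<^sup>+x. ennreal (A (rn n) x) \<partial>lborel)"
    by (rule nn_integral_liminf) (use Am in measurable)
  also have "\<dots> \<le> ennreal (a * (LINT t|lborel. r t powr p))"
    by (rule Liminf_le) (use An in \<open>auto intro: always_eventually\<close>)
  finally show ?thesis by (simp only: A_def)
qed

text \<open>One constant serves both half-planes and all heights, as the supremum in the Hardy norm
  demands. The extended nonnegative integral lets the inequality assert finiteness instead of
  presupposing it.\<close>

definition riesz_bound :: "real \<Rightarrow> real \<Rightarrow> bool" where
  "riesz_bound p K \<longleftrightarrow> (\<forall>s f y. (s = 1 \<or> s = -1) \<longrightarrow> f \<in> borel_measurable borel \<longrightarrow> integrable lborel (\<lambda>t. norm (f t) powr p) \<longrightarrow> 0 < y \<longrightarrow>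
     (\<integral>\<^sup>+x. ennreal (norm (cauchy_transform s f (Complex x (s * y))) powr p) \<partial>lborel) \<le> ennreal (K * (LINT t|lborel. norm (f t) powr p)))"

lemma powr_add_le:
  fixes u v p :: real
  assumes "0 \<le> u" "0 \<le> v" "0 < p" shows "(u + v) powr p \<le> 2 powr p * (u powr p + v powr p)"
proof -
  have "(u + v) powr p \<le> (2 * max u v) powr p" using assms by (intro powr_mono2) auto
  also have "\<dots> = 2 powr p * (max u v) powr p" by (rule powr_mult)
  also have "\<dots> \<le> 2 powr p * (u powr p + v powr p)" by (intro mult_left_mono) (auto simp: max_def)
  finally show ?thesis .
qed

text \<open>Joins positive and negative parts with c = -1, and real and imaginary parts with c =
  i.\<close>

lemma nn_integral_cauchy_transform_add:
  assumes f: "cauchy_integrable f" and g: "cauchy_integrable g" and c: "norm c = 1" and s: "s = 1 \<or> s = -1" and y: "0 < y" and p: "0 < p"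
    and E: "(\<integral>\<^sup>+x. ennreal (norm (cauchy_transform s f (Complex x (s * y))) powr p) \<partial>lborel) \<le> ennreal E"
      "(\<integral>\<^sup>+x. ennreal (norm (cauchy_transform s g (Complex x (s * y))) powr p) \<partial>lborel) \<le> ennreal E" and E0: "0 \<le> E"
  shows "(\<integral>\<^sup>+x. ennreal (norm (cauchy_transform s (\<lambda>t. f t + c * g t) (Complex x (s * y))) powr p) \<partial>lborel) \<le> ennreal (2 powr p * 2 * E)"
proof -
  let ?f = "\<lambda>x. ennreal (norm (cauchy_transform s f (Complex x (s * y))) powr p)"
  let ?g = "\<lambda>x. ennreal (norm (cauchy_transform s g (Complex x (s * y))) powr p)"
  have [measurable]: "?f \<in> borel_measurable lborel" "?g \<in> borel_measurable lborel"
    using measurable_cauchy_transform_line[OF f s y] measurable_cauchy_transform_line[OF g s y] by measurable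
  have "(\<integral>\<^sup>+x. ennreal (norm (cauchy_transform s (\<lambda>t. f t + c * g t) (Complex x (s * y))) powr p) \<partial>lborel) \<le> (\<integral>\<^sup>+x. ennreal (2 powr p) * (?f x + ?g x) \<partial>lborel)"
  proof (rule nn_integral_mono)
    fix x
    have z: "Im (Complex x (s * y)) \<noteq> 0" using s y by auto
    have "norm (cauchy_transform s (\<lambda>t. f t + c * g t) (Complex x (s * y))) \<le> norm (cauchy_transform s f (Complex x (s * y))) + norm (cauchy_transform s g (Complex x (s * y)))"
      unfolding cauchy_transform_linear[OF f g z] by (rule order_trans[OF norm_triangle_ineq]) (simp add: norm_mult c)
    then have "norm (cauchy_transform s (\<lambda>t. f t + c * g t) (Complex x (s * y))) powr p \<le> (norm (cauchy_transform s f (Complex x (s * y))) + norm (cauchy_transform s g (Complex x (s * y)))) powr p"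
      using p by (intro powr_mono2) auto
    also have "\<dots> \<le> 2 powr p * (norm (cauchy_transform s f (Complex x (s * y))) powr p + norm (cauchy_transform s g (Complex x (s * y))) powr p)"
      by (rule powr_add_le) (use p in auto)
    finally show "ennreal (norm (cauchy_transform s (\<lambda>t. f t + c * g t) (Complex x (s * y))) powr p) \<le> ennreal (2 powr p) * (?f x + ?g x)"
      by (simp add: ennreal_mult[symmetric] ennreal_plus[symmetric] ennreal_leI del: ennreal_plus)
  qed
  also have "\<dots> = ennreal (2 powr p) * (\<integral>\<^sup>+x. ?f x + ?g x \<partial>lborel)" by (rule nn_integral_cmult) measurable
  also have "(\<integral>\<^sup>+x. ?f x + ?g x \<partial>lborel) = (\<integral>\<^sup>+x. ?f x \<partial>lborel) + (\<integral>\<^sup>+x. ?g x \<partial>lborel)" by (rule nn_integral_add) measurable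
  also have "ennreal (2 powr p) * ((\<integral>\<^sup>+x. ?f x \<partial>lborel) + (\<integral>\<^sup>+x. ?g x \<partial>lborel)) \<le> ennreal (2 powr p) * (ennreal E + ennreal E)"
    by (intro mult_left_mono add_mono E) simp
  also have "\<dots> = ennreal (2 powr p * 2 * E)"
    using E0 by (simp add: ennreal_plus[symmetric] ennreal_mult[symmetric] del: ennreal_plus)
  finally show ?thesis .
qed

lemma riesz_le_2:
  assumes p: "1 < p" "p \<le> 2" obtains K where "0 \<le> K" "riesz_bound p K"
proof -
  obtain a \<beta> where ab: "0 \<le> a" "0 \<le> \<beta>" and c: "\<And>\<theta>. \<bar>\<theta>\<bar> \<le> pi / 2 \<Longrightarrow> 1 \<le> a * (cos \<theta>) powr p - \<beta> * cos (p * \<theta>)"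
    by (rule riesz_constants[OF p]) (rule that, assumption+)
  \<comment> \<open>The splittings into real and imaginary parts and into positive and negative
    parts cost a factor 2^p 2 each.\<close>
  have "riesz_bound p (2 powr p * 2 * (2 powr p * 2 * a))"
    unfolding riesz_bound_def
  proof (intro allI impI)
    fix s y :: real and f :: "real \<Rightarrow> complex"
    assume s: "s = 1 \<or> s = -1" and fm[measurable]: "f \<in> borel_measurable borel" and fp: "integrable lborel (\<lambda>t. norm (f t) powr p)" and y: "0 < y"
    define I where "I = (LINT t|lborel. norm (f t) powr p)"
    have I0: "0 \<le> I" unfolding I_def by (intro integral_nonneg_AE) auto
    have ci: "cauchy_integrable f" by (rule cauchy_integrable_Lp[OF less_imp_le[OF p(1)] fm fp])
    have nonneg: "(\<integral>\<^sup>+x. ennreal (norm (cauchy_transform s (\<lambda>t. complex_of_real (r t)) (Complex x (s * y))) powr p) \<partial>lborel) \<le> ennreal (a * I)"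
      if rm[measurable]: "r \<in> borel_measurable borel" and r0: "\<And>t. 0 \<le> r t" and rf: "\<And>t. r t \<le> norm (f t)" for r :: "real \<Rightarrow> real"
    proof -
      have le: "r t powr p \<le> norm (f t) powr p" for t using r0 rf p by (intro powr_mono2) auto
      have rp: "integrable lborel (\<lambda>t. r t powr p)"
        by (rule Bochner_Integration.integrable_bound[OF fp]) (use le in auto)
      have "(\<integral>\<^sup>+x. ennreal (norm (cauchy_transform s (\<lambda>t. complex_of_real (r t)) (Complex x (s * y))) powr p) \<partial>lborel)
        \<le> (\<integral>\<^sup>+x. ennreal (norm (2 * cauchy_transform s (\<lambda>t. complex_of_real (r t)) (Complex x (s * y))) powr p) \<partial>lborel)"
        using p by (intro nn_integral_mono ennreal_leI powr_mono2) (auto simp: norm_mult)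
      also have "\<dots> \<le> ennreal (a * (LINT t|lborel. r t powr p))" by (rule riesz_nonneg[OF p(1) ab c rm r0 rp s y])
      also have "\<dots> \<le> ennreal (a * I)" unfolding I_def by (intro ennreal_leI mult_left_mono integral_mono rp fp le ab)
      finally show ?thesis .
    qed
    have real: "(\<integral>\<^sup>+x. ennreal (norm (cauchy_transform s (\<lambda>t. complex_of_real (r t)) (Complex x (s * y))) powr p) \<partial>lborel) \<le> ennreal (2 powr p * 2 * (a * I))"
      if rm[measurable]: "r \<in> borel_measurable borel" and rf: "\<And>t. \<bar>r t\<bar> \<le> norm (f t)" for r :: "real \<Rightarrow> real"
    proof -
      have rle: "r t \<le> norm (f t)" "- r t \<le> norm (f t)" for t using rf[of t] by auto
      have m: "0 \<le> max 0 (r t)" "0 \<le> max 0 (- r t)" "max 0 (r t) \<le> norm (f t)" "max 0 (- r t) \<le> norm (f t)" for t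
        using rle[of t] by simp_all
      have c1: "cauchy_integrable (\<lambda>t. complex_of_real (max 0 (r t)))" "cauchy_integrable (\<lambda>t. complex_of_real (max 0 (- r t)))"
        by (rule cauchy_integrable_le[OF ci]; use m in simp)+
      have dec: "complex_of_real (r t) = complex_of_real (max 0 (r t)) + (-1) * complex_of_real (max 0 (- r t))" for t
        by (simp add: max_def)
      show ?thesis
        unfolding dec
        by (rule nn_integral_cauchy_transform_add[OF c1 _ s y]) (use p ab I0 nonneg[OF _ m(1,3)] nonneg[OF _ m(2,4)] in simp_all)
    qed
    have c2: "cauchy_integrable (\<lambda>t. complex_of_real (Re (f t)))" "cauchy_integrable (\<lambda>t. complex_of_real (Im (f t)))"
      by (rule cauchy_integrable_le[OF ci]; simp add: abs_Re_le_cmod abs_Im_le_cmod)+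
    have dec: "f = (\<lambda>t. complex_of_real (Re (f t)) + \<i> * complex_of_real (Im (f t)))" by (rule ext) (rule complex_eq)
    have "(\<integral>\<^sup>+x. ennreal (norm (cauchy_transform s (\<lambda>t. complex_of_real (Re (f t)) + \<i> * complex_of_real (Im (f t))) (Complex x (s * y))) powr p) \<partial>lborel) \<le> ennreal (2 powr p * 2 * (2 powr p * 2 * (a * I)))"
      by (rule nn_integral_cauchy_transform_add[OF c2 _ s y])
        (use p ab I0 real[OF _ abs_Re_le_cmod] real[OF _ abs_Im_le_cmod] in simp_all)
    then show "(\<integral>\<^sup>+x. ennreal (norm (cauchy_transform s f (Complex x (s * y))) powr p) \<partial>lborel) \<le> ennreal (2 powr p * 2 * (2 powr p * 2 * a) * (LINT t|lborel. norm (f t) powr p))"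
      unfolding dec[symmetric] I_def by (simp only: mult.assoc)
  qed
  then show ?thesis using that[of "2 powr p * 2 * (2 powr p * 2 * a)"] ab by simp
qed

section \<open>Exponents above 2 by duality\<close>

lemma integrable_product:
  fixes h k :: "real \<Rightarrow> real"
  assumes h: "integrable lborel h" and k: "integrable lborel k"
  shows "integrable (lborel \<Otimes>\<^sub>M lborel) (\<lambda>(x, t). h x * k t)"
proof (rule lborel_pair.Fubini_integrable)
  have [measurable]: "h \<in> borel_measurable lborel" "k \<in> borel_measurable lborel" using h k by auto
  show "(\<lambda>(x, t). h x * k t) \<in> borel_measurable (lborel \<Otimes>\<^sub>M lborel)" by measurable
  have "(\<lambda>x. LINT t|lborel. norm (case (x, t) of (x, t) \<Rightarrow> h x * k t)) = (\<lambda>x. \<bar>h x\<bar> * (LINT t|lborel. \<bar>k t\<bar>))"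
    by (simp add: abs_mult)
  then show "integrable lborel (\<lambda>x. LINT t|lborel. norm (case (x, t) of (x, t) \<Rightarrow> h x * k t))"
    using h by simp
  show "AE x in lborel. integrable lborel (\<lambda>t. case (x, t) of (x, t) \<Rightarrow> h x * k t)"
    using k by simp
qed

text \<open>The kernel is antisymmetric up to reflection: t - (x + i s y) = - (x - (t - i s y)), and
  replacing s by -s absorbs the sign. The bounded support of \<open>g\<close> gives a majorant of
  product form, so Fubini's theorem applies.\<close>

lemma cauchy_transform_duality:
  assumes f: "cauchy_integrable f" and g: "integrable lborel g" and supp: "\<And>x. R < \<bar>x\<bar> \<Longrightarrow> g x = 0"
    and s: "s = 1 \<or> s = -1" and y: "0 < y" and R: "0 \<le> R"
  shows "(LINT x|lborel. cauchy_transform s f (Complex x (s * y)) * g x) = (LINT t|lborel. f t * cauchy_transform (- s) g (Complex t (- s * y)))"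
proof -
  have fm[measurable]: "f \<in> borel_measurable borel" using f by (simp add: cauchy_integrable_def)
  have gm[measurable]: "g \<in> borel_measurable borel" using g by auto
  define \<Phi> where "\<Phi> = (\<lambda>x t. f t * g x / (of_real t - (of_real x + \<i> * of_real (s * y))))"
  define C where "C = 1 + (1 + (R + y)) / y"
  have Cz: "of_real x + \<i> * of_real (s * y) = Complex x (s * y)" for x by (simp only: Complex_eq)
  have bound: "norm (\<Phi> x t) \<le> (C * norm (g x)) * (norm (f t) / (1 + \<bar>t\<bar>))" for x t
  proof (cases "R < \<bar>x\<bar>")
    case True then show ?thesis by (simp add: \<Phi>_def supp)
  next
    case False
    have im: "\<bar>Im (Complex x (s * y))\<bar> = y" using s y by (auto simp: abs_mult)
    have nz: "norm (Complex x (s * y)) \<le> R + y"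
      using cmod_le[of "Complex x (s * y)"] False im by simp
    have "norm (1 / (of_real t - Complex x (s * y))) \<le> (1 + (1 + norm (Complex x (s * y))) / \<bar>Im (Complex x (s * y))\<bar>) / (1 + \<bar>t\<bar>)"
      by (rule Cauchy_kernel_weight) (use im y in auto)
    also have "\<dots> \<le> C / (1 + \<bar>t\<bar>)"
      unfolding C_def im using nz y by (intro divide_right_mono add_left_mono) auto
    finally have k: "norm (1 / (of_real t - Complex x (s * y))) \<le> C / (1 + \<bar>t\<bar>)" .
    have "norm (\<Phi> x t) = norm (f t) * norm (g x) * norm (1 / (of_real t - Complex x (s * y)))"
      by (simp add: \<Phi>_def Cz[symmetric] norm_mult norm_divide)
    also have "\<dots> \<le> norm (f t) * norm (g x) * (C / (1 + \<bar>t\<bar>))" by (intro mult_left_mono k) simp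
    also have "\<dots> = (C * norm (g x)) * (norm (f t) / (1 + \<bar>t\<bar>))" by simp
    finally show ?thesis .
  qed
  have int: "integrable (lborel \<Otimes>\<^sub>M lborel) (\<lambda>(x, t). \<Phi> x t)"
  proof (rule Bochner_Integration.integrable_bound)
    show "integrable (lborel \<Otimes>\<^sub>M lborel) (\<lambda>(x, t). (C * norm (g x)) * (norm (f t) / (1 + \<bar>t\<bar>)))"
      using g f unfolding cauchy_integrable_def by (intro integrable_product integrable_mult_right integrable_norm) auto
    have "borel_measurable (lborel \<Otimes>\<^sub>M lborel :: (real \<times> real) measure) = (borel_measurable (borel \<Otimes>\<^sub>M borel) :: (real \<times> real \<Rightarrow> complex) set)"
      by (rule measurable_cong_sets) (auto intro: sets_pair_measure_cong)
    moreover have "(\<lambda>(x, t). \<Phi> x t) \<in> borel_measurable (borel \<Otimes>\<^sub>M borel)" unfolding \<Phi>_def by measurable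
    ultimately show "(\<lambda>(x, t). \<Phi> x t) \<in> borel_measurable (lborel \<Otimes>\<^sub>M lborel)" by simp
    show "AE z in lborel \<Otimes>\<^sub>M lborel. norm (case z of (x, t) \<Rightarrow> \<Phi> x t) \<le> norm (case z of (x, t) \<Rightarrow> (C * norm (g x)) * (norm (f t) / (1 + \<bar>t\<bar>)))"
    proof (rule AE_I2)
      fix z :: "real \<times> real"
      show "norm (case z of (x, t) \<Rightarrow> \<Phi> x t) \<le> norm (case z of (x, t) \<Rightarrow> (C * norm (g x)) * (norm (f t) / (1 + \<bar>t\<bar>)))"
        using bound[of "fst z" "snd z"] by (simp only: case_prod_beta real_norm_def order_trans[OF _ abs_ge_self])
    qed
  qed
  define \<kappa> where "\<kappa> = complex_of_real s / (2 * of_real pi * \<i>)"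
  have \<kappa>': "complex_of_real (- s) / (2 * of_real pi * \<i>) = - \<kappa>" by (simp add: \<kappa>_def)
  have L: "cauchy_transform s f (Complex x (s * y)) * g x = \<kappa> * (LINT t|lborel. \<Phi> x t)" for x
  proof -
    have "(LINT t|lborel. \<Phi> x t) = (LINT t|lborel. f t / (of_real t - Complex x (s * y)) * g x)"
      by (rule Bochner_Integration.integral_cong[OF refl]) (simp only: \<Phi>_def Cz times_divide_eq_left)
    also have "\<dots> = (LINT t|lborel. f t / (of_real t - Complex x (s * y))) * g x" by (rule integral_mult_left_zero)
    finally show ?thesis unfolding cauchy_transform_lborel[OF fm] \<kappa>_def[symmetric] by (simp only: mult.assoc)
  qed
  have Rr: "f t * cauchy_transform (- s) g (Complex t (- s * y)) = \<kappa> * (LINT x|lborel. \<Phi> x t)" for t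
  proof -
    have ker: "of_real t - Complex x (s * y) = - (of_real x - Complex t (- s * y))" for x by (simp add: complex_eq_iff)
    have "(LINT x|lborel. \<Phi> x t) = (LINT x|lborel. (- f t) * (g x / (of_real x - Complex t (- s * y))))"
    proof (rule Bochner_Integration.integral_cong[OF refl])
      fix x
      have "u * v / (- w) = (- u) * (v / w)" for u v w :: complex by simp
      then show "\<Phi> x t = (- f t) * (g x / (of_real x - Complex t (- s * y)))"
        unfolding \<Phi>_def Cz ker .
    qed
    also have "\<dots> = (- f t) * (LINT x|lborel. g x / (of_real x - Complex t (- s * y)))" by (rule integral_mult_right_zero)
    finally show ?thesis unfolding cauchy_transform_lborel[OF gm] \<kappa>' by simp
  qed
  have "(LINT x|lborel. LINT t|lborel. \<Phi> x t) = (LINT t|lborel. LINT x|lborel. \<Phi> x t)"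
    by (rule lborel_pair.Fubini_integral[symmetric, OF int])
  then show ?thesis unfolding L Rr integral_mult_right_zero by simp
qed

text \<open>Duality with the conjugate exponent, applied on a bounded interval where the left-hand side is
  known to be finite, so that half of it can be absorbed.\<close>

lemma riesz_ge_2:
  assumes p: "2 < p" obtains K where "0 \<le> K" "riesz_bound p K"
proof -
  define q where "q = p / (p - 1)"
  have q: "1 < q" "q \<le> 2" "1 / p + 1 / q = 1" "(p - 1) * q = p" "0 < q"
    using p by (auto simp: q_def field_simps)
  obtain Kq where Kq0: "0 \<le> Kq" and Kq: "riesz_bound q Kq" by (rule riesz_le_2[OF q(1,2)]) (rule that)
  \<comment> \<open>The weight in Young's inequality is chosen so that the dual term carries the
    factor 1 / (2 Kq + 1). After the bound with \<open>Kq\<close> its share is at most half of the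
    left-hand side.\<close>
  define \<mu> where "\<mu> = (2 * Kq + 1) powr (1 / q)"
  have \<mu>0: "0 < \<mu>" using Kq0 by (simp add: \<mu>_def)
  have \<mu>q: "\<mu> powr q = 2 * Kq + 1" using Kq0 q by (simp add: \<mu>_def powr_powr)
  have young: "u * v \<le> \<mu> powr p * u powr p + v powr q / (2 * Kq + 1)" if "0 \<le> u" "0 \<le> v" for u v
  proof -
    have "u * v = (\<mu> * u) * (v / \<mu>)" using \<mu>0 by simp
    also have "\<dots> \<le> (\<mu> * u) powr p / p + (v / \<mu>) powr q / q"
      by (rule Youngs_inequality) (use p q \<mu>0 that in auto)
    also have "\<dots> \<le> (\<mu> * u) powr p + (v / \<mu>) powr q"
      using p q by (intro add_mono) (auto simp: divide_le_eq mult_le_cancel_left1)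
    also have "\<dots> = \<mu> powr p * u powr p + v powr q / (2 * Kq + 1)"
      by (simp add: powr_mult powr_divide \<mu>q)
    finally show ?thesis .
  qed
  have "riesz_bound p (2 * \<mu> powr p)"
    unfolding riesz_bound_def
  proof (intro allI impI)
    fix s y :: real and f :: "real \<Rightarrow> complex"
    assume s: "s = 1 \<or> s = -1" and fm[measurable]: "f \<in> borel_measurable borel" and fp: "integrable lborel (\<lambda>t. norm (f t) powr p)" and y: "0 < y"
    have s': "- s = 1 \<or> - s = -1" using s by auto
    define I where "I = (LINT t|lborel. norm (f t) powr p)"
    have I0: "0 \<le> I" unfolding I_def by (intro integral_nonneg_AE) auto
    have ci: "cauchy_integrable f" by (rule cauchy_integrable_Lp[OF _ fm fp]) (use p in simp)
    define h where "h = (\<lambda>x. cauchy_transform s f (Complex x (s * y)))"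
    have hc: "continuous_on UNIV h" unfolding h_def by (rule continuous_on_line[OF holomorphic_cauchy_transform[OF ci] s y])
    have hm[measurable]: "h \<in> borel_measurable borel" by (rule borel_measurable_continuous_onI[OF hc])
    have hpi: "set_integrable lborel {- R..R} (\<lambda>x. norm (h x) powr r)" if "0 < r" for R r :: real
      by (intro borel_integrable_atLeastAtMost' continuous_on_powr' continuous_on_norm continuous_on_subset[OF hc] continuous_on_const) (use that in auto)
    have J: "(\<integral>\<^sup>+x. ennreal (indicator {- R..R} x * norm (h x) powr p) \<partial>lborel) \<le> ennreal (2 * \<mu> powr p * I)" if R: "0 \<le> R" for R
    proof -
      \<comment> \<open>The extremal function of the duality, restricted to [-R, R]: there h g =
        |h|^p, and |g|^q = |h|^p because (p - 1) q = p. Continuity of \<open>h\<close> makes these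
        integrals finite.\<close>
      define g where "g = (\<lambda>x. indicator {- R..R} x *\<^sub>R (cnj (h x) * of_real (norm (h x) powr (p - 2))))"
      have gm[measurable]: "g \<in> borel_measurable borel"
      proof -
        have [measurable]: "(\<lambda>x. cnj (h x)) \<in> borel_measurable borel"
          by (rule borel_measurable_continuous_onI[OF continuous_on_cnj[OF hc]])
        show ?thesis unfolding g_def by measurable
      qed
      have ng: "norm (g x) = indicator {- R..R} x * norm (h x) powr (p - 1)" for x
      proof -
        have "norm (h x) * norm (h x) powr (p - 2) = norm (h x) powr (p - 1)"
          using powr_mult_base[of "norm (h x)" "p - 2"] by simp
        then show ?thesis by (simp add: g_def norm_mult)
      qed
      have hg: "h x * g x = of_real (indicator {- R..R} x * norm (h x) powr p)" for x
      proof -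
        have e: "(norm (h x))\<^sup>2 * norm (h x) powr (p - 2) = norm (h x) powr p"
        proof (cases "h x = 0")
          case False
          then have "norm (h x) powr 2 * norm (h x) powr (p - 2) = norm (h x) powr (2 + (p - 2))"
            by (simp only: powr_add)
          then show ?thesis by simp
        qed simp
        have "h x * cnj (h x) = of_real ((norm (h x))\<^sup>2)" by (rule complex_norm_square[symmetric])
        then have "h x * (cnj (h x) * of_real (norm (h x) powr (p - 2))) = of_real ((norm (h x))\<^sup>2 * norm (h x) powr (p - 2))"
          by (simp only: mult.assoc[symmetric] of_real_mult)
        then have "h x * (cnj (h x) * of_real (norm (h x) powr (p - 2))) = of_real (norm (h x) powr p)" unfolding e .
        then show ?thesis unfolding g_def by (cases "x \<in> {- R..R}") simp_all
      qed
      have gi: "integrable lborel g"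
      proof -
        have "integrable lborel (\<lambda>x. indicator {- R..R} x * norm (h x) powr (p - 1))"
          using hpi[of "p - 1" R] p by (simp add: set_integrable_def)
        then have "integrable lborel (\<lambda>x. norm (g x))" unfolding ng .
        then show ?thesis using gm by (simp add: integrable_norm_iff)
      qed
      have gq: "norm (g x) powr q = indicator {- R..R} x * norm (h x) powr p" for x
        unfolding ng by (cases "x \<in> {- R..R}") (simp_all add: powr_powr q)
      have ihp: "integrable lborel (\<lambda>x. indicator {- R..R} x * norm (h x) powr p)"
        using hpi[of p R] p by (simp add: set_integrable_def)
      define j where "j = (LINT x|lborel. indicator {- R..R} x * norm (h x) powr p)"
      have j0: "0 \<le> j" unfolding j_def by (intro integral_nonneg_AE) auto
      have gqi: "integrable lborel (\<lambda>x. norm (g x) powr q)" unfolding gq by (rule ihp)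
      have gci: "cauchy_integrable g" by (rule cauchy_integrable_Lp[OF less_imp_le[OF q(1)] gm gqi])
      define G where "G = (\<lambda>t. cauchy_transform (- s) g (Complex t (- s * y)))"
      have Gm[measurable]: "G \<in> borel_measurable borel" unfolding G_def by (rule measurable_cauchy_transform_line[OF gci s' y])
      have Gb: "(\<integral>\<^sup>+t. ennreal (norm (G t) powr q) \<partial>lborel) \<le> ennreal (Kq * j)"
        using Kq s' gm gqi y unfolding riesz_bound_def G_def j_def gq[symmetric] by blast
      have "complex_of_real j = (LINT x|lborel. h x * g x)" unfolding j_def hg by (rule integral_of_real[OF ihp, symmetric])
      also have "\<dots> = (LINT t|lborel. f t * G t)"
        unfolding h_def G_def by (rule cauchy_transform_duality[OF ci gi _ s y R]) (auto simp: g_def indicator_def)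
      finally have jfG: "complex_of_real j = (LINT t|lborel. f t * G t)" .
      have "ennreal j = ennreal (norm (complex_of_real j))" using j0 by simp
      also have "\<dots> \<le> (\<integral>\<^sup>+t. ennreal (norm (f t * G t)) \<partial>lborel)"
      proof (cases "integrable lborel (\<lambda>t. f t * G t)")
        case True
        then show ?thesis unfolding jfG by (rule integral_norm_bound_ennreal)
      next
        \<comment> \<open>Without integrability the Bochner integral is 0 by convention, so that j =
          0 and the estimate is trivial.\<close>
        case False
        then show ?thesis unfolding jfG by (simp add: not_integrable_integral_eq)
      qed
      also have "\<dots> \<le> (\<integral>\<^sup>+t. ennreal (\<mu> powr p * norm (f t) powr p) + ennreal (1 / (2 * Kq + 1)) * ennreal (norm (G t) powr q) \<partial>lborel)"
      proof (rule nn_integral_mono)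
        fix t
        have "norm (f t * G t) \<le> \<mu> powr p * norm (f t) powr p + 1 / (2 * Kq + 1) * norm (G t) powr q"
          using young[of "norm (f t)" "norm (G t)"] by (simp add: norm_mult)
        then show "ennreal (norm (f t * G t)) \<le> ennreal (\<mu> powr p * norm (f t) powr p) + ennreal (1 / (2 * Kq + 1)) * ennreal (norm (G t) powr q)"
          using Kq0 by (simp add: ennreal_mult[symmetric] ennreal_plus[symmetric] ennreal_leI del: ennreal_plus)
      qed
      also have "\<dots> = (\<integral>\<^sup>+t. ennreal (\<mu> powr p * norm (f t) powr p) \<partial>lborel) + (\<integral>\<^sup>+t. ennreal (1 / (2 * Kq + 1)) * ennreal (norm (G t) powr q) \<partial>lborel)"
        by (rule nn_integral_add) measurable
      also have "(\<integral>\<^sup>+t. ennreal (1 / (2 * Kq + 1)) * ennreal (norm (G t) powr q) \<partial>lborel) = ennreal (1 / (2 * Kq + 1)) * (\<integral>\<^sup>+t. ennreal (norm (G t) powr q) \<partial>lborel)"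
        by (rule nn_integral_cmult) measurable
      also have "(\<integral>\<^sup>+t. ennreal (\<mu> powr p * norm (f t) powr p) \<partial>lborel) = ennreal (\<mu> powr p * I)"
      proof -
        have "(\<integral>\<^sup>+t. ennreal (\<mu> powr p * norm (f t) powr p) \<partial>lborel) = ennreal (LINT t|lborel. \<mu> powr p * norm (f t) powr p)"
          by (rule nn_integral_eq_integral[OF integrable_mult_right[OF fp]]) simp
        then show ?thesis unfolding I_def by simp
      qed
      also have "ennreal (\<mu> powr p * I) + ennreal (1 / (2 * Kq + 1)) * (\<integral>\<^sup>+t. ennreal (norm (G t) powr q) \<partial>lborel) \<le> ennreal (\<mu> powr p * I) + ennreal (1 / (2 * Kq + 1)) * ennreal (Kq * j)"
        by (intro add_left_mono mult_left_mono Gb) simp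
      also have "\<dots> = ennreal (\<mu> powr p * I + 1 / (2 * Kq + 1) * (Kq * j))"
        using Kq0 j0 I0 by (simp add: ennreal_mult[symmetric] ennreal_plus[symmetric] del: ennreal_plus)
      finally have le: "j \<le> \<mu> powr p * I + 1 / (2 * Kq + 1) * (Kq * j)"
        using Kq0 j0 I0 by (subst (asm) ennreal_le_iff) auto
      have "1 / (2 * Kq + 1) * (Kq * j) \<le> j / 2"
        using Kq0 j0 by (simp add: divide_le_eq add_pos_nonneg algebra_simps)
      then have "j \<le> \<mu> powr p * I + j / 2" using le by (rule order_trans[OF _ add_left_mono, rotated])
      then have "j \<le> 2 * \<mu> powr p * I" by simp
      moreover have "(\<integral>\<^sup>+x. ennreal (indicator {- R..R} x * norm (h x) powr p) \<partial>lborel) = ennreal j"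
        unfolding j_def by (rule nn_integral_eq_integral[OF ihp]) simp
      ultimately show ?thesis by (simp add: ennreal_leI)
    qed
    have "(\<integral>\<^sup>+x. ennreal (norm (h x) powr p) \<partial>lborel) = (\<integral>\<^sup>+x. liminf (\<lambda>n. ennreal (indicator {- real n..real n} x * norm (h x) powr p)) \<partial>lborel)"
    proof (rule nn_integral_cong)
      fix x
      obtain m :: nat where m: "\<bar>x\<bar> \<le> real m" using real_arch_simple by blast
      have "\<forall>\<^sub>F n in sequentially. ennreal (indicator {- real n..real n} x * norm (h x) powr p) = ennreal (norm (h x) powr p)"
        unfolding eventually_sequentially
      proof (intro exI[of _ m] allI impI)
        fix n assume "m \<le> n"
        then have "\<bar>x\<bar> \<le> real n" using m by (meson of_nat_mono order_trans)
        then have "x \<in> {- real n..real n}" by auto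
        then show "ennreal (indicator {- real n..real n} x * norm (h x) powr p) = ennreal (norm (h x) powr p)" by simp
      qed
      then have "(\<lambda>n. ennreal (indicator {- real n..real n} x * norm (h x) powr p)) \<longlonglongrightarrow> ennreal (norm (h x) powr p)"
        by (rule tendsto_eventually)
      then show "ennreal (norm (h x) powr p) = liminf (\<lambda>n. ennreal (indicator {- real n..real n} x * norm (h x) powr p))"
        by (intro lim_imp_Liminf[symmetric]) simp_all
    qed
    also have "\<dots> \<le> liminf (\<lambda>n. \<integral>\<^sup>+x. ennreal (indicator {- real n..real n} x * norm (h x) powr p) \<partial>lborel)"
      by (rule nn_integral_liminf) measurable
    also have "\<dots> \<le> ennreal (2 * \<mu> powr p * I)"
      by (rule Liminf_le) (use J in \<open>auto intro: always_eventually\<close>)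
    finally show "(\<integral>\<^sup>+x. ennreal (norm (cauchy_transform s f (Complex x (s * y))) powr p) \<partial>lborel) \<le> ennreal (2 * \<mu> powr p * (LINT t|lborel. norm (f t) powr p))"
      by (simp only: h_def I_def)
  qed
  then show ?thesis using that[of "2 * \<mu> powr p"] by simp
qed

theorem cauchy_transform_in_hardy:
  assumes p: "1 < p" and s: "s = 1 \<or> s = -1" and fm: "f \<in> borel_measurable borel" and fp: "integrable lborel (\<lambda>t. norm (f t) powr p)"
  shows "cauchy_transform s f \<in> hardy s p"
proof -
  obtain K where K0: "0 \<le> K" and K: "riesz_bound p K"
  proof (cases "p \<le> 2")
    case True
    show ?thesis by (rule riesz_le_2[OF p True]) (rule that)
  next
    case False
    then have "2 < p" by simp
    then show ?thesis by (rule riesz_ge_2) (rule that)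
  qed
  have ci: "cauchy_integrable f" by (rule cauchy_integrable_Lp[OF less_imp_le[OF p] fm fp])
  define I where "I = (LINT t|lborel. norm (f t) powr p)"
  have I0: "0 \<le> I" unfolding I_def by (intro integral_nonneg_AE) auto
  have m: "(\<lambda>x. norm (cauchy_transform s f (Complex x (s * y))) powr p) \<in> borel_measurable lborel" if "0 < y" for y
    using measurable_cauchy_transform_line[OF ci s that] by measurable
  have b: "(\<integral>\<^sup>+x. ennreal (norm (cauchy_transform s f (Complex x (s * y))) powr p) \<partial>lborel) \<le> ennreal (K * I)" if "0 < y" for y
    using K s fm fp that unfolding riesz_bound_def I_def by blast
  have i: "integrable lborel (\<lambda>x. norm (cauchy_transform s f (Complex x (s * y))) powr p)" if y: "0 < y" for y
  proof (rule integrableI_bounded[OF m[OF y]])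
    show "(\<integral>\<^sup>+x. ennreal (norm (norm (cauchy_transform s f (Complex x (s * y))) powr p)) \<partial>lborel) < \<infinity>"
      using b[OF y] by (simp add: le_less_trans)
  qed
  show ?thesis
  proof (rule hardyI[OF holomorphic_cauchy_transform[OF ci] s less_imp_le[OF p] i])
    fix y :: real assume y: "0 < y"
    have "ennreal (LINT x|lborel. norm (cauchy_transform s f (Complex x (s * y))) powr p) \<le> ennreal (K * I)"
      using b[OF y] nn_integral_eq_integral[OF i[OF y]] by simp
    then show "(LINT x|lborel. norm (cauchy_transform s f (Complex x (s * y))) powr p) \<le> K * I"
      using K0 I0 by (subst (asm) ennreal_le_iff) auto
  qed
qed

section \<open>Test functions\<close>

lemma tendsto_poly_times_exp: "((\<lambda>u. poly P u * exp (- u)) \<longlongrightarrow> 0) at_top" for P :: "real poly"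
proof -
  have "((\<lambda>u. \<Sum>i\<le>degree P. coeff P i * (u ^ i / exp u)) \<longlongrightarrow> (\<Sum>i\<le>degree P. coeff P i * 0)) at_top"
    by (intro tendsto_intros tendsto_power_div_exp_0)
  moreover have "(\<Sum>i\<le>degree P. coeff P i * (u ^ i / exp u)) = poly P u * exp (- u)" for u
    by (simp add: poly_altdef sum_distrib_right exp_minus divide_inverse mult.assoc)
  ultimately show ?thesis by simp
qed

text \<open>A family closed under differentiation: with u = 1/x the derivative replaces P by u^2 (P
  - P'), and \<open>[:0, 0, 1:]\<close> is the factor u^2. At 0 all these functions are flat because
  exp (-u) beats every polynomial in u.\<close>

definition flat :: "real poly \<Rightarrow> real \<Rightarrow> real" where
  "flat P x = (if 0 < x then poly P (1 / x) * exp (- (1 / x)) else 0)"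

lemma has_field_derivative_flat:
  "(flat P has_field_derivative flat ([:0, 0, 1:] * (P - pderiv P)) x) (at x)"
proof -
  consider "0 < x" | "x < 0" | "x = 0" by linarith
  then show ?thesis
  proof cases
    case 1
    have "((\<lambda>x. poly P (1 / x) * exp (- (1 / x))) has_field_derivative flat ([:0, 0, 1:] * (P - pderiv P)) x) (at x)"
      using 1 by (auto intro!: derivative_eq_intros simp: flat_def field_simps power2_eq_square)
    then show ?thesis
      by (rule has_field_derivative_transform_within_open[of _ _ _ "{0<..}"]) (use 1 in \<open>auto simp: flat_def\<close>)
  next
    case 2
    have "((\<lambda>x. 0) has_field_derivative flat ([:0, 0, 1:] * (P - pderiv P)) x) (at x)"
      using 2 by (simp add: flat_def)
    then show ?thesis
      by (rule has_field_derivative_transform_within_open[of _ _ _ "{..<0}"]) (use 2 in \<open>auto simp: flat_def\<close>)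
  next
    case 3
    have "((\<lambda>h. flat P h / h) \<longlongrightarrow> 0) (at_left 0)"
      by (rule tendsto_eventually) (auto simp: eventually_at_filter flat_def)
    moreover have "((\<lambda>h. flat P h / h) \<longlongrightarrow> 0) (at_right 0)"
    proof -
      \<comment> \<open>Division by h raises the degree in 1/h by one, which is the effect of
        \<open>pCons 0\<close>.\<close>
      have "((\<lambda>h. poly (pCons 0 P) (inverse h) * exp (- inverse h)) \<longlongrightarrow> 0) (at_right (0::real))"
        by (rule filterlim_compose[OF tendsto_poly_times_exp filterlim_inverse_at_top_right])
      then show ?thesis
        by (rule Lim_transform_eventually) (auto simp: eventually_at_filter flat_def divide_inverse)
    qed
    ultimately have "((\<lambda>h. flat P h / h) \<longlongrightarrow> 0) (at 0)" by (simp add: filterlim_split_at)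
    then show ?thesis using 3 by (simp add: has_field_derivative_iff flat_def)
  qed
qed

text \<open>A class closed under differentiation that contains the cut-off Cauchy kernels; membership gives
  smoothness without a Leibniz formula for higher derivatives.\<close>

inductive_set smooth_class :: "(real \<Rightarrow> real) set" where
  const: "(\<lambda>_. c) \<in> smooth_class"
| flat: "flat P \<in> smooth_class"
| kernel: "Im z \<noteq> 0 \<Longrightarrow> (\<lambda>t. Re (c * inverse (of_real t - z) ^ k)) \<in> smooth_class"
| add: "f \<in> smooth_class \<Longrightarrow> g \<in> smooth_class \<Longrightarrow> (\<lambda>t. f t + g t) \<in> smooth_class"
| mult: "f \<in> smooth_class \<Longrightarrow> g \<in> smooth_class \<Longrightarrow> (\<lambda>t. f t * g t) \<in> smooth_class"
| affine: "f \<in> smooth_class \<Longrightarrow> (\<lambda>t. f (a * t + b)) \<in> smooth_class"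

lemma of_real_minus_nonzero: "Im z \<noteq> 0 \<Longrightarrow> of_real t - z \<noteq> 0"
  by (metis Im_complex_of_real eq_iff_diff_eq_0)

lemma has_field_derivative_Re_kernel:
  assumes z: "Im z \<noteq> 0"
  shows "((\<lambda>t. Re (c * inverse (of_real t - z) ^ k)) has_field_derivative
      Re ((- of_nat k * c) * inverse (of_real t - z) ^ Suc k)) (at t)"
proof -
  have nz: "of_real t - z \<noteq> 0" by (rule of_real_minus_nonzero[OF z])
  have i: "((\<lambda>w. inverse (w - z)) has_field_derivative - (inverse (of_real t - z) * 1 * inverse (of_real t - z))) (at (of_real t))"
    by (rule DERIV_inverse'; (rule nz)?) (auto intro!: derivative_eq_intros)
  have "((\<lambda>w. c * inverse (w - z) ^ k) has_field_derivative (- of_nat k * c) * inverse (of_real t - z) ^ Suc k) (at (of_real t))"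
  proof (rule DERIV_cong[OF DERIV_cmult[OF DERIV_power[OF i]]])
    \<comment> \<open>For k = 0 the truncated exponent \<open>k - Suc 0\<close> is harmless, since
      it comes with the coefficient 0.\<close>
    have "c * (of_nat k * (- (u * 1 * u) * u ^ (k - Suc 0))) = (- of_nat k * c) * u ^ Suc k" for u :: complex
      by (cases k) (simp_all add: algebra_simps)
    then show "c * (of_nat k * (- (inverse (of_real t - z) * 1 * inverse (of_real t - z)) * inverse (of_real t - z) ^ (k - Suc 0)))
        = (- of_nat k * c) * inverse (of_real t - z) ^ Suc k" .
  qed
  then have "((\<lambda>w. c * inverse (w - z) ^ k) \<circ> of_real has_vector_derivative 1 * ((- of_nat k * c) * inverse (of_real t - z) ^ Suc k)) (at t)"
    by (intro field_vector_diff_chain_at) (auto intro!: has_vector_derivative_of_real derivative_eq_intros)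
  from bounded_linear.has_vector_derivative[OF bounded_linear_Re this]
  have "((\<lambda>t. Re (c * inverse (of_real t - z) ^ k)) has_vector_derivative
      Re ((- of_nat k * c) * inverse (of_real t - z) ^ Suc k)) (at t)"
    by (simp only: o_def mult_1)
  then show ?thesis by (simp only: has_real_derivative_iff_has_vector_derivative)
qed

lemma smooth_class_has_derivative:
  "f \<in> smooth_class \<Longrightarrow> \<exists>f'\<in>smooth_class. \<forall>x. (f has_field_derivative f' x) (at x)"
proof (induction rule: smooth_class.induct)
  case (const c)
  show ?case by (rule bexI[OF _ smooth_class.const[of 0]]) simp
next
  case (flat P)
  show ?case by (rule bexI[OF _ smooth_class.flat[of "[:0, 0, 1:] * (P - pderiv P)"]]) (intro allI has_field_derivative_flat)
next
  case (kernel z c k)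
  show ?case by (rule bexI[OF _ smooth_class.kernel[OF kernel, of "- of_nat k * c" "Suc k"]]) (intro allI has_field_derivative_Re_kernel kernel)
next
  case (add f g)
  then obtain f' g' where "f' \<in> smooth_class" "g' \<in> smooth_class"
    "\<And>x. (f has_field_derivative f' x) (at x)" "\<And>x. (g has_field_derivative g' x) (at x)" by auto
  then show ?case by (intro bexI[of _ "\<lambda>t. f' t + g' t"] allI DERIV_add smooth_class.add)
next
  case (mult f g)
  then obtain f' g' where "f' \<in> smooth_class" "g' \<in> smooth_class"
    "\<And>x. (f has_field_derivative f' x) (at x)" "\<And>x. (g has_field_derivative g' x) (at x)" by auto
  then show ?case using mult
    by (intro bexI[of _ "\<lambda>t. f' t * g t + g' t * f t"] allI DERIV_mult smooth_class.add smooth_class.mult)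
next
  case (affine f a b)
  then obtain f' where f': "f' \<in> smooth_class" "\<And>x. (f has_field_derivative f' x) (at x)" by auto
  have "((\<lambda>t. f (a * t + b)) has_field_derivative f' (a * t + b) * a) (at t)" for t
  proof (rule DERIV_chain2[OF f'(2)])
    show "((\<lambda>t. a * t + b) has_field_derivative a) (at t)" by (auto intro!: derivative_eq_intros)
  qed
  then show ?case
    by (intro bexI[OF _ smooth_class.mult[OF smooth_class.affine[OF f'(1), of a b] smooth_class.const[of a]]] allI)
qed

lemma smooth_class_deriv:
  assumes "f \<in> smooth_class"
  shows "(f has_field_derivative deriv f x) (at x)" and "deriv f \<in> smooth_class"
proof -
  obtain f' where f': "f' \<in> smooth_class" "\<And>x. (f has_field_derivative f' x) (at x)"
    using smooth_class_has_derivative[OF assms] by auto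
  have "deriv f = f'" using DERIV_imp_deriv[OF f'(2)] by auto
  then show "(f has_field_derivative deriv f x) (at x)" "deriv f \<in> smooth_class" using f' by auto
qed

lemma smooth_class_smooth: "f \<in> smooth_class \<Longrightarrow> (deriv ^^ k) f field_differentiable (at x)"
proof -
  assume f: "f \<in> smooth_class"
  have "(deriv ^^ k) f \<in> smooth_class" using f by (induction k) (auto intro: smooth_class_deriv)
  from smooth_class_deriv(1)[OF this] show ?thesis unfolding field_differentiable_def by blast
qed

text \<open>The two flat factors vanish for t <= -1 and for t >= 1; at 0 each equals exp (-1), which
  \<open>exp 2\<close> compensates. The arguments are spelled as a * t + b to match the rule
  \<open>affine\<close>.\<close>

definition bump :: "real \<Rightarrow> real" where
  "bump t = flat [:1:] (1 * t + 1) * flat [:1:] ((- 1) * t + 1) * exp 2"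

lemma bump_smooth: "bump \<in> smooth_class"
  unfolding bump_def[abs_def] by (rule smooth_class.mult[OF smooth_class.mult[OF smooth_class.affine[OF smooth_class.flat]
      smooth_class.affine[OF smooth_class.flat]] smooth_class.const])

lemma bump_0: "bump 0 = 1"
  by (simp add: bump_def flat_def exp_add[symmetric])

lemma bump_support: "1 \<le> \<bar>t\<bar> \<Longrightarrow> bump t = 0"
  by (auto simp: bump_def flat_def)

lemma deriv_bump_support: "1 < \<bar>t\<bar> \<Longrightarrow> deriv bump t = 0"
proof -
  assume t: "1 < \<bar>t\<bar>"
  have "((\<lambda>_. 0) has_field_derivative 0) (at t)" by simp
  then have "(bump has_field_derivative 0) (at t)"
    by (rule has_field_derivative_transform_within_open[of _ _ _ "{t. 1 < \<bar>t\<bar>}"])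
       (use t in \<open>auto simp: bump_support intro!: open_Collect_less continuous_intros\<close>)
  then show ?thesis by (rule DERIV_imp_deriv)
qed

lemma bounded_compact_support:
  fixes h :: "real \<Rightarrow> real"
  assumes h: "continuous_on UNIV h" and supp: "\<And>t. R < \<bar>t\<bar> \<Longrightarrow> h t = 0"
  obtains M where "0 \<le> M" "\<And>t. \<bar>h t\<bar> \<le> M"
proof -
  have "compact (h ` {- R..R})" by (intro compact_continuous_image continuous_on_subset[OF h]) auto
  then have "bounded (h ` {- R..R})" by (rule compact_imp_bounded)
  then obtain M where M: "\<forall>u\<in>h ` {- R..R}. \<bar>u\<bar> \<le> M" unfolding bounded_iff by auto
  have "\<bar>h t\<bar> \<le> max M 0" for t
  proof (cases "R < \<bar>t\<bar>")
    case False
    then have "t \<in> {- R..R}" by auto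
    then show ?thesis using M by (auto intro: max.coboundedI1)
  qed (simp add: supp)
  then show ?thesis by (intro that[of "max M 0"]) auto
qed

lemma bump_bounds:
  obtains M where "0 \<le> M" "\<And>t. \<bar>bump t\<bar> \<le> M" "\<And>t. \<bar>deriv bump t\<bar> \<le> M"
proof -
  have c: "continuous_on UNIV f" if "f \<in> smooth_class" for f
    using smooth_class_deriv(1)[OF that] by (rule DERIV_continuous_on[OF has_field_derivative_at_within])
  obtain A where A: "0 \<le> A" "\<And>t. \<bar>bump t\<bar> \<le> A"
    by (rule bounded_compact_support[OF c[OF bump_smooth], of 1]) (auto simp: bump_support)
  obtain B where B: "0 \<le> B" "\<And>t. \<bar>deriv bump t\<bar> \<le> B"
    by (rule bounded_compact_support[OF c[OF smooth_class_deriv(2)[OF bump_smooth]], of 1]) (auto simp: deriv_bump_support)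
  show ?thesis by (rule that[of "max A B"]) (use A B in \<open>simp_all add: le_max_iff_disj\<close>)
qed

section \<open>Supports, derivatives and bounds of test functions\<close>

lemma test_function_deriv:
  assumes "test_function \<phi>" shows "test_function (deriv \<phi>)"
proof -
  have d: "(deriv ^^ k) \<phi> field_differentiable (at x)" for k x using assms unfolding test_function_def by simp
  have "(deriv ^^ k) (deriv \<phi>) field_differentiable (at x)" for k x
    using d[of "Suc k" x] by (simp only: funpow_Suc_right o_apply)
  moreover have "{x. deriv \<phi> x \<noteq> 0} \<subseteq> closure {x. \<phi> x \<noteq> 0}"
  proof (rule ccontr)
    assume "\<not> ?thesis"
    then obtain x where x: "deriv \<phi> x \<noteq> 0" "x \<in> - closure {x. \<phi> x \<noteq> 0}" by auto
    have "((\<lambda>_. 0) has_field_derivative 0) (at x)" by simp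
    then have "(\<phi> has_field_derivative 0) (at x)"
      by (rule has_field_derivative_transform_within_open[of _ _ _ "- closure {x. \<phi> x \<noteq> 0}"])
         (use x(2) closure_subset[of "{x. \<phi> x \<noteq> 0}"] in \<open>auto simp: open_Compl\<close>)
    then show False using x(1) DERIV_imp_deriv by blast
  qed
  then have "closure {x. deriv \<phi> x \<noteq> 0} \<subseteq> closure {x. \<phi> x \<noteq> 0}" by (rule closure_minimal) simp
  then have "compact (closure {x. deriv \<phi> x \<noteq> 0})"
    using compact_Int_closed[OF assms[unfolded test_function_def, THEN conjunct2] closed_closure[of "{x. deriv \<phi> x \<noteq> 0}"]]
    by (simp add: Int_absorb1)
  ultimately show ?thesis unfolding test_function_def by blast
qed

lemma test_function_higher_deriv: "test_function \<phi> \<Longrightarrow> test_function ((deriv ^^ k) \<phi>)"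
  by (induction k) (auto intro: test_function_deriv)

lemma test_functionD:
  assumes "test_function \<phi>"
  shows "(\<phi> has_field_derivative deriv \<phi> x) (at x)" "continuous_on UNIV \<phi>" "\<exists>R\<ge>0. \<forall>x. R < \<bar>x\<bar> \<longrightarrow> \<phi> x = 0"
proof -
  have "\<forall>k x. (deriv ^^ k) \<phi> field_differentiable (at x)" using assms unfolding test_function_def by (rule conjunct1)
  then have "(deriv ^^ 0) \<phi> field_differentiable (at x)" for x by (simp only: simp_thms)
  then show d: "(\<phi> has_field_derivative deriv \<phi> x) (at x)" for x by (simp add: DERIV_deriv_iff_field_differentiable)
  show "continuous_on UNIV \<phi>" by (rule DERIV_continuous_on[OF has_field_derivative_at_within[OF d]])
  have "bounded (closure {x. \<phi> x \<noteq> 0})"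
    by (rule compact_imp_bounded[OF assms[unfolded test_function_def, THEN conjunct2]])
  then have "\<exists>R>0. \<forall>x\<in>closure {x. \<phi> x \<noteq> 0}. norm x \<le> R" by (simp only: bounded_pos)
  then obtain R where R: "0 < R" "\<And>x. x \<in> closure {x. \<phi> x \<noteq> 0} \<Longrightarrow> norm x \<le> R" by (elim exE conjE bexE) (rule that, assumption, erule bspec)
  have "\<phi> x = 0" if "R < \<bar>x\<bar>" for x
  proof (rule ccontr)
    assume "\<phi> x \<noteq> 0"
    then have "x \<in> closure {x. \<phi> x \<noteq> 0}" by (intro subsetD[OF closure_subset]) simp
    from R(2)[OF this] show False using that by simp
  qed
  then show "\<exists>R\<ge>0. \<forall>x. R < \<bar>x\<bar> \<longrightarrow> \<phi> x = 0"
    by (intro exI[of _ R] conjI less_imp_le[OF R(1)] allI impI)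
qed

text \<open>Brings test functions under the decay condition for which convergence to the boundary
  function is available.\<close>

lemma test_function_bound:
  assumes "test_function \<phi>"
  obtains C where "0 \<le> C" "\<And>x. \<bar>\<phi> x\<bar> \<le> C / (1 + \<bar>x\<bar>)"
proof -
  obtain R where R: "0 \<le> R" "\<And>x. R < \<bar>x\<bar> \<Longrightarrow> \<phi> x = 0" using test_functionD(3)[OF assms] by blast
  have "continuous_on UNIV (\<lambda>x. \<phi> x * (1 + \<bar>x\<bar>))" by (intro continuous_intros test_functionD(2)[OF assms])
  then obtain M where M: "0 \<le> M" "\<And>t. \<bar>\<phi> t * (1 + \<bar>t\<bar>)\<bar> \<le> M"
    by (rule bounded_compact_support[where R = R]) (auto simp: R)
  have "\<bar>\<phi> x\<bar> \<le> M / (1 + \<bar>x\<bar>)" for x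
    using M(2)[of x] by (simp add: abs_mult pos_le_divide_eq add_pos_nonneg)
  with M(1) show ?thesis by (rule that)
qed

lemma smooth_class_test_function:
  assumes "\<phi> \<in> smooth_class" and "\<And>x. R < \<bar>x\<bar> \<Longrightarrow> \<phi> x = 0"
  shows "test_function \<phi>"
proof -
  have "{x. \<phi> x \<noteq> 0} \<subseteq> {- R..R}"
  proof
    fix x assume "x \<in> {x. \<phi> x \<noteq> 0}"
    then have "\<not> R < \<bar>x\<bar>" using assms(2) by blast
    then show "x \<in> {- R..R}" by auto
  qed
  then have "bounded {x. \<phi> x \<noteq> 0}" using bounded_subset bounded_closed_interval by blast
  then show ?thesis
    unfolding test_function_def using smooth_class_smooth[OF assms(1)] by (simp add: compact_closure)
qed

text \<open>The derivative of order k is tested with \<open>deriv \<phi>\<close>. This turns a list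
  of weak derivatives of one function into first-order steps between neighbours, as an induction on
  the order requires.\<close>

lemma weak_derivative_step:
  assumes "weak_derivative k f g" "weak_derivative (Suc k) f h"
  shows "weak_derivative 1 g h"
  unfolding weak_derivative_def
proof (intro allI impI)
  fix \<phi> assume \<phi>: "test_function \<phi>"
  have s: "(deriv ^^ k) (deriv \<phi>) = (deriv ^^ Suc k) \<phi>" by (simp only: funpow_Suc_right o_apply)
  have 1: "(LINT x|lebesgue. f x * of_real ((deriv ^^ Suc k) \<phi> x)) = (-1) ^ k * (LINT x|lebesgue. g x * of_real (deriv \<phi> x))"
    using assms(1)[unfolded weak_derivative_def, rule_format, OF test_function_deriv[OF \<phi>]] unfolding s .
  have 2: "(LINT x|lebesgue. f x * of_real ((deriv ^^ Suc k) \<phi> x)) = (-1) ^ Suc k * (LINT x|lebesgue. h x * of_real (\<phi> x))"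
    by (rule assms(2)[unfolded weak_derivative_def, rule_format, OF \<phi>])
  have cancel: "u = - v" if "(-1) ^ k * u = (-1) ^ Suc k * v" for u v :: complex
    using that by (cases "even k") auto
  have "(LINT x|lebesgue. g x * of_real (deriv \<phi> x)) = - (LINT x|lebesgue. h x * of_real (\<phi> x))"
    by (rule cancel) (use 1 2 in simp)
  then show "(LINT x|lebesgue. g x * of_real ((deriv ^^ 1) \<phi> x)) = (-1) ^ 1 * (LINT x|lebesgue. h x * of_real (\<phi> x))"
    by simp
qed

section \<open>Weak derivatives and Cauchy transforms\<close>

lemma has_vector_derivative_line:
  assumes F: "F holomorphic_on U" "open U" and line: "\<And>x. Complex x \<sigma> \<in> U"
  shows "((\<lambda>x. F (Complex x \<sigma>)) has_vector_derivative deriv F (Complex x \<sigma>)) (at x)"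
proof -
  have "((\<lambda>x. of_real x + \<i> * of_real \<sigma>) has_vector_derivative of_real 1 + 0) (at x)"
    by (intro has_vector_derivative_add has_vector_derivative_const has_vector_derivative_of_real DERIV_ident)
  then have l: "((\<lambda>x. Complex x \<sigma>) has_vector_derivative 1) (at x)" unfolding Complex_eq by (simp only: add_0_right of_real_1)
  have "(F has_field_derivative deriv F (Complex x \<sigma>)) (at (Complex x \<sigma>))"
    by (rule holomorphic_derivI[OF F line])
  from field_vector_diff_chain_at[OF l this] show ?thesis by (simp only: o_def mult_1)
qed

lemma line_integration_by_parts:
  assumes F: "F holomorphic_on U" "open U" and line: "\<And>x. Complex x \<sigma> \<in> U" and \<phi>: "test_function \<phi>"
  shows "(LINT x|lborel. F (Complex x \<sigma>) * of_real (deriv \<phi> x)) = - (LINT x|lborel. deriv F (Complex x \<sigma>) * of_real (\<phi> x))"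
proof -
  note \<phi>' = test_function_deriv[OF \<phi>]
  obtain R1 where R1: "0 \<le> R1" "\<And>x. R1 < \<bar>x\<bar> \<Longrightarrow> \<phi> x = 0" using test_functionD(3)[OF \<phi>] by blast
  obtain R2 where R2: "0 \<le> R2" "\<And>x. R2 < \<bar>x\<bar> \<Longrightarrow> deriv \<phi> x = 0" using test_functionD(3)[OF \<phi>'] by blast
  \<comment> \<open>Strictly beyond both supports, so that the functions vanish at the end points as
    well and no boundary terms remain.\<close>
  define R where "R = R1 + R2 + 1"
  have R: "0 \<le> R" "\<And>x. R \<le> \<bar>x\<bar> \<Longrightarrow> \<phi> x = 0" "\<And>x. R \<le> \<bar>x\<bar> \<Longrightarrow> deriv \<phi> x = 0"
    using R1 R2 by (auto simp: R_def)
  have F': "deriv F holomorphic_on U" by (rule holomorphic_deriv[OF F])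
  have c: "continuous_on UNIV (\<lambda>x. G (Complex x \<sigma>))" if "G holomorphic_on U" for G
    using has_vector_derivative_line[OF that F(2) line]
    by (intro continuous_at_imp_continuous_on ballI) (rule has_vector_derivative_continuous)
  have ind: "indicator {- R..R} x *\<^sub>R (a * of_real (\<phi> x)) = a * of_real (\<phi> x)"
      "indicator {- R..R} x *\<^sub>R (a * of_real (deriv \<phi> x)) = a * of_real (deriv \<phi> x)" for x and a :: complex
    using R(2,3)[of x] by (cases "x \<in> {- R..R}"; auto)+
  have c1: "continuous_on UNIV (\<lambda>x. F (Complex x \<sigma>) * of_real (deriv \<phi> x))"
    by (intro continuous_intros c[OF F(1)] test_functionD(2)[OF \<phi>'])
  have c2: "continuous_on UNIV (\<lambda>x. deriv F (Complex x \<sigma>) * of_real (\<phi> x))"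
    by (intro continuous_intros c[OF F'] test_functionD(2)[OF \<phi>])
  have i1: "integrable lborel (\<lambda>x. F (Complex x \<sigma>) * of_real (deriv \<phi> x))"
    using borel_integrable_atLeastAtMost'[OF continuous_on_subset[OF c1 subset_UNIV], of "-R" R]
    unfolding set_integrable_def ind .
  have i2: "integrable lborel (\<lambda>x. deriv F (Complex x \<sigma>) * of_real (\<phi> x))"
    using borel_integrable_atLeastAtMost'[OF continuous_on_subset[OF c2 subset_UNIV], of "-R" R]
    unfolding set_integrable_def ind .
  have d: "((\<lambda>x. F (Complex x \<sigma>) * of_real (\<phi> x)) has_vector_derivative
      (F (Complex x \<sigma>) * of_real (deriv \<phi> x) + deriv F (Complex x \<sigma>) * of_real (\<phi> x))) (at x within {- R..R})" for x
    by (intro has_vector_derivative_at_within[OF bounded_bilinear.has_vector_derivative[OF bounded_bilinear_mult]]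
        has_vector_derivative_line[OF F line] has_vector_derivative_of_real test_functionD(1)[OF \<phi>])
  have "has_bochner_integral lborel (\<lambda>x. indicator {- R..R} x *\<^sub>R
      (F (Complex x \<sigma>) * of_real (deriv \<phi> x) + deriv F (Complex x \<sigma>) * of_real (\<phi> x)))
      (F (Complex R \<sigma>) * of_real (\<phi> R) - F (Complex (- R) \<sigma>) * of_real (\<phi> (- R)))"
    by (rule has_bochner_integral_FTC_Icc[OF _ d continuous_on_subset[OF continuous_on_add[OF c1 c2] subset_UNIV]]) (use R(1) in simp)
  then have "has_bochner_integral lborel (\<lambda>x. F (Complex x \<sigma>) * of_real (deriv \<phi> x) + deriv F (Complex x \<sigma>) * of_real (\<phi> x)) 0"
    unfolding scaleR_add_right ind using R(2)[of R] R(2)[of "- R"] by simp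
  then have "(LINT x|lborel. F (Complex x \<sigma>) * of_real (deriv \<phi> x) + deriv F (Complex x \<sigma>) * of_real (\<phi> x)) = 0"
    by (rule has_bochner_integral_integral_eq)
  then show ?thesis unfolding Bochner_Integration.integral_add[OF i1 i2] by (simp only: add_eq_0_iff2)
qed

lemma line_weak_derivative:
  assumes "F holomorphic_on U" "open U" "\<And>x. Complex x \<sigma> \<in> U" "test_function \<phi>"
  shows "(LINT x|lborel. F (Complex x \<sigma>) * of_real ((deriv ^^ k) \<phi> x)) = (-1) ^ k * (LINT x|lborel. (deriv ^^ k) F (Complex x \<sigma>) * of_real (\<phi> x))"
  using assms(1)
proof (induction k arbitrary: F)
  case 0
  show ?case by simp
next
  case (Suc k)
  have "(LINT x|lborel. F (Complex x \<sigma>) * of_real ((deriv ^^ Suc k) \<phi> x)) = - (LINT x|lborel. deriv F (Complex x \<sigma>) * of_real ((deriv ^^ k) \<phi> x))"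
    using line_integration_by_parts[OF Suc.prems assms(2,3) test_function_higher_deriv[OF assms(4), of k]]
    by (simp only: funpow.simps o_apply)
  also have "\<dots> = - ((-1) ^ k * (LINT x|lborel. (deriv ^^ k) (deriv F) (Complex x \<sigma>) * of_real (\<phi> x)))"
    by (simp only: Suc.IH[OF holomorphic_deriv[OF Suc.prems assms(2)]])
  also have "\<dots> = (-1) ^ Suc k * (LINT x|lborel. (deriv ^^ Suc k) F (Complex x \<sigma>) * of_real (\<phi> x))"
    by (simp only: funpow_Suc_right o_apply power_Suc mult_minus_left mult_1)
  finally show ?case .
qed

text \<open>Test functions are real-valued, so a complex kernel has to enter through its real and
  imaginary parts. The latter is written as a real part with factor -i, so that one statement with a
  free constant covers both.\<close>

lemma integral_Re_Im_split:
  assumes f: "cauchy_integrable f" and [measurable]: "k \<in> borel_measurable borel" and b: "\<And>t. norm (k t) \<le> C / (1 + \<bar>t\<bar>)"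
  shows "(LINT t|lborel. f t * k t) = (LINT t|lborel. f t * of_real (Re (1 * k t))) + \<i> * (LINT t|lborel. f t * of_real (Re (- \<i> * k t)))"
proof -
  have i: "integrable lborel (\<lambda>t. f t * of_real (Re (c * k t)))" if "norm c = 1" for c
  proof (rule cauchy_integrable_bound[OF f])
    fix t show "norm (complex_of_real (Re (c * k t))) \<le> C / (1 + \<bar>t\<bar>)"
      unfolding norm_of_real by (rule order_trans[OF abs_Re_le_cmod]) (use b[of t] that in \<open>simp add: norm_mult\<close>)
  qed measurable
  have k: "k t = of_real (Re (1 * k t)) + \<i> * of_real (Re (- \<i> * k t))" for t
    by (simp add: complex_eq_iff)
  have "f t * k t = f t * of_real (Re (1 * k t)) + \<i> * (f t * of_real (Re (- \<i> * k t)))" for t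
    by (subst k) (simp only: distrib_left mult.left_commute)
  then have "(LINT t|lborel. f t * k t) = (LINT t|lborel. f t * of_real (Re (1 * k t)) + \<i> * (f t * of_real (Re (- \<i> * k t))))"
    by (simp only:)
  also have "\<dots> = (LINT t|lborel. f t * of_real (Re (1 * k t))) + (LINT t|lborel. \<i> * (f t * of_real (Re (- \<i> * k t))))"
    by (intro Bochner_Integration.integral_add integrable_mult_right i) auto
  finally show ?thesis by (simp only: integral_mult_right_zero)
qed

lemma weak_derivative_Cauchy_Re:
  assumes w: "weak_derivative 1 f g" and f: "cauchy_integrable f" and g: "cauchy_integrable g" and z: "Im z \<noteq> 0"
  shows "(LINT t|lborel. f t * of_real (Re (c * inverse (of_real t - z) ^ 2))) = (LINT t|lborel. g t * of_real (Re (c * inverse (of_real t - z))))"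
proof -
  have fm[measurable]: "f \<in> borel_measurable borel" and gm[measurable]: "g \<in> borel_measurable borel"
    using f g by (simp_all add: cauchy_integrable_def)
  obtain M where M: "0 \<le> M" "\<And>t. \<bar>bump t\<bar> \<le> M" "\<And>t. \<bar>deriv bump t\<bar> \<le> M" by (rule bump_bounds) (rule that, assumption+)
  define u where "u = (\<lambda>t. inverse (complex_of_real t - z))"
  define K where "K = 1 + (1 + norm z) / \<bar>Im z\<bar>"
  have K0: "0 \<le> K" by (simp add: K_def)
  have u1: "norm (u t) \<le> K / (1 + \<bar>t\<bar>)" for t
    using Cauchy_kernel_weight[OF z, of t] by (simp add: u_def K_def divide_inverse)
  have u2: "norm (u t) \<le> 1 / \<bar>Im z\<bar>" for t
    using Cauchy_kernel_norm_le[OF z, of t] by (simp add: u_def divide_inverse)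
  have um[measurable]: "u \<in> borel_measurable borel" unfolding u_def by measurable
  have r1: "\<bar>Re (a * u t)\<bar> \<le> norm a * (K / (1 + \<bar>t\<bar>))" for a t
    using abs_Re_le_cmod[of "a * u t"] mult_left_mono[OF u1[of t] norm_ge_zero[of a]] by (simp only: norm_mult)
  have r2: "\<bar>Re (a * u t ^ 2)\<bar> \<le> norm a * (K / (1 + \<bar>t\<bar>)) * (1 / \<bar>Im z\<bar>)" for a t
  proof -
    have "\<bar>Re (a * u t ^ 2)\<bar> \<le> norm a * norm (u t) * norm (u t)"
      using abs_Re_le_cmod[of "a * u t ^ 2"] by (simp only: norm_mult power2_eq_square mult.assoc)
    also have "\<dots> \<le> norm a * (K / (1 + \<bar>t\<bar>)) * (1 / \<bar>Im z\<bar>)"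
      using K0 by (intro mult_mono u1 u2) auto
    finally show ?thesis .
  qed
  define a where "a = (\<lambda>n. 1 / real (Suc n))"
  have a0: "a \<longlonglongrightarrow> 0" unfolding a_def by (rule LIMSEQ_Suc[OF lim_1_over_n])
  have a: "0 < a n" "a n \<le> 1" for n by (simp_all add: a_def)
  \<comment> \<open>The Cauchy kernel cut off at distance 1 / a n = n + 1. As \<open>a n\<close>
    tends to 0 the cut-off tends to \<open>bump 0\<close>, that is to 1, and the term containing the
    derivative of the cut-off carries the factor \<open>a n\<close>; all terms stay below a multiple
    of 1/(1 + |t|).\<close>
  define \<phi> where "\<phi> = (\<lambda>n t. bump (a n * t + 0) * Re (c * u t ^ 1))"
  define \<phi>' where "\<phi>' = (\<lambda>n t. (deriv bump (a n * t + 0) * a n) * Re (c * u t ^ 1) + Re ((- of_nat 1 * c) * u t ^ Suc 1) * bump (a n * t + 0))"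
  have d: "(\<phi> n has_field_derivative \<phi>' n t) (at t)" for n t
    unfolding \<phi>_def \<phi>'_def u_def
  proof (rule DERIV_mult)
    show "((\<lambda>t. bump (a n * t + 0)) has_field_derivative deriv bump (a n * t + 0) * a n) (at t)"
    proof (rule DERIV_chain2[OF smooth_class_deriv(1)[OF bump_smooth]])
      show "((\<lambda>t. a n * t + 0) has_field_derivative a n) (at t)" by (auto intro!: derivative_eq_intros)
    qed
    show "((\<lambda>t. Re (c * inverse (complex_of_real t - z) ^ 1)) has_field_derivative
       Re ((- of_nat 1 * c) * inverse (complex_of_real t - z) ^ Suc 1)) (at t)" by (rule has_field_derivative_Re_kernel[OF z])
  qed
  have t: "test_function (\<phi> n)" for n
  proof (rule smooth_class_test_function)
    show "\<phi> n \<in> smooth_class" unfolding \<phi>_def u_def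
      by (rule smooth_class.mult[OF smooth_class.affine[OF bump_smooth] smooth_class.kernel[OF z]])
    fix t assume "real (Suc n) < \<bar>t\<bar>"
    then have "1 \<le> \<bar>a n * t + 0\<bar>" by (simp add: a_def abs_mult)
    then show "\<phi> n t = 0" by (simp only: \<phi>_def bump_support mult_zero_left)
  qed
  have dd: "deriv (\<phi> n) = \<phi>' n" for n using DERIV_imp_deriv[OF d] by (rule ext)
  have bm: "h \<in> borel_measurable borel" if "h \<in> smooth_class" for h
    by (rule borel_measurable_continuous_onI[OF DERIV_continuous_on[OF has_field_derivative_at_within[OF smooth_class_deriv(1)[OF that]]]])
  have [measurable]: "bump \<in> borel_measurable borel" "deriv bump \<in> borel_measurable borel"
    using bm[OF bump_smooth] bm[OF smooth_class_deriv(2)[OF bump_smooth]] .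
  have [measurable]: "\<phi> n \<in> borel_measurable borel" "\<phi>' n \<in> borel_measurable borel" for n
    unfolding \<phi>_def \<phi>'_def by measurable
  have eq: "(LINT t|lborel. f t * of_real (\<phi>' n t)) = - (LINT t|lborel. g t * of_real (\<phi> n t))" for n
  proof -
    have "(LINT x|lebesgue. f x * of_real ((deriv ^^ 1) (\<phi> n) x)) = (-1) ^ 1 * (LINT x|lebesgue. g x * of_real (\<phi> n x))"
      by (rule w[unfolded weak_derivative_def, rule_format, OF t])
    then have "(LINT x|lebesgue. f x * of_real (\<phi>' n x)) = - (LINT x|lebesgue. g x * of_real (\<phi> n x))"
      by (simp add: dd)
    moreover have "(LINT x|lebesgue. f x * of_real (\<phi>' n x)) = (LINT x|lborel. f x * of_real (\<phi>' n x))"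
      by (rule integral_completion) measurable
    moreover have "(LINT x|lebesgue. g x * of_real (\<phi> n x)) = (LINT x|lborel. g x * of_real (\<phi> n x))"
      by (rule integral_completion) measurable
    ultimately show ?thesis by (simp only:)
  qed
  have arg: "(\<lambda>n. a n * t + 0) \<longlonglongrightarrow> 0" for t
    using tendsto_add[OF tendsto_mult_right[OF a0, of t] tendsto_const[of 0]] by (simp only: mult_zero_left add_0_right)
  have cont: "isCont h x" if "h \<in> smooth_class" for h x
    by (rule DERIV_isCont[OF smooth_class_deriv(1)[OF that]])
  have lb: "(\<lambda>n. bump (a n * t + 0)) \<longlonglongrightarrow> 1" for t
    using isCont_tendsto_compose[OF cont[OF bump_smooth] arg[of t]] by (simp only: bump_0)
  have lb': "(\<lambda>n. deriv bump (a n * t + 0)) \<longlonglongrightarrow> deriv bump 0" for t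
    by (rule isCont_tendsto_compose[OF cont[OF smooth_class_deriv(2)[OF bump_smooth]] arg])
  have l1: "(\<lambda>n. \<phi> n t) \<longlonglongrightarrow> Re (c * u t)" for t
    using tendsto_mult_right[OF lb[of t], of "Re (c * u t)"] by (simp only: \<phi>_def power_one_right mult_1)
  have l2: "(\<lambda>n. \<phi>' n t) \<longlonglongrightarrow> (deriv bump 0 * 0) * Re (c * u t ^ 1) + Re ((- of_nat 1 * c) * u t ^ Suc 1) * 1" for t
    unfolding \<phi>'_def by (intro tendsto_add tendsto_mult tendsto_const lb lb' a0)
  have l2': "(deriv bump 0 * 0) * Re (c * u t ^ 1) + Re ((- of_nat 1 * c) * u t ^ Suc 1) * 1 = - Re (c * u t ^ 2)" for t
    by (simp add: numeral_2_eq_2)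
  have L1: "(\<lambda>n. LINT t|lborel. g t * of_real (\<phi> n t)) \<longlonglongrightarrow> (LINT t|lborel. g t * of_real (Re (c * u t)))"
  proof (rule integral_dominated_convergence[where w="\<lambda>t. M * (norm c * K) * (norm (g t) / (1 + \<bar>t\<bar>))"])
    show "integrable lborel (\<lambda>t. M * (norm c * K) * (norm (g t) / (1 + \<bar>t\<bar>)))"
      using g unfolding cauchy_integrable_def by (intro integrable_mult_right) simp
    show "AE t in lborel. (\<lambda>n. g t * of_real (\<phi> n t)) \<longlonglongrightarrow> g t * of_real (Re (c * u t))"
      by (intro AE_I2 tendsto_mult_left tendsto_of_real l1)
    show "AE t in lborel. norm (g t * of_real (\<phi> n t)) \<le> M * (norm c * K) * (norm (g t) / (1 + \<bar>t\<bar>))" for n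
    proof (rule AE_I2)
      fix t
      have "\<bar>\<phi> n t\<bar> \<le> M * (norm c * (K / (1 + \<bar>t\<bar>)))"
        unfolding \<phi>_def abs_mult power_one_right using M by (intro mult_mono r1) auto
      then have "norm (g t) * \<bar>\<phi> n t\<bar> \<le> norm (g t) * (M * (norm c * (K / (1 + \<bar>t\<bar>))))" by (rule mult_left_mono) simp
      then show "norm (g t * of_real (\<phi> n t)) \<le> M * (norm c * K) * (norm (g t) / (1 + \<bar>t\<bar>))" by (simp add: norm_mult mult_ac)
    qed
  qed measurable
  have L2: "(\<lambda>n. LINT t|lborel. f t * of_real (\<phi>' n t)) \<longlonglongrightarrow> (LINT t|lborel. f t * of_real (- Re (c * u t ^ 2)))"
  proof (rule integral_dominated_convergence[where w="\<lambda>t. (M * (norm c * K) + norm c * K * (1 / \<bar>Im z\<bar>) * M) * (norm (f t) / (1 + \<bar>t\<bar>))"])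
    show "integrable lborel (\<lambda>t. (M * (norm c * K) + norm c * K * (1 / \<bar>Im z\<bar>) * M) * (norm (f t) / (1 + \<bar>t\<bar>)))"
      using f unfolding cauchy_integrable_def by (intro integrable_mult_right) simp
    show "AE t in lborel. (\<lambda>n. f t * of_real (\<phi>' n t)) \<longlonglongrightarrow> f t * of_real (- Re (c * u t ^ 2))"
      by (intro AE_I2 tendsto_mult_left tendsto_of_real l2[unfolded l2'])
    show "AE t in lborel. norm (f t * of_real (\<phi>' n t)) \<le> (M * (norm c * K) + norm c * K * (1 / \<bar>Im z\<bar>) * M) * (norm (f t) / (1 + \<bar>t\<bar>))" for n
    proof (rule AE_I2)
      fix t
      have "\<bar>deriv bump (a n * t + 0) * a n\<bar> \<le> M * 1"
        unfolding abs_mult using M a[of n] by (intro mult_mono) auto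
      then have "\<bar>(deriv bump (a n * t + 0) * a n) * Re (c * u t ^ 1)\<bar> \<le> M * (norm c * (K / (1 + \<bar>t\<bar>)))"
        unfolding abs_mult[of "_ * _" "Re _"] power_one_right using M by (intro mult_mono r1) auto
      moreover have "\<bar>Re ((- of_nat 1 * c) * u t ^ Suc 1) * bump (a n * t + 0)\<bar> \<le> norm (- of_nat 1 * c) * (K / (1 + \<bar>t\<bar>)) * (1 / \<bar>Im z\<bar>) * M"
        unfolding abs_mult Suc_1 using M K0 by (intro mult_mono r2) auto
      moreover have "norm (- of_nat 1 * c) = norm c" by simp
      ultimately have "\<bar>\<phi>' n t\<bar> \<le> M * (norm c * (K / (1 + \<bar>t\<bar>))) + norm c * (K / (1 + \<bar>t\<bar>)) * (1 / \<bar>Im z\<bar>) * M"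
        unfolding \<phi>'_def by (simp only: order_trans[OF abs_triangle_ineq add_mono])
      also have "\<dots> = (M * (norm c * K) + norm c * K * (1 / \<bar>Im z\<bar>) * M) / (1 + \<bar>t\<bar>)"
        by (simp add: add_divide_distrib)
      finally have le: "norm (f t) * \<bar>\<phi>' n t\<bar> \<le> norm (f t) * ((M * (norm c * K) + norm c * K * (1 / \<bar>Im z\<bar>) * M) / (1 + \<bar>t\<bar>))"
        by (rule mult_left_mono) simp
      have "a * (b / w) = b * (a / w)" for a b w :: real by simp
      from ord_le_eq_trans[OF le this] show "norm (f t * of_real (\<phi>' n t)) \<le> (M * (norm c * K) + norm c * K * (1 / \<bar>Im z\<bar>) * M) * (norm (f t) / (1 + \<bar>t\<bar>))"
        unfolding norm_mult norm_of_real .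
    qed
  qed measurable
  from L2 have "(\<lambda>n. LINT t|lborel. g t * of_real (\<phi> n t)) \<longlonglongrightarrow> - (LINT t|lborel. f t * of_real (- Re (c * u t ^ 2)))"
    unfolding eq by (simp only: tendsto_minus_cancel_left[symmetric] minus_minus)
  then have "- (LINT t|lborel. f t * of_real (- Re (c * u t ^ 2))) = (LINT t|lborel. g t * of_real (Re (c * u t)))"
    using L1 by (rule LIMSEQ_unique)
  then show ?thesis by (simp only: u_def of_real_minus mult_minus_right Bochner_Integration.integral_minus minus_minus)
qed

lemma weak_derivative_Cauchy_integral:
  assumes w: "weak_derivative 1 f g" and f: "cauchy_integrable f" and g: "cauchy_integrable g" and z: "Im z \<noteq> 0"
  shows "(LINT t|lborel. f t / (of_real t - z)\<^sup>2) = (LINT t|lborel. g t / (of_real t - z))"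
proof -
  define K where "K = 1 + (1 + norm z) / \<bar>Im z\<bar>"
  have K0: "0 \<le> K" by (simp add: K_def)
  have u1: "norm (inverse (of_real t - z)) \<le> K / (1 + \<bar>t\<bar>)" for t
    using Cauchy_kernel_weight[OF z, of t] by (simp add: K_def divide_inverse)
  have u2: "norm (inverse (of_real t - z) ^ 2) \<le> (K * (1 / \<bar>Im z\<bar>)) / (1 + \<bar>t\<bar>)" for t
  proof -
    have "norm (inverse (of_real t - z)) * norm (inverse (of_real t - z)) \<le> K / (1 + \<bar>t\<bar>) * (1 / \<bar>Im z\<bar>)"
      using Cauchy_kernel_norm_le[OF z, of t] K0 by (intro mult_mono u1) (auto simp: divide_inverse)
    then show ?thesis by (simp only: power2_eq_square norm_mult times_divide_eq_left)
  qed
  have "(LINT t|lborel. f t * inverse (of_real t - z) ^ 2) = (LINT t|lborel. g t * inverse (of_real t - z))"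
    unfolding integral_Re_Im_split[OF f _ u2, simplified] integral_Re_Im_split[OF g _ u1, simplified]
    using weak_derivative_Cauchy_Re[OF w f g z, of 1] weak_derivative_Cauchy_Re[OF w f g z, of "- \<i>"] by simp
  then show ?thesis by (simp only: divide_inverse power_inverse)
qed

text \<open>Differentiation in z squares the kernel; the squared kernel is the negative of the
  derivative in t, which the weak derivative moves onto f.\<close>

lemma has_field_derivative_cauchy_transform_weak:
  assumes w: "weak_derivative 1 f g" and f: "cauchy_integrable f" and g: "cauchy_integrable g" and z: "Im z \<noteq> 0"
  shows "(cauchy_transform r f has_field_derivative cauchy_transform r g z) (at z)"
proof -
  have gm: "g \<in> borel_measurable borel" using g by (simp add: cauchy_integrable_def)
  show ?thesis
    using has_field_derivative_cauchy_transform[OF f z, of r]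
    unfolding weak_derivative_Cauchy_integral[OF assms] cauchy_transform_lborel[OF gm] .
qed

lemma higher_deriv_cauchy_transform:
  assumes ci: "\<And>j. j \<le> n \<Longrightarrow> cauchy_integrable (G j)" and w: "\<And>j. j \<le> n \<Longrightarrow> weak_derivative j (G 0) (G j)"
  shows "k \<le> n \<Longrightarrow> Im z \<noteq> 0 \<Longrightarrow> (deriv ^^ k) (cauchy_transform r (G 0)) z = cauchy_transform r (G k) z"
proof (induction k arbitrary: z)
  case (Suc k)
  have "(cauchy_transform r (G k) has_field_derivative cauchy_transform r (G (Suc k)) z) (at z)"
    by (rule has_field_derivative_cauchy_transform_weak[OF weak_derivative_step[OF w w] ci ci]) (use Suc.prems in auto)
  then have "((deriv ^^ k) (cauchy_transform r (G 0)) has_field_derivative cauchy_transform r (G (Suc k)) z) (at z)"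
  proof (rule has_field_derivative_transform_within_open)
    have "{w. Im w \<noteq> 0} = {w. 0 < Im w} \<union> {w. Im w < 0}" by auto
    then show "open {w. Im w \<noteq> 0}" by (simp only:) (intro open_Un open_Collect_less continuous_intros)
  qed (use Suc in auto)
  then show ?case by (simp add: DERIV_imp_deriv)
qed simp

section \<open>Hardy--Sobolev spaces\<close>

lemma Lp_realI:
  assumes f: "f \<in> borel_measurable borel" and fp: "integrable lborel (\<lambda>x. norm (f x) powr p)"
  shows "f \<in> Lp_real p"
proof -
  have "(\<lambda>x. norm (f x) powr p) \<in> borel_measurable lborel" using f by measurable
  from integrable_completion[OF this] fp show ?thesis
    unfolding Lp_real_def using measurable_lebesgueI[OF f] by simp
qed

text \<open>Functions in the statement are measurable for the completed measure, while the arguments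
  with Tonelli's theorem use Borel functions. Cauchy transforms, truncated Hilbert transforms and
  weak derivatives are integrals and do not see the exchange.\<close>

lemma Lp_real_representative:
  assumes f: "f \<in> Lp_real p"
  obtains g where "g \<in> borel_measurable borel" "integrable lborel (\<lambda>x. norm (g x) powr p)" "AE x in lebesgue. f x = g x"
proof -
  have fm: "f \<in> borel_measurable lebesgue" using f by (simp add: Lp_real_def)
  have "(\<lambda>x. Re (f x)) \<in> borel_measurable lebesgue" "(\<lambda>x. Im (f x)) \<in> borel_measurable lebesgue"
    using fm by measurable
  from this[THEN completion_ex_borel_measurable_real]
  obtain u v where u: "u \<in> borel_measurable lborel" "AE x in lborel. Re (f x) = u x"
    and v: "v \<in> borel_measurable lborel" "AE x in lborel. Im (f x) = v x" by (elim bexE)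
  define g where "g = (\<lambda>x. of_real (u x) + \<i> * of_real (v x))"
  have [measurable]: "u \<in> borel_measurable borel" "v \<in> borel_measurable borel" using u v by simp_all
  have gm[measurable]: "g \<in> borel_measurable borel" unfolding g_def by measurable
  have ae: "AE x in lebesgue. f x = g x"
    unfolding AE_completion_iff using u(2) v(2) by eventually_elim (simp add: g_def complex_eq_iff)
  have m: "(\<lambda>x. norm (g x) powr p) \<in> borel_measurable lborel" by measurable
  have "integrable lebesgue (\<lambda>x. norm (g x) powr p) \<longleftrightarrow> integrable lebesgue (\<lambda>x. norm (f x) powr p)"
  proof (rule integrable_cong_AE)
    show "(\<lambda>x. norm (g x) powr p) \<in> borel_measurable lebesgue" using measurable_completion[OF m] .
    show "(\<lambda>x. norm (f x) powr p) \<in> borel_measurable lebesgue" using fm by measurable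
    show "AE x in lebesgue. norm (g x) powr p = norm (f x) powr p" using ae by eventually_elim simp
  qed
  then have "integrable lborel (\<lambda>x. norm (g x) powr p)"
    using f unfolding integrable_completion[OF m] Lp_real_def by simp
  from that[OF gm this ae] show ?thesis .
qed

lemma integral_lebesgue_cong_mult:
  fixes f g k :: "real \<Rightarrow> complex"
  assumes f: "f \<in> borel_measurable lebesgue" and g: "g \<in> borel_measurable lebesgue" and ae: "AE x in lebesgue. f x = g x"
    and k: "k \<in> borel_measurable borel"
  shows "(LINT x|lebesgue. f x * k x) = (LINT x|lebesgue. g x * k x)"
proof (rule integral_cong_AE)
  have k': "k \<in> borel_measurable lebesgue" by (rule measurable_lebesgueI[OF k])
  show "(\<lambda>x. f x * k x) \<in> borel_measurable lebesgue" by (rule borel_measurable_times[OF f k'])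
  show "(\<lambda>x. g x * k x) \<in> borel_measurable lebesgue" by (rule borel_measurable_times[OF g k'])
  show "AE x in lebesgue. f x * k x = g x * k x" using ae by eventually_elim simp
qed

lemma cauchy_transform_cong_AE:
  assumes "f \<in> borel_measurable lebesgue" "g \<in> borel_measurable lebesgue" "AE x in lebesgue. f x = g x"
  shows "cauchy_transform s f = cauchy_transform s g"
proof
  fix z
  have "(LINT x|lebesgue. f x * (1 / (of_real x - z))) = (LINT x|lebesgue. g x * (1 / (of_real x - z)))"
    by (rule integral_lebesgue_cong_mult[OF assms]) measurable
  then show "cauchy_transform s f z = cauchy_transform s g z" unfolding cauchy_transform_def by simp
qed

lemma truncated_hilbert_cong_AE:
  assumes "f \<in> borel_measurable lebesgue" "g \<in> borel_measurable lebesgue" "AE x in lebesgue. f x = g x"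
  shows "truncated_hilbert f = truncated_hilbert g"
proof (intro ext)
  fix x e
  have "(LINT t|lebesgue. f t * (indicator {t. \<bar>x - t\<bar> > e} t *\<^sub>R (1 / of_real (x - t)))) = (LINT t|lebesgue. g t * (indicator {t. \<bar>x - t\<bar> > e} t *\<^sub>R (1 / of_real (x - t))))"
    by (rule integral_lebesgue_cong_mult[OF assms]) measurable
  then show "truncated_hilbert f x e = truncated_hilbert g x e"
    unfolding truncated_hilbert_def set_lebesgue_integral_def by simp
qed

lemma borel_measurable_test_function: "test_function \<phi> \<Longrightarrow> (\<lambda>x. complex_of_real (\<phi> x)) \<in> borel_measurable borel"
  by (intro borel_measurable_continuous_onI continuous_on_of_real test_functionD(2))

lemma weak_derivative_cong_AE:
  assumes "f \<in> borel_measurable lebesgue" "f' \<in> borel_measurable lebesgue" "AE x in lebesgue. f x = f' x"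
    and "g \<in> borel_measurable lebesgue" "g' \<in> borel_measurable lebesgue" "AE x in lebesgue. g x = g' x"
    and "weak_derivative k f g"
  shows "weak_derivative k f' g'"
  unfolding weak_derivative_def
proof (intro allI impI)
  fix \<phi> assume \<phi>: "test_function \<phi>"
  show "(LINT x|lebesgue. f' x * of_real ((deriv ^^ k) \<phi> x)) = (- 1) ^ k * (LINT x|lebesgue. g' x * of_real (\<phi> x))"
    using assms(7)[unfolded weak_derivative_def, rule_format, OF \<phi>]
    unfolding integral_lebesgue_cong_mult[OF assms(1-3) borel_measurable_test_function[OF test_function_higher_deriv[OF \<phi>]]]
      integral_lebesgue_cong_mult[OF assms(4-6) borel_measurable_test_function[OF \<phi>]] .
qed

lemma weak_derivative_0: "weak_derivative 0 f f"
  by (simp add: weak_derivative_def)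

lemma hardy_cong:
  assumes eq: "\<And>z. z \<in> half_plane s \<Longrightarrow> F z = G z" and s: "s = 1 \<or> s = -1" and F: "F \<in> hardy s p" and p: "1 \<le> p"
  shows "G \<in> hardy s p"
proof -
  have e: "G (Complex x (s * y)) = F (Complex x (s * y))" if "0 < y" for x y
    using eq[OF Complex_in_half_plane[OF s that]] by simp
  obtain M where M: "\<And>y. 0 < y \<Longrightarrow> (LINT x|lborel. norm (F (Complex x (s * y))) powr p) \<le> M"
    using hardyD(4)[OF F s p] by auto
  show ?thesis
  proof (rule hardyI[OF _ s p])
    show "G holomorphic_on half_plane s" by (rule holomorphic_transform[OF hardyD(1)[OF F s p] eq])
    show "integrable lborel (\<lambda>x. norm (G (Complex x (s * y))) powr p)" if "0 < y" for y
      unfolding e[OF that] by (rule hardyD(3)[OF F s p that])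
    show "(LINT x|lborel. norm (G (Complex x (s * y))) powr p) \<le> M" if "0 < y" for y
      unfolding e[OF that] by (rule M[OF that])
  qed
qed

lemma hardy_sobolevI:
  assumes hol: "F holomorphic_on half_plane s" and s: "s = 1 \<or> s = -1" and p: "1 \<le> p"
    and H: "\<And>k. k \<le> n \<Longrightarrow> H k \<in> hardy s p" and eq: "\<And>k z. k \<le> n \<Longrightarrow> z \<in> half_plane s \<Longrightarrow> H k z = (deriv ^^ k) F z"
  shows "F \<in> hardy_sobolev s p n"
  unfolding hardy_sobolev_def using hol hardy_cong[OF eq s H p] by blast

text \<open>Jensen's inequality bounds |H|^p by the Poisson integral of |g|^p, whose integral over
  every line is that of |g|^p.\<close>

lemma poisson_integral_in_hardy:
  assumes hol: "H holomorphic_on half_plane s" and s: "s = 1 \<or> s = -1" and p: "1 \<le> p"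
    and g: "g \<in> borel_measurable borel" and gp: "integrable lborel (\<lambda>t. norm (g t) powr p)"
    and H: "\<And>x y. 0 < y \<Longrightarrow> H (Complex x (s * y)) = poisson_integral y g x"
  shows "H \<in> hardy s p"
proof -
  have b: "has_bochner_integral lborel (poisson_integral y (\<lambda>t. norm (g t) powr p)) (LINT t|lborel. norm (g t) powr p)" if "0 < y" for y
    by (rule integrable_poisson_integral[OF that gp]) simp
  have le: "norm (H (Complex x (s * y))) powr p \<le> poisson_integral y (\<lambda>t. norm (g t) powr p) x" if "0 < y" for x y
    unfolding H[OF that] by (rule norm_poisson_integral_powr_le[OF that p g gp])
  have i: "integrable lborel (\<lambda>x. norm (H (Complex x (s * y))) powr p)" if y: "0 < y" for y
  proof (rule Bochner_Integration.integrable_bound)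
    show "integrable lborel (poisson_integral y (\<lambda>t. norm (g t) powr p))" using b[OF y] by (rule integrable.intros)
    show "(\<lambda>x. norm (H (Complex x (s * y))) powr p) \<in> borel_measurable lborel"
      using borel_measurable_continuous_onI[OF continuous_on_line[OF hol s y]] by measurable
    show "AE x in lborel. norm (norm (H (Complex x (s * y))) powr p) \<le> norm (poisson_integral y (\<lambda>t. norm (g t) powr p) x)"
    proof (rule AE_I2)
      fix x
      show "norm (norm (H (Complex x (s * y))) powr p) \<le> norm (poisson_integral y (\<lambda>t. norm (g t) powr p) x)"
        unfolding real_norm_def abs_of_nonneg[OF powr_ge_zero] by (rule order_trans[OF le[OF y] abs_ge_self])
    qed
  qed
  show ?thesis
  proof (rule hardyI[OF hol s p i])
    fix y :: real assume y: "0 < y"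
    have "(LINT x|lborel. norm (H (Complex x (s * y))) powr p) \<le> (LINT x|lborel. poisson_integral y (\<lambda>t. norm (g t) powr p) x)"
      by (rule integral_mono[OF i[OF y] integrable.intros[OF b[OF y]] le[OF y]])
    also have "\<dots> = (LINT t|lborel. norm (g t) powr p)" by (rule has_bochner_integral_integral_eq[OF b[OF y]])
    finally show "(LINT x|lborel. norm (H (Complex x (s * y))) powr p) \<le> (LINT t|lborel. norm (g t) powr p)" .
  qed
qed

section \<open>From Hardy--Sobolev functions to boundary functions and back\<close>

lemma hardy_reprD:
  assumes "hardy_repr s p F f"
  shows "f \<in> borel_measurable borel" "integrable lborel (\<lambda>t. norm (f t) powr p)"
    "\<And>x y. 0 < y \<Longrightarrow> cauchy_transform s f (Complex x (s * y)) = F (Complex x (s * y))"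
    "\<And>x y. 0 < y \<Longrightarrow> cauchy_transform (- s) f (Complex x (- s * y)) = 0"
    "AE x in lborel. has_nontangential_limit s F x (f x)"
    "\<And>\<kappa> C. \<kappa> \<in> borel_measurable borel \<Longrightarrow> (\<And>t. norm (\<kappa> t) \<le> C / (1 + \<bar>t\<bar>)) \<Longrightarrow>
       (\<lambda>k. LINT t|lborel. F (Complex t (s * (1 / real (Suc k)))) * \<kappa> t) \<longlonglongrightarrow> (LINT t|lborel. f t * \<kappa> t)"
proof -
  note D = assms[unfolded hardy_repr_def]
  show "f \<in> borel_measurable borel" by (rule D[THEN conjunct1])
  show "integrable lborel (\<lambda>t. norm (f t) powr p)" by (rule D[THEN conjunct2, THEN conjunct1])
  note D = D[THEN conjunct2, THEN conjunct2, THEN conjunct2]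
  show "cauchy_transform s f (Complex x (s * y)) = F (Complex x (s * y))" if "0 < y" for x y
    by (rule D[THEN conjunct1, THEN spec, THEN spec, THEN mp, OF that])
  note D = D[THEN conjunct2]
  show "cauchy_transform (- s) f (Complex x (- s * y)) = 0" if "0 < y" for x y
    by (rule D[THEN conjunct1, THEN spec, THEN spec, THEN mp, OF that])
  note D = D[THEN conjunct2]
  show "AE x in lborel. has_nontangential_limit s F x (f x)" by (rule D[THEN conjunct1])
  note D = D[THEN conjunct2]
  show "(\<lambda>k. LINT t|lborel. F (Complex t (s * (1 / real (Suc k)))) * \<kappa> t) \<longlonglongrightarrow> (LINT t|lborel. f t * \<kappa> t)"
    if "\<kappa> \<in> borel_measurable borel" "\<And>t. norm (\<kappa> t) \<le> C / (1 + \<bar>t\<bar>)" for \<kappa> C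
    using D[THEN spec, of \<kappa>, THEN spec, of C] that by simp
qed

text \<open>Membership in \<open>hardy_boundary\<close> provides some Hardy function with boundary
  values f. Its boundary function from the representation theorem is a second vertical limit of the
  same function, so the two agree a.e. and f inherits the Cauchy formula.\<close>

lemma hardy_boundary_representative:
  assumes f: "f \<in> hardy_boundary s p" and s: "s = 1 \<or> s = -1" and p: "1 \<le> p"
  obtains f0 F0 where "hardy_repr s p F0 f0" "AE x in lebesgue. f x = f0 x"
    "\<And>z. z \<in> half_plane s \<Longrightarrow> cauchy_transform s f z = F0 z"
    "AE x in lebesgue. has_nontangential_limit s F0 x (f x)"
proof -
  obtain F0 where F0: "F0 \<in> hardy s p" and nt: "AE x in lebesgue. has_nontangential_limit s F0 x (f x)"
    and fL: "f \<in> Lp_real p" using f by (auto simp: hardy_boundary_def)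
  obtain f0 where f0: "hardy_repr s p F0 f0" using hardy_boundary_function[OF F0 s p] by (elim exE)
  have nt0: "AE x in lebesgue. has_nontangential_limit s F0 x (f0 x)"
    unfolding AE_completion_iff by (rule hardy_reprD(5)[OF f0])
  have ae: "AE x in lebesgue. f x = f0 x"
    using nt nt0
  proof eventually_elim
    case (elim x)
    show ?case
      by (rule tendsto_unique[OF _ nontangential_imp_vertical(1)[OF elim(1) s] nontangential_imp_vertical(1)[OF elim(2) s]]) simp
  qed
  have c: "cauchy_transform s f = cauchy_transform s f0"
    using fL by (intro cauchy_transform_cong_AE[OF _ measurable_lebesgueI[OF hardy_reprD(1)[OF f0]] ae]) (simp add: Lp_real_def)
  have "cauchy_transform s f z = F0 z" if z: "z \<in> half_plane s" for z
  proof -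
    obtain x y where "0 < y" "z = Complex x (s * y)" by (rule half_plane_cases[OF z s]) (rule that, assumption+)
    then show ?thesis unfolding c by (simp only: hardy_reprD(3)[OF f0])
  qed
  from that[OF f0 ae this nt] show ?thesis .
qed

lemma sobolev_representative:
  assumes f: "f \<in> sobolev p n" and f0: "f0 \<in> borel_measurable borel" "integrable lborel (\<lambda>t. norm (f0 t) powr p)" and ae: "AE x in lebesgue. f x = f0 x"
  obtains G where "G 0 = f0"
    "\<And>k. k \<le> n \<Longrightarrow> G k \<in> borel_measurable borel \<and> integrable lborel (\<lambda>t. norm (G k t) powr p) \<and> weak_derivative k f0 (G k)"
proof -
  have fm: "f \<in> borel_measurable lebesgue" using f by (simp add: sobolev_def Lp_real_def)
  have f0m: "f0 \<in> borel_measurable lebesgue" by (rule measurable_lebesgueI[OF f0(1)])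
  have "\<exists>g. g \<in> borel_measurable borel \<and> integrable lborel (\<lambda>t. norm (g t) powr p) \<and> weak_derivative k f0 g" if k: "k \<in> {1..n}" for k
  proof -
    have "\<forall>k\<in>{1..n}. \<exists>g\<in>Lp_real p. weak_derivative k f g" using f unfolding sobolev_def by simp
    from bspec[OF this k] obtain g where g: "g \<in> Lp_real p" and w: "weak_derivative k f g" by (elim bexE)
    obtain g0 where g0: "g0 \<in> borel_measurable borel" "integrable lborel (\<lambda>x. norm (g0 x) powr p)" and gae: "AE x in lebesgue. g x = g0 x"
      by (rule Lp_real_representative[OF g]) (rule that, assumption+)
    have "weak_derivative k f0 g0"
      by (rule weak_derivative_cong_AE[OF fm f0m ae _ measurable_lebesgueI[OF g0(1)] gae w]) (use g in \<open>simp add: Lp_real_def\<close>)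
    with g0 show ?thesis by (intro exI[of _ g0] conjI)
  qed
  then have "\<forall>k\<in>{1..n}. \<exists>g. g \<in> borel_measurable borel \<and> integrable lborel (\<lambda>t. norm (g t) powr p) \<and> weak_derivative k f0 g"
    by (intro ballI)
  then obtain G where G: "\<forall>k\<in>{1..n}. G k \<in> borel_measurable borel \<and> integrable lborel (\<lambda>t. norm (G k t) powr p) \<and> weak_derivative k f0 (G k)"
    unfolding bchoice_iff by (elim exE)
  show ?thesis
  proof (rule that[of "\<lambda>k. if k = 0 then f0 else G k"])
    fix k assume "k \<le> n"
    then show "(if k = 0 then f0 else G k) \<in> borel_measurable borel \<and> integrable lborel (\<lambda>t. norm ((if k = 0 then f0 else G k) t) powr p) \<and>
        weak_derivative k f0 (if k = 0 then f0 else G k)"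
      using f0 weak_derivative_0[of f0] bspec[OF G, of k] by (cases "k = 0") simp_all
  qed simp
qed

lemma higher_deriv_cong_open:
  assumes "open S" "\<And>w. w \<in> S \<Longrightarrow> F w = G w"
  shows "w \<in> S \<Longrightarrow> (deriv ^^ k) F w = (deriv ^^ k) G w"
proof (induction k arbitrary: w)
  case (Suc k)
  have "\<forall>\<^sub>F v in nhds w. (deriv ^^ k) F v = (deriv ^^ k) G v"
    unfolding eventually_nhds using assms(1) Suc by (intro exI[of _ S]) simp
  then show ?case by (simp add: deriv_cong_ev)
qed (simp add: assms)

text \<open>Each derivative of \<open>F\<close> has a boundary function of its own. On the line at
  height 1 / (m + 1) integration by parts against a test function is classical; the weak convergence
  in \<open>hardy_repr\<close> carries both sides to the boundary, so these functions are weak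
  derivatives of the first.\<close>

lemma hardy_sobolev_imp_boundary:
  assumes F: "F \<in> hardy_sobolev s p n" and s: "s = 1 \<or> s = -1" and p: "1 \<le> p"
  obtains f where "f \<in> hardy_sobolev_boundary s p n" "\<And>z. z \<in> half_plane s \<Longrightarrow> F z = cauchy_transform s f z"
proof -
  have hol: "F holomorphic_on half_plane s" and Fk: "\<And>k. k \<le> n \<Longrightarrow> (deriv ^^ k) F \<in> hardy s p"
    using F by (simp_all add: hardy_sobolev_def)
  have "\<forall>k\<in>{..n}. \<exists>g. hardy_repr s p ((deriv ^^ k) F) g" by (intro ballI hardy_boundary_function[OF Fk s p]) simp
  then obtain G where "\<forall>k\<in>{..n}. hardy_repr s p ((deriv ^^ k) F) (G k)" unfolding bchoice_iff by (elim exE)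
  then have G: "\<And>k. k \<le> n \<Longrightarrow> hardy_repr s p ((deriv ^^ k) F) (G k)" by simp
  have G0: "hardy_repr s p F (G 0)" using G[of 0] by simp
  have L: "G k \<in> Lp_real p" if "k \<le> n" for k by (rule Lp_realI[OF hardy_reprD(1,2)[OF G[OF that]]])
  have wk: "weak_derivative k (G 0) (G k)" if k: "k \<le> n" for k
    unfolding weak_derivative_def
  proof (intro allI impI)
    fix \<phi> assume \<phi>: "test_function \<phi>"
    note \<phi>k = test_function_higher_deriv[OF \<phi>, of k]
    obtain C where C: "\<And>x. \<bar>\<phi> x\<bar> \<le> C / (1 + \<bar>x\<bar>)" by (rule test_function_bound[OF \<phi>]) (rule that)
    obtain Ck where Ck: "\<And>x. \<bar>(deriv ^^ k) \<phi> x\<bar> \<le> Ck / (1 + \<bar>x\<bar>)" by (rule test_function_bound[OF \<phi>k]) (rule that)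
    have 1: "(\<lambda>m. LINT t|lborel. F (Complex t (s * (1 / real (Suc m)))) * of_real ((deriv ^^ k) \<phi> t)) \<longlonglongrightarrow> (LINT t|lborel. G 0 t * of_real ((deriv ^^ k) \<phi> t))"
      by (rule hardy_reprD(6)[OF G0 borel_measurable_test_function[OF \<phi>k]]) (unfold norm_of_real, rule Ck)
    have 2: "(\<lambda>m. LINT t|lborel. (deriv ^^ k) F (Complex t (s * (1 / real (Suc m)))) * of_real (\<phi> t)) \<longlonglongrightarrow> (LINT t|lborel. G k t * of_real (\<phi> t))"
      by (rule hardy_reprD(6)[OF G[OF k] borel_measurable_test_function[OF \<phi>]]) (unfold norm_of_real, rule C)
    have e: "(LINT t|lborel. F (Complex t (s * (1 / real (Suc m)))) * of_real ((deriv ^^ k) \<phi> t)) = (-1) ^ k * (LINT t|lborel. (deriv ^^ k) F (Complex t (s * (1 / real (Suc m)))) * of_real (\<phi> t))" for m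
      by (rule line_weak_derivative[OF hol open_half_plane Complex_in_half_plane[OF s] \<phi>]) simp
    have "(LINT t|lborel. G 0 t * of_real ((deriv ^^ k) \<phi> t)) = (-1) ^ k * (LINT t|lborel. G k t * of_real (\<phi> t))"
      by (rule LIMSEQ_unique[OF 1[unfolded e] tendsto_mult_left[OF 2]])
    moreover have "(LINT t|lebesgue. G 0 t * of_real ((deriv ^^ k) \<phi> t)) = (LINT t|lborel. G 0 t * of_real ((deriv ^^ k) \<phi> t))"
      using borel_measurable_times[OF hardy_reprD(1)[OF G0] borel_measurable_test_function[OF \<phi>k]] by (intro integral_completion) simp
    moreover have "(LINT t|lebesgue. G k t * of_real (\<phi> t)) = (LINT t|lborel. G k t * of_real (\<phi> t))"
      using borel_measurable_times[OF hardy_reprD(1)[OF G[OF k]] borel_measurable_test_function[OF \<phi>]] by (intro integral_completion) simp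
    ultimately show "(LINT t|lebesgue. G 0 t * of_real ((deriv ^^ k) \<phi> t)) = (-1) ^ k * (LINT t|lebesgue. G k t * of_real (\<phi> t))"
      by (simp only:)
  qed
  have "AE x in lebesgue. has_nontangential_limit s F x (G 0 x)" unfolding AE_completion_iff by (rule hardy_reprD(5)[OF G0])
  moreover have "F \<in> hardy s p" using Fk[of 0] by simp
  ultimately have "G 0 \<in> hardy_boundary s p" unfolding hardy_boundary_def using L[of 0] by blast
  moreover have "G 0 \<in> sobolev p n"
    unfolding sobolev_def
  proof (intro CollectI conjI ballI)
    show "G 0 \<in> Lp_real p" by (rule L) simp
    fix k assume "k \<in> {1..n}"
    then have "k \<le> n" by simp
    then show "\<exists>g\<in>Lp_real p. weak_derivative k (G 0) g" using L wk by (intro bexI[of _ "G k"])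
  qed
  ultimately have "G 0 \<in> hardy_sobolev_boundary s p n" by (simp add: hardy_sobolev_boundary_def)
  moreover have "F z = cauchy_transform s (G 0) z" if z: "z \<in> half_plane s" for z
  proof -
    obtain x y where "0 < y" "z = Complex x (s * y)" by (rule half_plane_cases[OF z s]) (rule that, assumption+)
    then show ?thesis by (simp only: hardy_reprD(3)[OF G0])
  qed
  ultimately show ?thesis by (rule that)
qed

text \<open>Over the opposite half-plane the transform of the boundary function vanishes
  identically, hence so do its derivatives, which are the opposite transforms of the weak
  derivatives. The transform of each weak derivative is therefore its Poisson integral and lies in
  Hp, even for p = 1, where Cauchy transforms in general do not.\<close>

lemma hardy_sobolev_boundary_imp:
  assumes f: "f \<in> hardy_sobolev_boundary s p n" and F: "\<And>z. z \<in> half_plane s \<Longrightarrow> F z = cauchy_transform s f z"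
    and s: "s = 1 \<or> s = -1" and p: "1 \<le> p"
  shows "F \<in> hardy_sobolev s p n"
proof -
  have fb: "f \<in> hardy_boundary s p" and fs: "f \<in> sobolev p n" using f by (simp_all add: hardy_sobolev_boundary_def)
  obtain f0 F0 where f0: "hardy_repr s p F0 f0" and ae: "AE x in lebesgue. f x = f0 x"
    by (rule hardy_boundary_representative[OF fb s p]) (rule that, assumption+)
  obtain G where G0: "G 0 = f0"
    and G: "\<And>k. k \<le> n \<Longrightarrow> G k \<in> borel_measurable borel \<and> integrable lborel (\<lambda>t. norm (G k t) powr p) \<and> weak_derivative k f0 (G k)"
    by (rule sobolev_representative[OF fs hardy_reprD(1,2)[OF f0] ae]) (rule that, assumption+)
  have ci: "cauchy_integrable (G k)" if "k \<le> n" for k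
    by (rule cauchy_integrable_Lp[OF p]) (use G[OF that] in auto)
  have w: "weak_derivative k (G 0) (G k)" if "k \<le> n" for k using G[OF that] by (simp only: G0)
  note hd = higher_deriv_cauchy_transform[OF ci w]
  have s': "- s = 1 \<or> - s = -1" using s by auto
  have im: "Im z \<noteq> 0" if "z \<in> half_plane r" for z r using that by (auto simp: half_plane_def)
  have zero: "cauchy_transform (- s) (G k) z = 0" if k: "k \<le> n" and z: "z \<in> half_plane (- s)" for k z
  proof -
    have z0: "cauchy_transform (- s) (G 0) w = 0" if w: "w \<in> half_plane (- s)" for w
    proof -
      obtain x y where "0 < y" "w = Complex x (- s * y)" by (rule half_plane_cases[OF w s']) (rule that, assumption+)
      then show ?thesis unfolding G0 by (simp only: hardy_reprD(4)[OF f0])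
    qed
    have "(deriv ^^ k) (cauchy_transform (- s) (G 0)) z = (deriv ^^ k) (\<lambda>_. 0) z"
      by (rule higher_deriv_cong_open[OF open_half_plane z0 z])
    moreover have "(deriv ^^ k) (\<lambda>_. 0) = (\<lambda>_. 0 :: complex)" by (induction k) simp_all
    ultimately show ?thesis using hd[OF _ _ k im[OF z]] by simp
  qed
  have c: "cauchy_transform s f = cauchy_transform s f0"
    using fs by (intro cauchy_transform_cong_AE[OF _ measurable_lebesgueI[OF hardy_reprD(1)[OF f0]] ae]) (simp add: Lp_real_def sobolev_def)
  have Fk: "(deriv ^^ k) F z = cauchy_transform s (G k) z" if k: "k \<le> n" and z: "z \<in> half_plane s" for k z
  proof -
    have "(deriv ^^ k) F z = (deriv ^^ k) (cauchy_transform s (G 0)) z"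
      by (rule higher_deriv_cong_open[OF open_half_plane F[unfolded c G0[symmetric]] z])
    then show ?thesis using hd[OF _ _ k im[OF z]] by simp
  qed
  have H: "cauchy_transform s (G k) \<in> hardy s p" if k: "k \<le> n" for k
  proof (rule poisson_integral_in_hardy[OF holomorphic_cauchy_transform[OF ci[OF k]] s p])
    show "G k \<in> borel_measurable borel" "integrable lborel (\<lambda>t. norm (G k t) powr p)" using G[OF k] by simp_all
    fix x y :: real assume y: "0 < y"
    have "cauchy_transform (- s) (G k) (Complex x (- s * y)) = 0"
      by (rule zero[OF k Complex_in_half_plane[OF s' y]])
    then show "cauchy_transform s (G k) (Complex x (s * y)) = poisson_integral y (G k) x"
      using poisson_integral_eq_cauchy[OF ci[OF k] s y, of x] by simp
  qed
  have hol: "F holomorphic_on half_plane s"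
    by (rule holomorphic_transform[OF holomorphic_cauchy_transform[OF ci[of 0]]]) (use F in \<open>simp_all add: G0 c\<close>)
  show ?thesis by (rule hardy_sobolevI[OF hol s p H Fk[symmetric]])
qed

lemma hardy_sobolev_boundary_limits:
  assumes f: "f \<in> hardy_sobolev_boundary s p n" and F: "\<And>z. z \<in> half_plane s \<Longrightarrow> F z = cauchy_transform s f z"
    and s: "s = 1 \<or> s = -1" and p: "1 \<le> p"
  shows "AE x in lebesgue. ((\<lambda>y. F (Complex x y)) \<longlongrightarrow> f x) (at 0 within {y. 0 < s * y})"
    and "AE x in lebesgue. ((\<lambda>y. F (Complex x (s * y))) \<longlongrightarrow> f x) (at_right 0)"
proof -
  have fb: "f \<in> hardy_boundary s p" using f by (simp add: hardy_sobolev_boundary_def)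
  obtain f0 F0 where CF: "\<And>z. z \<in> half_plane s \<Longrightarrow> cauchy_transform s f z = F0 z"
    and nt: "AE x in lebesgue. has_nontangential_limit s F0 x (f x)"
    by (rule hardy_boundary_representative[OF fb s p]) (rule that, assumption+)
  have e1: "\<forall>\<^sub>F y in at 0 within {y. 0 < s * y}. F0 (Complex x y) = F (Complex x y)" for x
    unfolding eventually_at_filter by (intro always_eventually allI impI) (simp add: F CF half_plane_def)
  have e2: "\<forall>\<^sub>F y in at_right 0. F0 (Complex x (s * y)) = F (Complex x (s * y))" for x
    unfolding eventually_at_filter by (intro always_eventually allI impI) (simp add: F CF Complex_in_half_plane[OF s])
  show "AE x in lebesgue. ((\<lambda>y. F (Complex x y)) \<longlongrightarrow> f x) (at 0 within {y. 0 < s * y})"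
    using nt by eventually_elim (rule Lim_transform_eventually[OF nontangential_imp_vertical(2)[OF _ s] e1])
  show "AE x in lebesgue. ((\<lambda>y. F (Complex x (s * y))) \<longlongrightarrow> f x) (at_right 0)"
    using nt by eventually_elim (rule Lim_transform_eventually[OF nontangential_imp_vertical(1)[OF _ s] e2])
qed

text \<open>Every representing boundary function is the vertical limit of \<open>F\<close> a.e., and
  such limits are unique.\<close>

lemma hardy_sobolev_boundary_unique:
  assumes "f \<in> hardy_sobolev_boundary s p n" "\<And>z. z \<in> half_plane s \<Longrightarrow> F z = cauchy_transform s f z"
    and "g \<in> hardy_sobolev_boundary s p n" "\<And>z. z \<in> half_plane s \<Longrightarrow> F z = cauchy_transform s g z"
    and s: "s = 1 \<or> s = -1" and p: "1 \<le> p"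
  shows "AE x in lebesgue. g x = f x"
proof -
  have "AE x in lebesgue. ((\<lambda>y. F (Complex x (s * y))) \<longlongrightarrow> f x) (at_right 0)"
    by (rule hardy_sobolev_boundary_limits(2)[OF assms(1) _ s p]) (rule assms(2))
  moreover have "AE x in lebesgue. ((\<lambda>y. F (Complex x (s * y))) \<longlongrightarrow> g x) (at_right 0)"
    by (rule hardy_sobolev_boundary_limits(2)[OF assms(3) _ s p]) (rule assms(4))
  ultimately show ?thesis
  proof eventually_elim
    case (elim x)
    show ?case by (rule tendsto_unique[OF _ elim(2) elim(1)]) simp
  qed
qed

lemma cauchy_transform_sobolev:
  assumes f: "f \<in> sobolev p n" and s: "s = 1 \<or> s = -1" and p: "1 < p"
  shows "cauchy_transform s f \<in> hardy_sobolev s p n"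
proof -
  have p1: "1 \<le> p" using p by simp
  have fL: "f \<in> Lp_real p" using f by (simp add: sobolev_def)
  obtain f0 where f0: "f0 \<in> borel_measurable borel" "integrable lborel (\<lambda>x. norm (f0 x) powr p)" and ae: "AE x in lebesgue. f x = f0 x"
    by (rule Lp_real_representative[OF fL]) (rule that, assumption+)
  obtain G where G0: "G 0 = f0"
    and G: "\<And>k. k \<le> n \<Longrightarrow> G k \<in> borel_measurable borel \<and> integrable lborel (\<lambda>t. norm (G k t) powr p) \<and> weak_derivative k f0 (G k)"
    by (rule sobolev_representative[OF f f0 ae]) (rule that, assumption+)
  have ci: "cauchy_integrable (G k)" if "k \<le> n" for k
    by (rule cauchy_integrable_Lp[OF p1]) (use G[OF that] in auto)
  have w: "weak_derivative k (G 0) (G k)" if "k \<le> n" for k using G[OF that] by (simp only: G0)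
  have c: "cauchy_transform s f = cauchy_transform s (G 0)"
    unfolding G0 using fL by (intro cauchy_transform_cong_AE[OF _ measurable_lebesgueI[OF f0(1)] ae]) (simp add: Lp_real_def)
  show ?thesis
  proof (rule hardy_sobolevI[OF _ s p1])
    show "cauchy_transform s f holomorphic_on half_plane s" unfolding c by (rule holomorphic_cauchy_transform[OF ci]) simp
    show "cauchy_transform s (G k) \<in> hardy s p" if "k \<le> n" for k
      by (rule cauchy_transform_in_hardy[OF p s]) (use G[OF that] in auto)
    show "cauchy_transform s (G k) z = (deriv ^^ k) (cauchy_transform s f) z" if "k \<le> n" "z \<in> half_plane s" for k z
      unfolding c by (rule higher_deriv_cauchy_transform[OF ci w that(1), symmetric]) (use that(2) in \<open>auto simp: half_plane_def\<close>)
  qed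
qed

lemma cauchy_transform_sobolev_boundary:
  assumes f: "f \<in> sobolev p n" and s: "s = 1 \<or> s = -1" and p: "1 \<le> p"
  shows "AE x in lebesgue. (truncated_hilbert f x \<longlongrightarrow> hilbert_transform f x) (at_right 0) \<and>
     ((\<lambda>y. cauchy_transform s f (Complex x y)) \<longlongrightarrow> f x / 2 + of_real s * (\<i> / 2) * hilbert_transform f x) (at 0 within {y. 0 < s * y})"
proof -
  have fL: "f \<in> Lp_real p" using f by (simp add: sobolev_def)
  obtain f0 where f0: "f0 \<in> borel_measurable borel" "integrable lborel (\<lambda>x. norm (f0 x) powr p)" and ae: "AE x in lebesgue. f x = f0 x"
    by (rule Lp_real_representative[OF fL]) (rule that, assumption+)
  have fm: "f \<in> borel_measurable lebesgue" using fL by (simp add: Lp_real_def)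
  note cong = fm measurable_lebesgueI[OF f0(1)] ae
  have h: "hilbert_transform f = hilbert_transform f0"
    unfolding hilbert_transform_def[abs_def] truncated_hilbert_cong_AE[OF cong] ..
  have "AE x in lebesgue. (truncated_hilbert f0 x \<longlongrightarrow> hilbert_transform f0 x) (at_right 0) \<and>
     ((\<lambda>y. cauchy_transform s f0 (Complex x y)) \<longlongrightarrow> f0 x / 2 + of_real s * (\<i> / 2) * hilbert_transform f0 x) (at 0 within {y. 0 < s * y})"
    unfolding AE_completion_iff by (rule cauchy_transform_boundary_values[OF cauchy_integrable_Lp[OF p f0] s])
  with ae show ?thesis
    unfolding h truncated_hilbert_cong_AE[OF cong] cauchy_transform_cong_AE[OF cong]
    by eventually_elim (simp only:)
qed

section \<open>The case of exponent one\<close>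

text \<open>The Poisson kernel of height 1 continued from the real line; its poles i and -i bound
  the strip |Im z| < 1. Derivatives on the real line can then be estimated by Cauchy's inequality
  instead of being computed.\<close>

definition poisson_kernel_extension :: "complex \<Rightarrow> complex" where
  "poisson_kernel_extension z = 1 / (of_real pi * (z\<^sup>2 + 1))"

lemma poisson_kernel_extension_real: "poisson_kernel_extension (Complex t 0) = of_real (poisson 1 t)"
  by (simp add: poisson_kernel_extension_def poisson_def complex_of_real_def[symmetric])

text \<open>With u = Re w the real part of w^2 + 1 is at least u^2 + 3/4, while t^2 <= 2 u^2 + 1/2.
  The constant 8 leaves ample room.\<close>

lemma norm_square_plus_1_ge:
  assumes "\<bar>Im w\<bar> \<le> 1 / 2" "\<bar>Re w - t\<bar> \<le> 1 / 2"
  shows "(t\<^sup>2 + 1) / 8 \<le> norm (w\<^sup>2 + 1)"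
proof -
  define u v where "u = Re w" and "v = Im w"
  have v: "\<bar>v\<bar> \<le> 1 / 2" and ut: "\<bar>u - t\<bar> \<le> 1 / 2" using assms by (simp_all add: u_def v_def)
  have v2: "v\<^sup>2 \<le> 1 / 4" using power_mono[OF v abs_ge_zero, of 2] by (simp add: power2_eq_square)
  have ut2: "(t - u)\<^sup>2 \<le> 1 / 4" using power_mono[OF ut abs_ge_zero, of 2] by (simp add: power2_eq_square algebra_simps)
  have "t\<^sup>2 \<le> 2 * u\<^sup>2 + 2 * (t - u)\<^sup>2" using zero_le_power2[of "2 * u - t"] by (simp add: power2_eq_square algebra_simps)
  then have "(t\<^sup>2 + 1) / 8 \<le> (2 * u\<^sup>2 + 3 / 2) / 8" using ut2 by simp
  also have "\<dots> \<le> u\<^sup>2 - v\<^sup>2 + 1"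
  proof -
    have "(2 * a + 3 / 2) / 8 \<le> a - b + 1" if "0 \<le> a" "b \<le> 1 / 4" for a b :: real using that by argo
    from this[OF zero_le_power2 v2] show ?thesis .
  qed
  also have "\<dots> = Re (w\<^sup>2 + 1)" by (simp add: u_def v_def power2_eq_square)
  also have "\<dots> \<le> norm (w\<^sup>2 + 1)" by (rule complex_Re_le_cmod)
  finally show ?thesis .
qed

lemma square_plus_1_nonzero: "\<bar>Im w\<bar> < 1 \<Longrightarrow> w\<^sup>2 + 1 \<noteq> (0 :: complex)"
proof
  assume "\<bar>Im w\<bar> < 1" "w\<^sup>2 + 1 = 0"
  then have "w\<^sup>2 = \<i>\<^sup>2" by (simp add: add_eq_0_iff2)
  then have "w = \<i> \<or> w = - \<i>" by (simp only: power2_eq_iff)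
  with \<open>\<bar>Im w\<bar> < 1\<close> show False by auto
qed

lemma holomorphic_poisson_kernel_extension: "poisson_kernel_extension holomorphic_on {z. \<bar>Im z\<bar> < 1}"
  unfolding poisson_kernel_extension_def[abs_def] by (intro holomorphic_intros) (simp add: square_plus_1_nonzero)

lemma open_strip: "open {z. \<bar>Im z\<bar> < 1}"
  by (intro open_Collect_less continuous_intros)

text \<open>Cauchy's inequality on the circle of radius 1/2: on it the extension is bounded by a
  multiple of the kernel at the centre, so every derivative is dominated by an integrable
  function.\<close>

lemma higher_deriv_poisson_kernel_extension_le:
  "norm ((deriv ^^ k) poisson_kernel_extension (Complex t 0)) \<le> fact k * 8 / (1 / 2) ^ k * poisson 1 t"
proof -
  have near: "\<bar>Im w\<bar> \<le> 1 / 2" "\<bar>Re w - t\<bar> \<le> 1 / 2" if "norm (Complex t 0 - w) \<le> 1 / 2" for w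
    using abs_Im_le_cmod[of "Complex t 0 - w"] abs_Re_le_cmod[of "Complex t 0 - w"] that
    by (simp_all add: abs_minus_commute[of "Re w"])
  have sub: "cball (Complex t 0) (1 / 2) \<subseteq> {z. \<bar>Im z\<bar> < 1}"
  proof
    fix w assume "w \<in> cball (Complex t 0) (1 / 2)"
    then have "norm (Complex t 0 - w) \<le> 1 / 2" by (simp add: dist_norm)
    from near(1)[OF this] show "w \<in> {z. \<bar>Im z\<bar> < 1}" by simp
  qed
  have "norm ((deriv ^^ k) poisson_kernel_extension (Complex t 0)) \<le> fact k * (8 / (pi * (t\<^sup>2 + 1))) / (1 / 2) ^ k"
  proof (rule Cauchy_inequality)
    show "poisson_kernel_extension holomorphic_on ball (Complex t 0) (1 / 2)"
      by (rule holomorphic_on_subset[OF holomorphic_poisson_kernel_extension subset_trans[OF ball_subset_cball sub]])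
    show "continuous_on (cball (Complex t 0) (1 / 2)) poisson_kernel_extension"
      by (rule continuous_on_subset[OF holomorphic_on_imp_continuous_on[OF holomorphic_poisson_kernel_extension] sub])
    fix w assume "norm (Complex t 0 - w) = 1 / 2"
    then have le: "(t\<^sup>2 + 1) / 8 \<le> norm (w\<^sup>2 + 1)" by (intro norm_square_plus_1_ge near) simp_all
    have pos: "0 < (t\<^sup>2 + 1) / 8" by (simp add: add_nonneg_pos)
    have "1 / (pi * norm (w\<^sup>2 + 1)) \<le> 1 / (pi * ((t\<^sup>2 + 1) / 8))"
      by (intro divide_left_mono mult_left_mono mult_pos_pos le pos less_le_trans[OF pos le] pi_gt_zero pi_ge_zero zero_le_one)
    then show "norm (poisson_kernel_extension w) \<le> 8 / (pi * (t\<^sup>2 + 1))"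
      by (simp add: poisson_kernel_extension_def norm_divide norm_mult)
  qed simp
  then show ?thesis by (simp add: poisson_def mult_ac)
qed

lemma poisson_in_sobolev: "(\<lambda>t. complex_of_real (poisson 1 t)) \<in> sobolev 1 n"
proof -
  define G where "G = (\<lambda>k t. (deriv ^^ k) poisson_kernel_extension (Complex t 0))"
  have line: "Complex x 0 \<in> {z. \<bar>Im z\<bar> < 1}" for x by simp
  have G0: "G 0 = (\<lambda>t. complex_of_real (poisson 1 t))" by (simp add: G_def poisson_kernel_extension_real)
  have Gm: "G k \<in> borel_measurable borel" for k
  proof (rule borel_measurable_continuous_onI)
    have "isCont (G k) x" for x
      unfolding G_def
      by (rule has_vector_derivative_continuous[OF has_vector_derivative_line[OF holomorphic_higher_deriv[OF holomorphic_poisson_kernel_extension open_strip] open_strip line]])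
    then show "continuous_on UNIV (G k)" by (simp add: continuous_on_eq_continuous_at)
  qed
  have Gi: "integrable lborel (\<lambda>t. norm (G k t) powr 1)" for k
  proof (rule Bochner_Integration.integrable_bound)
    show "integrable lborel (\<lambda>t. fact k * 8 / (1 / 2) ^ k * poisson 1 t)"
      using has_bochner_integral_poisson[of 1] by (intro integrable_mult_right) (simp add: has_bochner_integral_iff)
    show "(\<lambda>t. norm (G k t) powr 1) \<in> borel_measurable lborel" using Gm[of k] by measurable
    show "AE t in lborel. norm (norm (G k t) powr 1) \<le> norm (fact k * 8 / (1 / 2) ^ k * poisson 1 t)"
    proof (rule AE_I2)
      fix t
      have "norm (norm (G k t) powr 1) = norm (G k t)" by simp
      also have "\<dots> \<le> fact k * 8 / (1 / 2) ^ k * poisson 1 t" unfolding G_def by (rule higher_deriv_poisson_kernel_extension_le)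
      finally show "norm (norm (G k t) powr 1) \<le> norm (fact k * 8 / (1 / 2) ^ k * poisson 1 t)"
        unfolding real_norm_def[of "_ * poisson 1 t"] by (rule order_trans[OF _ abs_ge_self])
    qed
  qed
  have w: "weak_derivative k (G 0) (G k)" for k
    unfolding weak_derivative_def
  proof (intro allI impI)
    fix \<phi> assume \<phi>: "test_function \<phi>"
    have "(LINT t|lborel. G 0 t * of_real ((deriv ^^ k) \<phi> t)) = (-1) ^ k * (LINT t|lborel. G k t * of_real (\<phi> t))"
      using line_weak_derivative[OF holomorphic_poisson_kernel_extension open_strip line \<phi>, of k] by (simp add: G_def)
    moreover have "(LINT t|lebesgue. G 0 t * of_real ((deriv ^^ k) \<phi> t)) = (LINT t|lborel. G 0 t * of_real ((deriv ^^ k) \<phi> t))"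
      using borel_measurable_times[OF Gm[of 0] borel_measurable_test_function[OF test_function_higher_deriv[OF \<phi>, of k]]] by (intro integral_completion) simp
    moreover have "(LINT t|lebesgue. G k t * of_real (\<phi> t)) = (LINT t|lborel. G k t * of_real (\<phi> t))"
      using borel_measurable_times[OF Gm[of k] borel_measurable_test_function[OF \<phi>]] by (intro integral_completion) simp
    ultimately show "(LINT t|lebesgue. G 0 t * of_real ((deriv ^^ k) \<phi> t)) = (-1) ^ k * (LINT t|lebesgue. G k t * of_real (\<phi> t))"
      by (simp only:)
  qed
  show ?thesis
    unfolding sobolev_def G0[symmetric]
  proof (intro CollectI conjI ballI)
    show "G 0 \<in> Lp_real 1" by (rule Lp_realI[OF Gm Gi])
    show "\<exists>g\<in>Lp_real 1. weak_derivative k (G 0) g" for k by (intro bexI[of _ "G k"] w Lp_realI Gm Gi)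
  qed
qed

text \<open>If the Cauchy transform of an integrable \<open>f\<close> lies in \<open>H\<^sup>1\<close>, its integral over a horizontal
  line vanishes, while the expansion at infinity identifies this integral with that of \<open>f\<close>.\<close>

lemma cauchy_transform_hardy1_imp_integral_0:
  assumes fm: "f \<in> borel_measurable borel" and fi: "integrable lborel f" and s: "s = 1 \<or> s = -1"
    and H: "cauchy_transform s f \<in> hardy s 1"
  shows "(LINT t|lborel. f t) = 0"
proof -
  have p: "(1::real) \<le> 1" by simp
  define g where "g = (\<lambda>t. cauchy_transform s f (Complex t (s * 1)))"
  have gm: "g \<in> borel_measurable borel" unfolding g_def by (rule hardyD(2)[OF H s p]) simp
  have gi: "integrable lborel g"
    using hardyD(3)[OF H s p, of 1] gm by (simp add: g_def integrable_norm_iff)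
  have g0: "(LINT t|lborel. g t) = 0" unfolding g_def by (rule hardy1_line_integral_0[OF H s]) simp
  define v where "v = (\<lambda>n. Complex 0 (s * real (Suc n)))"
  have vn: "Complex 0 (s * real (Suc n)) = v n" for n by (simp only: v_def)
  define I where "I = (\<lambda>n. LINT t|lborel. f t / (of_real t - v n))"
  define c where "c = complex_of_real s / (2 * of_real pi * \<i>)"
  have c0: "c \<noteq> 0" using s by (auto simp: c_def)
  \<comment> \<open>The transform of the values at height 1 reproduces
    \<open>cauchy_transform s f\<close> one unit further from the axis, which moves the n-th sample
    point to the next one.\<close>
  have shift: "(LINT t|lborel. g t / (of_real t - v n)) = I (Suc n)" for n
  proof -
    have "cauchy_transform s g (v n) = cauchy_transform s f (v (Suc n))"
      using hardy_line_Cauchy(1)[OF H s p, of 1 "real (Suc n)" 0] by (simp add: g_def v_def add_ac)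
    then show ?thesis
      unfolding cauchy_transform_lborel[OF fm] cauchy_transform_lborel[OF gm] c_def[symmetric] I_def using c0 by simp
  qed
  have A: "(\<lambda>n. v n * I (Suc n)) \<longlonglongrightarrow> 0"
    using Cauchy_integral_asymptotic[OF gi s] unfolding vn shift g0 minus_zero .
  have B: "(\<lambda>n. v (Suc n) * I (Suc n)) \<longlonglongrightarrow> - (LINT t|lborel. f t)"
    using LIMSEQ_Suc[OF Cauchy_integral_asymptotic[OF fi s]] unfolding v_def I_def .
  \<comment> \<open>Neighbouring sample points differ by a factor tending to 1. The asymptotics
    \<open>A\<close> and \<open>B\<close> of the same integrals must therefore share their limit,
    which is 0 in one and minus the integral of f in the other.\<close>
  have vS: "v (Suc n) = of_real (1 + 1 / real (Suc n)) * v n" for n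
    by (simp add: v_def complex_eq_iff field_simps)
  have "(\<lambda>n. of_real (1 + 1 / real (Suc n)) * (v n * I (Suc n))) \<longlonglongrightarrow> of_real (1 + 0) * 0"
    by (intro tendsto_intros A LIMSEQ_Suc[OF lim_1_over_n])
  then have "(\<lambda>n. v (Suc n) * I (Suc n)) \<longlonglongrightarrow> 0" unfolding vS by (simp add: mult.assoc)
  from LIMSEQ_unique[OF B this] show ?thesis by simp
qed

text \<open>The Poisson kernel has integral 1, so membership fails already at order 0.\<close>

lemma cauchy_transform_poisson_not_hardy_sobolev:
  assumes s: "s = 1 \<or> s = -1"
  shows "cauchy_transform s (\<lambda>t. complex_of_real (poisson 1 t)) \<notin> hardy_sobolev s 1 n"
proof
  assume "cauchy_transform s (\<lambda>t. complex_of_real (poisson 1 t)) \<in> hardy_sobolev s 1 n"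
  then have "\<forall>k\<le>n. (deriv ^^ k) (cauchy_transform s (\<lambda>t. complex_of_real (poisson 1 t))) \<in> hardy s 1"
    by (simp add: hardy_sobolev_def)
  then have "(deriv ^^ 0) (cauchy_transform s (\<lambda>t. complex_of_real (poisson 1 t))) \<in> hardy s 1" by blast
  then have H: "cauchy_transform s (\<lambda>t. complex_of_real (poisson 1 t)) \<in> hardy s 1" by simp
  have i: "has_bochner_integral lborel (poisson 1) 1" by (rule has_bochner_integral_poisson) simp
  have "(LINT t|lborel. complex_of_real (poisson 1 t)) = 0"
    by (rule cauchy_transform_hardy1_imp_integral_0[OF _ _ s H]) (use i in \<open>simp_all add: has_bochner_integral_iff\<close>)
  moreover have "(LINT t|lborel. complex_of_real (poisson 1 t)) = of_real (LINT t|lborel. poisson 1 t)"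
    by (rule integral_of_real) (rule integrable.intros[OF i])
  moreover have "(LINT t|lborel. poisson 1 t) = 1" by (rule has_bochner_integral_integral_eq[OF i])
  ultimately show False by simp
qed

text \<open>Convergence of the truncations is claimed along with the boundary formula because
  \<open>Lim\<close> is a mere default value where they diverge. The limit in the first part is
  claimed for every representing \<open>f\<close>, which ties it to all members of the a.e.
  equivalence class.\<close>

theorem proposition3p6:
  fixes p s :: real and n :: nat
  assumes "1 \<le> p" and "s = 1 \<or> s = -1"
  shows
    "(\<forall>F :: complex \<Rightarrow> complex.
        (F \<in> hardy_sobolev s p n \<longleftrightarrow>
          (\<exists>f\<in>hardy_sobolev_boundary s p n.
             (\<forall>z\<in>half_plane s. F z = cauchy_transform s f z) \<and>
             (\<forall>g\<in>hardy_sobolev_boundary s p n.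
                (\<forall>z\<in>half_plane s. F z = cauchy_transform s g z) \<longrightarrow>
                (AE x in lebesgue. g x = f x)))) \<and>
        (\<forall>f\<in>hardy_sobolev_boundary s p n.
           (\<forall>z\<in>half_plane s. F z = cauchy_transform s f z) \<longrightarrow>
           (AE x in lebesgue.
              ((\<lambda>y. F (Complex x y)) \<longlongrightarrow> f x) (at 0 within {y. 0 < s * y})))) \<and>
     (\<forall>f\<in>sobolev p n.
        (p \<noteq> 1 \<longrightarrow> cauchy_transform s f \<in> hardy_sobolev s p n) \<and>
        (AE x in lebesgue.
           (truncated_hilbert f x \<longlongrightarrow> hilbert_transform f x) (at_right 0) \<and>
           ((\<lambda>y. cauchy_transform s f (Complex x y)) \<longlongrightarrow>
              f x / 2 + complex_of_real s * (\<i> / 2) * hilbert_transform f x)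
             (at 0 within {y. 0 < s * y}))) \<and>
     (p = 1 \<longrightarrow> (\<exists>f\<in>sobolev p n. cauchy_transform s f \<notin> hardy_sobolev s p n))"
proof (intro conjI allI ballI impI)
  note p = assms(1) and s = assms(2)
  fix F :: "complex \<Rightarrow> complex"
  show "F \<in> hardy_sobolev s p n \<longleftrightarrow>
          (\<exists>f\<in>hardy_sobolev_boundary s p n.
             (\<forall>z\<in>half_plane s. F z = cauchy_transform s f z) \<and>
             (\<forall>g\<in>hardy_sobolev_boundary s p n.
                (\<forall>z\<in>half_plane s. F z = cauchy_transform s g z) \<longrightarrow>
                (AE x in lebesgue. g x = f x)))"
  proof
    assume F: "F \<in> hardy_sobolev s p n"
    obtain f where f: "f \<in> hardy_sobolev_boundary s p n" "\<And>z. z \<in> half_plane s \<Longrightarrow> F z = cauchy_transform s f z"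
      by (rule hardy_sobolev_imp_boundary[OF F s p]) (rule that, assumption+)
    show "\<exists>f\<in>hardy_sobolev_boundary s p n.
             (\<forall>z\<in>half_plane s. F z = cauchy_transform s f z) \<and>
             (\<forall>g\<in>hardy_sobolev_boundary s p n.
                (\<forall>z\<in>half_plane s. F z = cauchy_transform s g z) \<longrightarrow>
                (AE x in lebesgue. g x = f x))"
    proof (intro bexI[OF _ f(1)] conjI ballI impI)
      show "F z = cauchy_transform s f z" if "z \<in> half_plane s" for z by (rule f(2)[OF that])
      fix g assume g: "g \<in> hardy_sobolev_boundary s p n" "\<forall>z\<in>half_plane s. F z = cauchy_transform s g z"
      show "AE x in lebesgue. g x = f x"
        by (rule hardy_sobolev_boundary_unique[OF f(1) _ g(1) _ s p]) (erule f(2), erule bspec[OF g(2)])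
    qed
  next
    assume "\<exists>f\<in>hardy_sobolev_boundary s p n.
             (\<forall>z\<in>half_plane s. F z = cauchy_transform s f z) \<and>
             (\<forall>g\<in>hardy_sobolev_boundary s p n.
                (\<forall>z\<in>half_plane s. F z = cauchy_transform s g z) \<longrightarrow>
                (AE x in lebesgue. g x = f x))"
    then obtain f where f: "f \<in> hardy_sobolev_boundary s p n" "\<forall>z\<in>half_plane s. F z = cauchy_transform s f z"
      by (elim bexE conjE)
    show "F \<in> hardy_sobolev s p n" by (rule hardy_sobolev_boundary_imp[OF f(1) bspec[OF f(2)] s p])
  qed
  fix f assume f: "f \<in> hardy_sobolev_boundary s p n" "\<forall>z\<in>half_plane s. F z = cauchy_transform s f z"
  show "AE x in lebesgue. ((\<lambda>y. F (Complex x y)) \<longlongrightarrow> f x) (at 0 within {y. 0 < s * y})"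
    by (rule hardy_sobolev_boundary_limits(1)[OF f(1) bspec[OF f(2)] s p])
next
  fix f assume f: "f \<in> sobolev p n"
  show "cauchy_transform s f \<in> hardy_sobolev s p n" if "p \<noteq> 1"
    by (rule cauchy_transform_sobolev[OF f assms(2)]) (use assms(1) that in simp)
  show "AE x in lebesgue.
           (truncated_hilbert f x \<longlongrightarrow> hilbert_transform f x) (at_right 0) \<and>
           ((\<lambda>y. cauchy_transform s f (Complex x y)) \<longlongrightarrow>
              f x / 2 + complex_of_real s * (\<i> / 2) * hilbert_transform f x)
             (at 0 within {y. 0 < s * y})"
    by (rule cauchy_transform_sobolev_boundary[OF f assms(2,1)])
next
  assume p: "p = 1"
  show "\<exists>f\<in>sobolev p n. cauchy_transform s f \<notin> hardy_sobolev s p n"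
    unfolding p
    by (intro bexI[of _ "\<lambda>t. complex_of_real (poisson 1 t)"] cauchy_transform_poisson_not_hardy_sobolev[OF assms(2)] poisson_in_sobolev)
qed

end
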